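(* Let $X^{m|m}$ be a $\Pi$-symmetric supermanifold, let $\mathbb B^{n|n}\subset\mathbb R^{n|n}$ be an open superball, let $\Psi: X^{m|m}\times\mathbb B^{n|n}\to\mathbb R^{n|n}$ be a morphism in the category of $\Pi$-symmetric supermanifolds, and suppose $\Psi$ is supertransversal to a ($\Pi$-symmetric) subsupermanifold $Z^{k|k}$ of $\mathbb R^{n|n}$. Let $W=\Psi^{-1}(Z)$ be the preimage subsupermanifold of $X\times\mathbb B^{n|n}$, of dimension $m+k|m+k$. Then the tangent sheaf $\mathcal T_W$ is $\Pi$-symmetric.
   Context: Supermanifolds are smooth: $M=(\tilde M,\mathcal O_M)$, locally isomorphic to $(U,C^\infty(\cdot)[\theta^1,\dots,\theta^b])$, $U\subset\mathbb R^a$ open; morphisms are $\psi=(\tilde\psi,\psi^* )$ with $\psi^*$ a homomorphism of sheaves of $\mathbb Z_2$-graded supercommutative rings; $T_xM$ is the space of derivations of $\mathcal O_{M,x}$ and $d\psi_x(\eta)=\eta\circ\psi^*$. $\mathcal T_M=Der(\mathcal O_M)$ is the tangent sheaf. The open superball is $\mathbb B^{n|n}=(\tilde{\mathbb B},\mathcal O_{\mathbb R^{n|n}}|_{\tilde{\mathbb B}})$ with $\tilde{\mathbb B}$ an open ball in $\mathbb R^n$. $\Pi$-symmetry: let $\Pi$ be the parity change functor. A $\Pi$-symmetry on a module (or sheaf of modules) $S$ is an (even) isomorphism $P_S:S\to\Pi S$ with $P_S^2=\mathrm{id}_S$; equivalently an odd endomorphism $P:S\to S$ with $P^2=\mathrm{id}_S$.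 A supermanifold is $\Pi$-symmetric if its tangent sheaf carries a $\Pi$-symmetry, called a $\Pi$-symmetry of the supermanifold. $\mathbb R^{n|n}$ and $\mathbb B^{n|n}$ are $\Pi$-symmetric, and products carry the product $\Pi$-symmetry $P_{X\times\mathbb B}=P_X\times P_{\mathbb B}$ on $\mathcal T_{X\times\mathbb B}=\mathcal T_X\oplus\mathcal T_{\mathbb B}$. A morphism $\psi:M\to N$ of supermanifolds with $\Pi$-symmetries $P_M,P_N$ is a morphism in the category of $\Pi$-symmetric supermanifolds if $\bar P_N\circ\bar D(\psi)=\bar D(\psi)^\Pi\circ P_M$ as maps $\psi_*\mathcal T_M\to\Pi\mathcal T_{N,M}$. Here $\mathcal T_{N,M}=Der(\mathcal O_N\to\psi_*\mathcal O_M)$; $\bar D(\psi):\psi_*\mathcal T_M\to\mathcal T_{N,M}$ is $\bar D(\psi)(V)(g)=V(\psi^*g)$; $\bar D(\psi)^\Pi$ is the map induced by $\bar D(\psi)$ on parity-changed modules; and $\bar P_N(f\,\partial/\partial y)=fP_N(\partial/\partial y)$ for $f\in\mathcal O_M$ and coordinate vector fields $\partial/\partial y$ on $N$. A $\Pi$-symmetric subsupermanifold is one whose embedding is a morphism in this category. A subsupermanifold is an embedded supermanifold whose embedding has underlying map the inclusion. $\Psi$ is supertransversal to $Z$ if $\mathrm{Im}\,d\Psi_x+T_yZ=T_y\mathbb R^{n|n}$ for all $x\in\tilde\Psi^{-1}(\tilde Z)$, $y=\tilde\Psi(x)$. In that case $\Psi^{-1}(Z)$ is the subsupermanifold with underlying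 space $\tilde\Psi^{-1}(\tilde Z)$ obtained by gluing the local fibres $(G_U\circ\Psi)^{-1}(0)$, where $U\subset\mathbb R^{n|n}$ ranges over small open subsupermanifolds around points of $\tilde Z$ and $G_U:U\to\mathbb R^{n-k|n-k}$ is a submersion with $Z\cap U=G_U^{-1}(0)$. *)

theory Defs
  imports "HOL-Analysis.Analysis" "HOL-Algebra.Ideal" "HOL-Algebra.Module"
begin

section \<open>Supercommutative superalgebras and supermodules\<close>

text \<open>Parities are Booleans: \<^term>\<open>False\<close> is even, \<^term>\<open>True\<close> is odd, and addition of
  parities is \<open>\<noteq>\<close>. One record serves both for superalgebras over the reals, type
  \<open>(real, 'a) graded_module\<close>, and for supermodules over a superalgebra with elements of type
  \<open>'s\<close>, type \<open>('s, 'v) graded_module\<close>; in the second case the fields \<open>mult\<close> and \<open>one\<close> inherited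
  from the library record play no role.\<close>

record ('r, 'a) graded_module = "('r, 'a) module" +
  part :: "bool \<Rightarrow> 'a set"

definition real_ring :: "real ring" where
  "real_ring = \<lparr>carrier = UNIV, mult = (*), one = 1, zero = 0, add = (+)\<rparr>"

definition signed :: "('a, 'm) ring_scheme \<Rightarrow> bool \<Rightarrow> 'a \<Rightarrow> 'a" where
  "signed A s x = (if s then \<ominus>\<^bsub>A\<^esub> x else x)"

definition superalgebra :: "(real, 'a) graded_module \<Rightarrow> bool" where
  "superalgebra A \<longleftrightarrow>
     ring A \<and> Module.module real_ring A \<and>
     (\<forall>c. \<forall>x\<in>carrier A. \<forall>y\<in>carrier A.
        (c \<odot>\<^bsub>A\<^esub> x) \<otimes>\<^bsub>A\<^esub> y = c \<odot>\<^bsub>A\<^esub> (x \<otimes>\<^bsub>A\<^esub> y) \<and> x \<otimes>\<^bsub>A\<^esub> (c \<odot>\<^bsub>A\<^esub> y) = c \<odot>\<^bsub>A\<^esub> (x \<otimes>\<^bsub>A\<^esub> y)) \<and>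
     (\<forall>p. additive_subgroup (part A p) A) \<and>
     (\<forall>p c. \<forall>x\<in>part A p. c \<odot>\<^bsub>A\<^esub> x \<in> part A p) \<and>
     (\<forall>x\<in>carrier A. \<exists>!y. y \<in> part A False \<and> x \<ominus>\<^bsub>A\<^esub> y \<in> part A True) \<and>
     (\<forall>p q. \<forall>x\<in>part A p. \<forall>y\<in>part A q.
        x \<otimes>\<^bsub>A\<^esub> y \<in> part A (p \<noteq> q) \<and> x \<otimes>\<^bsub>A\<^esub> y = signed A (p \<and> q) (y \<otimes>\<^bsub>A\<^esub> x))"

definition superalgebra_hom ::
  "(real, 'a) graded_module \<Rightarrow> (real, 'b) graded_module \<Rightarrow> ('a \<Rightarrow> 'b) \<Rightarrow> bool" where
  "superalgebra_hom A B h \<longleftrightarrow>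
     h \<in> ring_hom A B \<and>
     (\<forall>c. \<forall>x\<in>carrier A. h (c \<odot>\<^bsub>A\<^esub> x) = c \<odot>\<^bsub>B\<^esub> h x) \<and>
     (\<forall>p. \<forall>x\<in>part A p. h x \<in> part B p)"

text \<open>The grading involution, acting as \<open>+1\<close> on even and \<open>-1\<close> on odd elements.\<close>

definition grade_inv :: "(real, 'a) graded_module \<Rightarrow> 'a \<Rightarrow> 'a" where
  "grade_inv A x = (let y = (THE y. y \<in> part A False \<and> x \<ominus>\<^bsub>A\<^esub> y \<in> part A True)
                    in y \<ominus>\<^bsub>A\<^esub> (x \<ominus>\<^bsub>A\<^esub> y))"

text \<open>The parity change \<open>\<Pi>S\<close> of a (left) supermodule \<open>S\<close>: same underlying group, reversed
  parities, and \<open>f \<cdot> \<Pi>v = (-1)^{|f|} \<Pi>(f v)\<close>. With this sign an even module homomorphism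
  \<open>S \<rightarrow> \<Pi>S\<close> is the same thing as an odd endomorphism of \<open>S\<close>.\<close>

definition parity_change ::
  "(real, 's) graded_module \<Rightarrow> ('s, 'v) graded_module \<Rightarrow> ('s, 'v) graded_module" where
  "parity_change A S = S\<lparr>smult := (\<lambda>f v. grade_inv A f \<odot>\<^bsub>S\<^esub> v), part := (\<lambda>p. part S (\<not> p))\<rparr>"


section \<open>Superringed spaces and their morphisms\<close>

text \<open>\<open>sec M U\<close> is the superalgebra of sections over \<open>U\<close>, and \<open>rst M U V\<close> the restriction
  from \<open>U\<close> to \<open>V\<close>; both are only relevant for open sets.\<close>

record ('p, 's) superspace =
  spc :: "'p topology"
  sec :: "'p set \<Rightarrow> (real, 's) graded_module"
  rst :: "'p set \<Rightarrow> 'p set \<Rightarrow> 's \<Rightarrow> 's"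

definition superringed_space :: "('p, 's) superspace \<Rightarrow> bool" where
  "superringed_space M \<longleftrightarrow>
     (\<forall>U. openin (spc M) U \<longrightarrow> superalgebra (sec M U) \<and> (\<forall>f\<in>carrier (sec M U). rst M U U f = f)) \<and>
     (\<forall>U V. openin (spc M) U \<and> openin (spc M) V \<and> V \<subseteq> U \<longrightarrow>
        superalgebra_hom (sec M U) (sec M V) (rst M U V)) \<and>
     (\<forall>U V V'. openin (spc M) U \<and> openin (spc M) V \<and> openin (spc M) V' \<and> V \<subseteq> U \<and> V' \<subseteq> V \<longrightarrow>
        (\<forall>f\<in>carrier (sec M U). rst M V V' (rst M U V f) = rst M U V' f)) \<and>
     (\<forall>\<U>. (\<forall>V\<in>\<U>. openin (spc M) V) \<longrightarrow>
        (\<forall>f\<in>carrier (sec M (\<Union>\<U>)). \<forall>g\<in>carrier (sec M (\<Union>\<U>)).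
           (\<forall>V\<in>\<U>. rst M (\<Union>\<U>) V f = rst M (\<Union>\<U>) V g) \<longrightarrow> f = g) \<and>
        (\<forall>s. (\<forall>V\<in>\<U>. s V \<in> carrier (sec M V)) \<and>
             (\<forall>V\<in>\<U>. \<forall>V'\<in>\<U>. rst M V (V \<inter> V') (s V) = rst M V' (V \<inter> V') (s V')) \<longrightarrow>
           (\<exists>f\<in>carrier (sec M (\<Union>\<U>)). \<forall>V\<in>\<U>. rst M (\<Union>\<U>) V f = s V)))"

text \<open>The restriction of a superringed space to an open subset.\<close>

definition srestrict :: "('p, 's) superspace \<Rightarrow> 'p set \<Rightarrow> ('p, 's) superspace" where
  "srestrict M U = M\<lparr>spc := subtopology (spc M) U\<rparr>"

text \<open>A morphism \<open>\<psi> : M \<rightarrow> N\<close> consists of the underlying map and of the pull-backs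
  \<open>pull \<psi> V : O_N(V) \<rightarrow> O_M(\<psi>^{-1}(V))\<close> for open \<open>V\<close>.\<close>

record ('p, 'q, 's, 't) smor =
  umap :: "'p \<Rightarrow> 'q"
  pull :: "'q set \<Rightarrow> 't \<Rightarrow> 's"

definition preim :: "('p, 's) superspace \<Rightarrow> ('p, 'q, 's, 't) smor \<Rightarrow> 'q set \<Rightarrow> 'p set" where
  "preim M \<psi> V = {x \<in> topspace (spc M). umap \<psi> x \<in> V}"

definition smorphism ::
  "('p, 's) superspace \<Rightarrow> ('q, 't) superspace \<Rightarrow> ('p, 'q, 's, 't) smor \<Rightarrow> bool" where
  "smorphism M N \<psi> \<longleftrightarrow>
     continuous_map (spc M) (spc N) (umap \<psi>) \<and>
     (\<forall>V. openin (spc N) V \<longrightarrow> superalgebra_hom (sec N V) (sec M (preim M \<psi> V)) (pull \<psi> V)) \<and>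
     (\<forall>V V'. openin (spc N) V \<and> openin (spc N) V' \<and> V' \<subseteq> V \<longrightarrow>
        (\<forall>g\<in>carrier (sec N V).
           pull \<psi> V' (rst N V V' g) = rst M (preim M \<psi> V) (preim M \<psi> V') (pull \<psi> V g)))"

definition smor_id :: "('p, 'p, 's, 's) smor" where
  "smor_id = \<lparr>umap = (\<lambda>x. x), pull = (\<lambda>U f. f)\<rparr>"

text \<open>\<open>smor_comp N \<phi> \<psi>\<close> is \<open>\<phi> \<circ> \<psi>\<close>, where \<open>N\<close> is the domain of \<open>\<phi>\<close>.\<close>

definition smor_comp ::
  "('q, 't) superspace \<Rightarrow> ('q, 'r, 't, 'u) smor \<Rightarrow> ('p, 'q, 's, 't) smor \<Rightarrow> ('p, 'r, 's, 'u) smor" where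
  "smor_comp N \<phi> \<psi> = \<lparr>umap = umap \<phi> \<circ> umap \<psi>,
                      pull = (\<lambda>V f. pull \<psi> (preim N \<phi> V) (pull \<phi> V f))\<rparr>"

definition smor_iso ::
  "('p, 's) superspace \<Rightarrow> ('q, 't) superspace \<Rightarrow> ('p, 'q, 's, 't) smor \<Rightarrow> bool" where
  "smor_iso M N \<psi> \<longleftrightarrow>
     smorphism M N \<psi> \<and> homeomorphic_map (spc M) (spc N) (umap \<psi>) \<and>
     (\<forall>V. openin (spc N) V \<longrightarrow>
        bij_betw (pull \<psi> V) (carrier (sec N V)) (carrier (sec M (preim M \<psi> V))))"


section \<open>The model superspaces and supermanifolds\<close>

text \<open>Points of \<open>\<real>^a\<close> are the points of the library space \<^term>\<open>Euclidean_space a\<close>, i.e. the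
  sequences \<open>x :: nat \<Rightarrow> real\<close> with \<open>x i = 0\<close> for \<open>i \<ge> a\<close>. Smoothness on an open set \<open>U\<close> means that all
  iterated partial derivatives exist and are continuous on \<open>U\<close>.\<close>

definition partial_deriv :: "nat \<Rightarrow> ((nat \<Rightarrow> real) \<Rightarrow> real) \<Rightarrow> (nat \<Rightarrow> real) \<Rightarrow> real" where
  "partial_deriv i f x = deriv (\<lambda>t. f (x(i := t))) (x i)"

definition smooth_on :: "nat \<Rightarrow> (nat \<Rightarrow> real) set \<Rightarrow> ((nat \<Rightarrow> real) \<Rightarrow> real) \<Rightarrow> bool" where
  "smooth_on a U f \<longleftrightarrow>
     (\<forall>js. set js \<subseteq> {..<a} \<longrightarrow>
        continuous_map (subtopology (Euclidean_space a) U) euclideanreal (foldr partial_deriv js f) \<and>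
        (\<forall>i<a. \<forall>x\<in>U. (\<lambda>t. foldr partial_deriv js f (x(i := t))) differentiable (at (x i))))"

text \<open>A section \<open>\<Sum>\<^sub>I f\<^sub>I \<theta>\<^sup>I\<close> of \<open>C^\<infinity>(U)[\<theta>_0, \<dots>, \<theta>_{b-1}]\<close> is encoded by its coefficients
  \<open>f I x\<close>, where \<open>\<theta>\<^sup>I\<close> is the product of the \<open>\<theta>_i\<close>, \<open>i \<in> I\<close>, in increasing order. Coefficients are set
  to \<open>0\<close> outside \<open>U\<close> and for \<open>I\<close> not contained in \<open>{..<b}\<close>. The sign of \<open>\<theta>\<^sup>I \<theta>\<^sup>J\<close> counts the pairs
  that have to be interchanged.\<close>

definition wedge_sign :: "nat set \<Rightarrow> nat set \<Rightarrow> real" where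
  "wedge_sign I J = (-1) ^ card {(i, j). i \<in> I \<and> j \<in> J \<and> j < i}"

definition superfunctions ::
  "nat \<Rightarrow> nat \<Rightarrow> (nat \<Rightarrow> real) set \<Rightarrow> (real, nat set \<Rightarrow> (nat \<Rightarrow> real) \<Rightarrow> real) graded_module" where
  "superfunctions a b U =
     (let C = {f. \<forall>I. (I \<subseteq> {..<b} \<longrightarrow> smooth_on a U (f I)) \<and>
                      (\<forall>x. \<not> (I \<subseteq> {..<b} \<and> x \<in> U) \<longrightarrow> f I x = 0)}
      in \<lparr>carrier = C,
          mult = (\<lambda>f g K x. \<Sum>I\<in>Pow K. wedge_sign I (K - I) * f I x * g (K - I) x),
          one = (\<lambda>I x. if I = {} \<and> x \<in> U then 1 else 0),
          zero = (\<lambda>I x. 0),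
          add = (\<lambda>f g I x. f I x + g I x),
          smult = (\<lambda>c f I x. c * f I x),
          part = (\<lambda>p. {f \<in> C. \<forall>I. odd (card I) \<noteq> p \<longrightarrow> (\<forall>x. f I x = 0)})\<rparr>)"

definition super_euclidean ::
  "nat \<Rightarrow> nat \<Rightarrow> (nat \<Rightarrow> real, nat set \<Rightarrow> (nat \<Rightarrow> real) \<Rightarrow> real) superspace" where
  "super_euclidean a b =
     \<lparr>spc = Euclidean_space a, sec = superfunctions a b,
      rst = (\<lambda>U V f I x. if x \<in> V then f I x else 0)\<rparr>"

definition superball ::
  "nat \<Rightarrow> (nat \<Rightarrow> real) \<Rightarrow> real \<Rightarrow> (nat \<Rightarrow> real, nat set \<Rightarrow> (nat \<Rightarrow> real) \<Rightarrow> real) superspace" where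
  "superball n c r = srestrict (super_euclidean n n)
     {x \<in> topspace (Euclidean_space n). sqrt (\<Sum>i<n. (x i - c i)\<^sup>2) < r}"

text \<open>The standard coordinates on \<open>U \<subseteq> \<real>^{a|b}\<close>: even for \<open>i < a\<close>, odd for \<open>a \<le> i < a + b\<close>.
  All coordinate systems below are indexed in this way.\<close>

definition std_coord ::
  "nat \<Rightarrow> (nat \<Rightarrow> real) set \<Rightarrow> nat \<Rightarrow> nat set \<Rightarrow> (nat \<Rightarrow> real) \<Rightarrow> real" where
  "std_coord a U i = (\<lambda>I x.
     if x \<notin> U then 0
     else if i < a then (if I = {} then x i else 0)
     else (if I = {i - a} then 1 else 0))"

definition coordinates ::
  "nat \<Rightarrow> nat \<Rightarrow> ('p, 's) superspace \<Rightarrow> 'p set \<Rightarrow> (nat \<Rightarrow> 's) \<Rightarrow> bool" where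
  "coordinates a b M U y \<longleftrightarrow>
     openin (spc M) U \<and>
     (\<exists>U' \<phi>. openin (Euclidean_space a) U' \<and>
        smor_iso (srestrict M U) (srestrict (super_euclidean a b) U') \<phi> \<and>
        (\<forall>i<a + b. y i = pull \<phi> U' (std_coord a U' i)))"

definition supermanifold :: "nat \<Rightarrow> nat \<Rightarrow> ('p, 's) superspace \<Rightarrow> bool" where
  "supermanifold a b M \<longleftrightarrow>
     superringed_space M \<and> Hausdorff_space (spc M) \<and> second_countable (spc M) \<and>
     (\<forall>x\<in>topspace (spc M). \<exists>U. openin (spc M) U \<and> x \<in> U \<and>
        (\<exists>U' \<phi>. openin (Euclidean_space a) U' \<and>
           smor_iso (srestrict M U) (srestrict (super_euclidean a b) U') \<phi>))"


section \<open>Sheaves of derivations\<close>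

text \<open>A sheaf of supermodules on a space, over the sheaf of superalgebras \<open>mbase\<close>.\<close>

record ('q, 's, 'v) supermodule_sheaf =
  mspc :: "'q topology"
  mbase :: "'q set \<Rightarrow> (real, 's) graded_module"
  msec :: "'q set \<Rightarrow> ('s, 'v) graded_module"
  mrst :: "'q set \<Rightarrow> 'q set \<Rightarrow> 'v \<Rightarrow> 'v"

definition parity_change_sheaf ::
  "('q, 's, 'v) supermodule_sheaf \<Rightarrow> ('q, 's, 'v) supermodule_sheaf" where
  "parity_change_sheaf S = S\<lparr>msec := (\<lambda>U. parity_change (mbase S U) (msec S U))\<rparr>"

text \<open>Even homomorphisms between sheaves of supermodules on the same space over the same sheaf
  of superalgebras.\<close>

definition even_sheaf_hom ::
  "('q, 's, 'v) supermodule_sheaf \<Rightarrow> ('q, 's, 'w) supermodule_sheaf \<Rightarrow>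
   ('q set \<Rightarrow> 'v \<Rightarrow> 'w) \<Rightarrow> bool" where
  "even_sheaf_hom S T P \<longleftrightarrow>
     (\<forall>U. openin (mspc S) U \<longrightarrow>
        (\<forall>v\<in>carrier (msec S U). P U v \<in> carrier (msec T U)) \<and>
        (\<forall>v\<in>carrier (msec S U). \<forall>w\<in>carrier (msec S U).
           P U (v \<oplus>\<^bsub>msec S U\<^esub> w) = P U v \<oplus>\<^bsub>msec T U\<^esub> P U w) \<and>
        (\<forall>f\<in>carrier (mbase S U). \<forall>v\<in>carrier (msec S U).
           P U (f \<odot>\<^bsub>msec S U\<^esub> v) = f \<odot>\<^bsub>msec T U\<^esub> P U v) \<and>
        (\<forall>p. \<forall>v\<in>part (msec S U) p. P U v \<in> part (msec T U) p)) \<and>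
     (\<forall>U U'. openin (mspc S) U \<and> openin (mspc S) U' \<and> U' \<subseteq> U \<longrightarrow>
        (\<forall>v\<in>carrier (msec S U). P U' (mrst S U U' v) = mrst T U U' (P U v)))"

text \<open>The condition \<open>P\<^sup>2 = id\<close> makes \<open>P\<close> an isomorphism.\<close>

definition Pi_symmetry ::
  "('q, 's, 'v) supermodule_sheaf \<Rightarrow> ('q set \<Rightarrow> 'v \<Rightarrow> 'v) \<Rightarrow> bool" where
  "Pi_symmetry S P \<longleftrightarrow>
     even_sheaf_hom S (parity_change_sheaf S) P \<and>
     (\<forall>U. openin (mspc S) U \<longrightarrow> (\<forall>v\<in>carrier (msec S U). P U (P U v) = v))"

text \<open>The sheaf \<open>Der(O_N \<rightarrow> \<psi>_* O_M)\<close> on \<open>N\<close>, a sheaf of \<open>\<psi>_* O_M\<close>-modules. Its elements over \<open>U\<close> are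
  families \<open>D V : O_N(V) \<rightarrow> O_M(\<psi>^{-1}(V))\<close>, for \<open>V \<subseteq> U\<close> open, compatible with restrictions; outside
  of these domains they are normalized to be \<open>undefined\<close>. A general derivation is the sum of an even
  and an odd one.\<close>

type_synonym ('q, 't, 's) sder = "'q set \<Rightarrow> 't \<Rightarrow> 's"

definition normal_der :: "('q, 't) superspace \<Rightarrow> 'q set \<Rightarrow> ('q, 't, 's) sder \<Rightarrow> ('q, 't, 's) sder" where
  "normal_der N U D = (\<lambda>V g. if openin (spc N) V \<and> V \<subseteq> U \<and> g \<in> carrier (sec N V)
                             then D V g else undefined)"

definition homogeneous_ders ::
  "('q, 't) superspace \<Rightarrow> ('p, 's) superspace \<Rightarrow> ('p, 'q, 's, 't) smor \<Rightarrow> 'q set \<Rightarrow> bool \<Rightarrow>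
   ('q, 't, 's) sder set" where
  "homogeneous_ders N M \<psi> U p = {D.
     normal_der N U D = D \<and>
     (\<forall>V. openin (spc N) V \<and> V \<subseteq> U \<longrightarrow>
        (let A = sec N V; B = sec M (preim M \<psi> V) in
          (\<forall>g\<in>carrier A. D V g \<in> carrier B) \<and>
          (\<forall>f\<in>carrier A. \<forall>g\<in>carrier A. D V (f \<oplus>\<^bsub>A\<^esub> g) = D V f \<oplus>\<^bsub>B\<^esub> D V g) \<and>
          (\<forall>c. \<forall>g\<in>carrier A. D V (c \<odot>\<^bsub>A\<^esub> g) = c \<odot>\<^bsub>B\<^esub> D V g) \<and>
          (\<forall>q. \<forall>g\<in>part A q. D V g \<in> part B (p \<noteq> q)) \<and>
          (\<forall>q. \<forall>f\<in>part A q. \<forall>g\<in>carrier A.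
             D V (f \<otimes>\<^bsub>A\<^esub> g) =
               (D V f \<otimes>\<^bsub>B\<^esub> pull \<psi> V g) \<oplus>\<^bsub>B\<^esub> signed B (p \<and> q) (pull \<psi> V f \<otimes>\<^bsub>B\<^esub> D V g)))) \<and>
     (\<forall>V V'. openin (spc N) V \<and> openin (spc N) V' \<and> V' \<subseteq> V \<and> V \<subseteq> U \<longrightarrow>
        (\<forall>g\<in>carrier (sec N V).
           D V' (rst N V V' g) = rst M (preim M \<psi> V) (preim M \<psi> V') (D V g)))}"

definition der_sheaf ::
  "('q, 't) superspace \<Rightarrow> ('p, 's) superspace \<Rightarrow> ('p, 'q, 's, 't) smor \<Rightarrow>
   ('q, 's, ('q, 't, 's) sder) supermodule_sheaf" where
  "der_sheaf N M \<psi> =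
     (let plus = (\<lambda>U D E. normal_der N U (\<lambda>V g. D V g \<oplus>\<^bsub>sec M (preim M \<psi> V)\<^esub> E V g))
      in \<lparr>mspc = spc N,
          mbase = (\<lambda>U. sec M (preim M \<psi> U)),
          msec = (\<lambda>U.
            \<lparr>carrier = {plus U D E | D E.
               D \<in> homogeneous_ders N M \<psi> U False \<and> E \<in> homogeneous_ders N M \<psi> U True},
             mult = undefined,
             one = undefined,
             zero = normal_der N U (\<lambda>V g. \<zero>\<^bsub>sec M (preim M \<psi> V)\<^esub>),
             add = plus U,
             smult = (\<lambda>h D. normal_der N U (\<lambda>V g.
                rst M (preim M \<psi> U) (preim M \<psi> V) h \<otimes>\<^bsub>sec M (preim M \<psi> V)\<^esub> D V g)),
             part = homogeneous_ders N M \<psi> U\<rparr>),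
          mrst = (\<lambda>U U' D. normal_der N U' D)\<rparr>)"

definition tangent_sheaf ::
  "('p, 's) superspace \<Rightarrow> ('p, 's, ('p, 's, 's) sder) supermodule_sheaf" where
  "tangent_sheaf M = der_sheaf M M smor_id"

text \<open>Coordinate vector fields: \<open>e i\<close> has the parity of \<open>y i\<close> and \<open>e i (y j) = \<delta>_{ij}\<close>.\<close>

definition coordinate_fields ::
  "nat \<Rightarrow> nat \<Rightarrow> ('p, 's) superspace \<Rightarrow> 'p set \<Rightarrow> (nat \<Rightarrow> 's) \<Rightarrow> (nat \<Rightarrow> ('p, 's, 's) sder) \<Rightarrow> bool" where
  "coordinate_fields a b M U y e \<longleftrightarrow>
     coordinates a b M U y \<and>
     (\<forall>i<a + b. e i \<in> part (msec (tangent_sheaf M) U) (a \<le> i)) \<and>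
     (\<forall>i<a + b. \<forall>j<a + b. e i U (y j) = (if i = j then \<one>\<^bsub>sec M U\<^esub> else \<zero>\<^bsub>sec M U\<^esub>))"


section \<open>Morphisms of \<open>\<Pi>\<close>-symmetric supermanifolds\<close>

text \<open>\<open>tangent_map\<close> is \<open>\<psi>_* T_M \<rightarrow> T_{N,M}\<close>, \<open>V \<mapsto> V \<circ> \<psi>\<^sup>*\<close>, and \<open>along\<close> is \<open>T_N \<rightarrow> T_{N,M}\<close>,
  \<open>Y \<mapsto> \<psi>\<^sup>* \<circ> Y\<close>; the latter is how vector fields of \<open>N\<close>, in particular \<open>\<partial>/\<partial>y\<close>, are viewed as
  elements of \<open>T_{N,M}\<close>.\<close>

definition tangent_map ::
  "('p, 's) superspace \<Rightarrow> ('q, 't) superspace \<Rightarrow> ('p, 'q, 's, 't) smor \<Rightarrow> 'q set \<Rightarrow>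
   ('p, 's, 's) sder \<Rightarrow> ('q, 't, 's) sder" where
  "tangent_map M N \<psi> U X = normal_der N U (\<lambda>V g. X (preim M \<psi> V) (pull \<psi> V g))"

definition along ::
  "('q, 't) superspace \<Rightarrow> ('p, 'q, 's, 't) smor \<Rightarrow> 'q set \<Rightarrow> ('q, 't, 't) sder \<Rightarrow> ('q, 't, 's) sder" where
  "along N \<psi> U Y = normal_der N U (\<lambda>V g. pull \<psi> V (Y V g))"

text \<open>\<open>Pbar : T_{N,M} \<rightarrow> \<Pi> T_{N,M}\<close> with \<open>Pbar (f \<partial>/\<partial>y) = f PN(\<partial>/\<partial>y)\<close>, the product on the right being
  that of \<open>\<Pi> T_{N,M}\<close>. As the coordinate fields generate \<open>T_{N,M}\<close> locally, this determines \<open>Pbar\<close>.\<close>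

definition Pbar_of ::
  "('p, 's) superspace \<Rightarrow> ('q, 't) superspace \<Rightarrow> ('p, 'q, 's, 't) smor \<Rightarrow>
   ('q set \<Rightarrow> ('q, 't, 't) sder \<Rightarrow> ('q, 't, 't) sder) \<Rightarrow>
   ('q set \<Rightarrow> ('q, 't, 's) sder \<Rightarrow> ('q, 't, 's) sder) \<Rightarrow> bool" where
  "Pbar_of M N \<psi> PN Pbar \<longleftrightarrow>
     (let T = der_sheaf N M \<psi>; T' = parity_change_sheaf T in
       even_sheaf_hom T T' Pbar \<and>
       (\<forall>a b U y e. coordinate_fields a b N U y e \<longrightarrow>
          (\<forall>i<a + b. \<forall>f\<in>carrier (mbase T U).
             Pbar U (f \<odot>\<^bsub>msec T U\<^esub> along N \<psi> U (e i)) =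
               f \<odot>\<^bsub>msec T' U\<^esub> along N \<psi> U (PN U (e i)))))"

definition Pi_morphism ::
  "('p, 's) superspace \<Rightarrow> ('p set \<Rightarrow> ('p, 's, 's) sder \<Rightarrow> ('p, 's, 's) sder) \<Rightarrow>
   ('q, 't) superspace \<Rightarrow> ('q set \<Rightarrow> ('q, 't, 't) sder \<Rightarrow> ('q, 't, 't) sder) \<Rightarrow>
   ('p, 'q, 's, 't) smor \<Rightarrow> bool" where
  "Pi_morphism M PM N PN \<psi> \<longleftrightarrow>
     smorphism M N \<psi> \<and>
     (\<exists>Pbar. Pbar_of M N \<psi> PN Pbar \<and>
        (\<forall>U. openin (spc N) U \<longrightarrow>
           (\<forall>X\<in>carrier (msec (tangent_sheaf M) (preim M \<psi> U)).
              Pbar U (tangent_map M N \<psi> U X) = tangent_map M N \<psi> U (PM (preim M \<psi> U) X))))"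


section \<open>Products\<close>

text \<open>\<open>M\<close> with projections \<open>\<pi>\<close> and \<open>\<rho>\<close> is the product of \<open>A\<close> (of dimension \<open>a|b\<close>) and \<open>C\<close> (of
  dimension \<open>c|d\<close>): the underlying space is the product, and coordinates of \<open>A\<close> and of \<open>C\<close> together are
  coordinates of \<open>M\<close>. They are reordered such that even coordinates precede odd ones.\<close>

definition product_coord ::
  "nat \<Rightarrow> nat \<Rightarrow> nat \<Rightarrow> (nat \<Rightarrow> 's) \<Rightarrow> (nat \<Rightarrow> 's) \<Rightarrow> nat \<Rightarrow> 's" where
  "product_coord a b c x y i =
     (if i < a then x i
      else if i < a + c then y (i - a)
      else if i < a + c + b then x (i - c)
      else y (i - a - b))"

definition is_product ::
  "nat \<Rightarrow> nat \<Rightarrow> ('p, 's) superspace \<Rightarrow> nat \<Rightarrow> nat \<Rightarrow> ('q, 't) superspace \<Rightarrow>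
   ('p \<times> 'q, 'u) superspace \<Rightarrow> ('p \<times> 'q, 'p, 'u, 's) smor \<Rightarrow> ('p \<times> 'q, 'q, 'u, 't) smor \<Rightarrow> bool" where
  "is_product a b A c d C M \<pi> \<rho> \<longleftrightarrow>
     supermanifold (a + c) (b + d) M \<and>
     spc M = prod_topology (spc A) (spc C) \<and>
     smorphism M A \<pi> \<and> umap \<pi> = fst \<and>
     smorphism M C \<rho> \<and> umap \<rho> = snd \<and>
     (\<forall>U x V y. coordinates a b A U x \<and> coordinates c d C V y \<longrightarrow>
        coordinates (a + c) (b + d) M (U \<times> V)
          (product_coord a b c
            (\<lambda>i. rst M (preim M \<pi> U) (U \<times> V) (pull \<pi> U (x i)))
            (\<lambda>i. rst M (preim M \<rho> V) (U \<times> V) (pull \<rho> V (y i)))))"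

text \<open>In a product with projections \<open>\<pi> : M \<rightarrow> A\<close> and \<open>\<rho> : M \<rightarrow> C\<close>, the vector field \<open>X\<close> of \<open>A\<close> over \<open>U\<close>,
  regarded as a section of the summand \<open>T_A\<close> of \<open>T_{A \<times> C}\<close>, is the vector field \<open>X'\<close> of \<open>M\<close> over
  \<open>\<pi>^{-1}(U)\<close> which acts as \<open>X\<close> on functions from \<open>A\<close> and annihilates functions from \<open>C\<close>.\<close>

definition is_lift ::
  "('p, 's) superspace \<Rightarrow> ('m, 'p, 'u, 's) smor \<Rightarrow> ('q, 't) superspace \<Rightarrow> ('m, 'q, 'u, 't) smor \<Rightarrow>
   ('m, 'u) superspace \<Rightarrow> 'p set \<Rightarrow> ('p, 's, 's) sder \<Rightarrow> ('m, 'u, 'u) sder \<Rightarrow> bool" where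
  "is_lift A \<pi> C \<rho> M U X X' \<longleftrightarrow>
     X' \<in> carrier (msec (tangent_sheaf M) (preim M \<pi> U)) \<and>
     (\<forall>V. openin (spc A) V \<and> V \<subseteq> U \<longrightarrow>
        (\<forall>f\<in>carrier (sec A V). X' (preim M \<pi> V) (pull \<pi> V f) = pull \<pi> V (X V f))) \<and>
     (\<forall>V. openin (spc C) V \<longrightarrow>
        (let O' = preim M \<pi> U \<inter> preim M \<rho> V in
          \<forall>g\<in>carrier (sec C V). X' O' (rst M (preim M \<rho> V) O' (pull \<rho> V g)) = \<zero>\<^bsub>sec M O'\<^esub>))"

text \<open>\<open>PM\<close> is the \<open>\<Pi>\<close>-symmetry \<open>PA \<times> PC\<close> on \<open>T_A \<oplus> T_C\<close>. It is determined by its values on the lifts,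
  which generate the tangent sheaf of the product.\<close>

definition product_Pi_symmetry ::
  "('p, 's) superspace \<Rightarrow> ('p set \<Rightarrow> ('p, 's, 's) sder \<Rightarrow> ('p, 's, 's) sder) \<Rightarrow>
   ('m, 'p, 'u, 's) smor \<Rightarrow>
   ('q, 't) superspace \<Rightarrow> ('q set \<Rightarrow> ('q, 't, 't) sder \<Rightarrow> ('q, 't, 't) sder) \<Rightarrow>
   ('m, 'q, 'u, 't) smor \<Rightarrow>
   ('m, 'u) superspace \<Rightarrow> ('m set \<Rightarrow> ('m, 'u, 'u) sder \<Rightarrow> ('m, 'u, 'u) sder) \<Rightarrow> bool" where
  "product_Pi_symmetry A PA \<pi> C PC \<rho> M PM \<longleftrightarrow>
     Pi_symmetry (tangent_sheaf M) PM \<and>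
     (\<forall>U X X'. openin (spc A) U \<and> X \<in> carrier (msec (tangent_sheaf A) U) \<and> is_lift A \<pi> C \<rho> M U X X' \<longrightarrow>
        is_lift A \<pi> C \<rho> M U (PA U X) (PM (preim M \<pi> U) X')) \<and>
     (\<forall>V Y Y'. openin (spc C) V \<and> Y \<in> carrier (msec (tangent_sheaf C) V) \<and> is_lift C \<rho> A \<pi> M V Y Y' \<longrightarrow>
        is_lift C \<rho> A \<pi> M V (PC V Y) (PM (preim M \<rho> V) Y'))"


section \<open>Tangent spaces, subsupermanifolds and transversality\<close>

text \<open>The value of \<open>f\<close> at \<open>x\<close> is the number \<open>c\<close> such that \<open>f - c\<close> is not invertible in the stalk at \<open>x\<close>.\<close>

definition value_at :: "('p, 's) superspace \<Rightarrow> 'p \<Rightarrow> 'p set \<Rightarrow> 's \<Rightarrow> real" where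
  "value_at M x U f = (THE c. \<not> (\<exists>V. openin (spc M) V \<and> x \<in> V \<and> V \<subseteq> U \<and>
     rst M U V f \<ominus>\<^bsub>sec M V\<^esub> (c \<odot>\<^bsub>sec M V\<^esub> \<one>\<^bsub>sec M V\<^esub>) \<in> Units (sec M V)))"

text \<open>A derivation \<open>\<eta>\<close> of the stalk at \<open>x\<close> with values in \<open>\<real>\<close> is given by its values \<open>\<eta> U f\<close> on the
  representatives \<open>(U, f)\<close> of germs at \<open>x\<close>; it is normalized to \<open>0\<close> on other arguments.\<close>

definition homogeneous_tangents ::
  "('p, 's) superspace \<Rightarrow> 'p \<Rightarrow> bool \<Rightarrow> ('p set \<Rightarrow> 's \<Rightarrow> real) set" where
  "homogeneous_tangents M x p = {\<eta>.
     (\<forall>U f. \<not> (openin (spc M) U \<and> x \<in> U \<and> f \<in> carrier (sec M U)) \<longrightarrow> \<eta> U f = 0) \<and>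
     (\<forall>U. openin (spc M) U \<and> x \<in> U \<longrightarrow>
        (let A = sec M U in
          (\<forall>f\<in>carrier A. \<forall>g\<in>carrier A. \<eta> U (f \<oplus>\<^bsub>A\<^esub> g) = \<eta> U f + \<eta> U g) \<and>
          (\<forall>c. \<forall>f\<in>carrier A. \<eta> U (c \<odot>\<^bsub>A\<^esub> f) = c * \<eta> U f) \<and>
          (\<forall>f\<in>part A (\<not> p). \<eta> U f = 0) \<and>
          (\<forall>q. \<forall>f\<in>part A q. \<forall>g\<in>carrier A.
             \<eta> U (f \<otimes>\<^bsub>A\<^esub> g) =
               \<eta> U f * value_at M x U g + (if p \<and> q then -1 else 1) * value_at M x U f * \<eta> U g) \<and>
          (\<forall>V. openin (spc M) V \<and> x \<in> V \<and> V \<subseteq> U \<longrightarrow>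
             (\<forall>f\<in>carrier A. \<eta> V (rst M U V f) = \<eta> U f))))}"

definition tangent_space :: "('p, 's) superspace \<Rightarrow> 'p \<Rightarrow> ('p set \<Rightarrow> 's \<Rightarrow> real) set" where
  "tangent_space M x = {\<lambda>U f. \<eta> U f + \<zeta> U f | \<eta> \<zeta>.
     \<eta> \<in> homogeneous_tangents M x False \<and> \<zeta> \<in> homogeneous_tangents M x True}"

definition differential ::
  "('p, 's) superspace \<Rightarrow> ('q, 't) superspace \<Rightarrow> ('p, 'q, 's, 't) smor \<Rightarrow> 'p \<Rightarrow>
   ('p set \<Rightarrow> 's \<Rightarrow> real) \<Rightarrow> 'q set \<Rightarrow> 't \<Rightarrow> real" where
  "differential M N \<psi> x \<eta> =
     (\<lambda>V g. if openin (spc N) V \<and> umap \<psi> x \<in> V \<and> g \<in> carrier (sec N V)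
            then \<eta> (preim M \<psi> V) (pull \<psi> V g) else 0)"

definition submersion ::
  "('p, 's) superspace \<Rightarrow> ('q, 't) superspace \<Rightarrow> ('p, 'q, 's, 't) smor \<Rightarrow> bool" where
  "submersion M N \<psi> \<longleftrightarrow>
     smorphism M N \<psi> \<and>
     (\<forall>x\<in>topspace (spc M).
        differential M N \<psi> x ` tangent_space M x = tangent_space N (umap \<psi> x))"

definition sembedding ::
  "('p, 's) superspace \<Rightarrow> ('q, 't) superspace \<Rightarrow> ('p, 'q, 's, 't) smor \<Rightarrow> bool" where
  "sembedding M N \<psi> \<longleftrightarrow>
     smorphism M N \<psi> \<and> embedding_map (spc M) (spc N) (umap \<psi>) \<and>
     (\<forall>x\<in>topspace (spc M). inj_on (differential M N \<psi> x) (tangent_space M x))"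

definition subsupermanifold ::
  "nat \<Rightarrow> nat \<Rightarrow> ('p, 's) superspace \<Rightarrow> ('p, 't) superspace \<Rightarrow> ('p, 'p, 't, 's) smor \<Rightarrow> bool" where
  "subsupermanifold a b M Z j \<longleftrightarrow>
     supermanifold a b Z \<and> sembedding Z M j \<and> (\<forall>z\<in>topspace (spc Z). umap j z = z)"

definition supertransversal ::
  "('p, 's) superspace \<Rightarrow> ('q, 't) superspace \<Rightarrow> ('p, 'q, 's, 't) smor \<Rightarrow>
   ('q, 'u) superspace \<Rightarrow> ('q, 'q, 'u, 't) smor \<Rightarrow> bool" where
  "supertransversal M N \<psi> Z j \<longleftrightarrow>
     (\<forall>x\<in>preim M \<psi> (topspace (spc Z)).
        let y = umap \<psi> x in
        {\<lambda>V g. \<xi> V g + \<zeta> V g | \<xi> \<zeta>.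
           \<xi> \<in> differential M N \<psi> x ` tangent_space M x \<and>
           \<zeta> \<in> differential Z N j y ` tangent_space Z y} = tangent_space N y)"

text \<open>\<open>S\<close>, with inclusion \<open>j : S \<rightarrow> M\<close>, is the fibre \<open>F^{-1}(0)\<close> of \<open>F : M \<rightarrow> \<real>^{p|q}\<close>: its points are
  the zeros of the underlying map of \<open>F\<close>, and its structure sheaf is the quotient of \<open>O_M\<close> by the ideal
  sheaf generated by the pull-backs under \<open>F\<close> of the coordinates of \<open>\<real>^{p|q}\<close>. The last two conjuncts say
  that \<open>j\<^sup>*\<close> is surjective on stalks and has that ideal sheaf as its kernel.\<close>

definition is_zero_fibre ::
  "('p, 's) superspace \<Rightarrow> nat \<Rightarrow> nat \<Rightarrow>
   ('p, nat \<Rightarrow> real, 's, nat set \<Rightarrow> (nat \<Rightarrow> real) \<Rightarrow> real) smor \<Rightarrow>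
   ('p, 't) superspace \<Rightarrow> ('p, 'p, 't, 's) smor \<Rightarrow> bool" where
  "is_zero_fibre M p q F S j \<longleftrightarrow>
     superringed_space S \<and>
     spc S = subtopology (spc M) {x \<in> topspace (spc M). umap F x = (\<lambda>i. 0)} \<and>
     smorphism S M j \<and> (\<forall>x\<in>topspace (spc S). umap j x = x) \<and>
     (\<forall>V s x. openin (spc S) V \<and> s \<in> carrier (sec S V) \<and> x \<in> V \<longrightarrow>
        (\<exists>U f. openin (spc M) U \<and> x \<in> U \<and> preim S j U \<subseteq> V \<and> f \<in> carrier (sec M U) \<and>
               pull j U f = rst S V (preim S j U) s)) \<and>
     (\<forall>U f. openin (spc M) U \<and> f \<in> carrier (sec M U) \<longrightarrow>
        (pull j U f = \<zero>\<^bsub>sec S (preim S j U)\<^esub> \<longleftrightarrow>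
           (\<forall>x\<in>preim S j U. \<exists>U'. openin (spc M) U' \<and> x \<in> U' \<and> U' \<subseteq> U \<and>
              rst M U U' f \<in> Idl\<^bsub>sec M U'\<^esub>
                ((\<lambda>i. rst M (topspace (spc M)) U'
                        (pull F (topspace (Euclidean_space p))
                                (std_coord p (topspace (Euclidean_space p)) i))) ` {..<p + q}))))"

text \<open>\<open>W\<close>, with inclusion \<open>\<iota>\<close>, is \<open>\<Psi>^{-1}(Z)\<close> for \<open>\<Psi> : M \<rightarrow> N\<close> and a subsupermanifold \<open>Z\<close> of \<open>N\<close> of
  codimension \<open>p|q\<close>: it is glued from the local fibres \<open>(G \<circ> \<Psi>)^{-1}(0)\<close>.\<close>

definition is_preimage ::
  "('p, 's) superspace \<Rightarrow> ('q, 't) superspace \<Rightarrow> ('p, 'q, 's, 't) smor \<Rightarrow> nat \<Rightarrow> nat \<Rightarrow>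
   ('q, 'u) superspace \<Rightarrow> ('q, 'q, 'u, 't) smor \<Rightarrow>
   ('p, 'w) superspace \<Rightarrow> ('p, 'p, 'w, 's) smor \<Rightarrow> bool" where
  "is_preimage M N \<Psi> p q Z j W \<iota> \<longleftrightarrow>
     topspace (spc W) = preim M \<Psi> (topspace (spc Z)) \<and>
     (\<forall>z\<in>topspace (spc Z). \<exists>U G.
        openin (spc N) U \<and> z \<in> U \<and>
        submersion (srestrict N U) (super_euclidean p q) G \<and>
        is_zero_fibre (srestrict N U) p q G (srestrict Z (topspace (spc Z) \<inter> U)) j \<and>
        is_zero_fibre (srestrict M (preim M \<Psi> U)) p q (smor_comp (srestrict N U) G \<Psi>)
          (srestrict W (topspace (spc W) \<inter> preim M \<Psi> U)) \<iota>)"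

end

theory Submission
 imports Defs
begin

text \<open>A vector field \<open>v\<close> of \<open>W\<close> is locally the restriction of a vector field \<open>X\<close> of \<open>M\<close>, and \<open>P\<^sub>W v\<close> is the
 restriction of \<open>P\<^sub>M X\<close>. The choice of \<open>X\<close> does not matter: \<open>P\<^sub>M\<close> is linear up to sign, so it preserves the fields with
 values in the ideal of \<open>W\<close>. The point is that \<open>P\<^sub>M X\<close> is tangent to \<open>W\<close> if \<open>X\<close> is. The ideal of \<open>W\<close> is generated by
 functions \<open>\<Psi>\<^sup>* g\<close> with \<open>g = 0\<close> on \<open>Z\<close>, and since \<open>\<Psi>\<close> is a morphism of \<open>\<Pi>\<close>-symmetric supermanifolds,
 \<open>P\<^sub>M X (\<Psi>\<^sup>* g)\<close> is the sum of the terms \<open>X(\<Psi>\<^sup>* y) \<cdot> \<Psi>\<^sup>*(P\<^sub>N \<partial>\<^sub>y g)\<close>, up to signs, over the coordinates \<open>y\<close> of \<open>N\<close>.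
 The derivation \<open>X \<circ> \<Psi>\<^sup>*\<close>, restricted to \<open>W\<close>, kills the functions which vanish on \<open>Z\<close>. Hence it is a combination of
 fields \<open>V\<close> of \<open>N\<close> which extend the coordinate fields of \<open>Z\<close>, and \<open>P\<^sub>M X (\<Psi>\<^sup>* g)\<close> restricts to the corresponding
 combination of the functions \<open>P\<^sub>N V g\<close>. These vanish on \<open>Z\<close>, because \<open>Z \<rightarrow> N\<close> is a morphism of \<open>\<Pi>\<close>-symmetric supermanifolds.\<close>

text \<open>That a derivation killing the functions which vanish on Z is a combination of extended
  coordinate fields is a uniqueness statement. Two derivations into functions on W agree if they
  agree on functions \<open>y i\<close> and on a family K of subsets for which the
  \<open>y i\<close> satisfy a Hadamard lemma modulo K (\<open>had\<close>). Coordinates of N give K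
  = 0; coordinates of Z, lifted to N, give the functions vanishing on Z. The proof climbs through
  the degrees in the odd coordinates of W, because values at points do not see nilpotents. It is
  done once, for derivations along a local morphism of sheaves (\<open>shmor\<close>,
  \<open>lder\<close>); fields, derivations along a morphism and their restrictions to W are
  instances.

  Two obstacles shape the rest. The morphism condition speaks about fields on full preimages of open
  sets, while fields of W lift only near a point, since only stalks map onto stalks; cut-off
  functions bridge this, and \<open>PW\<close> is glued from local values. Moreover a map into a
  parity change is linear only up to \<open>grade_inv\<close>, so homogeneous parts are treated
  first.\<close>

abbreviation (input) ring_add_in ("(_ +[_]/ _)" [65, 0, 66] 65) where "x +[A] y \<equiv> x \<oplus>\<^bsub>A\<^esub> y"
abbreviation (input) ring_minus_in ("(_ -[_]/ _)" [65, 0, 66] 65) where "x -[A] y \<equiv> x \<ominus>\<^bsub>A\<^esub> y"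
abbreviation (input) ring_uminus_in ("(-[_]/ _)" [0, 81] 80) where "-[A] x \<equiv> \<ominus>\<^bsub>A\<^esub> x"
abbreviation (input) ring_mult_in ("(_ *[_]/ _)" [70, 0, 71] 70) where "x *[A] y \<equiv> x \<otimes>\<^bsub>A\<^esub> y"
abbreviation (input) ring_smult_in ("(_ \<odot>[_]/ _)" [70, 0, 71] 70) where "c \<odot>[A] x \<equiv> c \<odot>\<^bsub>A\<^esub> x"
abbreviation (input) ring_zero_in ("0[_]") where "0[A] \<equiv> \<zero>\<^bsub>A\<^esub>"
abbreviation (input) ring_one_in ("1[_]") where "1[A] \<equiv> \<one>\<^bsub>A\<^esub>"
abbreviation (input) oset where "oset M V \<equiv> openin (spc M) V"
abbreviation (input) Part where "Part M V \<equiv> part (sec M V)"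
abbreviation (input) tpart where "tpart M U \<equiv> part (msec (tangent_sheaf M) U)"
abbreviation (input) Sec where "Sec M V \<equiv> carrier (sec M V)"

section \<open>Smooth functions on Euclidean space\<close>

text \<open>The product topology of the library space is the type class topology on sequences, so
  that \<open>open\<close> and \<open>continuous_on\<close> become available.\<close>

lemma Euclidean_space_eq: "Euclidean_space a = top_of_set (topspace (Euclidean_space a))"
 by (simp add: Euclidean_space_def euclidean_product_topology)

lemma subtopology_Euclidean_space_open:
 assumes "openin (Euclidean_space a) U"
 shows "subtopology (Euclidean_space a) U = top_of_set U"
proof -
 have "U <= topspace (Euclidean_space a)" using assms openin_subset by blast
 then show ?thesis
  by (subst Euclidean_space_eq) (simp add: subtopology_subtopology inf.absorb2)
qed

lemma continuous_on_fun_upd: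
 fixes f :: "'z::topological_space => nat => real"
 assumes "continuous_on S f" "continuous_on S g"
 shows "continuous_on S (%z. (f z)(i := g z))"
proof (rule continuous_on_coordinatewise_then_product)
 fix j
 have "continuous_on S (%z. f z j)" for j
  using continuous_on_product_then_coordinatewise[OF assms(1)] .
 then show "continuous_on S (%z. ((f z)(i := g z)) j)"
  using assms(2) by (cases "j = i") auto
qed

lemma openin_Euclidean_space_upd:
 assumes U: "openin (Euclidean_space a) U" and x: "x : U" and i: "i < a"
 shows "\<exists>e>0. \<forall>t. \<bar>t - x i\<bar> < e --> x(i := t) : U"
proof -
 obtain T where T: "open T" "U = topspace (Euclidean_space a) Int T"
  using U by (subst (asm) Euclidean_space_eq) (auto simp: openin_open)
 have "continuous_on UNIV (%t. x(i := t))"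
  by (intro continuous_on_fun_upd continuous_intros)
 then have "open ((%t. x(i := t)) -` T)" using T(1) by (simp add: open_vimage)
 moreover have "x i : (%t. x(i := t)) -` T" using x T by auto
 ultimately obtain e where "e > 0" "ball (x i) e <= (%t. x(i := t)) -` T"
  by (meson open_contains_ball)
 moreover have "x(i := t) : topspace (Euclidean_space a)" for t
  using x i T(2) by (auto simp: topspace_Euclidean_space)
 ultimately show ?thesis using T(2) by (force simp: dist_real_def abs_minus_commute)
qed

lemma eventually_upd_in:
 assumes "openin (Euclidean_space a) U" "x : U" "i < a"
 shows "eventually (%t. x(i := t) : U) (nhds (x i))"
proof -
 obtain e where "e > 0" "\<forall>t. \<bar>t - x i\<bar> < e --> x(i := t) : U"
  using openin_Euclidean_space_upd[OF assms] by blast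
 then show ?thesis by (auto simp: eventually_nhds_metric dist_real_def)
qed

section \<open>Functions of class C^k\<close>

definition has_partial :: "nat => (nat => real) set => ((nat => real) => real) => ((nat => real) => real) => bool"
 where "has_partial i U f g \<longleftrightarrow> (\<forall>x\<in>U. ((%t. f (x(i := t))) has_real_derivative g x) (at (x i)))"

lemma has_partial_eq: "has_partial i U f g ==> x : U ==> partial_deriv i f x = g x"
 unfolding has_partial_def partial_deriv_def by (meson DERIV_imp_deriv)

lemma has_partial_cong:
 assumes U: "openin (Euclidean_space a) U" "i < a" and eq: "\<And>x. x : U ==> f x = f' x"
  and g: "\<And>x. x : U ==> g x = g' x"
 shows "has_partial i U f g \<longleftrightarrow> has_partial i U f' g'"
proof -
 have "((%t. f (x(i := t))) has_real_derivative D) (at (x i)) \<longleftrightarrow>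
    ((%t. f' (x(i := t))) has_real_derivative D) (at (x i))" if "x : U" for x D
  by (rule DERIV_cong_ev) (use eventually_upd_in[OF U(1) that U(2)] eq in \<open>auto elim: eventually_mono\<close>)
 then show ?thesis unfolding has_partial_def using g by auto
qed

text \<open>Differentiability of finite order, with derivatives taken recursively, so that closure
  properties can be proved by induction on \<open>k\<close>. The clause \<open>has_partial\<close>
  is needed besides \<open>partial_deriv\<close>, because \<open>deriv\<close> has a value even
  where no derivative exists.\<close>

primrec Ck :: "nat => (nat => real) set => nat => ((nat => real) => real) => bool" where
 "Ck a U 0 f = continuous_on U f"
| "Ck a U (Suc k) f = (continuous_on U f &
   (\<forall>i<a. has_partial i U f (partial_deriv i f) & Ck a U k (partial_deriv i f)))"

lemma Ck_continuous: "Ck a U k f ==> continuous_on U f"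
 by (cases k) auto

lemma Ck_cong:
 assumes U: "openin (Euclidean_space a) U" and eq: "\<And>x. x : U ==> f x = g x"
 shows "Ck a U k f \<longleftrightarrow> Ck a U k g"
 using eq
proof (induction k arbitrary: f g)
 case 0 then show ?case by (simp cong: continuous_on_cong)
next
 case (Suc k)
 have pd: "partial_deriv i f x = partial_deriv i g x" if "i < a" "x : U" for i x
  unfolding partial_deriv_def
  by (rule deriv_cong_ev) (use eventually_upd_in[OF U that(2,1)] Suc.prems in \<open>auto elim!: eventually_mono\<close>)
 show ?case
  using Suc.IH[of "partial_deriv _ f" "partial_deriv _ g"] pd has_partial_cong[OF U _ Suc.prems pd] Suc.prems
  by (auto cong: continuous_on_cong)
qed

text \<open>Derivatives are unique, so any candidate \<open>g\<close> agrees with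
  \<open>partial_deriv i f\<close> on \<open>U\<close>, and class C^k on the open set
  \<open>U\<close> depends only on the values there.\<close>

lemma Ck_SucI:
 assumes U: "openin (Euclidean_space a) U" and "continuous_on U f"
  and "\<And>i. i < a ==> \<exists>g. has_partial i U f g & Ck a U k g"
 shows "Ck a U (Suc k) f"
proof -
 have "has_partial i U f (partial_deriv i f) & Ck a U k (partial_deriv i f)" if i: "i < a" for i
 proof -
  obtain g where g: "has_partial i U f g" "Ck a U k g" using assms(3)[OF i] by blast
  then show ?thesis
   using has_partial_eq[OF g(1)] has_partial_cong[OF U i, of f f "partial_deriv i f" g]
    Ck_cong[OF U, of "partial_deriv i f" g]
   by blast
 qed
 then show ?thesis using assms(2) by simp
qed

lemma Ck_Suc_imp: "Ck a U (Suc k) f ==> Ck a U k f"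
proof (induction k arbitrary: f)
 case (Suc k)
 have "Ck a U k (partial_deriv i f)" if "i < a" for i
  by (rule Suc.IH) (use Suc.prems that in simp)
 then show ?case using Suc.prems by simp
qed simp

lemma Ck_mono: "Ck a U k f ==> V <= U ==> Ck a V k f"
 by (induction k arbitrary: f) (auto simp: has_partial_def intro: continuous_on_subset)

lemma continuous_on_open_cover:
 fixes f :: "(nat => real) => real"
 assumes "\<And>x. x : U ==> \<exists>V. openin (Euclidean_space a) V & x : V & V <= U & continuous_on V f"
 shows "continuous_on U f"
 unfolding continuous_on_eq_continuous_within
proof
 fix x assume x: "x : U"
 obtain V where V: "openin (Euclidean_space a) V" "x : V" "V <= U" "continuous_on V f"
  using assms x by blast
 obtain T where T: "open T" "V = topspace (Euclidean_space a) Int T"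
  using V(1) by (subst (asm) Euclidean_space_eq) (auto simp: openin_open)
 have "U <= topspace (Euclidean_space a)" using assms openin_subset by blast
 then have "V Int T - {x} = U Int T - {x}" using V T by auto
 then have "at x within U = at x within V"
  using V T by (intro at_within_nhd[of x T]) auto
 then show "continuous (at x within U) f"
  using V by (simp add: continuous_on_eq_continuous_within continuous_within)
qed

lemma Ck_local:
 assumes "\<And>x. x : U ==> \<exists>V. openin (Euclidean_space a) V & x : V & V <= U & Ck a V k f"
 shows "Ck a U k f"
 using assms
proof (induction k arbitrary: f)
 case 0
 have "continuous_on U f"
  by (rule continuous_on_open_cover) (use 0 in \<open>simp only: Ck.simps\<close>)
 then show ?case by simp
next
 case (Suc k)
 have ex: "\<exists>V. openin (Euclidean_space a) V & x : V & V <= U & continuous_on V f &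
   (\<forall>i<a. has_partial i V f (partial_deriv i f) & Ck a V k (partial_deriv i f))" if "x : U" for x
  using Suc.prems[OF that] unfolding Ck.simps .
 have "continuous_on U f"
  by (rule continuous_on_open_cover) (use ex in blast)
 moreover have "Ck a U k (partial_deriv i f)" if i: "i < a" for i
  by (rule Suc.IH) (use ex i in blast)
 moreover have "has_partial i U f (partial_deriv i f)" if i: "i < a" for i
  unfolding has_partial_def using ex i unfolding has_partial_def by blast
 ultimately show ?case by simp
qed

text \<open>Each index of the list costs one order of differentiability. One direction is an
  induction on the order for all lists at once, the other an induction on the list for all
  orders.\<close>

lemma smooth_on_iff:
 assumes U: "openin (Euclidean_space a) U"
 shows "smooth_on a U f \<longleftrightarrow> (\<forall>k. Ck a U k f)"
proof
 assume f: "smooth_on a U f"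
 have "set js <= {..<a} ==> Ck a U k (foldr partial_deriv js f)" for k js
 proof (induction k arbitrary: js)
  case 0 then show ?case
   using f unfolding smooth_on_def by (auto simp: subtopology_Euclidean_space_open[OF U])
 next
  case (Suc k)
  have "Ck a U k (foldr partial_deriv (i # js) f)" if "i < a" for i
   by (rule Suc.IH) (use Suc.prems that in auto)
  moreover have "has_partial i U (foldr partial_deriv js f) (partial_deriv i (foldr partial_deriv js f))"
   if "i < a" for i
  proof -
   have "\<forall>x\<in>U. (%t. foldr partial_deriv js f (x(i := t))) differentiable (at (x i))"
    using f Suc.prems that unfolding smooth_on_def by blast
   then show ?thesis
    unfolding has_partial_def partial_deriv_def
    by (simp add: DERIV_deriv_iff_real_differentiable)
  qed
  moreover have "continuous_on U (foldr partial_deriv js f)"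
   using f Suc.prems unfolding smooth_on_def by (auto simp: subtopology_Euclidean_space_open[OF U])
  ultimately show ?case by simp
 qed
 from this[of "[]"] show "\<forall>k. Ck a U k f" by simp
next
 assume f: "\<forall>k. Ck a U k f"
 have *: "set js <= {..<a} ==> \<forall>k. Ck a U k (foldr partial_deriv js f)" for js
 proof (induction js)
  case (Cons i js)
  then have js: "set js <= {..<a}" by simp
  have "Ck a U (Suc k) (foldr partial_deriv js f)" for k using Cons.IH[OF js] by blast
  then show ?case using Cons.prems unfolding Ck.simps by simp
 qed (use f in simp)
 show "smooth_on a U f"
  unfolding smooth_on_def
 proof (intro allI impI conjI ballI)
  fix js :: "nat list" assume js: "set js <= {..<a}"
  have "Ck a U 1 (foldr partial_deriv js f)" using *[OF js] by blast
  then have ck: "continuous_on U (foldr partial_deriv js f)"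
   "\<And>i. i < a ==> has_partial i U (foldr partial_deriv js f) (partial_deriv i (foldr partial_deriv js f))"
   by auto
  show "continuous_map (subtopology (Euclidean_space a) U) euclideanreal (foldr partial_deriv js f)"
   using ck by (simp add: subtopology_Euclidean_space_open[OF U])
  fix i x assume "i < a" "x : U"
  then show "(%t. foldr partial_deriv js f (x(i := t))) differentiable at (x i)"
   using ck(2)[of i] unfolding has_partial_def by (auto simp: real_differentiable_def)
 qed
qed

section \<open>Closure properties of C^k functions\<close>

lemma Ck_const: "openin (Euclidean_space a) U ==> Ck a U k (%x. c)"
proof (induction k arbitrary: c)
 case (Suc k)
 show ?case by (rule Ck_SucI) (use Suc in \<open>auto simp: has_partial_def intro!: exI[of _ "%x. 0"]\<close>)
qed simp

lemma Ck_coord: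
 assumes U: "openin (Euclidean_space a) U"
 shows "Ck a U k (%x. x j)"
proof -
 have c: "continuous_on U (%x. x j)"
  using continuous_on_product_then_coordinatewise[OF continuous_on_id] .
 show ?thesis
 proof (cases k)
  case (Suc k)
  show ?thesis unfolding Suc
  proof (rule Ck_SucI[OF U c])
   fix i
   have "has_partial i U (%x. x j) (%x. if i = j then 1 else 0)"
    unfolding has_partial_def by (auto simp: fun_upd_apply intro!: derivative_eq_intros)
   then show "\<exists>g. has_partial i U (%x. x j) g & Ck a U k g" using Ck_const[OF U] by blast
  qed
 qed (use c in simp)
qed

lemma Ck_add:
 assumes U: "openin (Euclidean_space a) U"
 shows "Ck a U k f ==> Ck a U k g ==> Ck a U k (%x. f x + g x)"
proof (induction k arbitrary: f g)
 case 0 then show ?case by (auto intro: continuous_intros)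
next
 case (Suc k)
 show ?case
 proof (rule Ck_SucI[OF U])
  show "continuous_on U (%x. f x + g x)" using Suc.prems by (auto intro: continuous_intros)
  fix i assume i: "i < a"
  have "has_partial i U (%x. f x + g x) (%x. partial_deriv i f x + partial_deriv i g x)"
   using Suc.prems i unfolding has_partial_def Ck.simps by (auto intro!: derivative_intros)
  then show "\<exists>h. has_partial i U (%x. f x + g x) h & Ck a U k h"
   using Suc i by auto
 qed
qed

lemma has_partial_mult:
 assumes "has_partial i U f f'" "has_partial i U g g'"
 shows "has_partial i U (%x. f x * g x) (%x. f' x * g x + f x * g' x)"
 unfolding has_partial_def
proof
 fix x assume "x : U"
 then have "((%t. f (x(i := t))) has_real_derivative f' x) (at (x i))"
  "((%t. g (x(i := t))) has_real_derivative g' x) (at (x i))"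
  using assms by (auto simp: has_partial_def)
 from DERIV_mult[OF this]
 show "((%t. f (x(i := t)) * g (x(i := t))) has_real_derivative f' x * g x + f x * g' x) (at (x i))"
  by (simp add: algebra_simps)
qed

lemma Ck_mult:
 assumes U: "openin (Euclidean_space a) U"
 shows "Ck a U k f ==> Ck a U k g ==> Ck a U k (%x. f x * g x)"
proof (induction k arbitrary: f g)
 case 0 then show ?case by (auto intro: continuous_intros)
next
 case (Suc k)
 show ?case
 proof (rule Ck_SucI[OF U])
  show "continuous_on U (%x. f x * g x)" using Suc.prems by (auto intro: continuous_intros)
  fix i assume i: "i < a"
  have "has_partial i U (%x. f x * g x) (%x. partial_deriv i f x * g x + f x * partial_deriv i g x)"
   using Suc.prems i by (auto intro: has_partial_mult)
  moreover have "Ck a U k (%x. partial_deriv i f x * g x + f x * partial_deriv i g x)"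
   using Suc.prems i Ck_Suc_imp[OF Suc.prems(1)] Ck_Suc_imp[OF Suc.prems(2)]
   by (intro Ck_add[OF U] Suc.IH) auto
  ultimately show "\<exists>h. has_partial i U (%x. f x * g x) h & Ck a U k h" by blast
 qed
qed

lemma Ck_sum:
 assumes U: "openin (Euclidean_space a) U"
 shows "(\<And>j. j : J ==> Ck a U k (f j)) ==> Ck a U k (%x. \<Sum>j\<in>J. f j x)"
 by (induction J rule: infinite_finite_induct) (auto intro: Ck_const[OF U] Ck_add[OF U])

lemma Ck_prod:
 assumes U: "openin (Euclidean_space a) U"
 shows "(\<And>j. j : J ==> Ck a U k (f j)) ==> Ck a U k (%x. \<Prod>j\<in>J. f j x)"
 by (induction J rule: infinite_finite_induct) (auto intro: Ck_const[OF U] Ck_mult[OF U])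

lemma Ck_inverse:
 assumes U: "openin (Euclidean_space a) U" and nz: "\<And>x. x : U ==> f x \<noteq> 0"
 shows "Ck a U k f ==> Ck a U k (%x. inverse (f x))"
proof (induction k)
 case 0 then show ?case using nz by (auto intro!: continuous_intros)
next
 case (Suc k)
 show ?case
 proof (rule Ck_SucI[OF U])
  show "continuous_on U (%x. inverse (f x))" using Suc.prems nz by (auto intro!: continuous_intros)
  fix i assume i: "i < a"
  let ?h = "%x. - 1 * (partial_deriv i f x * (inverse (f x) * inverse (f x)))"
  have "has_partial i U (%x. inverse (f x)) ?h"
   unfolding has_partial_def
  proof
   fix x assume x: "x : U"
   have "((%t. f (x(i := t))) has_real_derivative partial_deriv i f x) (at (x i))"
    using Suc.prems i x by (auto simp: has_partial_def)
   from DERIV_inverse'[OF this]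
   show "((%t. inverse (f (x(i := t)))) has_real_derivative ?h x) (at (x i))"
    using nz[OF x] by (simp add: algebra_simps)
  qed
  moreover have "Ck a U k ?h"
   using Suc.prems i Ck_Suc_imp[OF Suc.prems] Suc.IH
   by (intro Ck_mult[OF U] Ck_const[OF U]) auto
  ultimately show "\<exists>h. has_partial i U (%x. inverse (f x)) h & Ck a U k h" by blast
 qed
qed

section \<open>Hadamard's lemma for smooth functions\<close>

lemma Ck_subst:
 assumes U: "openin (Euclidean_space a) U" and T: "\<And>x. x : U ==> x(i := p) : U"
 shows "Ck a U k f ==> Ck a U k (%x. f (x(i := p)))"
proof (induction k arbitrary: f)
 have TU: "(%x. x(i := p)) ` U <= U" using T by blast
 have upd: "continuous_on U (%x. x(i := p))"
  by (intro continuous_on_fun_upd continuous_on_id continuous_on_const)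
 {
 case 0
 then show ?case unfolding Ck.simps using continuous_on_compose2[OF _ upd TU] by blast
next
 case (Suc k)
 show ?case
 proof (rule Ck_SucI[OF U])
  show "continuous_on U (%x. f (x(i := p)))"
   using Suc.prems continuous_on_compose2[OF _ upd TU] unfolding Ck.simps by blast
  fix j assume j: "j < a"
  show "\<exists>h. has_partial j U (%x. f (x(i := p))) h & Ck a U k h"
  proof (cases "j = i")
   case True
   then have "has_partial j U (%x. f (x(i := p))) (%x. 0)" by (simp add: has_partial_def)
   then show ?thesis using Ck_const[OF U] by blast
  next
   case False
   have "has_partial j U (%x. f (x(i := p))) (%x. partial_deriv j f (x(i := p)))"
    unfolding has_partial_def
   proof
    fix x assume "x : U"
    then have "((%t. f (x(i := p, j := t))) has_real_derivative partial_deriv j f (x(i := p))) (at ((x(i := p)) j))"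
     using Suc.prems j T unfolding has_partial_def Ck.simps by blast
    then show "((%t. f (x(j := t, i := p))) has_real_derivative partial_deriv j f (x(i := p))) (at (x j))"
     using False by (simp add: fun_upd_twist)
   qed
   moreover have "Ck a U k (%x. partial_deriv j f (x(i := p)))"
    by (rule Suc.IH) (use Suc.prems j in simp)
   ultimately show ?thesis by blast
  qed
 qed
 }
qed

text \<open>Differentiating \<open>G\<close> under the integral sign gives an integral of the same form, with weight
 \<open>t w(t)\<close> in direction \<open>i\<close>.\<close>

lemma Ck_integral:
 fixes p :: real
 assumes U: "openin (Euclidean_space a) U" and i: "i < a"
  and T: "\<And>x t. x : U ==> 0 \<le> t ==> t \<le> 1 ==> x(i := p + t * (x i - p)) : U"
 shows "Ck a U k f ==> continuous_on {0..1} w ==>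
   Ck a U k (%x. integral {0..1} (%t. w t * f (x(i := p + t * (x i - p)))))"
proof (induction k arbitrary: f w)
 have cont0: "continuous_on (S \<times> {0..1}) (%(x, t). w t * f (g x t))"
  if f: "continuous_on U f" and w: "continuous_on {0..1} w"
   and g: "continuous_on (S \<times> {0..1}) (%(x, t). g x t)" "\<And>x t. x : S ==> 0 \<le> t ==> t \<le> 1 ==> g x t : U"
  for f :: "(nat => real) => real" and w :: "real => real" and S :: "'z::topological_space set" and g
 proof -
  have "continuous_on (S \<times> {0..1}) (%z. f (case z of (x, t) => g x t))"
   by (rule continuous_on_compose2[OF f g(1)]) (use g(2) in auto)
  moreover have "continuous_on (S \<times> {0..1}) (%z. w (snd z))"
   by (rule continuous_on_compose2[OF w]) (auto intro: continuous_intros)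
  ultimately have "continuous_on (S \<times> {0..1}) (%z. w (snd z) * f (case z of (x, t) => g x t))"
   by (intro continuous_intros)
  then show ?thesis by (simp add: case_prod_beta)
 qed
 have upd: "continuous_on (S \<times> {0..1}) (%(x, t). (h x)(i := p + t * (h x i - p)))"
  if "continuous_on S h" for S :: "'z::topological_space set" and h :: "'z => nat => real"
 proof -
  have h: "continuous_on (S \<times> {0..1::real}) (%z. h (fst z))"
   by (rule continuous_on_compose2[OF that]) (auto intro: continuous_intros)
  have hi: "continuous_on (S \<times> {0..1::real}) (%z. h (fst z) i)"
   using continuous_on_product_then_coordinatewise[OF h] .
  show ?thesis unfolding case_prod_beta by (intro continuous_on_fun_upd h hi continuous_intros)
 qed
 have cont: "continuous_on U (%x. integral {0..1} (%t. w t * f (x(i := p + t * (x i - p)))))"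
  if "continuous_on U f" "continuous_on {0..1} w" for f :: "(nat => real) => real" and w
  using integral_continuous_on_param[of U 0 "1::real" "%x t. w t * f (x(i := p + t * (x i - p)))"]
   cont0[OF that upd[OF continuous_on_id]] T by (simp add: case_prod_beta)
 {
  case 0 then show ?case unfolding Ck.simps by (rule cont)
 next
  case (Suc k)
  show ?case
  proof (rule Ck_SucI[OF U])
   show "continuous_on U (%x. integral {0..1} (%t. w t * f (x(i := p + t * (x i - p)))))"
    by (rule cont) (use Suc.prems in simp_all)
   fix j assume j: "j < a"
   define w' where "w' = (%t. if j = i then t * w t else w t)"
   have w': "continuous_on {0..1} w'"
    using Suc.prems by (cases "j = i") (auto simp: w'_def intro!: continuous_intros)
   let ?h = "%x. integral {0..1} (%t. w' t * partial_deriv j f (x(i := p + t * (x i - p))))"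
   have "has_partial j U (%x. integral {0..1} (%t. w t * f (x(i := p + t * (x i - p))))) ?h"
    unfolding has_partial_def
   proof
    fix x assume x: "x : U"
    obtain e where e: "e > 0" "\<And>s. \<bar>s - x j\<bar> < e ==> x(j := s) : U"
     using openin_Euclidean_space_upd[OF U x j] by blast
    let ?S = "ball (x j) e"
    let ?y = "%s t. (x(j := s))(i := p + t * ((x(j := s)) i - p))"
    have S: "x(j := s) : U" if "s : ?S" for s
     using e that by (auto simp: dist_real_def abs_minus_commute)
    have yU: "?y s t : U" if "s : ?S" "0 \<le> t" "t \<le> 1" for s t
     using T[OF S[OF that(1)] that(2,3)] by simp
    have ycont: "continuous_on (?S \<times> {0..1}) (%(s, t). ?y s t)"
     by (rule upd) (intro continuous_on_fun_upd continuous_intros)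
    \<comment> \<open>Differentiation under the integral sign in the single variable
      \<open>s\<close>, over an interval \<open>?S\<close> for which the point
      \<open>x(j := s)\<close> stays in \<open>U\<close>.\<close>
    have "((%s. integral (cbox 0 1) (%t. w t * f (?y s t))) has_real_derivative
      integral (cbox 0 1) (%t. w' t * partial_deriv j f (?y (x j) t))) (at (x j) within ?S)"
    proof (rule leibniz_rule_field_derivative)
     fix s t assume s: "s : ?S" and t: "t : cbox 0 (1::real)"
     have yU': "?y s t : U" using yU s t by auto
     have d: "((%r. f ((?y s t)(j := r))) has_real_derivative partial_deriv j f (?y s t)) (at (?y s t j))"
      using Suc.prems(1) j yU' unfolding has_partial_def Ck.simps by blast
     have "((%s. f (?y s t)) has_real_derivative
       (if j = i then t else 1) * partial_deriv j f (?y s t)) (at s)"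
     proof (cases "j = i")
      case True
      have "((%r. f (x(i := r))) has_real_derivative partial_deriv j f (?y s t)) (at (p + t * (s - p)))"
       using d True by simp
      moreover have "((%s. p + t * (s - p)) has_real_derivative t) (at s)"
       by (auto intro!: derivative_eq_intros)
      ultimately have "((%s. f (x(i := p + t * (s - p)))) has_real_derivative
         partial_deriv j f (?y s t) * t) (at s)"
       by (rule DERIV_chain2)
      then show ?thesis using True by (simp add: mult.commute)
     next
      case False
      then show ?thesis using d by (simp add: fun_upd_twist)
     qed
     from has_field_derivative_at_within[OF DERIV_cmult[OF this, of "w t"]]
     have "((%s. w t * f (?y s t)) has_real_derivative
       w t * ((if j = i then t else 1) * partial_deriv j f (?y s t))) (at s within ?S)" .
     moreover have "w t * ((if j = i then t else 1) * D) = w' t * D" for D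
      by (simp add: w'_def)
     ultimately show "((%s. w t * f (?y s t)) has_real_derivative w' t * partial_deriv j f (?y s t)) (at s within ?S)"
      by (simp only:)
    next
     fix s assume s: "s : ?S"
     have "continuous_on {0..1} (%t. w t * f (?y s t))"
     proof -
      have "continuous_on ({s} \<times> {0..1}) (%(s, t). w t * f (?y s t))"
      proof (rule cont0[OF _ _ continuous_on_subset[OF ycont]])
       show "continuous_on U f" "continuous_on {0..1} w" using Suc.prems by simp_all
      qed (use yU s in blast)+
      then have "continuous_on {0..1} (%t. (%(s, t). w t * f (?y s t)) (s, t))"
       by (rule continuous_on_compose2) (auto intro!: continuous_on_Pair continuous_on_const continuous_on_id)
      then show ?thesis unfolding prod.case .
     qed
     then show "(%t. w t * f (?y s t)) integrable_on cbox 0 1"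
      unfolding box_real by (rule integrable_continuous_real)
    next
     have "continuous_on (?S \<times> {0..1}) (%(s, t). w' t * partial_deriv j f (?y s t))"
     proof (rule cont0[OF _ w' ycont])
      have "Ck a U k (partial_deriv j f)" using Suc.prems j by simp
      then show "continuous_on U (partial_deriv j f)" by (rule Ck_continuous)
     qed (rule yU)
     then show "continuous_on (?S \<times> cbox 0 1) (%(s, t). w' t * partial_deriv j f (?y s t))"
      unfolding box_real .
     show "x j : ?S" using e by simp
     show "convex ?S" by simp
    qed
    moreover have "at (x j) within ?S = at (x j)"
     by (rule at_within_open) (use e in auto)
    ultimately show "((%s. integral {0..1} (%t. w t * f (?y s t))) has_real_derivative ?h x) (at (x j))"
     by (simp only: box_real fun_upd_triv)
   qed
   moreover have "Ck a U k ?h"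
    by (rule Suc.IH) (use Suc.prems j w' in simp_all)
   ultimately show "\<exists>h. has_partial j U (%x. integral {0..1} (%t. w t * f (x(i := p + t * (x i - p))))) h & Ck a U k h"
    by blast
  qed
 }
qed

text \<open>The fundamental theorem of calculus along the segment from \<open>x(i := p)\<close> to
  \<open>x\<close>. The quotient is the mean of the \<open>i\<close>-th partial derivative over this
  segment, which is smooth by \<open>Ck_integral\<close> with weight 1.\<close>

lemma Hadamard_coordinate:
 fixes p :: real
 assumes U: "openin (Euclidean_space a) U" and i: "i < a"
  and T: "\<And>x t. x : U ==> 0 \<le> t ==> t \<le> 1 ==> x(i := p + t * (x i - p)) : U"
  and f: "smooth_on a U f"
 shows "\<exists>g. smooth_on a U g & (\<forall>x\<in>U. f x = f (x(i := p)) + (x i - p) * g x)"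
proof (intro exI conjI ballI)
 let ?g = "%x. integral {0..1} (%t. 1 * partial_deriv i f (x(i := p + t * (x i - p))))"
 have ck: "Ck a U k f" for k using f smooth_on_iff[OF U] by blast
 have "Ck a U k (partial_deriv i f)" for k using ck[of "Suc k"] i by simp
 then show "smooth_on a U ?g"
  unfolding smooth_on_iff[OF U] by (intro allI Ck_integral[OF U i T] continuous_intros) auto
 fix x assume x: "x : U"
 let ?F = "%t. f (x(i := p + t * (x i - p)))"
 let ?F' = "%t. (x i - p) * partial_deriv i f (x(i := p + t * (x i - p)))"
 have "(?F has_vector_derivative ?F' t) (at t within {0..1})" if "t : {0..1}" for t
 proof -
  let ?y = "x(i := p + t * (x i - p))"
  have "?y : U" using T x that by auto
  then have "((%r. f (?y(i := r))) has_real_derivative partial_deriv i f ?y) (at (?y i))"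
   using ck[of "Suc 0"] i unfolding has_partial_def Ck.simps by blast
  then have "((%r. f (x(i := r))) has_real_derivative partial_deriv i f ?y) (at (p + t * (x i - p)))"
   by simp
  moreover have "((%t. p + t * (x i - p)) has_real_derivative (x i - p)) (at t)"
   by (auto intro!: derivative_eq_intros)
  ultimately have "(?F has_real_derivative partial_deriv i f ?y * (x i - p)) (at t)"
   by (rule DERIV_chain2)
  then have "(?F has_real_derivative ?F' t) (at t within {0..1})"
   using has_field_derivative_at_within by (metis mult.commute)
  then show ?thesis by (simp add: has_real_derivative_iff_has_vector_derivative)
 qed
 then have "(?F' has_integral (?F 1 - ?F 0)) {0..1}"
  by (rule fundamental_theorem_of_calculus[OF zero_le_one])
 then have "integral {0..1} ?F' = f x - f (x(i := p))" by (auto dest: integral_unique)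
 moreover have "integral {0..1} ?F' = (x i - p) * ?g x" by simp
 ultimately show "f x = f (x(i := p)) + (x i - p) * ?g x" by simp
qed

text \<open>A ball of the sup norm. Moving one coordinate towards that of the centre does not leave
  it, which is what \<open>Hadamard_coordinate\<close> asks for.\<close>

definition cube :: "nat => (nat => real) => real => (nat => real) set" where
 "cube a p e = {x : topspace (Euclidean_space a). \<forall>i<a. \<bar>x i - p i\<bar> < e}"

lemma openin_cube: "openin (Euclidean_space a) (cube a p e)"
proof -
 have "open (\<Inter>i<a. (%x. x i) -` {p i - e<..<p i + e})"
  by (intro open_INT ballI open_vimage) (auto simp: continuous_on_product_coordinates)
 moreover have "cube a p e = topspace (Euclidean_space a) Int (\<Inter>i<a. (%x. x i) -` {p i - e<..<p i + e})"
  by (auto simp: cube_def abs_diff_less_iff)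
 ultimately show ?thesis by (subst Euclidean_space_eq) (auto simp: openin_open)
qed

lemma cube_exists:
 assumes U: "openin (Euclidean_space a) U" and p: "p : U"
 shows "\<exists>e>0. cube a p e <= U"
proof -
 obtain T where T: "open T" "U = topspace (Euclidean_space a) Int T"
  using U by (subst (asm) Euclidean_space_eq) (auto simp: openin_open)
 then obtain X where X: "p : Pi\<^sub>E UNIV X" "\<And>i. open (X i)" "finite {i. X i \<noteq> UNIV}" "Pi\<^sub>E UNIV X <= T"
  using product_topology_open_contains_basis[of "%_. euclideanreal" UNIV T p] p
  by (auto simp: euclidean_product_topology)
 have "\<exists>e>0. ball (p i) e <= X i" for i
  using X(1,2) by (meson PiE_mem UNIV_I open_contains_ball)
 then obtain d where d: "\<And>i. d i > 0" "\<And>i. ball (p i) (d i) <= X i" by metis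
 \<comment> \<open>The coordinates from \<open>a\<close> on vanish on the whole space, so only
   finitely many radii matter. The \<open>1\<close> serves the case \<open>a = 0\<close>.\<close>
 let ?e = "Min (insert 1 (d ` {..<a}))"
 have "cube a p ?e <= U"
 proof
  fix x assume x: "x : cube a p ?e"
  have "x i : X i" for i
  proof (cases "i < a")
   case True
   then have "\<bar>x i - p i\<bar> < d i" using x by (auto simp: cube_def)
   then show ?thesis using d(2)[of i] by (auto simp: dist_real_def abs_minus_commute)
  next
   case False
   then have "x i = 0" "p i = 0" using x p T(2) by (auto simp: cube_def topspace_Euclidean_space)
   then show ?thesis using X(1) by (metis PiE_mem UNIV_I)
  qed
  then show "x : U" using X(4) T(2) x by (auto simp: cube_def)
 qed
 moreover have "?e > 0" using d by auto
 ultimately show ?thesis by blast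
qed

text \<open>The coordinates of \<open>x\<close> are replaced by those of \<open>p\<close> one at a
  time, \<open>m\<close> of them after \<open>m\<close> steps, and each replacement contributes one
  summand.\<close>

lemma Hadamard_cube:
 assumes p: "p : topspace (Euclidean_space a)" and f: "smooth_on a (cube a p e) f"
 shows "\<exists>g. (\<forall>i<a. smooth_on a (cube a p e) (g i)) &
   (\<forall>x\<in>cube a p e. f x = f p + (\<Sum>i<a. (x i - p i) * g i x))"
proof -
 let ?U = "cube a p e"
 note U = openin_cube[of a p e]
 have T: "x(i := p i + t * (x i - p i)) : ?U" if "x : ?U" "0 \<le> t" "t \<le> 1" "i < a" for x t i
 proof -
  have "\<bar>t * (x i - p i)\<bar> \<le> \<bar>x i - p i\<bar>"
   using that by (simp add: abs_mult mult_left_le_one_le)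
  then show ?thesis using that by (fastforce simp: cube_def topspace_Euclidean_space)
 qed
 have "m \<le> a ==> \<exists>g. (\<forall>i<m. smooth_on a ?U (g i)) & smooth_on a ?U (%x. f (%i. if i < m then p i else x i)) &
   (\<forall>x\<in>?U. f x = f (%i. if i < m then p i else x i) + (\<Sum>i<m. (x i - p i) * g i x))" for m
 proof (induction m)
  case 0 then show ?case using f by simp
 next
  case (Suc m)
  let ?F = "%x. f (%i. if i < m then p i else x i)"
  obtain g where g: "\<forall>i<m. smooth_on a ?U (g i)" "smooth_on a ?U ?F"
   "\<forall>x\<in>?U. f x = ?F x + (\<Sum>i<m. (x i - p i) * g i x)" using Suc by auto
  have m: "m < a" using Suc.prems by simp
  obtain h where h: "smooth_on a ?U h" "\<And>x. x : ?U ==> ?F x = ?F (x(m := p m)) + (x m - p m) * h x"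
   using Hadamard_coordinate[OF U m T g(2)] m by blast
  have F': "(%x. f (%i. if i < Suc m then p i else x i)) = (%x. ?F (x(m := p m)))"
   by (intro ext arg_cong[of _ _ f]) (auto simp: less_Suc_eq)
  have "x(m := p m) : ?U" if "x : ?U" for x using T[OF that, of 0 m] m by simp
  then have "smooth_on a ?U (%x. ?F (x(m := p m)))"
   using g(2) unfolding smooth_on_iff[OF U] by (intro allI Ck_subst[OF U]) auto
  moreover have "f x = ?F (x(m := p m)) + (\<Sum>i<Suc m. (x i - p i) * (g(m := h)) i x)" if "x : ?U" for x
  proof -
   have "(\<Sum>i<m. (x i - p i) * (g(m := h)) i x) = (\<Sum>i<m. (x i - p i) * g i x)"
    by (rule sum.cong) auto
   then show ?thesis using g(3) h(2)[OF that] that by auto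
  qed
  moreover have "\<forall>i<Suc m. smooth_on a ?U ((g(m := h)) i)" using g(1) h(1) by (auto simp: less_Suc_eq)
  ultimately show ?case using fun_cong[OF F'] by (intro exI[of _ "g(m := h)"]) (simp add: F')
 qed
 from this[OF order_refl] obtain g where g: "\<forall>i<a. smooth_on a ?U (g i)"
  "\<forall>x\<in>?U. f x = f (%i. if i < a then p i else x i) + (\<Sum>i<a. (x i - p i) * g i x)" by blast
 have "(%i. if i < a then p i else x i) = p" if "x : ?U" for x
  using that p by (auto simp: cube_def topspace_Euclidean_space)
 then show ?thesis using g by metis
qed

section \<open>Smooth bump functions\<close>

definition flat_fun :: "nat => real => real" where
 "flat_fun n t = (if t \<le> 0 then 0 else inverse t ^ n * exp (- inverse t))"

lemma flat_fun_tendsto: "(flat_fun n \<longlongrightarrow> 0) (at_right 0)"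
proof -
 have "((%t. inverse t ^ n / exp (inverse t)) \<longlongrightarrow> 0) (at_right (0::real))"
  using filterlim_compose[OF tendsto_power_div_exp_0 filterlim_inverse_at_top_right] by simp
 moreover have "eventually (%t. inverse t ^ n / exp (inverse t) = flat_fun n t) (at_right (0::real))"
  by (auto simp: flat_fun_def eventually_at_filter exp_minus divide_inverse)
 ultimately show ?thesis using tendsto_cong by fast
qed

text \<open>The function of interest is exp(-1/t), continued by 0; the powers of 1/t close the
  family under differentiation. At 0 the difference quotient of \<open>flat_fun n\<close> is
  \<open>flat_fun (Suc n)\<close> on the right and 0 on the left, and both tend to 0.\<close>

lemma flat_fun_deriv:
 "(flat_fun n has_real_derivative - real n * flat_fun (Suc n) t + flat_fun (Suc (Suc n)) t) (at t)"
proof -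
 consider "t < 0" | "t = 0" | "t > 0" by linarith
 then show ?thesis
 proof cases
  case 1
  have ev: "eventually (%s. flat_fun n s = 0) (nhds t)"
   using eventually_nhds_in_open[of "{..<0}" t] 1 by (auto simp: flat_fun_def elim!: eventually_mono)
  have "(flat_fun n has_real_derivative 0) (at t)"
   by (subst DERIV_cong_ev[OF refl ev refl]) simp
  then show ?thesis using 1 by (simp add: flat_fun_def)
 next
  case 2
  have "((%h. flat_fun n h / h) \<longlongrightarrow> 0) (at_right 0)"
   by (rule tendsto_cong[THEN iffD2, OF _ flat_fun_tendsto[of "Suc n"]])
    (auto simp: flat_fun_def eventually_at_filter field_simps)
  moreover have "((%h. flat_fun n h / h) \<longlongrightarrow> 0) (at_left 0)"
   by (rule tendsto_cong[THEN iffD2, OF _ tendsto_const[of 0]])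
    (auto simp: flat_fun_def eventually_at_filter)
  ultimately have "((%h. flat_fun n h / h) \<longlongrightarrow> 0) (at 0)"
   by (simp add: filterlim_split_at_real)
  then show ?thesis using 2 by (simp add: DERIV_def flat_fun_def)
 next
  case 3
  let ?d = "- real n * (inverse t ^ Suc n * exp (- inverse t)) + inverse t ^ Suc (Suc n) * exp (- inverse t)"
  have i: "(inverse has_real_derivative - (inverse t ^ Suc (Suc 0))) (at t)"
   using DERIV_inverse[of t] 3 by simp
  have "((%s. inverse s ^ n) has_real_derivative - real n * inverse t ^ Suc n) (at t)"
   using DERIV_power[OF i, of n] by (cases n) (simp_all add: algebra_simps)
  moreover have "((%s. exp (- inverse s)) has_real_derivative exp (- inverse t) * inverse t ^ Suc (Suc 0)) (at t)"
   using DERIV_chain2[OF DERIV_exp DERIV_minus[OF i]] by simp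
  ultimately have d: "((%s. inverse s ^ n * exp (- inverse s)) has_real_derivative
    - real n * inverse t ^ Suc n * exp (- inverse t) +
    exp (- inverse t) * inverse t ^ Suc (Suc 0) * inverse t ^ n) (at t)"
   by (rule DERIV_mult)
  have ev: "eventually (%s. flat_fun n s = inverse s ^ n * exp (- inverse s)) (nhds t)"
   using eventually_nhds_in_open[of "{0<..}" t] 3 by (auto simp: flat_fun_def elim!: eventually_mono)
  have "((%s. inverse s ^ n * exp (- inverse s)) has_real_derivative ?d) (at t)"
   using d by (simp add: mult_ac)
  then have "(flat_fun n has_real_derivative ?d) (at t)"
   using DERIV_cong_ev[OF refl ev refl] by blast
  then show ?thesis using 3 by (simp add: flat_fun_def)
 qed
qed

lemma Ck_flat_fun:
 assumes U: "openin (Euclidean_space a) U"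
 shows "Ck a U k q ==> Ck a U k (%x. flat_fun n (q x))"
proof (induction k arbitrary: n)
 have cont: "continuous_on U (%x. flat_fun n (q x))" if "continuous_on U q" for n
  by (rule continuous_on_compose2[OF _ that])
   (use DERIV_isCont[OF flat_fun_deriv] in \<open>auto simp: continuous_at_imp_continuous_on\<close>)
 {
  case 0 then show ?case using cont by simp
 next
  case (Suc k)
  show ?case
  proof (rule Ck_SucI[OF U cont])
   show "continuous_on U q" using Suc.prems by simp
   fix i assume i: "i < a"
   let ?h = "%x. (- real n * flat_fun (Suc n) (q x) + flat_fun (Suc (Suc n)) (q x)) * partial_deriv i q x"
   have "has_partial i U (%x. flat_fun n (q x)) ?h"
    unfolding has_partial_def
   proof
    fix x assume "x : U"
    then have d: "((%t. q (x(i := t))) has_real_derivative partial_deriv i q x) (at (x i))"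
     using Suc.prems i by (auto simp: has_partial_def)
    show "((%t. flat_fun n (q (x(i := t)))) has_real_derivative ?h x) (at (x i))"
     using DERIV_chain2[OF flat_fun_deriv d] by simp
   qed
   moreover have "Ck a U k ?h"
    using Suc Ck_Suc_imp[OF Suc.prems] i
    by (intro Ck_mult[OF U] Ck_add[OF U] Ck_const[OF U]) auto
   ultimately show "\<exists>h. has_partial i U (%x. flat_fun n (q x)) h & Ck a U k h" by blast
  qed
 }
qed

text \<open>Each factor is exp(-1/s) with s = d^2 - (x_i - p_i)^2, and 0 for s \<le> 0, so the
  function vanishes off a cube of half-side \<open>d\<close>. Differences are spelled with sums and
  products to match the closure rules for \<open>Ck\<close>.\<close>

definition bump :: "nat => (nat => real) => real => (nat => real) => real" where
 "bump a p d x = (\<Prod>i<a. flat_fun 0 (d\<^sup>2 + - 1 * ((x i + - p i) * (x i + - p i))))"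

lemma smooth_on_bump:
 assumes U: "openin (Euclidean_space a) U"
 shows "smooth_on a U (bump a p d)"
 unfolding smooth_on_iff[OF U] bump_def[abs_def]
 by (intro allI Ck_prod Ck_flat_fun Ck_add Ck_mult Ck_const Ck_coord U)

lemma bump_pos: "0 < d ==> bump a p d p \<noteq> 0"
 by (simp add: bump_def flat_fun_def)

lemma bump_zero: "0 < d ==> i < a ==> d \<le> \<bar>x i - p i\<bar> ==> bump a p d x = 0"
proof -
 assume "0 < d" "i < a" "d \<le> \<bar>x i - p i\<bar>"
 then have "d\<^sup>2 \<le> (x i - p i)\<^sup>2" by (metis abs_of_pos abs_le_square_iff)
 then have "flat_fun 0 (d\<^sup>2 + - 1 * ((x i + - p i) * (x i + - p i))) = 0"
  by (simp add: flat_fun_def power2_eq_square)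
 then show ?thesis using \<open>i < a\<close> unfolding bump_def by (meson finite_lessThan lessThan_iff prod_zero)
qed

section \<open>Closure properties of smooth functions\<close>

lemma smooth_on_cong:
 assumes U: "openin (Euclidean_space a) U" and "\<And>x. x : U ==> f x = g x"
 shows "smooth_on a U f \<longleftrightarrow> smooth_on a U g"
 using Ck_cong[OF assms] smooth_on_iff[OF U] by simp

lemma smooth_on_subset:
 "smooth_on a U f ==> openin (Euclidean_space a) U ==> openin (Euclidean_space a) V ==> V <= U ==> smooth_on a V f"
 unfolding smooth_on_iff using Ck_mono by blast

lemma smooth_on_local:
 assumes U: "openin (Euclidean_space a) U"
  and "\<And>x. x : U ==> \<exists>V. openin (Euclidean_space a) V & x : V & V <= U & smooth_on a V f"
 shows "smooth_on a U f"
 unfolding smooth_on_iff[OF U] using assms(2) smooth_on_iff by (intro allI Ck_local) metis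

context
 fixes a U assumes U: "openin (Euclidean_space a) U"
begin

lemma smooth_on_const: "smooth_on a U (%x. c)"
 and smooth_on_coord: "smooth_on a U (%x. x j)"
 and smooth_on_add: "smooth_on a U f ==> smooth_on a U g ==> smooth_on a U (%x. f x + g x)"
 and smooth_on_mult: "smooth_on a U f ==> smooth_on a U g ==> smooth_on a U (%x. f x * g x)"
 and smooth_on_sum: "(\<And>j. j : J ==> smooth_on a U (F j)) ==> smooth_on a U (%x. \<Sum>j\<in>J. F j x)"
 and smooth_on_inverse: "smooth_on a U f ==> (\<And>x. x : U ==> f x \<noteq> 0) ==> smooth_on a U (%x. inverse (f x))"
 and smooth_on_partial: "smooth_on a U f ==> i < a ==> smooth_on a U (partial_deriv i f)"
 and smooth_on_has_partial: "smooth_on a U f ==> i < a ==> has_partial i U f (partial_deriv i f)"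
 and smooth_on_continuous: "smooth_on a U f ==> continuous_on U f"
proof -
 assume f: "smooth_on a U f" and i: "i < a"
 have "Ck a U (Suc k) f" for k using f smooth_on_iff[OF U] by blast
 then have "Ck a U k (partial_deriv i f)" "has_partial i U f (partial_deriv i f)" for k
  using i by auto
 then show "smooth_on a U (partial_deriv i f)" "has_partial i U f (partial_deriv i f)"
  using smooth_on_iff[OF U] by auto
next
 show "smooth_on a U f ==> continuous_on U f" using Ck_continuous smooth_on_iff[OF U] by blast
qed (auto simp: smooth_on_iff[OF U] intro!: Ck_const Ck_coord Ck_add Ck_mult Ck_sum Ck_inverse U)

end

section \<open>Superfunctions form a superalgebra\<close>

lemma wedge_sign_empty [simp]: "wedge_sign {} J = 1" "wedge_sign I {} = 1"
 by (simp_all add: wedge_sign_def)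

lemma finite_inversions: "finite I ==> finite J ==> finite {(i::nat, j). i : I & j : J & j < i}"
 by (rule finite_subset[of _ "I \<times> J"]) auto

lemma wedge_sign_Un_left:
 assumes "finite A" "finite B" "finite C" "A Int B = {}"
 shows "wedge_sign (A \<union> B) C = wedge_sign A C * wedge_sign B C"
proof -
 have "{(i, j). i : A \<union> B & j : C & j < i} =
  {(i, j). i : A & j : C & j < i} \<union> {(i, j). i : B & j : C & j < i}" by auto
 moreover have "{(i, j). i : A & j : C & j < i} Int {(i, j). i : B & j : C & j < i} = {}"
  using assms(4) by auto
 ultimately show ?thesis
  unfolding wedge_sign_def using assms by (simp add: card_Un_disjoint finite_inversions power_add)
qed

lemma wedge_sign_Un_right:
 assumes "finite A" "finite B" "finite C" "A Int B = {}"
 shows "wedge_sign C (A \<union> B) = wedge_sign C A * wedge_sign C B"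
proof -
 have "{(i, j). i : C & j : A \<union> B & j < i} =
  {(i, j). i : C & j : A & j < i} \<union> {(i, j). i : C & j : B & j < i}" by auto
 moreover have "{(i, j). i : C & j : A & j < i} Int {(i, j). i : C & j : B & j < i} = {}"
  using assms(4) by auto
 ultimately show ?thesis
  unfolding wedge_sign_def using assms by (simp add: card_Un_disjoint finite_inversions power_add)
qed

lemma wedge_sign_square: "wedge_sign I J * wedge_sign I J = 1"
proof -
 have "(- 1) ^ c * (- 1) ^ c = (1::real)" for c by (cases "even c") auto
 then show ?thesis unfolding wedge_sign_def .
qed

text \<open>Each pair in \<open>A \<times> B\<close> is an inversion for exactly one of the two
  orders, so the two sets of inversions together have \<open>card A * card B\<close>
  elements.\<close>

lemma wedge_sign_swap:
 assumes "finite A" "finite B" "A Int B = {}"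
 shows "wedge_sign A B = (-1) ^ (card A * card B) * wedge_sign B A"
proof -
 let ?S = "{(i, j). i : A & j : B & j < i}" and ?T = "{(i, j). i : B & j : A & j < i}"
 have "A \<times> B = ?S \<union> prod.swap ` ?T"
 proof (intro equalityI subsetI)
  fix z assume "z : A \<times> B"
  then obtain i j where z: "z = (i, j)" "i : A" "j : B" by auto
  then have "i \<noteq> j" using assms(3) by auto
  then consider "j < i" | "i < j" by linarith
  then show "z : ?S \<union> prod.swap ` ?T"
  proof cases
   case 2
   then have "z = prod.swap (j, i)" "(j, i) : ?T" using z by auto
   then show ?thesis by blast
  qed (use z in auto)
 qed auto
 moreover have "?S Int prod.swap ` ?T = {}" by auto
 moreover have "finite ?S" "finite (prod.swap ` ?T)"
  using finite_inversions[OF assms(1,2)] finite_inversions[OF assms(2,1)] by blast+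
 ultimately have "card (A \<times> B) = card ?S + card (prod.swap ` ?T)"
  by (simp only: card_Un_disjoint)
 also have "card (prod.swap ` ?T) = card ?T" by (intro card_image) (auto simp: inj_on_def)
 finally have "(-1::real) ^ (card A * card B) = wedge_sign A B * wedge_sign B A"
  by (simp add: wedge_sign_def power_add card_cartesian_product)
 then show ?thesis by (simp add: wedge_sign_square mult.assoc)
qed

text \<open>The product of superfunctions at a single point, that is, of the Grassmann algebra. For
  infinite \<open>K\<close> the sum ranges over an infinite set and is 0 by convention, which is why
  finiteness of \<open>K\<close> is split off in the proofs.\<close>

definition gmul :: "(nat set => real) => (nat set => real) => nat set => real" where
 "gmul F G K = (\<Sum>I\<in>Pow K. wedge_sign I (K - I) * F I * G (K - I))"

text \<open>Both sides are sums over the partitions of \<open>K\<close> into three blocks J, L, R.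
  The signs agree because \<open>wedge_sign\<close> is multiplicative over disjoint unions in each
  argument.\<close>

lemma gmul_assoc: "gmul (gmul F G) H K = gmul F (gmul G H) K"
proof (cases "finite K")
 case True
 note fin = finite_subset[OF _ True]
 have "gmul (gmul F G) H K = (\<Sum>(I, J)\<in>Sigma (Pow K) Pow.
   wedge_sign I (K - I) * (wedge_sign J (I - J) * F J * G (I - J)) * H (K - I))"
  unfolding gmul_def sum_distrib_left sum_distrib_right
  by (rule sum.Sigma) (use True fin in auto)
 also have "\<dots> = (\<Sum>(J, L)\<in>Sigma (Pow K) (%J. Pow (K - J)).
   wedge_sign J (K - J) * F J * (wedge_sign L (K - J - L) * G L * H (K - J - L)))"
 proof (rule sum.reindex_bij_witness[where i = "%(J, L). (J \<union> L, J)" and j = "%(I, J). (J, I - J)"])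
  fix z assume "z : Sigma (Pow K) Pow"
  then obtain I J where z: "z = (I, J)" "I <= K" "J <= I" by auto
  define L R where "L = I - J" and "R = K - I"
  have f: "finite J" "finite L" "finite R" using fin z by (auto simp: L_def R_def)
  have s: "I = J \<union> L" "K - J = L \<union> R" "K - J - L = R" "J Int L = {}" "L Int R = {}"
   using z by (auto simp: L_def R_def)
  show "(case case z of (I, J) => (J, I - J) of (J, L) =>
    wedge_sign J (K - J) * F J * (wedge_sign L (K - J - L) * G L * H (K - J - L))) =
   (case z of (I, J) => wedge_sign I (K - I) * (wedge_sign J (I - J) * F J * G (I - J)) * H (K - I))"
  proof -
   have 1: "wedge_sign I R = wedge_sign J R * wedge_sign L R"
    unfolding s(1) using wedge_sign_Un_left[OF f s(4)] .
   have 2: "wedge_sign J (K - J) = wedge_sign J L * wedge_sign J R"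
    unfolding s(2) using wedge_sign_Un_right[OF f(2,3,1) s(5)] .
   show ?thesis
    unfolding z(1) prod.case L_def[symmetric] R_def[symmetric] s(3) 1 2 by (simp add: mult_ac)
  qed
 qed auto
 also have "\<dots> = gmul F (gmul G H) K"
  unfolding gmul_def sum_distrib_left sum_distrib_right
  by (rule sum.Sigma[symmetric]) (use True fin in auto)
 finally show ?thesis .
qed (simp add: gmul_def)

definition gone :: "nat set => real" where "gone I = (if I = {} then 1 else 0)"

lemma gmul_gone_left: "finite K ==> gmul gone G K = G K"
proof -
 assume K: "finite K"
 have "gmul gone G K = (\<Sum>I\<in>{{}}. wedge_sign I (K - I) * gone I * G (K - I))"
  unfolding gmul_def by (rule sum.mono_neutral_right) (use K in \<open>auto simp: gone_def\<close>)
 then show ?thesis by (simp add: gone_def)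
qed

lemma gmul_gone_right: "finite K ==> gmul F gone K = F K"
proof -
 assume K: "finite K"
 have "gmul F gone K = (\<Sum>I\<in>{K}. wedge_sign I (K - I) * F I * gone (K - I))"
  unfolding gmul_def by (rule sum.mono_neutral_right) (use K in \<open>auto simp: gone_def\<close>)
 then show ?thesis by (simp add: gone_def)
qed

lemma gmul_add:
 "gmul (%I. F I + G I) H K = gmul F H K + gmul G H K"
 "gmul H (%I. F I + G I) K = gmul H F K + gmul H G K"
 unfolding gmul_def sum.distrib[symmetric]
 by (rule sum.cong[OF refl], simp add: distrib_left distrib_right)+

lemma gmul_smult:
 "gmul (%I. c * F I) G K = c * gmul F G K"
 "gmul F (%I. c * G I) K = c * gmul F G K"
 unfolding gmul_def sum_distrib_left by (rule sum.cong[OF refl], simp)+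

text \<open>Passing to complements exchanges the factors. Only \<open>I\<close> and
  \<open>K - I\<close> of the prescribed parities contribute, and for these the sign of
  \<open>wedge_sign_swap\<close> depends on the parities alone.\<close>

lemma gmul_supercomm:
 assumes F: "\<And>I. odd (card I) \<noteq> p ==> F I = 0" and G: "\<And>I. odd (card I) \<noteq> q ==> G I = 0"
 shows "gmul F G K = (if p & q then - 1 else 1) * gmul G F K"
proof (cases "finite K")
 case True
 have "gmul F G K = (\<Sum>I\<in>Pow K. wedge_sign (K - I) I * F (K - I) * G I)"
  unfolding gmul_def
  by (rule sum.reindex_bij_witness[where i = "%I. K - I" and j = "%I. K - I"])
   (auto simp: double_diff)
 also have "\<dots> = (\<Sum>I\<in>Pow K. (if p & q then - 1 else 1) * (wedge_sign I (K - I) * G I * F (K - I)))"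
 proof (rule sum.cong[OF refl])
  fix I assume I: "I : Pow K"
  have fin: "finite I" "finite (K - I)" using I True finite_subset by auto
  show "wedge_sign (K - I) I * F (K - I) * G I =
   (if p & q then - 1 else 1) * (wedge_sign I (K - I) * G I * F (K - I))"
  proof (cases "odd (card (K - I)) = p & odd (card I) = q")
   case True
   have "wedge_sign (K - I) I = (-1) ^ (card (K - I) * card I) * wedge_sign I (K - I)"
    by (rule wedge_sign_swap) (use fin in auto)
   also have "(-1) ^ (card (K - I) * card I) = (if p & q then - 1 else (1::real))"
    using True by auto
   finally show ?thesis by simp
  next
   case False
   then show ?thesis using F G by auto
  qed
 qed
 also have "\<dots> = (if p & q then - 1 else 1) * gmul G F K"
  unfolding gmul_def by (rule sum_distrib_left[symmetric])
 finally show ?thesis .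
qed (simp add: gmul_def)

lemma gmul_parity:
 assumes F: "\<And>I. odd (card I) \<noteq> p ==> F I = 0" and G: "\<And>I. odd (card I) \<noteq> q ==> G I = 0"
  and K: "odd (card K) \<noteq> (p \<noteq> q)"
 shows "gmul F G K = 0"
proof (cases "finite K")
 case True
 have "wedge_sign I (K - I) * F I * G (K - I) = 0" if I: "I : Pow K" for I
 proof -
  have "card K = card I + card (K - I)"
   using I True by (metis Pow_iff card_Diff_subset card_mono finite_subset le_add_diff_inverse)
  then have "odd (card I) \<noteq> p \<or> odd (card (K - I)) \<noteq> q" using K by auto
  then show ?thesis using F[of I] G[of "K - I"] by auto
 qed
 then show ?thesis unfolding gmul_def by (simp add: sum.neutral)
qed (simp add: gmul_def)

section \<open>Superfunctions on a fixed open set\<close>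

lemma sf_simps:
 "f *[superfunctions a b U] g = (%K x. gmul (%I. f I x) (%I. g I x) K)"
 "1[superfunctions a b U] = (%I x. if I = {} & x : U then 1 else 0)"
 "0[superfunctions a b U] = (%I x. 0)"
 "f +[superfunctions a b U] g = (%I x. f I x + g I x)"
 "c \<odot>[superfunctions a b U] f = (%I x. c * f I x)"
 by (simp_all add: superfunctions_def Let_def gmul_def)

lemma sf_carrier:
 "f : carrier (superfunctions a b U) \<longleftrightarrow>
   (\<forall>I. I <= {..<b} --> smooth_on a U (f I)) & (\<forall>I x. \<not> (I <= {..<b} & x : U) --> f I x = 0)"
 by (auto simp: superfunctions_def Let_def)

lemma sf_part:
 "f : part (superfunctions a b U) p \<longleftrightarrow>
   f : carrier (superfunctions a b U) & (\<forall>I x. odd (card I) \<noteq> p --> f I x = 0)"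
 by (auto simp: superfunctions_def Let_def)

lemma cring_real_ring: "cring real_ring"
proof (rule cringI)
 have "\<exists>y. y + x = 0" for x :: real by (rule exI[of _ "- x"]) simp
 then show "abelian_group real_ring"
  by (intro abelian_groupI) (simp_all add: real_ring_def)
 show "comm_monoid real_ring"
  by (rule comm_monoidI) (simp_all add: real_ring_def)
qed (simp add: real_ring_def distrib_right)

context
 fixes a b :: nat and U :: "(nat => real) set"
 assumes U: "openin (Euclidean_space a) U"
begin

abbreviation "SF \<equiv> superfunctions a b U"

lemma sf_mult_closed:
 assumes "f : carrier SF" "g : carrier SF"
 shows "f *[SF] g : carrier SF"
 unfolding sf_carrier sf_simps
proof (intro conjI allI impI)
 fix K :: "nat set" assume K: "K <= {..<b}"
 show "smooth_on a U (%x. gmul (%I. f I x) (%I. g I x) K)"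
  unfolding gmul_def
 proof (rule smooth_on_sum[OF U])
  fix I assume "I : Pow K"
  then have "I <= {..<b}" "K - I <= {..<b}" using K by auto
  then have "smooth_on a U (f I)" "smooth_on a U (g (K - I))" using assms by (auto simp: sf_carrier)
  then show "smooth_on a U (%x. wedge_sign I (K - I) * f I x * g (K - I) x)"
   by (intro smooth_on_mult[OF U] smooth_on_const[OF U])
 qed
next
 fix K x assume K: "\<not> (K <= {..<b} & x : U)"
 have "wedge_sign I (K - I) * f I x * g (K - I) x = 0" if "I : Pow K" for I
 proof -
  have "K <= {..<b}" if "I <= {..<b}" "K - I <= {..<b}" using that by blast
  then consider "\<not> (I <= {..<b} & x : U)" | "\<not> (K - I <= {..<b} & x : U)" using K by argo
  then show ?thesis
  proof cases
   case 1 then have "f I x = 0" using assms(1) sf_carrier by blast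
   then show ?thesis by simp
  next
   case 2
   moreover have "\<And>I. \<not> (I <= {..<b} & x : U) ==> g I x = 0" using assms(2) unfolding sf_carrier by blast
   ultimately have "g (K - I) x = 0" by simp
   then show ?thesis by simp
  qed
 qed
 then show "gmul (%I. f I x) (%I. g I x) K = 0"
  unfolding gmul_def by (simp add: sum.neutral)
qed

lemma sf_add_closed: "f : carrier SF ==> g : carrier SF ==> f +[SF] g : carrier SF"
 unfolding sf_carrier sf_simps by (simp add: smooth_on_add[OF U])

lemma sf_smult_closed: "f : carrier SF ==> c \<odot>[SF] f : carrier SF"
 unfolding sf_carrier sf_simps by (simp add: smooth_on_mult[OF U] smooth_on_const[OF U])

lemma sf_zero_closed: "0[SF] : carrier SF"
 unfolding sf_carrier sf_simps by (simp add: smooth_on_const[OF U])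

lemma sf_one_closed: "1[SF] : carrier SF"
proof -
 have "smooth_on a U (%x. if I = {} & x : U then 1 else 0)" for I :: "nat set"
  by (rule smooth_on_cong[OF U, THEN iffD1, OF _ smooth_on_const[OF U, of "if I = {} then 1 else 0"]]) auto
 then show ?thesis by (auto simp: sf_carrier sf_simps)
qed

lemma sf_infinite: "f : carrier SF ==> infinite I ==> f I x = 0"
proof -
 assume f: "f : carrier SF" and "infinite I"
 then have "\<not> (I <= {..<b} & x : U)" using finite_subset by blast
 then show "f I x = 0" using f by (simp add: sf_carrier)
qed


lemma sf_abelian_group: "abelian_group SF"
proof (rule abelian_groupI)
 fix f assume f: "f : carrier SF"
 show "\<exists>g\<in>carrier SF. g +[SF] f = 0[SF]"
  using sf_smult_closed[OF f, of "-1"] by (intro bexI[of _ "(-1) \<odot>[SF] f"]) (auto simp: sf_simps)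
next
 show "f +[SF] g : carrier SF" if "f : carrier SF" "g : carrier SF" for f g
  using that by (rule sf_add_closed)
 show "0[SF] : carrier SF" by (rule sf_zero_closed)
qed (simp_all add: sf_simps add_ac)

lemma sf_a_inv: "f : carrier SF ==> -[SF] f = (%I x. - f I x)"
proof -
 assume f: "f : carrier SF"
 interpret abelian_group SF by (rule sf_abelian_group)
 have "-[SF] f = (-1) \<odot>[SF] f"
 proof (rule minus_equality)
  show "(-1) \<odot>[SF] f +[SF] f = 0[SF]" by (simp add: sf_simps)
 qed (use sf_smult_closed[OF f] f in auto)
 then show ?thesis by (simp add: sf_simps)
qed

lemma sf_ring: "ring SF"
proof (rule ringI[OF sf_abelian_group])
 show "monoid SF"
 proof (rule monoidI)
  fix f assume f: "f : carrier SF"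
  show "1[SF] *[SF] f = f"
  proof (intro ext)
   fix K x
   show "(1[SF] *[SF] f) K x = f K x"
   proof (cases "x : U & finite K")
    case True
    then have "(%I. if I = {} & x : U then 1 else 0) = gone" by (auto simp: gone_def)
    then show ?thesis using True by (simp add: sf_simps gmul_gone_left)
   next
    case False
    then show ?thesis using sf_infinite[OF f] f by (auto simp: sf_simps gmul_def sf_carrier)
   qed
  qed
  show "f *[SF] 1[SF] = f"
  proof (intro ext)
   fix K x
   show "(f *[SF] 1[SF]) K x = f K x"
   proof (cases "x : U & finite K")
    case True
    then have "(%I. if I = {} & x : U then 1 else 0) = gone" by (auto simp: gone_def)
    then show ?thesis using True by (simp add: sf_simps gmul_gone_right)
   next
    case False
    then show ?thesis using sf_infinite[OF f] f by (auto simp: sf_simps gmul_def sf_carrier)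
   qed
  qed
 next
  show "f *[SF] g : carrier SF" if "f : carrier SF" "g : carrier SF" for f g
   using that by (rule sf_mult_closed)
  show "1[SF] : carrier SF" by (rule sf_one_closed)
  show "f *[SF] g *[SF] h = f *[SF] (g *[SF] h)" for f g h
   unfolding sf_simps by (intro ext gmul_assoc)
 qed
qed (simp_all add: sf_simps gmul_add)

lemma sf_superalgebra: "superalgebra SF"
 unfolding superalgebra_def
proof (intro conjI allI ballI)
 show "ring SF" by (rule sf_ring)
 show "Module.module real_ring SF"
 proof (rule moduleI[OF cring_real_ring sf_abelian_group])
  show "c \<odot>[SF] x : carrier SF" if "x : carrier SF" for c x using that by (rule sf_smult_closed)
 qed (simp_all add: real_ring_def sf_simps distrib_left distrib_right mult.assoc)
next
 fix p
 interpret ring SF by (rule sf_ring)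
 show "additive_subgroup (part SF p) SF"
 proof (rule additive_subgroupI, unfold_locales)
  show "part SF p <= carrier (add_monoid SF)" by (auto simp: sf_part)
  show "x *[add_monoid SF] y : part SF p" if "x : part SF p" "y : part SF p" for x y
   using that sf_add_closed unfolding sf_part by (auto simp: sf_simps)
  show "1[add_monoid SF] : part SF p"
   using sf_zero_closed by (simp add: sf_part) (simp add: sf_simps)
  show "inv\<^bsub>add_monoid SF\<^esub> x : part SF p" if "x : part SF p" for x
  proof -
   have "-[SF] x : part SF p"
    using that a_inv_closed[of x] unfolding sf_part by (auto simp: sf_a_inv)
   then show ?thesis by (simp add: a_inv_def)
  qed
 qed
next
 fix p c x assume "x : part SF p"
 then show "c \<odot>[SF] x : part SF p"
  using sf_smult_closed unfolding sf_part by (auto simp: sf_simps)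
next
 interpret ring SF by (rule sf_ring)
 fix f assume f: "f : carrier SF"
 let ?g = "%I x. if even (card I) then f I x else 0"
 have g: "?g : carrier SF"
 proof -
  have "smooth_on a U (%x. if even (card I) then f I x else 0)" if "I <= {..<b}" for I
   using f that smooth_on_const[OF U, of 0] by (cases "even (card I)") (auto simp: sf_carrier)
  then show ?thesis using f by (auto simp: sf_carrier)
 qed
 have minus: "f -[SF] y = (%I x. f I x - y I x)" if "y : carrier SF" for y
  using that by (simp add: a_minus_def sf_a_inv sf_simps)
 show "\<exists>!y. y : part SF False & f -[SF] y : part SF True"
 proof (rule ex1I[of _ ?g])
  show "?g : part SF False & f -[SF] ?g : part SF True"
   using g minus_closed[OF f g] by (simp add: sf_part minus[OF g])
  fix y assume y: "y : part SF False & f -[SF] y : part SF True"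
  then have yc: "y : carrier SF" by (simp add: sf_part)
  show "y = ?g"
  proof (intro ext)
   fix I x show "y I x = ?g I x" using y by (cases "even (card I)") (auto simp: sf_part minus[OF yc])
  qed
 qed
next
 fix p q x y assume xy: "x : part SF p" "y : part SF q"
 have "gmul (%I. x I t) (%I. y I t) K = 0" if "odd (card K) \<noteq> (p \<noteq> q)" for t K
  by (rule gmul_parity[OF _ _ that]) (use xy in \<open>auto simp: sf_part\<close>)
 then show "x *[SF] y : part SF (p \<noteq> q)"
  using sf_mult_closed[of x y] xy unfolding sf_part by (simp add: sf_simps)
 have *: "y *[SF] x : carrier SF" using xy sf_mult_closed by (simp add: sf_part)
 show "x *[SF] y = signed SF (p & q) (y *[SF] x)"
 proof -
  have "gmul (%I. x I t) (%I. y I t) K = (if p & q then - 1 else 1) * gmul (%I. y I t) (%I. x I t) K" for t K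
   by (rule gmul_supercomm) (use xy in \<open>auto simp: sf_part\<close>)
  then show ?thesis using * by (auto simp: signed_def sf_a_inv sf_simps)
 qed
next
 fix c x y assume "x : carrier SF" "y : carrier SF"
 show "(c \<odot>[SF] x) *[SF] y = c \<odot>[SF] (x *[SF] y)" "x *[SF] (c \<odot>[SF] y) = c \<odot>[SF] (x *[SF] y)"
  by (simp_all add: sf_simps gmul_smult)
qed

end

section \<open>The structure sheaf of the model\<close>

lemma se_simps [simp]:
 "spc (super_euclidean a b) = Euclidean_space a" "sec (super_euclidean a b) = superfunctions a b"
 "rst (super_euclidean a b) U V f = (%I x. if x : V then f I x else 0)"
 by (simp_all add: super_euclidean_def)

lemma sf_restrict_closed:
 assumes U: "openin (Euclidean_space a) U" and V: "openin (Euclidean_space a) V" "V <= U"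
  and f: "f : carrier (superfunctions a b U)"
 shows "(%I x. if x : V then f I x else 0) : carrier (superfunctions a b V)"
proof -
 have "smooth_on a V (%x. if x : V then f I x else 0)" if "I <= {..<b}" for I
  by (rule smooth_on_cong[OF V(1), THEN iffD1, of "f I"])
   (use f that smooth_on_subset[OF _ U V] in \<open>auto simp: sf_carrier\<close>)
 then show ?thesis using f V by (auto simp: sf_carrier)
qed

lemma superringed_super_euclidean: "superringed_space (super_euclidean a b)"
 unfolding superringed_space_def se_simps
proof (intro conjI allI impI ballI)
 fix U assume "openin (Euclidean_space a) U"
 then show "superalgebra (superfunctions a b U)" by (rule sf_superalgebra)
 fix f assume "f : carrier (superfunctions a b U)"
 then show "(%I x. if x : U then f I x else 0) = f" by (auto simp: sf_carrier intro!: ext)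
next
 fix U V assume *: "openin (Euclidean_space a) U & openin (Euclidean_space a) V & V <= U"
 have "gmul (%I. if x : V then f I x else 0) (%I. if x : V then g I x else 0) K =
   (if x : V then gmul (%I. f I x) (%I. g I x) K else 0)"
  for f g :: "nat set => (nat => real) => real" and x K
  by (simp add: gmul_def)
 then show "superalgebra_hom (superfunctions a b U) (superfunctions a b V) (%f I x. if x : V then f I x else 0)"
  unfolding superalgebra_hom_def
  using * by (auto simp: ring_hom_def sf_simps sf_part intro!: sf_restrict_closed ext)
next
 fix \<U> f g
 assume *: "\<forall>V\<in>\<U>. openin (Euclidean_space a) V" "f : carrier (superfunctions a b (\<Union>\<U>))"
  "g : carrier (superfunctions a b (\<Union>\<U>))"
  and eq: "\<forall>V\<in>\<U>. (%I x. if x : V then f I x else 0) = (%I x. if x : V then g I x else 0)"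
 show "f = g"
 proof (intro ext)
  fix I x
  show "f I x = g I x"
  proof (cases "x : \<Union>\<U>")
   case True
   then obtain V where V: "V : \<U>" "x : V" by blast
   then show ?thesis using fun_cong[OF fun_cong[OF bspec[OF eq V(1)]], of x I] by simp
  qed (use * in \<open>auto simp: sf_carrier\<close>)
 qed
next
 fix \<U> s
 assume op: "\<forall>V\<in>\<U>. openin (Euclidean_space a) V"
  and s: "(\<forall>V\<in>\<U>. s V : carrier (superfunctions a b V)) &
   (\<forall>V\<in>\<U>. \<forall>V'\<in>\<U>. (%I x. if x : V Int V' then s V I x else 0) = (%I x. if x : V Int V' then s V' I x else 0))"
 define f where "f I x = (if \<exists>V\<in>\<U>. x : V then s (SOME V. V : \<U> & x : V) I x else 0)" for I x
 have f: "f I x = s V I x" if V: "V : \<U>" "x : V" for V I x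
 proof -
  let ?V = "SOME V. V : \<U> & x : V"
  have V': "?V : \<U> & x : ?V" by (rule someI[of _ V]) (use V in simp)
  then have "(%I x. if x : V Int ?V then s V I x else 0) = (%I x. if x : V Int ?V then s ?V I x else 0)"
   using s V by blast
  from fun_cong[OF fun_cong[OF this], of x I] show ?thesis using V V' by (auto simp: f_def)
 qed
 have "f : carrier (superfunctions a b (\<Union>\<U>))"
  unfolding sf_carrier
 proof (intro conjI allI impI)
  fix I :: "nat set" assume I: "I <= {..<b}"
  show "smooth_on a (\<Union>\<U>) (f I)"
  proof (rule smooth_on_local)
   show "openin (Euclidean_space a) (\<Union>\<U>)" using op by blast
   fix x assume "x : \<Union>\<U>"
   then obtain V where V: "V : \<U>" "x : V" by blast
   have "smooth_on a V (f I)"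
    by (rule smooth_on_cong[THEN iffD1, of _ _ "s V I"]) (use op V s I f in \<open>auto simp: sf_carrier\<close>)
   then show "\<exists>V. openin (Euclidean_space a) V & x : V & V <= \<Union>\<U> & smooth_on a V (f I)"
    using V op by blast
  qed
 next
  fix I x assume "\<not> (I <= {..<b} & x : \<Union>\<U>)"
  then consider V where "V : \<U>" "x : V" "\<not> I <= {..<b}" | "\<not> (\<exists>V\<in>\<U>. x : V)" by blast
  then show "f I x = 0"
  proof cases
   case 1
   then have "s V I x = 0" using s unfolding sf_carrier by blast
   then show ?thesis using f 1 by simp
  qed (simp add: f_def)
 qed
 moreover have "(%I x. if x : V then f I x else 0) = s V" if "V : \<U>" for V
  using that s f by (auto simp: sf_carrier intro!: ext)
 ultimately show "\<exists>f\<in>carrier (superfunctions a b (\<Union>\<U>)). \<forall>V\<in>\<U>. (%I x. if x : V then f I x else 0) = s V"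
  by blast
next
 fix U V V' f assume "openin (Euclidean_space a) U & openin (Euclidean_space a) V & openin (Euclidean_space a) V' & V <= U & V' <= V"
 then show "(%I x. if x : V' then if x : V then f I x else 0 else 0) = (%I x. if x : V' then f I x else 0)"
  by (auto intro!: ext)
qed

section \<open>Superalgebras, local morphisms and local derivations\<close>

locale superalg = fixes A :: "(real, 'a) graded_module" (structure) assumes sa: "superalgebra A"

sublocale superalg \<subseteq> ring A using sa by (simp add: superalgebra_def)

context superalg begin

lemma module: "Module.module real_ring A" using sa by (simp add: superalgebra_def)

lemma smult_closed [simp, intro]: "x : carrier A ==> c \<odot> x : carrier A"
 using module.smult_closed[OF module] by (simp add: real_ring_def)

lemma smult_add: "x : carrier A ==> y : carrier A ==> c \<odot> (x \<oplus> y) = c \<odot> x \<oplus> c \<odot> y"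
 using module.smult_r_distr[OF module] by (simp add: real_ring_def)

lemma smult_add_left: "x : carrier A ==> (c + d) \<odot> x = c \<odot> x \<oplus> d \<odot> x"
 using module.smult_l_distr[OF module, of c d x] by (simp add: real_ring_def)

lemma smult_one [simp]: "x : carrier A ==> 1 \<odot> x = x"
 using module.smult_one[OF module] by (simp add: real_ring_def)

lemma smult_zero [simp]: "x : carrier A ==> 0 \<odot> x = \<zero>"
 using smult_add_left[of x 0 0] by (metis add.r_cancel_one' add_0 smult_closed)

lemma smult_uminus: "x : carrier A ==> (-1) \<odot> x = \<ominus> x"
 using smult_add_left[of x "-1" 1] by (simp add: minus_equality)

lemma smult_mult_left: "x : carrier A ==> y : carrier A ==> (c \<odot> x) \<otimes> y = c \<odot> (x \<otimes> y)"
 and smult_mult_right: "x : carrier A ==> y : carrier A ==> x \<otimes> (c \<odot> y) = c \<odot> (x \<otimes> y)"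
 using sa by (simp_all add: superalgebra_def)

lemma part_subgroup: "additive_subgroup (part A p) A" using sa by (simp add: superalgebra_def)

lemma part_closed [simp, intro]: "x : part A p ==> x : carrier A"
 using additive_subgroup.a_subset[OF part_subgroup] by blast

lemma part_add: "x : part A p ==> y : part A p ==> x \<oplus> y : part A p"
 using additive_subgroup.a_closed[OF part_subgroup] .

lemma part_zero [simp, intro]: "\<zero> : part A p"
 using additive_subgroup.zero_closed[OF part_subgroup] .

lemma part_uminus: "x : part A p ==> \<ominus> x : part A p"
 using additive_subgroup.a_inv_closed[OF part_subgroup] .

lemma part_minus: "x : part A p ==> y : part A p ==> x \<ominus> y : part A p"
 by (simp add: a_minus_def part_add part_uminus)

lemma part_mult: "x : part A p ==> y : part A q ==> x \<otimes> y : part A (p \<noteq> q)"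
 using sa unfolding superalgebra_def by (elim conjE) blast

lemma supercomm: "x : part A p ==> y : part A q ==> x \<otimes> y = signed A (p & q) (y \<otimes> x)"
 using sa unfolding superalgebra_def by (elim conjE) blast

lemma signed_closed [simp, intro]: "x : carrier A ==> signed A s x : carrier A"
 by (simp add: signed_def)

lemma decomp_ex1: "x : carrier A ==> \<exists>!y. y : part A False & x \<ominus> y : part A True"
 using sa by (simp add: superalgebra_def)

lemma add_minus: "x : carrier A ==> y : carrier A ==> x \<oplus> y \<ominus> x = y"
 by (simp add: a_minus_def a_comm[of x y] a_assoc r_neg)

lemma add_minus': "x : carrier A ==> y : carrier A ==> y \<oplus> (x \<ominus> y) = x"
 by (metis a_assoc a_comm a_minus_def a_inv_closed r_neg r_zero)

lemma decomp:
 assumes "x : carrier A"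
 obtains x0 x1 where "x0 : part A False" "x1 : part A True" "x = x0 \<oplus> x1"
 using decomp_ex1[OF assms] add_minus'[OF assms] part_closed by metis

lemma decomp_unique:
 assumes "x0 : part A False" "x1 : part A True" "y0 : part A False" "y1 : part A True" "x0 \<oplus> x1 = y0 \<oplus> y1"
 shows "x0 = y0" "x1 = y1"
proof -
 have "x0 \<oplus> x1 \<ominus> x0 = x1" "y0 \<oplus> y1 \<ominus> y0 = y1"
  using assms(1-4) by (simp_all add: add_minus part_closed)
 then show "x0 = y0" using decomp_ex1[of "x0 \<oplus> x1"] assms(1-4) assms(5)[symmetric] by (auto simp: part_closed)
 have "x1 = x0 \<oplus> x1 \<ominus> x0" using \<open>x0 \<oplus> x1 \<ominus> x0 = x1\<close> ..
 also have "\<dots> = y0 \<oplus> y1 \<ominus> y0" unfolding assms(5) unfolding \<open>x0 = y0\<close> ..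
 finally show "x1 = y1" using \<open>y0 \<oplus> y1 \<ominus> y0 = y1\<close> by (rule trans)
qed

lemma grade_inv_decomp: "x : part A False ==> y : part A True ==> grade_inv A (x \<oplus> y) = x \<ominus> y"
proof -
 assume xy: "x : part A False" "y : part A True"
 then have "(THE z. z : part A False & x \<oplus> y \<ominus> z : part A True) = x"
  by (intro the1_equality decomp_ex1) (auto simp: add_minus)
 then show ?thesis using xy by (simp add: grade_inv_def Let_def add_minus)
qed

lemma grade_inv_part: "x : part A p ==> grade_inv A x = signed A p x"
 using grade_inv_decomp[of x \<zero>] grade_inv_decomp[of \<zero> x]
 by (cases p) (auto simp: signed_def a_minus_def)

lemma grade_inv_closed [simp, intro]: "x : carrier A ==> grade_inv A x : carrier A"
 using decomp[of x] grade_inv_decomp by (metis minus_closed part_closed)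

lemma grade_inv_zero [simp]: "grade_inv A \<zero> = \<zero>"
 using grade_inv_part[of \<zero> False] by (simp add: signed_def)

lemma grade_inv_add:
 assumes "x : carrier A" "y : carrier A"
 shows "grade_inv A (x \<oplus> y) = grade_inv A x \<oplus> grade_inv A y"
proof -
 obtain x0 x1 where x: "x0 : part A False" "x1 : part A True" "x = x0 \<oplus> x1" using decomp[OF assms(1)] .
 obtain y0 y1 where y: "y0 : part A False" "y1 : part A True" "y = y0 \<oplus> y1" using decomp[OF assms(2)] .
 have c: "x0 : carrier A" "x1 : carrier A" "y0 : carrier A" "y1 : carrier A" using x y by auto
 have "x \<oplus> y = (x0 \<oplus> y0) \<oplus> (x1 \<oplus> y1)" using c by (simp add: x(3) y(3) a_ac)
 then have "grade_inv A (x \<oplus> y) = (x0 \<oplus> y0) \<ominus> (x1 \<oplus> y1)"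
  using grade_inv_decomp[of "x0 \<oplus> y0" "x1 \<oplus> y1"] x y by (simp add: part_add)
 also have "\<dots> = (x0 \<ominus> x1) \<oplus> (y0 \<ominus> y1)" using c by (simp add: a_minus_def minus_add a_ac)
 finally show ?thesis using grade_inv_decomp x y by simp
qed

lemma grade_inv_mult:
 assumes "x : carrier A" "y : carrier A"
 shows "grade_inv A (x \<otimes> y) = grade_inv A x \<otimes> grade_inv A y"
proof -
 obtain x0 x1 where x: "x0 : part A False" "x1 : part A True" "x = x0 \<oplus> x1" using decomp[OF assms(1)] .
 obtain y0 y1 where y: "y0 : part A False" "y1 : part A True" "y = y0 \<oplus> y1" using decomp[OF assms(2)] .
 have c: "x0 : carrier A" "x1 : carrier A" "y0 : carrier A" "y1 : carrier A" using x y by auto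
 have p: "x0 \<otimes> y0 \<oplus> x1 \<otimes> y1 : part A False" "x0 \<otimes> y1 \<oplus> x1 \<otimes> y0 : part A True"
  using part_mult[OF x(1) y(1)] part_mult[OF x(2) y(2)] part_mult[OF x(1) y(2)] part_mult[OF x(2) y(1)]
  by (auto intro!: part_add)
 have "x \<otimes> y = (x0 \<otimes> y0 \<oplus> x1 \<otimes> y1) \<oplus> (x0 \<otimes> y1 \<oplus> x1 \<otimes> y0)"
  using c by (simp add: x(3) y(3) l_distr r_distr a_ac)
 then have "grade_inv A (x \<otimes> y) = (x0 \<otimes> y0 \<oplus> x1 \<otimes> y1) \<ominus> (x0 \<otimes> y1 \<oplus> x1 \<otimes> y0)"
  using grade_inv_decomp[OF p] by simp
 also have "\<dots> = (x0 \<ominus> x1) \<otimes> (y0 \<ominus> y1)"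
  using c by (simp add: a_minus_def l_distr r_distr l_minus r_minus minus_add a_ac)
 finally show ?thesis using grade_inv_decomp x y by simp
qed

text \<open>The axioms do not fix the parity of 1. Write 1 = x0 + x1. Comparing parities in x1 = 1
  x1 gives x1 x1 = 0, and in x0 = x0 1 gives x0 x1 = 0; hence x1 = x0 x1 + x1 x1 = 0.\<close>

lemma one_even: "\<one> : part A False"
proof -
 obtain x0 x1 where x: "x0 : part A False" "x1 : part A True" "\<one> = x0 \<oplus> x1" using decomp[OF one_closed] .
 have c: "x0 : carrier A" "x1 : carrier A" using x by auto
 have "x1 = x0 \<otimes> x1 \<oplus> x1 \<otimes> x1" using x(3) c by (metis l_distr l_one)
 moreover have "x0 \<otimes> x1 : part A True" "x1 \<otimes> x1 : part A False"
  using part_mult[OF x(1,2)] part_mult[OF x(2,2)] by auto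
 ultimately have "\<zero> = x1 \<otimes> x1" using decomp_unique(1)[of \<zero> x1 "x1 \<otimes> x1" "x0 \<otimes> x1"] x c
  by (metis a_comm l_zero m_closed part_zero)
 moreover have "x0 = x0 \<otimes> x0 \<oplus> x0 \<otimes> x1" using x(3) c by (metis r_distr r_one)
 moreover have "x0 \<otimes> x0 : part A False" using part_mult[OF x(1,1)] by auto
 ultimately have "x0 \<otimes> x1 = \<zero>"
  using decomp_unique(2)[of x0 \<zero> "x0 \<otimes> x0" "x0 \<otimes> x1"] x c \<open>x0 \<otimes> x1 : part A True\<close>
  by (metis r_zero part_zero)
 then have "x1 = \<zero>" using \<open>x1 = x0 \<otimes> x1 \<oplus> x1 \<otimes> x1\<close> \<open>\<zero> = x1 \<otimes> x1\<close> by (metis zero_closed l_zero)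
 then show ?thesis using x by simp
qed

lemma minus_self [simp]: "x : carrier A ==> x \<ominus> x = \<zero>" by (simp add: a_minus_def r_neg)

lemma minus_eq_zero_iff: "x : carrier A ==> y : carrier A ==> x \<ominus> y = \<zero> \<longleftrightarrow> x = y"
 by (metis add_minus' minus_self r_zero)

end

text \<open>Only \<open>zero\<close> and \<open>add\<close> of the record are used, so the same sum
  serves for sections of a sheaf of derivations, which are never shown to form an abelian
  group.\<close>

primrec rsum :: "('a, 'm) ring_scheme => (nat => 'a) => nat => 'a" where
 "rsum A f 0 = 0[A]"
| "rsum A f (Suc k) = rsum A f k +[A] f k"

lemma rsum_cong: "(\<And>i. i < k ==> f i = g i) ==> rsum A f k = rsum A g k"
 by (induction k) auto

context superalg begin

lemma rsum_closed [simp, intro]: "(\<And>i. i < k ==> f i : carrier A) ==> rsum A f k : carrier A"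
 by (induction k) auto

lemma rsum_zero: "(\<And>i. i < k ==> f i = \<zero>) ==> rsum A f k = \<zero>"
 by (induction k) auto

lemma rsum_mult_left:
 "(\<And>i. i < k ==> f i : carrier A) ==> x : carrier A ==> x \<otimes> rsum A f k = rsum A (%i. x \<otimes> f i) k"
 by (induction k) (auto simp: r_distr)

lemma rsum_mult_right:
 "(\<And>i. i < k ==> f i : carrier A) ==> x : carrier A ==> rsum A f k \<otimes> x = rsum A (%i. f i \<otimes> x) k"
 by (induction k) (auto simp: l_distr)

lemma rsum_add:
 "(\<And>i. i < k ==> f i : carrier A) ==> (\<And>i. i < k ==> g i : carrier A) ==>
  rsum A f k \<oplus> rsum A g k = rsum A (%i. f i \<oplus> g i) k"
 by (induction k) (auto simp: a_ac)

lemma rsum_swap: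
 "(\<And>i j. i < k ==> j < l ==> f i j : carrier A) ==>
  rsum A (%i. rsum A (f i) l) k = rsum A (%j. rsum A (%i. f i j) k) l"
proof (induction k)
 case 0 then show ?case by (simp add: rsum_zero)
next
 case (Suc k) then show ?case by (simp add: rsum_add)
qed

lemma rsum_single:
 "j < k ==> (\<And>i. i < k ==> f i : carrier A) ==> (\<And>i. i < k ==> i \<noteq> j ==> f i = \<zero>) ==> rsum A f k = f j"
proof (induction k)
 case (Suc k)
 show ?case
 proof (cases "j = k")
  case True
  then have "rsum A f k = \<zero>" using Suc.prems by (intro rsum_zero) auto
  then show ?thesis using Suc.prems True by simp
 next
  case False
  then show ?thesis using Suc by simp
 qed
qed simp

end

text \<open>No law of \<open>A\<close> or \<open>B\<close> is assumed, only closure of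
  \<open>C\<close>; thus \<open>h\<close> may also be a map between modules of derivations.\<close>

lemma rsum_additive:
 assumes "h 0[A] = 0[B]" and "\<And>x y. x : C ==> y : C ==> h (x +[A] y) = h x +[B] h y"
  and "0[A] : C" and "\<And>x y. x : C ==> y : C ==> x +[A] y : C" and "\<And>i. i < k ==> f i : C"
 shows "h (rsum A f k) = rsum B (%i. h (f i)) k"
proof -
 have "rsum A f k : C & h (rsum A f k) = rsum B (%i. h (f i)) k"
  using assms(5) by (induction k) (use assms(1-4) in auto)
 then show ?thesis ..
qed

locale superalg_hom = A: superalg A + B: superalg B
 for A :: "(real, 'a) graded_module" and B :: "(real, 'b) graded_module" +
 fixes h assumes hom: "superalgebra_hom A B h"
begin

lemma closed [simp, intro]: "x : carrier A ==> h x : carrier B"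
 and add: "x : carrier A ==> y : carrier A ==> h (x +[A] y) = h x +[B] h y"
 and mult: "x : carrier A ==> y : carrier A ==> h (x *[A] y) = h x *[B] h y"
 and one: "h 1[A] = 1[B]"
 and smult: "x : carrier A ==> h (c \<odot>[A] x) = c \<odot>[B] h x"
 and parity: "x : part A p ==> h x : part B p"
 using hom by (auto simp: superalgebra_hom_def ring_hom_def)

lemma zero: "h 0[A] = 0[B]"
 using smult[OF A.zero_closed, of 0] by simp

lemma uminus: "x : carrier A ==> h (-[A] x) = -[B] h x"
 using smult[of x "-1"] by (simp add: A.smult_uminus B.smult_uminus)

lemma minus: "x : carrier A ==> y : carrier A ==> h (x -[A] y) = h x -[B] h y"
 by (simp add: a_minus_def add uminus)

lemma signed: "x : carrier A ==> h (signed A s x) = signed B s (h x)"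
 by (simp add: signed_def uminus)

lemma grade_inv: "x : carrier A ==> h (grade_inv A x) = grade_inv B (h x)"
proof -
 assume "x : carrier A"
 then obtain x0 x1 where x: "x0 : part A False" "x1 : part A True" "x = x0 +[A] x1" by (rule A.decomp)
 then show ?thesis
  using A.grade_inv_decomp[OF x(1,2)] B.grade_inv_decomp[OF parity[OF x(1)] parity[OF x(2)]]
  by (simp add: add minus A.part_closed)
qed

lemma rsum: "(\<And>i. i < k ==> f i : carrier A) ==> h (rsum A f k) = rsum B (%i. h (f i)) k"
 by (rule rsum_additive[of _ _ _ "carrier A"]) (auto simp: zero add)

end

lemma superalgebra_hom_comp:
 assumes "superalgebra_hom A B h" "superalgebra_hom B C k" "superalg A" "superalg B"
 shows "superalgebra_hom A C (%x. k (h x))"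
proof -
 have "x : carrier A ==> h x : carrier B" for x using assms(1) by (auto simp: superalgebra_hom_def ring_hom_def)
 then show ?thesis using assms by (auto simp: superalgebra_hom_def ring_hom_def)
qed

section \<open>Superringed spaces\<close>

locale sspace = fixes M :: "('p, 's) superspace" assumes srs: "superringed_space M"
begin

abbreviation opn :: "'p set => bool" where "opn U \<equiv> oset M U"

lemma alg: "opn U ==> superalg (sec M U)"
 using srs by (simp add: superringed_space_def superalg_def)

lemma rst_id [simp]: "opn U ==> f : Sec M U ==> rst M U U f = f"
 using srs by (simp add: superringed_space_def)

lemma rst_hom: "opn U ==> opn V ==> V <= U ==> superalgebra_hom (sec M U) (sec M V) (rst M U V)"
 using srs by (simp add: superringed_space_def)

lemma rst: "opn U ==> opn V ==> V <= U ==> superalg_hom (sec M U) (sec M V) (rst M U V)"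
 using rst_hom alg by (simp add: superalg_hom_def superalg_hom_axioms_def)

lemma rst_rst [simp]: "opn U ==> opn V ==> opn V' ==> V <= U ==> V' <= V ==> f : Sec M U ==>
  rst M V V' (rst M U V f) = rst M U V' f"
 using srs unfolding superringed_space_def by blast

lemma rst_closed [simp, intro]: "opn U ==> opn V ==> V <= U ==> f : Sec M U ==> rst M U V f : Sec M V"
 using superalg_hom.closed[OF rst] .

lemma sheaf:
 assumes "\<forall>V\<in>\<U>. opn V"
 shows "(\<forall>f\<in>Sec M (\<Union>\<U>). \<forall>g\<in>Sec M (\<Union>\<U>).
      (\<forall>V\<in>\<U>. rst M (\<Union>\<U>) V f = rst M (\<Union>\<U>) V g) --> f = g) &
    (\<forall>s. (\<forall>V\<in>\<U>. s V : Sec M V) &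
       (\<forall>V\<in>\<U>. \<forall>V'\<in>\<U>. rst M V (V Int V') (s V) = rst M V' (V Int V') (s V')) -->
      (\<exists>f\<in>Sec M (\<Union>\<U>). \<forall>V\<in>\<U>. rst M (\<Union>\<U>) V f = s V))"
 using conjunct2[OF conjunct2[OF conjunct2[OF srs[unfolded superringed_space_def]]], THEN spec, THEN mp, OF assms] .

lemma sec_eqI:
 assumes U: "opn U" and f: "f : Sec M U" "g : Sec M U"
  and loc: "\<And>x. x : U ==> \<exists>V. opn V & x : V & V <= U & rst M U V f = rst M U V g"
 shows "f = g"
proof -
 define \<U> where "\<U> = {V. opn V & V <= U & rst M U V f = rst M U V g}"
 have U': "\<Union>\<U> = U" using loc by (auto simp: \<U>_def)
 have o: "\<forall>V\<in>\<U>. opn V" by (auto simp: \<U>_def)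
 have e: "\<forall>V\<in>\<U>. rst M (\<Union>\<U>) V f = rst M (\<Union>\<U>) V g" unfolding U' by (auto simp: \<U>_def)
 show ?thesis
  by (rule conjunct1[OF sheaf[OF o], rule_format, of f g]) (use f e U' in auto)
qed

lemma glue:
 assumes "\<And>V. V : \<U> ==> opn V" "\<And>V. V : \<U> ==> s V : Sec M V"
  and "\<And>V V'. V : \<U> ==> V' : \<U> ==> rst M V (V Int V') (s V) = rst M V' (V Int V') (s V')"
 shows "\<exists>f\<in>Sec M (\<Union>\<U>). \<forall>V\<in>\<U>. rst M (\<Union>\<U>) V f = s V"
 by (rule conjunct2[OF sheaf, THEN spec, THEN mp]) (use assms in auto)

text \<open>Take the decomposition of \<open>f\<close> over \<open>U\<close>. Where \<open>f\<close>
  has parity \<open>p\<close>, uniqueness of the decomposition kills the component of the other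
  parity, and a section that vanishes locally is zero.\<close>

lemma part_local:
 assumes U: "opn U" and f: "f : Sec M U"
  and loc: "\<And>x. x : U ==> \<exists>V. opn V & x : V & V <= U & rst M U V f : Part M V p"
 shows "f : Part M U p"
proof -
 interpret superalg "sec M U" using alg[OF U] .
 obtain f0 f1 where f01: "f0 : Part M U False" "f1 : Part M U True" "f = f0 +[sec M U] f1"
  using decomp[OF f] .
 let ?g = "if p then f0 else f1"
 have "?g = 0[sec M U]"
 proof (rule sec_eqI[OF U])
  fix x assume "x : U"
  then obtain V where V: "opn V" "x : V" "V <= U" "rst M U V f : Part M V p" using loc by blast
  interpret h: superalg_hom "sec M U" "sec M V" "rst M U V" using rst[OF U V(1,3)] .
  have e: "rst M U V f = rst M U V f0 +[sec M V] rst M U V f1" using f01 by (simp add: h.add part_closed)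
  have r: "rst M U V f0 : Part M V False" "rst M U V f1 : Part M V True" using f01 h.parity by auto
  have "rst M U V ?g = 0[sec M V]"
  proof (cases p)
   case True
   then have f: "rst M U V f : Part M V True" using V(4) by simp
   have "rst M U V f0 +[sec M V] rst M U V f1 = 0[sec M V] +[sec M V] rst M U V f"
    unfolding e[symmetric] using f by (simp add: h.B.part_closed)
   then have "rst M U V f0 = 0[sec M V]" by (rule h.B.decomp_unique(1)[OF r h.B.part_zero f])
   then show ?thesis using True by simp
  next
   case False
   then have f: "rst M U V f : Part M V False" using V(4) by simp
   have "rst M U V f0 +[sec M V] rst M U V f1 = rst M U V f +[sec M V] 0[sec M V]"
    unfolding e[symmetric] using f by (simp add: h.B.part_closed)
   then have "rst M U V f1 = 0[sec M V]" by (rule h.B.decomp_unique(2)[OF r f h.B.part_zero])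
   then show ?thesis using False by simp
  qed
  then show "\<exists>V. opn V & x : V & V <= U & rst M U V ?g = rst M U V 0[sec M U]"
   using V by (auto simp: h.zero)
 qed (use f01 in auto)
 then show ?thesis using f01 by (cases p) (auto simp: part_closed)
qed

lemma opn_Int [intro]: "opn U ==> opn V ==> opn (U Int V)" by (rule openin_Int)

end

text \<open>\<open>h\<close> is a morphism of sheaves from \<open>O_N\<close> restricted to \<open>U\<close> to \<open>u_* O_W\<close>, where \<open>u\<close> is defined on the
 open set \<open>S U\<close> and \<open>S V\<close> is the preimage of \<open>V\<close>.\<close>

definition shmor ::
 "('q, 't) superspace => ('p, 's) superspace => 'q set => ('q set => 'p set) => ('p => 'q) =>
  ('q set => 't => 's) => bool" where
 "shmor N W U S u h \<longleftrightarrow>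
   oset N U & (\<forall>q\<in>S U. u q : U) &
   (\<forall>V. oset N V & V <= U -->
    oset W (S V) & S V = {q : S U. u q : V} & superalgebra_hom (sec N V) (sec W (S V)) (h V)) &
   (\<forall>V V'. oset N V & oset N V' & V' <= V & V <= U -->
    (\<forall>g\<in>Sec N V. h V' (rst N V V' g) = rst W (S V) (S V') (h V g)))"

text \<open>Derivations of parity \<open>p\<close> along the sheaf morphism \<open>h\<close>. With
  \<open>h\<close> the identity these are vector fields, with \<open>h\<close> a pull-back they are
  vector fields along a morphism, and composites with a further pull-back are again of this form.
  \<open>homogeneous_ders\<close> is the case of a full morphism, up to normalization.\<close>

definition lder ::
 "('q, 't) superspace => ('p, 's) superspace => 'q set => ('q set => 'p set) =>
  ('q set => 't => 's) => bool => ('q, 't, 's) sder => bool" where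
 "lder N W U S h p D \<longleftrightarrow>
   (\<forall>V. oset N V & V <= U -->
    (let A = sec N V; B = sec W (S V) in
     (\<forall>g\<in>carrier A. D V g : carrier B) &
     (\<forall>f\<in>carrier A. \<forall>g\<in>carrier A. D V (f +[A] g) = D V f +[B] D V g) &
     (\<forall>c. \<forall>g\<in>carrier A. D V (c \<odot>[A] g) = c \<odot>[B] D V g) &
     (\<forall>q. \<forall>g\<in>part A q. D V g : part B (p \<noteq> q)) &
     (\<forall>q. \<forall>f\<in>part A q. \<forall>g\<in>carrier A.
       D V (f *[A] g) =
        (D V f *[B] h V g) +[B] signed B (p & q) (h V f *[B] D V g)))) &
   (\<forall>V V'. oset N V & oset N V' & V' <= V & V <= U -->
    (\<forall>g\<in>Sec N V. D V' (rst N V V' g) = rst W (S V) (S V') (D V g)))"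

lemma shmorI:
 assumes "oset N U" "\<And>q. q : S U ==> u q : U"
  "\<And>V. oset N V ==> V <= U ==> oset W (S V)"
  "\<And>V. oset N V ==> V <= U ==> S V = {q : S U. u q : V}"
  "\<And>V. oset N V ==> V <= U ==> superalgebra_hom (sec N V) (sec W (S V)) (h V)"
  "\<And>V V' g. oset N V ==> oset N V' ==> V' <= V ==> V <= U ==> g : Sec N V ==>
    h V' (rst N V V' g) = rst W (S V) (S V') (h V g)"
 shows "shmor N W U S u h"
 unfolding shmor_def by (intro conjI allI impI ballI; (elim conjE)?; rule assms; assumption)

lemma homogeneous_ders_iff:
 "D : homogeneous_ders N M \<psi> U p \<longleftrightarrow> normal_der N U D = D & lder N M U (preim M \<psi>) (pull \<psi>) p D"
 by (simp add: homogeneous_ders_def lder_def)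

lemma lderI:
 assumes "\<And>V g. oset N V ==> V <= U ==> g : Sec N V ==> D V g : Sec W (S V)"
  "\<And>V f g. oset N V ==> V <= U ==> f : Sec N V ==> g : Sec N V ==>
    D V (f +[sec N V] g) = D V f +[sec W (S V)] D V g"
  "\<And>V c g. oset N V ==> V <= U ==> g : Sec N V ==>
    D V (c \<odot>[sec N V] g) = c \<odot>[sec W (S V)] D V g"
  "\<And>V q g. oset N V ==> V <= U ==> g : Part N V q ==> D V g : Part W (S V) (p \<noteq> q)"
  "\<And>V q f g. oset N V ==> V <= U ==> f : Part N V q ==> g : Sec N V ==>
    D V (f *[sec N V] g) = (D V f *[sec W (S V)] h V g) +[sec W (S V)]
     signed (sec W (S V)) (p & q) (h V f *[sec W (S V)] D V g)"
  "\<And>V V' g. oset N V ==> oset N V' ==> V' <= V ==> V <= U ==> g : Sec N V ==>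
    D V' (rst N V V' g) = rst W (S V) (S V') (D V g)"
 shows "lder N W U S h p D"
 unfolding lder_def Let_def by (intro conjI allI impI ballI; (elim conjE)?; rule assms; assumption)

lemma
 assumes D: "lder N W U S h p D" and V: "oset N V" "V <= U"
 shows lder_closed: "g : Sec N V ==> D V g : Sec W (S V)"
  and lder_add: "f : Sec N V ==> g : Sec N V ==>
    D V (f +[sec N V] g) = D V f +[sec W (S V)] D V g"
  and lder_smult: "g : Sec N V ==> D V (c \<odot>[sec N V] g) = c \<odot>[sec W (S V)] D V g"
  and lder_parity: "g : Part N V q ==> D V g : Part W (S V) (p \<noteq> q)"
  and lder_Leibniz: "f : Part N V q ==> g : Sec N V ==>
    D V (f *[sec N V] g) = (D V f *[sec W (S V)] h V g) +[sec W (S V)]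
     signed (sec W (S V)) (p & q) (h V f *[sec W (S V)] D V g)"
  and lder_rst: "oset N V' ==> V' <= V ==> g : Sec N V ==>
    D V' (rst N V V' g) = rst W (S V) (S V') (D V g)"
proof -
 note 1 = conjunct1[OF D[unfolded lder_def Let_def], rule_format, OF conjI[OF V]]
 note 2 = conjunct2[OF D[unfolded lder_def Let_def], rule_format]
 show "g : Sec N V ==> D V g : Sec W (S V)"
  "g : Sec N V ==> D V (c \<odot>[sec N V] g) = c \<odot>[sec W (S V)] D V g"
  "g : Part N V q ==> D V g : Part W (S V) (p \<noteq> q)"
  "f : Sec N V ==> g : Sec N V ==>
    D V (f +[sec N V] g) = D V f +[sec W (S V)] D V g"
  "f : Part N V q ==> g : Sec N V ==>
    D V (f *[sec N V] g) = (D V f *[sec W (S V)] h V g) +[sec W (S V)]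
     signed (sec W (S V)) (p & q) (h V f *[sec W (S V)] D V g)"
  by (rule 1[THEN conjunct1, rule_format], assumption)
   (rule 1[THEN conjunct2, THEN conjunct2, THEN conjunct1, rule_format], assumption,
    rule 1[THEN conjunct2, THEN conjunct2, THEN conjunct2, THEN conjunct1, rule_format], assumption,
    rule 1[THEN conjunct2, THEN conjunct1, rule_format], assumption, assumption,
    rule 1[THEN conjunct2, THEN conjunct2, THEN conjunct2, THEN conjunct2, rule_format], assumption, assumption)
 show "oset N V' ==> V' <= V ==> g : Sec N V ==>
    D V' (rst N V V' g) = rst W (S V) (S V') (D V g)" by (rule 2) (use V in simp_all)
qed

locale lmor = N: sspace N + W: sspace W
 for N :: "('q, 't) superspace" and W :: "('p, 's) superspace" +
 fixes U S u h assumes sh: "shmor N W U S u h"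
begin

lemma U_open: "oset N U" and u_in: "q : S U ==> u q : U"
 using sh[unfolded shmor_def, THEN conjunct1] sh[unfolded shmor_def, THEN conjunct2, THEN conjunct1]
 by simp_all

lemma S_open: "oset N V ==> V <= U ==> oset W (S V)"
 and S_eq: "oset N V ==> V <= U ==> S V = {q : S U. u q : V}"
 and hhom: "oset N V ==> V <= U ==> superalgebra_hom (sec N V) (sec W (S V)) (h V)"
 and h_rst: "oset N V ==> oset N V' ==> V' <= V ==> V <= U ==>
  g : Sec N V ==> h V' (rst N V V' g) = rst W (S V) (S V') (h V g)"
proof -
 note 1 = sh[unfolded shmor_def, THEN conjunct2, THEN conjunct2, THEN conjunct1, rule_format, OF conjI, of V]
 note 2 = sh[unfolded shmor_def, THEN conjunct2, THEN conjunct2, THEN conjunct2, rule_format, of V V' g]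
 show "oset N V ==> V <= U ==> oset W (S V)"
  "oset N V ==> V <= U ==> S V = {q : S U. u q : V}"
  "oset N V ==> V <= U ==> superalgebra_hom (sec N V) (sec W (S V)) (h V)"
  by (rule 1[THEN conjunct1], assumption, assumption)
   (rule 1[THEN conjunct2, THEN conjunct1], assumption, assumption,
    rule 1[THEN conjunct2, THEN conjunct2], assumption, assumption)
 show "oset N V ==> oset N V' ==> V' <= V ==> V <= U ==>
  g : Sec N V ==> h V' (rst N V V' g) = rst W (S V) (S V') (h V g)"
  by (rule 2) simp_all
qed

lemma S_mono: "oset N V ==> V <= U ==> oset N V' ==> V' <= V ==> S V' <= S V"
 using S_eq[of V] S_eq[of V'] by auto

lemma S_u: "oset N V ==> V <= U ==> q : S V ==> u q : V"
 using S_eq[of V] by auto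

lemma S_mem: "oset N V ==> V <= U ==> oset N V' ==> V' <= U ==> q : S V ==> u q : V' ==> q : S V'"
 using S_eq[of V] S_eq[of V'] by auto

lemma hh: "oset N V ==> V <= U ==> superalg_hom (sec N V) (sec W (S V)) (h V)"
 using hhom N.alg W.alg[OF S_open] by (simp add: superalg_hom_def superalg_hom_axioms_def)

lemma lder_minus:
 assumes D: "lder N W U S h p D" and E: "lder N W U S h p E"
 shows "lder N W U S h p (%V g. D V g -[sec W (S V)] E V g)"
proof (rule lderI)
 fix V assume V: "oset N V" "V <= U"
 interpret superalg_hom "sec N V" "sec W (S V)" "h V" using hh[OF V] .
 note D' = lder_closed[OF D V] lder_add[OF D V] lder_smult[OF D V] lder_parity[OF D V] lder_Leibniz[OF D V]
 note E' = lder_closed[OF E V] lder_add[OF E V] lder_smult[OF E V] lder_parity[OF E V] lder_Leibniz[OF E V]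
 let ?D = "%V g. D V g -[sec W (S V)] E V g"
 show "g : Sec N V ==> ?D V g : Sec W (S V)" for g using D'(1) E'(1) by simp
 show "f : Sec N V ==> g : Sec N V ==>
    ?D V (f +[sec N V] g) = ?D V f +[sec W (S V)] ?D V g" for f g
  using D'(1,2) E'(1,2) by (simp add: a_minus_def B.minus_add B.a_ac)
 show "g : Sec N V ==> ?D V (c \<odot>[sec N V] g) = c \<odot>[sec W (S V)] ?D V g" for c g
  using D'(1,3) E'(1,3) B.smult_mult_left[of "-[sec W (S V)] 1[sec W (S V)]" "E V g" c]
   B.smult_mult_right[of "-[sec W (S V)] 1[sec W (S V)]" "E V g" c]
  by (simp add: a_minus_def B.smult_add B.l_minus)
 show "g : Part N V q ==> ?D V g : Part W (S V) (p \<noteq> q)" for q g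
  using D'(4) E'(4) by (simp add: B.part_minus)
 show "f : Part N V q ==> g : Sec N V ==>
    ?D V (f *[sec N V] g) = (?D V f *[sec W (S V)] h V g) +[sec W (S V)]
     signed (sec W (S V)) (p & q) (h V f *[sec W (S V)] ?D V g)" for q f g
  using D'(1,5) E'(1,5)
  by (simp add: a_minus_def signed_def B.minus_add B.l_distr B.r_distr B.l_minus B.r_minus B.a_ac)
 show "?D V' (rst N V V' g) = rst W (S V) (S V') (?D V g)"
  if V': "oset N V'" "V' <= V" and g: "g : Sec N V" for V' g
  using lder_rst[OF D V V' g] lder_rst[OF E V V' g] D'(1)[OF g] E'(1)[OF g]
   superalg_hom.minus[OF W.rst[OF S_open[OF V] S_open[OF V'(1)] S_mono[OF V V']]] V V'
  by simp
qed

lemma lder_plus: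
 assumes D: "lder N W U S h p D" and E: "lder N W U S h p E"
 shows "lder N W U S h p (%V g. D V g +[sec W (S V)] E V g)"
proof (rule lderI)
 fix V assume V: "oset N V" "V <= U"
 interpret superalg_hom "sec N V" "sec W (S V)" "h V" using hh[OF V] .
 note D' = lder_closed[OF D V] lder_add[OF D V] lder_smult[OF D V] lder_parity[OF D V] lder_Leibniz[OF D V]
 note E' = lder_closed[OF E V] lder_add[OF E V] lder_smult[OF E V] lder_parity[OF E V] lder_Leibniz[OF E V]
 let ?D = "%V g. D V g +[sec W (S V)] E V g"
 show "g : Sec N V ==> ?D V g : Sec W (S V)" for g using D'(1) E'(1) by simp
 show "f : Sec N V ==> g : Sec N V ==>
    ?D V (f +[sec N V] g) = ?D V f +[sec W (S V)] ?D V g" for f g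
  using D'(1,2) E'(1,2) by (simp add: B.a_ac)
 show "g : Sec N V ==> ?D V (c \<odot>[sec N V] g) = c \<odot>[sec W (S V)] ?D V g" for c g
  using D'(1,3) E'(1,3) by (simp add: B.smult_add)
 show "g : Part N V q ==> ?D V g : Part W (S V) (p \<noteq> q)" for q g
  using D'(4) E'(4) by (simp add: B.part_add)
 show "f : Part N V q ==> g : Sec N V ==>
    ?D V (f *[sec N V] g) = (?D V f *[sec W (S V)] h V g) +[sec W (S V)]
     signed (sec W (S V)) (p & q) (h V f *[sec W (S V)] ?D V g)" for q f g
  using D'(1,5) E'(1,5)
  by (simp add: signed_def B.minus_add B.l_distr B.r_distr B.a_ac)
 show "?D V' (rst N V V' g) = rst W (S V) (S V') (?D V g)"
  if V': "oset N V'" "V' <= V" and g: "g : Sec N V" for V' g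
  using lder_rst[OF D V V' g] lder_rst[OF E V V' g] D'(1)[OF g] E'(1)[OF g]
   superalg_hom.add[OF W.rst[OF S_open[OF V] S_open[OF V'(1)] S_mono[OF V V']]] V V'
  by simp
qed

lemma lder_zero: "lder N W U S h p (%V g. 0[sec W (S V)])"
proof (rule lderI)
 fix V assume V: "oset N V" "V <= U"
 interpret superalg_hom "sec N V" "sec W (S V)" "h V" using hh[OF V] .
 let ?z = "0[sec W (S V)]"
 show "?z : Sec W (S V)" "?z = ?z +[sec W (S V)] ?z" "?z : Part W (S V) (p \<noteq> q)" for q by auto
 show "?z = c \<odot>[sec W (S V)] ?z" for c
  using smult[OF A.zero_closed, of c] B.smult_mult_left[of ?z ?z c] B.smult_mult_right[of ?z ?z c] B.l_null[of "c \<odot>[sec W (S V)] ?z"] by simp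
 show "f : Part N V q ==> g : Sec N V ==>
    ?z = (?z *[sec W (S V)] h V g) +[sec W (S V)]
     signed (sec W (S V)) (p & q) (h V f *[sec W (S V)] ?z)" for q f g
  by (simp add: signed_def)
 show "0[sec W (S V')] = rst W (S V) (S V') ?z" if V': "oset N V'" "V' <= V" for V'
  using superalg_hom.zero[OF W.rst[OF S_open[OF V] S_open[OF V'(1)] S_mono[OF V V']]] V V' by simp
qed

text \<open>Scalars of the target act from the left, so in the second term of the Leibniz rule
  \<open>c\<close> has to pass \<open>h V f\<close>. Supercommutativity supplies the sign by which
  the parity changes from \<open>p\<close> to that of the product.\<close>

lemma lder_scale:
 assumes D: "lder N W U S h p D" and c: "c : Part W (S U) s"
 shows "lder N W U S h (s \<noteq> p) (%V g. rst W (S U) (S V) c *[sec W (S V)] D V g)"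
proof (rule lderI)
 fix V assume V: "oset N V" "V <= U"
 interpret superalg_hom "sec N V" "sec W (S V)" "h V" using hh[OF V] .
 interpret r: superalg_hom "sec W (S U)" "sec W (S V)" "rst W (S U) (S V)"
  by (rule W.rst[OF S_open[OF U_open order_refl] S_open[OF V] S_mono[OF U_open order_refl V]])
 note D' = lder_closed[OF D V] lder_add[OF D V] lder_smult[OF D V] lder_parity[OF D V] lder_Leibniz[OF D V]
 define k where "k = rst W (S U) (S V) c"
 have k: "k : Part W (S V) s" unfolding k_def by (rule r.parity[OF c])
 have kc: "k : Sec W (S V)" using k by auto
 let ?D = "%V g. rst W (S U) (S V) c *[sec W (S V)] D V g"
 show "g : Sec N V ==> ?D V g : Sec W (S V)" for g
  using D'(1) kc unfolding k_def[symmetric] by simp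
 show "f : Sec N V ==> g : Sec N V ==>
    ?D V (f +[sec N V] g) = ?D V f +[sec W (S V)] ?D V g" for f g
  using D'(1,2) kc unfolding k_def[symmetric] by (simp add: B.r_distr)
 show "g : Sec N V ==> ?D V (c' \<odot>[sec N V] g) = c' \<odot>[sec W (S V)] ?D V g" for c' g
  using D'(1,3) kc unfolding k_def[symmetric] by (simp add: B.smult_mult_right)
 show "g : Part N V q ==> ?D V g : Part W (S V) ((s \<noteq> p) \<noteq> q)" for q g
  using B.part_mult[OF k D'(4), of g q] unfolding k_def[symmetric] by (cases s; cases p; cases q) auto
 show "?D V (f *[sec N V] g) = (?D V f *[sec W (S V)] h V g) +[sec W (S V)]
     signed (sec W (S V)) ((s \<noteq> p) & q) (h V f *[sec W (S V)] ?D V g)"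
  if f: "f : Part N V q" and g: "g : Sec N V" for q f g
 proof -
  have fc: "f : Sec N V" using f by auto
  have "k *[sec W (S V)] h V f = signed (sec W (S V)) (s & q) (h V f *[sec W (S V)] k)"
   by (rule B.supercomm[OF k parity[OF f]])
  then have "k *[sec W (S V)] (h V f *[sec W (S V)] D V g) =
    signed (sec W (S V)) (s & q) (h V f *[sec W (S V)] (k *[sec W (S V)] D V g))"
   using kc D'(1)[OF g] closed[OF fc]
   by (simp add: B.m_assoc[symmetric]) (simp add: signed_def B.l_minus)
  then show ?thesis
   unfolding k_def[symmetric] using D'(5)[OF f g] kc D'(1)[OF g] D'(1)[OF fc] closed[OF fc] closed[OF g]
   by (simp add: B.r_distr B.m_assoc) (cases s; cases p; cases q; simp add: signed_def B.r_minus)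
 qed
 show "?D V' (rst N V V' g) = rst W (S V) (S V') (?D V g)"
  if V': "oset N V'" "V' <= V" and g: "g : Sec N V" for V' g
 proof -
  have "rst W (S V) (S V') (rst W (S U) (S V) c) = rst W (S U) (S V') c"
   by (rule W.rst_rst) (use S_open U_open V V' S_mono c r.A.part_closed in auto)
  then show ?thesis
   using lder_rst[OF D V V' g] D'(1)[OF g] kc
    superalg_hom.mult[OF W.rst[OF S_open[OF V] S_open[OF V'(1)] S_mono[OF V V']]] V V'
   unfolding k_def by simp
 qed
qed

lemma lder_rsum:
 assumes "\<And>i. i < k ==> lder N W U S h p (D i)"
 shows "lder N W U S h p (%V g. rsum (sec W (S V)) (%i. D i V g) k)"
 using assms by (induction k) (auto intro: lder_zero lder_plus)

end

lemma lder_mono: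
 assumes D: "lder N W U S h p D" and sub: "U' <= U"
 shows "lder N W U' S h p D"
 by (rule lderI; (rule lder_closed[OF D] lder_smult[OF D] lder_parity[OF D] lder_add[OF D]
   lder_Leibniz[OF D] lder_rst[OF D]; (assumption | erule order_trans[OF _ sub])))

lemma lder_cong:
 assumes "\<And>V g. oset N V ==> V <= U ==> g : Sec N V ==> D V g = E V g"
  and N: "superringed_space N" and D: "lder N W U S h p D"
 shows "lder N W U S h p E"
proof -
 interpret sspace N using N by unfold_locales
 show ?thesis
 proof (rule lderI)
  fix V assume V: "oset N V" "V <= U"
  interpret superalg "sec N V" using alg[OF V(1)] .
  note D' = lder_closed[OF D V] lder_add[OF D V] lder_smult[OF D V] lder_parity[OF D V] lder_Leibniz[OF D V]
  note c = assms(1)[OF V, symmetric]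
  show "g : Sec N V ==> E V g : Sec W (S V)" for g using D'(1) c by simp
  show "f : Sec N V ==> g : Sec N V ==>
    E V (f +[sec N V] g) = E V f +[sec W (S V)] E V g" for f g using D'(2) c by simp
  show "g : Sec N V ==> E V (c \<odot>[sec N V] g) = c \<odot>[sec W (S V)] E V g" for c g using D'(3) c by simp
  show "g : Part N V q ==> E V g : Part W (S V) (p \<noteq> q)" for q g using D'(4) c by simp
  show "f : Part N V q ==> g : Sec N V ==>
    E V (f *[sec N V] g) = (E V f *[sec W (S V)] h V g) +[sec W (S V)]
     signed (sec W (S V)) (p & q) (h V f *[sec W (S V)] E V g)" for q f g using D'(5) c by simp
  show "E V' (rst N V V' g) = rst W (S V) (S V') (E V g)"
   if V': "oset N V'" "V' <= V" and g: "g : Sec N V" for V' g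
   using lder_rst[OF D V V' g] assms(1)[OF V g] assms(1)[OF V'(1) _ rst_closed[OF V(1) V' g]] V V' by auto
 qed
qed

lemma shmor_comp:
 assumes N: "superringed_space N" "superringed_space M"
  "superringed_space W"
  and 1: "shmor N M U S1 u1 h1" and 2: "shmor M W Q S2 u2 h2" and S: "S1 U <= Q"
 shows "shmor N W U (%V. S2 (S1 V)) (%x. u1 (u2 x)) (%V f. h2 (S1 V) (h1 V f))"
proof -
 interpret N: sspace N using N(1) by unfold_locales
 interpret M: sspace M using N(2) by unfold_locales
 interpret W: sspace W using N(3) by unfold_locales
 have U: "oset N U" using 1[unfolded shmor_def, THEN conjunct1] .
 interpret m1: lmor N M U S1 u1 h1 using 1 by unfold_locales
 interpret m2: lmor M W Q S2 u2 h2 using 2 by unfold_locales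
 have V: "oset M (S1 V)" "S1 V = {q : S1 U. u1 q : V}" "S1 V <= Q"
  "superalgebra_hom (sec N V) (sec M (S1 V)) (h1 V)"
  "oset W (S2 (S1 V))" "S2 (S1 V) = {q : S2 Q. u2 q : S1 V}"
  "superalgebra_hom (sec M (S1 V)) (sec W (S2 (S1 V))) (h2 (S1 V))"
  if "oset N V" "V <= U" for V
 proof -
  show *: "oset M (S1 V)" "S1 V = {q : S1 U. u1 q : V}"
   "superalgebra_hom (sec N V) (sec M (S1 V)) (h1 V)"
   by (rule m1.S_open m1.S_eq m1.hhom; fact that)+
  then show **: "S1 V <= Q" using S by blast
  show "oset W (S2 (S1 V))" "S2 (S1 V) = {q : S2 Q. u2 q : S1 V}"
  "superalgebra_hom (sec M (S1 V)) (sec W (S2 (S1 V))) (h2 (S1 V))"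
   by (rule m2.S_open m2.S_eq m2.hhom; fact *(1) **)+
 qed
 show ?thesis
  unfolding shmor_def
 proof (intro conjI allI impI ballI)
  show "oset N U" by (rule U)
  show "u1 (u2 q) : U" if "q : S2 (S1 U)" for q
   using that V(2)[OF U order_refl] V(6)[OF U order_refl] by auto
  fix V assume VU: "oset N V & V <= U"
  then have VU': "oset N V" "V <= U" by auto
  show "oset W (S2 (S1 V))" by (rule V(5)[OF VU'])
  show "S2 (S1 V) = {q : S2 (S1 U). u1 (u2 q) : V}"
   using V(2)[OF VU'] V(6)[OF VU'] V(6)[OF U order_refl] by auto
  show "superalgebra_hom (sec N V) (sec W (S2 (S1 V))) (%f. h2 (S1 V) (h1 V f))"
   by (rule superalgebra_hom_comp[OF V(4,7)[OF VU'] N.alg[OF VU'(1)] M.alg[OF V(1)[OF VU']]])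
 next
  fix V V' g assume *: "oset N V & oset N V' & V' <= V & V <= U" and g: "g : Sec N V"
  then have V'U: "V' <= U" by auto
  have "h1 V' (rst N V V' g) = rst M (S1 V) (S1 V') (h1 V g)" using m1.h_rst * g by blast
  moreover have "h1 V g : Sec M (S1 V)"
   using V(4)[of V] * g by (auto simp: superalgebra_hom_def ring_hom_def)
  moreover have "S1 V' <= S1 V" using V(2)[of V] V(2)[of V'] V'U * by auto
  ultimately show "h2 (S1 V') (h1 V' (rst N V V' g)) = rst W (S2 (S1 V)) (S2 (S1 V')) (h2 (S1 V) (h1 V g))"
   using m2.h_rst[of "S1 V" "S1 V'" "h1 V g"] * V(1)[of V] V(1)[of V'] V(3)[of V] V'U by simp
 qed
qed

lemma lder_comp_pre:
 assumes N: "superringed_space N" "superringed_space M"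
  and 1: "shmor N M U S1 u1 h1" and S: "S1 U <= Q" and D: "lder M W Q S2 h2 p D"
 shows "lder N W U (%V. S2 (S1 V)) (%V f. h2 (S1 V) (h1 V f)) p (%V f. D (S1 V) (h1 V f))"
proof -
 interpret N: sspace N using N(1) by unfold_locales
 interpret M: sspace M using N(2) by unfold_locales
 interpret lmor N M U S1 u1 h1 using 1 by unfold_locales
 show ?thesis
 proof (rule lderI)
  fix V assume V: "oset N V" "V <= U"
  interpret superalg_hom "sec N V" "sec M (S1 V)" "h1 V" using hh[OF V] .
  have V1: "oset M (S1 V)" "S1 V <= Q" using S_open[OF V] S_mono[OF U_open order_refl V] S by auto
  note D' = lder_closed[OF D V1] lder_add[OF D V1] lder_smult[OF D V1] lder_parity[OF D V1] lder_Leibniz[OF D V1]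
  let ?E = "%V f. D (S1 V) (h1 V f)"
  show "g : Sec N V ==> ?E V g : Sec W (S2 (S1 V))" for g using D'(1) by simp
  show "f : Sec N V ==> g : Sec N V ==>
    ?E V (f +[sec N V] g) = ?E V f +[sec W (S2 (S1 V))] ?E V g" for f g using D'(2) by (simp add: add)
  show "g : Sec N V ==> ?E V (c \<odot>[sec N V] g) = c \<odot>[sec W (S2 (S1 V))] ?E V g" for c g
   using D'(3) by (simp add: smult)
  show "g : Part N V q ==> ?E V g : Part W (S2 (S1 V)) (p \<noteq> q)" for q g using D'(4) parity by simp
  show "f : Part N V q ==> g : Sec N V ==>
    ?E V (f *[sec N V] g) = (?E V f *[sec W (S2 (S1 V))] h2 (S1 V) (h1 V g)) +[sec W (S2 (S1 V))]
     signed (sec W (S2 (S1 V))) (p & q) (h2 (S1 V) (h1 V f) *[sec W (S2 (S1 V))] ?E V g)" for q f g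
   using D'(5) parity by (simp add: mult A.part_closed)
  show "?E V' (rst N V V' g) = rst W (S2 (S1 V)) (S2 (S1 V')) (?E V g)"
   if V': "oset N V'" "V' <= V" and g: "g : Sec N V" for V' g
   using lder_rst[OF D V1 S_open[OF V'(1)] S_mono[OF V V'] closed[OF g]] h_rst[OF V(1) V' V(2) g] V V' by simp
 qed
qed

lemma lder_comp_post:
 assumes N: "superringed_space N" "superringed_space M" "superringed_space W"
  and 1: "shmor N M U S1 u1 h1" and 2: "shmor M W Q S2 u2 h2" and S: "S1 U <= Q" and D: "lder N M U S1 h1 p D"
 shows "lder N W U (%V. S2 (S1 V)) (%V f. h2 (S1 V) (h1 V f)) p (%V f. h2 (S1 V) (D V f))"
proof -
 interpret N: sspace N using N(1) by unfold_locales
 interpret M: sspace M using N(2) by unfold_locales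
 interpret W: sspace W using N(3) by unfold_locales
 interpret lmor N M U S1 u1 h1 using 1 by unfold_locales
 interpret m2: lmor M W Q S2 u2 h2 using 2 by unfold_locales
 show ?thesis
 proof (rule lderI)
  fix V assume V: "oset N V" "V <= U"
  interpret superalg_hom "sec N V" "sec M (S1 V)" "h1 V" using hh[OF V] .
  have V1: "oset M (S1 V)" "S1 V <= Q" using S_open[OF V] S_mono[OF U_open order_refl V] S by auto
  interpret k: superalg_hom "sec M (S1 V)" "sec W (S2 (S1 V))" "h2 (S1 V)" using m2.hh[OF V1] .
  note D' = lder_closed[OF D V] lder_add[OF D V] lder_smult[OF D V] lder_parity[OF D V] lder_Leibniz[OF D V]
  let ?E = "%V f. h2 (S1 V) (D V f)"
  show "g : Sec N V ==> ?E V g : Sec W (S2 (S1 V))" for g using D'(1) by simp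
  show "f : Sec N V ==> g : Sec N V ==>
    ?E V (f +[sec N V] g) = ?E V f +[sec W (S2 (S1 V))] ?E V g" for f g using D'(1,2) by (simp add: k.add)
  show "g : Sec N V ==> ?E V (c \<odot>[sec N V] g) = c \<odot>[sec W (S2 (S1 V))] ?E V g" for c g
   using D'(1,3) by (simp add: k.smult)
  show "g : Part N V q ==> ?E V g : Part W (S2 (S1 V)) (p \<noteq> q)" for q g using D'(4) k.parity by simp
  show "f : Part N V q ==> g : Sec N V ==>
    ?E V (f *[sec N V] g) = (?E V f *[sec W (S2 (S1 V))] h2 (S1 V) (h1 V g)) +[sec W (S2 (S1 V))]
     signed (sec W (S2 (S1 V))) (p & q) (h2 (S1 V) (h1 V f) *[sec W (S2 (S1 V))] ?E V g)" for q f g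
   using D'(1,5) by (simp add: k.mult k.add k.signed A.part_closed)
  show "?E V' (rst N V V' g) = rst W (S2 (S1 V)) (S2 (S1 V')) (?E V g)"
   if V': "oset N V'" "V' <= V" and g: "g : Sec N V" for V' g
   using m2.h_rst[OF V1(1) S_open[OF V'(1)] S_mono[OF V V'] V1(2) D'(1)[OF g]] lder_rst[OF D V V' g] V V' by simp
 qed
qed

lemma shmor_smorphism:
 assumes "smorphism M N \<psi>" "oset N U"
 shows "shmor N M U (preim M \<psi>) (umap \<psi>) (pull \<psi>)"
proof -
 have 1: "oset M (preim M \<psi> V)" if "oset N V" for V
  unfolding preim_def
  by (rule openin_continuous_map_preimage[OF assms(1)[unfolded smorphism_def, THEN conjunct1] that])
 have 2: "preim M \<psi> V = {q : preim M \<psi> U. umap \<psi> q : V}" if "V <= U" for V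
  using that by (auto simp: preim_def)
 have 3: "umap \<psi> q : U" if "q : preim M \<psi> U" for q using that by (simp add: preim_def)
 note 4 = assms(1)[unfolded smorphism_def, THEN conjunct2, THEN conjunct1, rule_format]
 note 5 = assms(1)[unfolded smorphism_def, THEN conjunct2, THEN conjunct2, rule_format, OF conjI[OF _ conjI]]
 show ?thesis by (rule shmorI[OF assms(2) 3 1 2 4 5])
qed

text \<open>The inclusion of the open subset \<open>Q\<close>. Composed with a pull-back it confines
  the target to \<open>Q\<close>, which yields derivations along a morphism from fields defined on
  \<open>Q\<close> only.\<close>

lemma shmor_restrict:
 assumes "superringed_space M" "oset M Q" "oset M U"
 shows "shmor M M U (%V. Q Int V) (%x. x) (%V. rst M V (Q Int V))"
proof -
 interpret sspace M using assms by unfold_locales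
 have 1: "rst M V' (Q Int V') (rst M V V' g) = rst M (Q Int V) (Q Int V') (rst M V (Q Int V) g)"
  if "opn V" "opn V'" "V' <= V" "g : Sec M V" for V V' g
 proof -
  note o = opn_Int[OF assms(2) that(1)] opn_Int[OF assms(2) that(2)]
  have "rst M V' (Q Int V') (rst M V V' g) = rst M V (Q Int V') g"
   by (rule rst_rst) (use that o in auto)
  also have "\<dots> = rst M (Q Int V) (Q Int V') (rst M V (Q Int V) g)"
   by (rule rst_rst[symmetric]) (use that o in auto)
  finally show ?thesis .
 qed
 have 2: "superalgebra_hom (sec M V) (sec M (Q Int V)) (rst M V (Q Int V))" if "opn V" for V
  by (rule rst_hom) (use that opn_Int[OF assms(2) that] in auto)
 show ?thesis
  by (rule shmorI[OF assms(3) _ _ _ 2 1]) (use opn_Int[OF assms(2)] in auto)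
qed

lemma shmor_ident:
 assumes "superringed_space M" "oset M U"
 shows "shmor M M U (%V. V) (%x. x) (%V f. f)"
 using assms unfolding shmor_def by (auto simp: superalgebra_hom_def ring_hom_def)

section \<open>Derivations are determined by their values on coordinates\<close>

definition unit_near :: "('p, 's) superspace => 'p => 'p set => 's => bool" where
 "unit_near M x V f \<longleftrightarrow> (\<exists>V' g. oset M V' & x : V' & V' <= V & g : Sec M V' &
   rst M V V' f *[sec M V'] g = 1[sec M V'])"

text \<open>Every number other than \<open>c\<close> gives a unit near \<open>x\<close>. In this
  form the property passes to pull-backs, because these preserve units; uniqueness of
  \<open>c\<close> is supplied by an evaluation, in \<open>value_is_iff\<close>.\<close>

definition value_is :: "('p, 's) superspace => 'p => 'p set => 's => real => bool" where
 "value_is M x V f c \<longleftrightarrow> (\<forall>r. r \<noteq> c --> unit_near M x V (f -[sec M V] (r \<odot>[sec M V] 1[sec M V])))"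

text \<open>\<open>e V f\<close> collects the coefficients of \<open>f\<close> at \<open>x\<close> in some coordinate system, so that
 \<open>e V f {}\<close> is the value of \<open>f\<close>.\<close>

definition evalat :: "nat => ('p, 's) superspace => 'p => ('p set => 's => nat set => real) => bool" where
 "evalat b M x e \<longleftrightarrow> (\<forall>V. oset M V & x : V -->
   (\<forall>f\<in>Sec M V. \<forall>g\<in>Sec M V.
    e V (f +[sec M V] g) = (%I. e V f I + e V g I) & e V (f *[sec M V] g) = gmul (e V f) (e V g)) &
   (\<forall>c. \<forall>f\<in>Sec M V. e V (c \<odot>[sec M V] f) = (%I. c * e V f I)) &
   e V 1[sec M V] = gone &
   (\<forall>f\<in>Sec M V. e V f {} \<noteq> 0 --> unit_near M x V f) &
   (\<forall>f\<in>Sec M V. \<forall>I. \<not> I <= {..<b} --> e V f I = 0) &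
   (\<forall>V'. oset M V' & x : V' & V' <= V --> (\<forall>f\<in>Sec M V. e V' (rst M V V' f) = e V f)))"

definition evals :: "nat => ('p, 's) superspace => 'p set => ('p => 'p set => 's => nat set => real) => bool" where
 "evals b M U e \<longleftrightarrow> oset M U & (\<forall>x\<in>U. evalat b M x (e x)) &
   (\<forall>V. oset M V & V <= U --> (\<forall>f\<in>Sec M V.
    (\<forall>x\<in>V. \<forall>I. e x V f I = 0) --> f = 0[sec M V]))"

text \<open>What the uniqueness of derivations asks of the target: coefficients at points which,
  near every point, jointly detect whether a section is zero.\<close>

definition has_evals :: "nat => ('p, 's) superspace => bool" where
 "has_evals b M \<longleftrightarrow> (\<forall>x\<in>topspace (spc M). \<exists>U e. x : U & evals b M U e)"

lemma
 assumes e: "evalat b M x e" and V: "oset M V" "x : V"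
 shows evalat_add: "f : Sec M V ==> g : Sec M V ==>
   e V (f +[sec M V] g) I = e V f I + e V g I"
  and evalat_mult: "f : Sec M V ==> g : Sec M V ==>
   e V (f *[sec M V] g) = gmul (e V f) (e V g)"
  and evalat_smult: "f : Sec M V ==> e V (c \<odot>[sec M V] f) I = c * e V f I"
  and evalat_one: "e V 1[sec M V] = gone"
  and evalat_unit: "f : Sec M V ==> e V f {} \<noteq> 0 ==> unit_near M x V f"
  and evalat_outside: "f : Sec M V ==> \<not> I <= {..<b} ==> e V f I = 0"
  and evalat_rst: "oset M V' ==> x : V' ==> V' <= V ==> f : Sec M V ==>
   e V' (rst M V V' f) = e V f"
proof -
 note 1 = e[unfolded evalat_def, rule_format, OF conjI[OF V]]
 show "f : Sec M V ==> g : Sec M V ==> e V (f +[sec M V] g) I = e V f I + e V g I"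
  "f : Sec M V ==> g : Sec M V ==> e V (f *[sec M V] g) = gmul (e V f) (e V g)"
  using 1[THEN conjunct1, rule_format] by simp_all
 show "f : Sec M V ==> e V (c \<odot>[sec M V] f) I = c * e V f I" "e V 1[sec M V] = gone"
  using 1[THEN conjunct2, THEN conjunct1, rule_format] 1[THEN conjunct2, THEN conjunct2, THEN conjunct1] by simp_all
 show "f : Sec M V ==> e V f {} \<noteq> 0 ==> unit_near M x V f"
  using 1[THEN conjunct2, THEN conjunct2, THEN conjunct2, THEN conjunct1] by blast
 show "f : Sec M V ==> \<not> I <= {..<b} ==> e V f I = 0"
  using 1[THEN conjunct2, THEN conjunct2, THEN conjunct2, THEN conjunct2, THEN conjunct1] by blast
 show "oset M V' ==> x : V' ==> V' <= V ==> f : Sec M V ==>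
   e V' (rst M V V' f) = e V f"
  using 1[THEN conjunct2, THEN conjunct2, THEN conjunct2, THEN conjunct2, THEN conjunct2] by blast
qed

lemma gmul_empty: "gmul F G {} = F {} * G {}" by (simp add: gmul_def)

lemma evalat_unit_iff:
 assumes M: "superringed_space M" and e: "evalat b M x e" and V: "oset M V" "x : V"
  and f: "f : Sec M V"
 shows "unit_near M x V f \<longleftrightarrow> e V f {} \<noteq> 0"
proof
 interpret sspace M using M by unfold_locales
 assume "unit_near M x V f"
 then obtain V' g where V': "oset M V'" "x : V'" "V' <= V" "g : Sec M V'"
  "rst M V V' f *[sec M V'] g = 1[sec M V']" unfolding unit_near_def by blast
 have "rst M V V' f : Sec M V'" using V V' f by simp
 then have "gmul (e V f) (e V' g) {} = gone {}"
  using evalat_mult[OF e V'(1,2), of "rst M V V' f" g] V'(4,5) evalat_rst[OF e V V'(1-3) f]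
   evalat_one[OF e V'(1,2)] by simp
 then show "e V f {} \<noteq> 0" by (auto simp: gmul_empty gone_def)
next
 show "e V f {} \<noteq> 0 ==> unit_near M x V f" using evalat_unit[OF e V f] .
qed

lemma evalat_minus_const:
 assumes M: "superringed_space M" and e: "evalat b M x e" and V: "oset M V" "x : V"
  and f: "f : Sec M V"
 shows "e V (f -[sec M V] (r \<odot>[sec M V] 1[sec M V])) I = e V f I - r * gone I"
proof -
 interpret sspace M using M by unfold_locales
 interpret superalg "sec M V" using alg[OF V(1)] .
 have "f -[sec M V] (r \<odot>[sec M V] 1[sec M V]) =
   f +[sec M V] ((-1) \<odot>[sec M V] (r \<odot>[sec M V] 1[sec M V]))"
  by (simp add: a_minus_def smult_uminus)
 then show ?thesis
  using evalat_add[OF e V f] evalat_smult[OF e V] evalat_one[OF e V] by simp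
qed

lemma value_is_iff:
 assumes M: "superringed_space M" and e: "evalat b M x e" and V: "oset M V" "x : V"
  and f: "f : Sec M V"
 shows "value_is M x V f c \<longleftrightarrow> e V f {} = c"
proof -
 interpret sspace M using M by unfold_locales
 interpret superalg "sec M V" using alg[OF V(1)] .
 have "unit_near M x V (f -[sec M V] (r \<odot>[sec M V] 1[sec M V])) \<longleftrightarrow> e V f {} \<noteq> r" for r
  using evalat_unit_iff[OF M e V, of "f -[sec M V] (r \<odot>[sec M V] 1[sec M V])"] f
   evalat_minus_const[OF M e V f, of r "{}"] by (simp add: gone_def)
 then show ?thesis unfolding value_is_def by auto
qed

text \<open>A factor without constant term raises the order of vanishing by one, since a nonempty
  \<open>I\<close> leaves fewer than \<open>n\<close> indices to \<open>G\<close>.\<close>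

lemma gmul_flat:
 assumes a: "F {} = 0" and b: "\<And>I. finite I ==> card I < n ==> G I = 0"
  and K: "finite K" "card K < Suc n"
 shows "gmul F G K = 0"
 unfolding gmul_def
proof (rule sum.neutral, rule ballI)
 fix I assume I: "I : Pow K"
 show "wedge_sign I (K - I) * F I * G (K - I) = 0"
 proof (cases "I = {}")
  case False
  have "card (K - I) < card K"
   using I K(1) False by (intro psubset_card_mono) auto
  then have "G (K - I) = 0" using K by (intro b) auto
  then show ?thesis by simp
 qed (use a in simp)
qed

text \<open>A Hadamard lemma at \<open>p\<close> for the functions \<open>y i\<close>, up to the subsets \<open>K V\<close>.\<close>

definition had :: "('q, 't) superspace => 'q set => nat => (nat => bool) => (nat => 't) => 'q =>
  ('q set => 't set) => bool" where
 "had N U r \<pi> y p K \<longleftrightarrow> (\<exists>t. (\<forall>i<r. value_is N p U (y i) (t i) & (\<pi> i --> t i = 0)) &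
   (\<forall>V f. oset N V & V <= U & p : V & f : Sec N V -->
    (\<exists>V' c g. oset N V' & p : V' & V' <= V & (\<forall>i<r. g i : Sec N V') &
     rst N V V' f -[sec N V'] (c \<odot>[sec N V'] 1[sec N V'] +[sec N V']
      rsum (sec N V') (%i. (rst N U V' (y i) -[sec N V'] (t i \<odot>[sec N V'] 1[sec N V'])) *[sec N V'] g i) r)
     : K V')))"

context lmor begin

lemma unit_near_h:
 assumes V: "oset N V" "V <= U" and q: "q : S V" and f: "f : Sec N V"
  and un: "unit_near N (u q) V f"
 shows "unit_near W q (S V) (h V f)"
proof -
 obtain V' g where V': "oset N V'" "u q : V'" "V' <= V" "g : Sec N V'"
  "rst N V V' f *[sec N V'] g = 1[sec N V']" using un unfolding unit_near_def by blast
 have V'U: "V' <= U" using V V' by auto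
 interpret superalg_hom "sec N V'" "sec W (S V')" "h V'" using hh[OF V'(1) V'U] .
 have "rst N V V' f : Sec N V'" using V V' f by simp
 then have "h V' (rst N V V' f) *[sec W (S V')] h V' g = 1[sec W (S V')]"
  using V'(4,5) mult one by metis
 moreover have "h V' (rst N V V' f) = rst W (S V) (S V') (h V f)" using h_rst[OF V(1) V'(1,3) V(2) f] .
 moreover have "q : S V'" using S_mem[OF V V'(1) V'U q V'(2)] .
 ultimately show ?thesis
  unfolding unit_near_def using S_open[OF V'(1) V'U] S_mono[OF V V'(1,3)] closed[OF V'(4)] by metis
qed

lemma value_is_h:
 assumes V: "oset N V" "V <= U" and q: "q : S V" and f: "f : Sec N V"
  and v: "value_is N (u q) V f c"
 shows "value_is W q (S V) (h V f) c"
 unfolding value_is_def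
proof (intro allI impI)
 fix r assume "r \<noteq> c"
 interpret superalg_hom "sec N V" "sec W (S V)" "h V" using hh[OF V] .
 have "unit_near N (u q) V (f -[sec N V] (r \<odot>[sec N V] 1[sec N V]))"
  using v \<open>r \<noteq> c\<close> unfolding value_is_def by blast
 from unit_near_h[OF V q _ this] f
 show "unit_near W q (S V) (h V f -[sec W (S V)] (r \<odot>[sec W (S V)] 1[sec W (S V)]))"
  by (simp add: minus smult one)
qed

lemma lder_one:
 assumes D: "lder N W U S h p D" and V: "oset N V" "V <= U"
 shows "D V 1[sec N V] = 0[sec W (S V)]"
proof -
 interpret superalg_hom "sec N V" "sec W (S V)" "h V" using hh[OF V] .
 have c: "D V 1[sec N V] : Sec W (S V)" using lder_closed[OF D V] by simp
 have "D V 1[sec N V] = D V 1[sec N V] +[sec W (S V)] D V 1[sec N V]"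
  using lder_Leibniz[OF D V A.one_even A.one_closed] c one by (simp add: signed_def)
 then show ?thesis using c by (metis B.add.r_cancel_one' B.a_closed)
qed

lemma lder_zero_arg:
 assumes D: "lder N W U S h p D" and V: "oset N V" "V <= U"
 shows "D V 0[sec N V] = 0[sec W (S V)]"
proof -
 interpret superalg_hom "sec N V" "sec W (S V)" "h V" using hh[OF V] .
 show ?thesis using lder_smult[OF D V A.zero_closed, of 0] lder_closed[OF D V A.zero_closed] by simp
qed

lemma lder_uminus:
 assumes D: "lder N W U S h p D" and V: "oset N V" "V <= U" and f: "f : Sec N V"
 shows "D V (-[sec N V] f) = -[sec W (S V)] D V f"
proof -
 interpret superalg_hom "sec N V" "sec W (S V)" "h V" using hh[OF V] .
 show ?thesis
  using lder_smult[OF D V f, of "-1"] lder_closed[OF D V f] f by (simp add: A.smult_uminus B.smult_uminus)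
qed

lemma lder_minus_arg:
 assumes D: "lder N W U S h p D" and V: "oset N V" "V <= U"
  and f: "f : Sec N V" and g: "g : Sec N V"
 shows "D V (f -[sec N V] g) = D V f -[sec W (S V)] D V g"
proof -
 interpret superalg_hom "sec N V" "sec W (S V)" "h V" using hh[OF V] .
 show ?thesis
  using lder_add[OF D V f, of "-[sec N V] g"] lder_uminus[OF D V g] g by (simp add: a_minus_def)
qed

lemma lder_rsum_arg:
 assumes D: "lder N W U S h p D" and V: "oset N V" "V <= U"
  and f: "\<And>i. i < k ==> f i : Sec N V"
 shows "D V (rsum (sec N V) f k) = rsum (sec W (S V)) (%i. D V (f i)) k"
proof -
 interpret superalg_hom "sec N V" "sec W (S V)" "h V" using hh[OF V] .
 show ?thesis
  by (rule rsum_additive[of _ _ _ "Sec N V"]) (use lder_zero_arg[OF D V] lder_add[OF D V] f in auto)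
qed

text \<open>Induction on the degree \<open>n\<close> up to which the coefficients of
  \<open>D V f\<close> vanish at \<open>q\<close>. Near \<open>u q\<close> the function
  \<open>f\<close> is a constant plus the sum of the (y_i - t_i) g_i, modulo \<open>K\<close>. As
  \<open>D\<close> kills constants, the \<open>y i\<close> and \<open>K\<close>, what remains of
  \<open>D f\<close> is, up to signs, the sum of the h(y_i - t_i) D(g_i). The first factor has value
  0 at \<open>q\<close> and the second is flat to degree \<open>n\<close> by induction, so
  \<open>gmul_flat\<close> gains one degree.\<close>

lemma lder_flat:
 assumes D: "lder N W U S h p D" and y: "\<And>i. i < r ==> y i : Part N U (\<pi> i)"
  and Dy: "\<And>i. i < r ==> D U (y i) = 0[sec W (S U)]"
  and K: "\<And>V k. oset N V ==> V <= U ==> k : K V ==> k : Sec N V ==> D V k = 0[sec W (S V)]"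
  and H: "had N U r \<pi> y (u q) K" and e: "evalat b W q e"
 shows "oset N V ==> V <= U ==> q : S V ==> f : Sec N V ==> finite I ==> card I < n ==>
  e (S V) (D V f) I = 0"
proof (induction n arbitrary: V f I)
 case (Suc n)
 note V = Suc.prems(1,2) and q = Suc.prems(3) and f = Suc.prems(4)
 obtain t where t': "\<forall>i<r. value_is N (u q) U (y i) (t i) & (\<pi> i --> t i = 0)"
  and ex: "\<forall>V f. oset N V & V <= U & u q : V & f : Sec N V -->
    (\<exists>V' c g. oset N V' & u q : V' & V' <= V & (\<forall>i<r. g i : Sec N V') &
     rst N V V' f -[sec N V'] (c \<odot>[sec N V'] 1[sec N V'] +[sec N V']
      rsum (sec N V') (%i. (rst N U V' (y i) -[sec N V'] (t i \<odot>[sec N V'] 1[sec N V'])) *[sec N V'] g i) r)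
     : K V')"
  using H[unfolded had_def] by (elim exE conjE) (rule that)
 have t: "\<And>i. i < r ==> value_is N (u q) U (y i) (t i)" "\<And>i. i < r ==> \<pi> i ==> t i = 0"
  using t' by auto
 obtain V' c g where V': "oset N V'" "u q : V'" "V' <= V" and g: "\<And>i. i < r ==> g i : Sec N V'"
  and k: "rst N V V' f -[sec N V'] (c \<odot>[sec N V'] 1[sec N V'] +[sec N V']
      rsum (sec N V') (%i. (rst N U V' (y i) -[sec N V'] (t i \<odot>[sec N V'] 1[sec N V'])) *[sec N V'] g i) r)
     : K V'"
  using ex[rule_format, OF conjI[OF V(1) conjI[OF V(2) conjI[OF S_u[OF V q] f]]]]
  by (elim exE conjE) (rule that; simp)
 have V'U: "V' <= U" using V V' by auto
 note VV = V'(1) V'U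
 interpret superalg_hom "sec N V'" "sec W (S V')" "h V'" using hh[OF VV] .
 interpret r: superalg_hom "sec N U" "sec N V'" "rst N U V'" using N.rst[OF U_open VV] .
 have qV': "q : S V'" using S_mem[OF V VV q V'(2)] .
 let ?B = "sec W (S V')" and ?A = "sec N V'"
 define z where "z i = rst N U V' (y i)" for i
 define T where "T i = (z i -[?A] (t i \<odot>[?A] 1[?A])) *[?A] g i" for i
 define f' where "f' = rst N V V' f"
 have f': "f' : carrier ?A" unfolding f'_def using V V' f by simp
 have z: "z i : part ?A (\<pi> i)" if "i < r" for i unfolding z_def using r.parity y that by blast
 have zc: "z i : carrier ?A" if "i < r" for i using z[OF that] by auto
 have Tc: "T i : carrier ?A" if "i < r" for i unfolding T_def using zc g that by simp
 have Dz: "D V' (z i) = 0[?B]" if "i < r" for i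
 proof -
  have "y i : Sec N U" using y[OF that] by (auto simp: r.A.part_closed)
  then have "D V' (z i) = rst W (S U) (S V') (D U (y i))"
   unfolding z_def using lder_rst[OF D U_open order_refl VV] by simp
  also have "\<dots> = 0[?B]"
   using Dy[OF that] superalg_hom.zero[OF W.rst[OF S_open[OF U_open order_refl] S_open[OF VV] S_mono[OF U_open order_refl VV]]]
   by simp
  finally show ?thesis .
 qed
 have sc: "c \<odot>[?A] 1[?A] +[?A] rsum ?A T r : carrier ?A" using Tc by (simp add: A.rsum_closed)
 have "D V' (f' -[?A] (c \<odot>[?A] 1[?A] +[?A] rsum ?A T r)) = 0[?B]"
  by (rule K[OF VV]) (use k f' sc in \<open>simp_all add: f'_def T_def[abs_def] z_def\<close>)
 then have "D V' f' = D V' (c \<odot>[?A] 1[?A] +[?A] rsum ?A T r)"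
  using lder_minus_arg[OF D VV f' sc] lder_closed[OF D VV] f' sc by (simp add: B.minus_eq_zero_iff)
 also have "\<dots> = 0[?B] +[?B] rsum ?B (%i. D V' (T i)) r"
  using Tc lder_one[OF D VV] lder_zero_arg[OF D VV] lder_smult[OF D VV, of "1[?A]" c] lder_smult[OF D VV, of "0[?A]" c]
   lder_rsum_arg[OF D VV Tc]
 proof -
  have "D V' (c \<odot>[?A] 1[?A] +[?A] rsum ?A T r) = D V' (c \<odot>[?A] 1[?A]) +[?B] D V' (rsum ?A T r)"
   by (rule lder_add[OF D VV]) (use Tc in \<open>simp_all add: A.rsum_closed\<close>)
  moreover have "D V' (c \<odot>[?A] 1[?A]) = 0[?B]"
   using lder_smult[OF D VV A.one_closed, of c] lder_one[OF D VV] smult[OF A.zero_closed, of c]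
    lder_smult[OF D VV A.zero_closed, of c] B.smult_mult_right[OF B.zero_closed B.zero_closed, of c] by simp
  ultimately show ?thesis using lder_rsum_arg[OF D VV Tc] by simp
 qed
 finally have Df: "D V' f' = rsum ?B (%i. D V' (T i)) r"
  using lder_closed[OF D VV Tc] by (simp add: B.rsum_closed)
 have flat: "e (S V') (D V' (T i)) I = 0" if i: "i < r" for i
 proof -
  note gi = g[OF i] and zi = z[OF i] zc[OF i]
  have Dg: "D V' (g i) : carrier ?B" using lder_closed[OF D VV gi] .
  have hz: "h V' (z i) : carrier ?B" using zi by simp
  have T: "T i = z i *[?A] g i -[?A] (t i \<odot>[?A] g i)"
   unfolding T_def using zi gi by (simp add: a_minus_def A.l_distr A.l_minus A.smult_mult_left)
  have "D V' (T i) = D V' (z i *[?A] g i) -[?B] (t i \<odot>[?B] D V' (g i))"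
   unfolding T using zi gi lder_minus_arg[OF D VV, of "z i *[?A] g i" "t i \<odot>[?A] g i"] lder_smult[OF D VV gi]
   by simp
  also have "D V' (z i *[?A] g i) = signed ?B (p & \<pi> i) (h V' (z i) *[?B] D V' (g i))"
   using lder_Leibniz[OF D VV zi(1) gi] Dz[OF i] Dg hz gi by (simp add: closed)
  \<comment> \<open>If the sign is present, then \<open>z i\<close> is odd and
    \<open>t i = 0\<close>, so it can be pulled out of the difference as well.\<close>
  also have "signed ?B (p & \<pi> i) (h V' (z i) *[?B] D V' (g i)) -[?B] (t i \<odot>[?B] D V' (g i)) =
    signed ?B (p & \<pi> i) ((h V' (z i) -[?B] (t i \<odot>[?B] 1[?B])) *[?B] D V' (g i))"
   using Dg hz t(2)[OF i]
   by (cases "p & \<pi> i") (auto simp: signed_def a_minus_def B.l_distr B.l_minus B.smult_mult_left)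
  finally have DT: "D V' (T i) = signed ?B (p & \<pi> i) ((h V' (z i) -[?B] (t i \<odot>[?B] 1[?B])) *[?B] D V' (g i))" .
  let ?v = "h V' (z i) -[?B] (t i \<odot>[?B] 1[?B])"
  have SV': "oset W (S V')" using S_open[OF VV] .
  have "y i : Sec N U" using y[OF i] by (auto simp: r.A.part_closed)
  then have "value_is W q (S U) (h U (y i)) (t i)"
   using value_is_h[OF U_open order_refl _ _ t(1)[OF i]] S_mono[OF U_open order_refl VV] qV' by blast
  moreover have hyc: "h U (y i) : Sec W (S U)"
   using superalg_hom.closed[OF hh[OF U_open order_refl] \<open>y i : Sec N U\<close>] .
  ultimately have "e (S U) (h U (y i)) {} = t i"
   using value_is_iff[OF W.srs e S_open[OF U_open order_refl]] S_mono[OF U_open order_refl VV] qV' by blast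
  then have "e (S V') (h V' (z i)) {} = t i"
   using h_rst[OF U_open VV order_refl \<open>y i : Sec N U\<close>] evalat_rst[OF e S_open[OF U_open order_refl] _ SV' qV' _ hyc]
    S_mono[OF U_open order_refl VV] qV' unfolding z_def by auto
  then have v0: "e (S V') ?v {} = 0"
   using evalat_minus_const[OF W.srs e SV' qV' hz] by (simp add: gone_def)
  have "gmul (e (S V') ?v) (e (S V') (D V' (g i))) I = 0"
   by (rule gmul_flat[of _ n]) (use v0 Suc.IH[OF VV qV' gi] Suc.prems(5,6) in auto)
  then have 0: "e (S V') (?v *[?B] D V' (g i)) I = 0"
   using evalat_mult[OF e SV' qV' _ Dg] hz by simp
  have vc: "?v *[?B] D V' (g i) : carrier ?B" using hz Dg by simp
  show ?thesis
   unfolding DT signed_def using 0 evalat_smult[OF e SV' qV' vc, of "-1"] vc by (auto simp: B.smult_uminus)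
 qed
 have "e (S V') (rsum ?B (%i. D V' (T i)) l) I = 0" if "l \<le> r" for l
  using that
 proof (induction l)
  case 0
  show ?case
   using evalat_smult[OF e S_open[OF VV] qV' B.one_closed, of 0 I] B.smult_zero[OF B.one_closed] by simp
 next
  case (Suc l)
  then show ?case
   using evalat_add[OF e S_open[OF VV] qV', of "rsum ?B (%i. D V' (T i)) l" "D V' (T l)"] flat
    lder_closed[OF D VV Tc] by (simp add: B.rsum_closed)
 qed
 then have "e (S V') (D V' f') I = 0" using Df by simp
 moreover have "D V' f' = rst W (S V) (S V') (D V f)"
  unfolding f'_def using lder_rst[OF D V V'(1,3) f] .
 ultimately show ?case
  using evalat_rst[OF e S_open[OF V] q S_open[OF VV] qV' S_mono[OF V V'(1,3)] lder_closed[OF D V f]] by simp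
qed simp

text \<open>Taken beyond the degree of each coefficient, \<open>lder_flat\<close> shows that all
  coefficients of \<open>D V f\<close> vanish at every point of \<open>S V\<close>; infinite index
  sets carry none. Evaluations detect zero near each point.\<close>

lemma lder_eq_zero:
 assumes D: "lder N W U S h p D" and y: "\<And>i. i < r ==> y i : Part N U (\<pi> i)"
  and Dy: "\<And>i. i < r ==> D U (y i) = 0[sec W (S U)]"
  and K: "\<And>V k. oset N V ==> V <= U ==> k : K V ==> k : Sec N V ==> D V k = 0[sec W (S V)]"
  and H: "\<And>q. q : S U ==> had N U r \<pi> y (u q) K" and ev: "has_evals b W"
  and V: "oset N V" "V <= U" and f: "f : Sec N V"
 shows "D V f = 0[sec W (S V)]"
proof (rule W.sec_eqI[OF S_open[OF V] lder_closed[OF D V f]])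
 interpret B: superalg "sec W (S V)" using W.alg[OF S_open[OF V]] .
 show "0[sec W (S V)] : Sec W (S V)" by simp
 fix x assume x: "x : S V"
 then have "x : topspace (spc W)" using S_open[OF V] openin_subset by blast
 then obtain U0 e where e: "x : U0" "evals b W U0 e" using ev unfolding has_evals_def by blast
 then have U0: "oset W U0" "\<And>q. q : U0 ==> evalat b W q (e q)"
  and inj: "\<And>V f. oset W V ==> V <= U0 ==> f : Sec W V ==>
    (\<And>x I. x : V ==> e x V f I = 0) ==> f = 0[sec W V]"
  unfolding evals_def by blast+
 let ?O = "S V Int U0"
 have O: "oset W ?O" "?O <= S V" using S_open[OF V] U0(1) by auto
 have "rst W (S V) ?O (D V f) = 0[sec W ?O]"
 proof (rule inj)
  fix q I assume q: "q : ?O"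
  then have qU: "q : S U" "q : U0" "q : S V" using S_mono[OF U_open order_refl V] by auto
  have "e q ?O (rst W (S V) ?O (D V f)) I = e q (S V) (D V f) I"
   using evalat_rst[OF U0(2)[OF qU(2)] S_open[OF V] qU(3) O(1) q O(2) lder_closed[OF D V f]] by simp
  also have "\<dots> = 0"
  proof (cases "finite I")
   case True
   show ?thesis
    by (rule lder_flat[where K = K and n = "Suc (card I)", OF D y Dy K H[OF qU(1)] U0(2)[OF qU(2)] V qU(3) f True]) auto
  next
   case False
   then show ?thesis
    using evalat_outside[OF U0(2)[OF qU(2)] S_open[OF V] qU(3) lder_closed[OF D V f], of I]
     finite_subset[of I "{..<b}"] by blast
  qed
  finally show "e q ?O (rst W (S V) ?O (D V f)) I = 0" .
 qed (use O lder_closed[OF D V f] S_open[OF V] in auto)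
 moreover have "rst W (S V) ?O 0[sec W (S V)] = 0[sec W ?O]"
  using superalg_hom.zero[OF W.rst[OF S_open[OF V] O]] .
 ultimately show "\<exists>V'. oset W V' & x : V' & V' <= S V &
   rst W (S V) V' (D V f) = rst W (S V) V' 0[sec W (S V)]"
  using O e x by (metis IntI)
qed

lemma lder_eq:
 assumes D: "lder N W U S h p D" and E: "lder N W U S h p E"
  and y: "\<And>i. i < r ==> y i : Part N U (\<pi> i)"
  and Dy: "\<And>i. i < r ==> D U (y i) = E U (y i)"
  and K: "\<And>V k. oset N V ==> V <= U ==> k : K V ==> k : Sec N V ==> D V k = E V k"
  and H: "\<And>q. q : S U ==> had N U r \<pi> y (u q) K" and ev: "has_evals b W"
  and V: "oset N V" "V <= U" and f: "f : Sec N V"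
 shows "D V f = E V f"
proof -
 have "D V f -[sec W (S V)] E V f = 0[sec W (S V)]"
 proof (rule lder_eq_zero[OF lder_minus[OF D E] y _ _ H ev V f])
  show "D U (y i) -[sec W (S U)] E U (y i) = 0[sec W (S U)]" if i: "i < r" for i
  proof -
   interpret superalg_hom "sec N U" "sec W (S U)" "h U" using hh[OF U_open order_refl] .
   show ?thesis using Dy[OF i] lder_closed[OF E U_open order_refl A.part_closed[OF y[OF i]]] by simp
  qed
  show "D V k -[sec W (S V)] E V k = 0[sec W (S V)]"
   if "oset N V" "V <= U" "k : K V" "k : Sec N V" for V k
  proof -
   interpret superalg_hom "sec N V" "sec W (S V)" "h V" using hh[OF that(1,2)] .
   show ?thesis using K[OF that] lder_closed[OF E that(1,2,4)] by simp
  qed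
 qed
 moreover interpret superalg_hom "sec N V" "sec W (S V)" "h V" using hh[OF V] .
 show ?thesis using calculation lder_closed[OF D V f] lder_closed[OF E V f] by (simp add: B.minus_eq_zero_iff)
qed

end

abbreviation (input) vder where "vder M U \<equiv> lder M M U (%V. V) (%V f. f)"

text \<open>What is used of a coordinate system. The fields \<open>e i\<close> act on all open
  subsets without normalization, and the Hadamard lemma with remainder 0 is part of the notion, so
  that later arguments do not return to charts.\<close>

definition good_coords :: "nat => nat => ('q, 't) superspace => 'q set => (nat => 't) =>
  (nat => ('q, 't, 't) sder) => bool" where
 "good_coords a b N U y e \<longleftrightarrow> oset N U &
   (\<forall>i<a + b. y i : Part N U (a \<le> i) & lder N N U (%V. V) (%V f. f) (a \<le> i) (e i) &
    (\<forall>j<a + b. e i U (y j) = (if i = j then 1[sec N U] else 0[sec N U]))) &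
   (\<forall>p\<in>U. had N U (a + b) (%i. a \<le> i) y p (%V. {0[sec N V]}))"

text \<open>Derivations that need not be homogeneous. The splitting is required only on the domain,
  so the notion is insensitive to the values of \<open>D\<close> elsewhere.\<close>

definition gder :: "('q, 't) superspace => ('p, 's) superspace => 'q set => ('q set => 'p set) =>
  ('q set => 't => 's) => ('q, 't, 's) sder => bool" where
 "gder N W U S h D \<longleftrightarrow> (\<exists>D0 D1. lder N W U S h False D0 & lder N W U S h True D1 &
   (\<forall>V f. oset N V & V <= U & f : Sec N V --> D V f = D0 V f +[sec W (S V)] D1 V f))"

abbreviation (input) gvder where "gvder M U \<equiv> gder M M U (%V. V) (%V f. f)"

context lmor begin

text \<open>The right-hand side is again a derivation of parity \<open>p\<close> along
  \<open>h\<close>, and by the duality of \<open>e\<close> and \<open>y\<close> it has the values of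
  \<open>D\<close> on the coordinates; now \<open>lder_eq\<close> applies.\<close>

lemma lder_expand:
 assumes G: "good_coords a b N U y e" and D: "lder N W U S h p D" and ev: "has_evals b' W"
  and V: "oset N V" "V <= U" and f: "f : Sec N V"
 shows "D V f = rsum (sec W (S V)) (%i. rst W (S U) (S V) (D U (y i)) *[sec W (S V)] h V (e i V f)) (a + b)"
proof (rule lder_eq[OF D _ _ _ _ _ ev V f])
 note G' = G[unfolded good_coords_def, THEN conjunct2, THEN conjunct1, rule_format]
 have y: "y i : Part N U (a \<le> i)" and e: "lder N N U (%V. V) (%V f. f) (a \<le> i) (e i)"
  and ey: "\<And>j. j < a + b ==> e i U (y j) = (if i = j then 1[sec N U] else 0[sec N U])" if "i < a + b" for i
  using G'[OF that] by blast+
 have "lder N W U S h p (%V g. rst W (S U) (S V) (D U (y i)) *[sec W (S V)] h V (e i V g))" if i: "i < a + b" for i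
 proof -
  have "lder N W U S h (a \<le> i) (%V f. h V (e i V f))"
   using lder_comp_post[OF N.srs N.srs W.srs shmor_ident[OF N.srs U_open] sh order_refl e[OF i]] .
  from lder_scale[OF this lder_parity[OF D U_open order_refl y[OF i]]]
  show ?thesis by (cases p; cases "a \<le> i") simp_all
 qed
 then show "lder N W U S h p (%V f. rsum (sec W (S V)) (%i. rst W (S U) (S V) (D U (y i)) *[sec W (S V)] h V (e i V f)) (a + b))"
  by (rule lder_rsum)
 show "y i : Part N U (a \<le> i)" if "i < a + b" for i using y[OF that] .
 show "had N U (a + b) (%i. a \<le> i) y (u q) (%V. {0[sec N V]})" if "q : S U" for q
  using G u_in[OF that] unfolding good_coords_def by blast
 interpret superalg_hom "sec N U" "sec W (S U)" "h U" using hh[OF U_open order_refl] .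
 have Dc: "D U (y i) : Sec W (S U)" if "i < a + b" for i
  using lder_closed[OF D U_open order_refl A.part_closed[OF y[OF that]]] .
 show "D U (y j) = rsum (sec W (S U)) (%i. rst W (S U) (S U) (D U (y i)) *[sec W (S U)] h U (e i U (y j))) (a + b)"
  if j: "j < a + b" for j
 proof -
  have "rsum (sec W (S U)) (%i. rst W (S U) (S U) (D U (y i)) *[sec W (S U)] h U (e i U (y j))) (a + b) =
   rsum (sec W (S U)) (%i. if i = j then D U (y j) else 0[sec W (S U)]) (a + b)"
   using Dc j ey W.rst_id[OF S_open[OF U_open order_refl] Dc] by (intro rsum_cong) (auto simp: one zero)
  also have "\<dots> = D U (y j)" using B.rsum_single[OF j] Dc[OF j] by simp
  finally show ?thesis by simp
 qed
 fix V k assume V: "oset N V" "V <= U" and k: "k : {0[sec N V]}"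
 interpret v: superalg_hom "sec N V" "sec W (S V)" "h V" using hh[OF V] .
 have "h V (e i V 0[sec N V]) = 0[sec W (S V)]" if i: "i < a + b" for i
  using lder_zero_arg[OF lder_comp_post[OF N.srs N.srs W.srs shmor_ident[OF N.srs U_open] sh order_refl e[OF i]] V] .
 then have "rsum (sec W (S V)) (%i. rst W (S U) (S V) (D U (y i)) *[sec W (S V)] h V (e i V k)) (a + b) = 0[sec W (S V)]"
  using k Dc W.rst_closed[OF S_open[OF U_open order_refl] S_open[OF V] S_mono[OF U_open order_refl V]]
  by (intro v.B.rsum_zero) simp
 then show "D V k = rsum (sec W (S V)) (%i. rst W (S U) (S V) (D U (y i)) *[sec W (S V)] h V (e i V k)) (a + b)"
  using k lder_zero_arg[OF D V] by simp
qed

text \<open>The expansion is additive in \<open>D\<close>, so it passes from the homogeneous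
  components to their sum.\<close>

lemma gder_expand:
 assumes G: "good_coords a b N U y e" and D: "gder N W U S h D" and ev: "has_evals b' W"
  and V: "oset N V" "V <= U" and f: "f : Sec N V"
 shows "D V f = rsum (sec W (S V)) (%i. rst W (S U) (S V) (D U (y i)) *[sec W (S V)] h V (e i V f)) (a + b)"
proof -
 obtain D0 D1 where D01: "lder N W U S h False D0" "lder N W U S h True D1"
  and eq: "\<And>V f. oset N V ==> V <= U ==> f : Sec N V ==> D V f = D0 V f +[sec W (S V)] D1 V f"
  using D unfolding gder_def by blast
 note G' = G[unfolded good_coords_def, THEN conjunct2, THEN conjunct1, rule_format]
 interpret superalg_hom "sec N V" "sec W (S V)" "h V" using hh[OF V] .
 interpret r: superalg_hom "sec W (S U)" "sec W (S V)" "rst W (S U) (S V)"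
  by (rule W.rst[OF S_open[OF U_open order_refl] S_open[OF V] S_mono[OF U_open order_refl V]])
 have y: "y i : Sec N U" and e: "h V (e i V f) : Sec W (S V)" if "i < a + b" for i
 proof -
  show "y i : Sec N U" using G'[OF that] superalg.part_closed[OF N.alg[OF U_open]] by blast
  show "h V (e i V f) : Sec W (S V)" using G'[OF that] lder_closed[OF _ V f] by blast
 qed
 have c: "D0 U (y i) : Sec W (S U)" "D1 U (y i) : Sec W (S U)" if "i < a + b" for i
  using lder_closed[OF D01(1) U_open order_refl y[OF that]] lder_closed[OF D01(2) U_open order_refl y[OF that]] by auto
 have "D V f = D0 V f +[sec W (S V)] D1 V f" using eq[OF V f] .
 also have "\<dots> = rsum (sec W (S V)) (%i. rst W (S U) (S V) (D0 U (y i)) *[sec W (S V)] h V (e i V f) +[sec W (S V)]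
   rst W (S U) (S V) (D1 U (y i)) *[sec W (S V)] h V (e i V f)) (a + b)"
  unfolding lder_expand[OF G D01(1) ev V f] lder_expand[OF G D01(2) ev V f]
  by (rule B.rsum_add) (use c e in auto)
 also have "\<dots> = rsum (sec W (S V)) (%i. rst W (S U) (S V) (D U (y i)) *[sec W (S V)] h V (e i V f)) (a + b)"
  by (rule rsum_cong) (use c e eq[OF U_open order_refl y] in \<open>simp add: r.add B.l_distr\<close>)
 finally show ?thesis .
qed

end

section \<open>Partial derivatives of superfunctions\<close>

text \<open>The left derivative with respect to the \<open>k\<close>-th odd coordinate. The sign
  moves this coordinate to the front of the monomial, where it is struck out.\<close>

definition odd_partial :: "nat => (nat set => real) => nat set => real" where
 "odd_partial k F I = (if k : I then 0 else wedge_sign {k} I * F (insert k I))"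

lemma sum_Pow_insert:
 assumes "finite K" "k \<notin> K"
 shows "(\<Sum>I\<in>Pow (insert k K). f I) = (\<Sum>J\<in>Pow K. f J + f (insert k J))"
proof -
 have "inj_on (insert k) (Pow K)" using assms(2) by (auto simp: inj_on_def)
 moreover have "Pow K Int insert k ` Pow K = {}" using assms(2) by auto
 ultimately show ?thesis
  using assms(1) by (simp add: Pow_insert sum.union_disjoint sum.reindex sum.distrib)
qed

text \<open>If \<open>k\<close> is not in \<open>K\<close>, the coefficient in question is that of
  \<open>insert k K\<close> in the product, and the two terms on the right correspond to
  \<open>k\<close> going to the left or to the right factor. If \<open>k\<close> is in
  \<open>K\<close>, the left side is 0 and the terms on the right cancel in pairs. The parity of
  \<open>F\<close> enters only through \<open>s\<close>, the sign for moving the derivation past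
  \<open>F\<close>.\<close>

lemma odd_partial_Leibniz:
 assumes F: "\<And>I. odd (card I) \<noteq> q ==> F I = 0" and K: "finite K"
 shows "odd_partial k (gmul F G) K =
  gmul (odd_partial k F) G K + (if q then - 1 else 1) * gmul F (odd_partial k G) K"
proof -
 define s where "s = (if q then - 1 else (1::real))"
 have s: "s * F I = (-1) ^ card I * F I" for I using F[of I] by (cases "odd (card I) = q") (auto simp: s_def)
 show ?thesis
 proof (cases "k : K")
  case False
  have "odd_partial k (gmul F G) K = (\<Sum>J\<in>Pow K.
    wedge_sign {k} K * (wedge_sign J (insert k K - J) * F J * G (insert k K - J)) +
    wedge_sign {k} K * (wedge_sign (insert k J) (insert k K - insert k J) * F (insert k J) * G (insert k K - insert k J)))"
   by (simp only: odd_partial_def gmul_def False if_False sum_distrib_left sum_Pow_insert[OF K False] distrib_left)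
  also have "\<dots> = (\<Sum>J\<in>Pow K. wedge_sign J (K - J) * odd_partial k F J * G (K - J) +
    s * (wedge_sign J (K - J) * F J * odd_partial k G (K - J)))"
  proof (rule sum.cong[OF refl])
   fix J assume J: "J : Pow K"
   define L where "L = K - J"
   have fin: "finite J" "finite L" "finite {k}" using J K finite_subset unfolding L_def by auto
   have d: "J Int L = {}" "{k} Int L = {}" "{k} Int J = {}" "K = J \<union> L" and k: "k \<notin> J" "k \<notin> L"
    using J False by (auto simp: L_def)
   have e: "insert k K - J = {k} \<union> L" "insert k K - insert k J = L" "insert k J = {k} \<union> J"
    using J False by (auto simp: L_def)
   have w1: "wedge_sign {k} K = wedge_sign {k} J * wedge_sign {k} L"
    unfolding d(4) using wedge_sign_Un_right[OF fin d(1)] .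
   have w2: "wedge_sign J ({k} \<union> L) = wedge_sign J {k} * wedge_sign J L"
    using wedge_sign_Un_right[OF fin(3,2,1) d(2)] .
   have w3: "wedge_sign ({k} \<union> J) L = wedge_sign {k} L * wedge_sign J L"
    using wedge_sign_Un_left[OF fin(3,1,2) d(3)] .
   have w4: "wedge_sign {k} J = (-1) ^ card J * wedge_sign J {k}"
    using wedge_sign_swap[OF fin(3,1) d(3)] by simp
   have sq: "wedge_sign J {k} * (wedge_sign J {k} * x) = x" "wedge_sign {k} L * (wedge_sign {k} L * x) = x" for x
    using wedge_sign_square by (simp_all flip: mult.assoc)
   have t1: "wedge_sign {k} K * (wedge_sign J ({k} \<union> L) * F J * G ({k} \<union> L)) =
     (s * F J) * (wedge_sign J L * wedge_sign {k} L * G ({k} \<union> L))"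
    unfolding w1 w2 w4 s using sq by (simp add: mult_ac)
   have t2: "wedge_sign {k} K * (wedge_sign ({k} \<union> J) L * F ({k} \<union> J) * G L) =
     wedge_sign J L * (wedge_sign {k} J * F ({k} \<union> J)) * G L"
    unfolding w1 w3 using sq by (simp add: mult_ac)
   show "wedge_sign {k} K * (wedge_sign J (insert k K - J) * F J * G (insert k K - J)) +
    wedge_sign {k} K * (wedge_sign (insert k J) (insert k K - insert k J) * F (insert k J) * G (insert k K - insert k J)) =
    wedge_sign J (K - J) * odd_partial k F J * G (K - J) +
    s * (wedge_sign J (K - J) * F J * odd_partial k G (K - J))"
   proof -
    have e': "K - J = L" "insert k L = {k} \<union> L" by (auto simp: L_def)
    show ?thesis
     unfolding e(1,2) e'(1) odd_partial_def
     by (simp only: k if_False e(3) e'(2) t1 t2) (simp add: mult_ac)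
   qed
  qed
  also have "\<dots> = gmul (odd_partial k F) G K + s * gmul F (odd_partial k G) K"
   by (simp add: gmul_def sum.distrib sum_distrib_left)
  finally show ?thesis by (simp add: s_def)
 next
  case True
  define K0 where "K0 = K - {k}"
  have K0: "K = insert k K0" "k \<notin> K0" "finite K0" using True K by (auto simp: K0_def)
  have "gmul (odd_partial k F) G K + s * gmul F (odd_partial k G) K =
   (\<Sum>I\<in>Pow K. wedge_sign I (K - I) * odd_partial k F I * G (K - I) +
    s * (wedge_sign I (K - I) * F I * odd_partial k G (K - I)))"
   by (simp add: gmul_def sum.distrib sum_distrib_left)
  also have "\<dots> = (\<Sum>J\<in>Pow K0. 0)"
   unfolding K0(1) sum_Pow_insert[OF K0(3,2)]
  proof (rule sum.cong[OF refl])
   fix J assume J: "J : Pow K0"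
   define L where "L = K0 - J"
   have fin: "finite J" "finite L" "finite {k}" using J K0(3) finite_subset unfolding L_def by auto
   have d: "{k} Int L = {}" "{k} Int J = {}" and k: "k \<notin> J" "k \<notin> L" using J K0(2) by (auto simp: L_def)
   have e: "insert k K0 - J = {k} \<union> L" "insert k K0 - insert k J = L" "insert k J = {k} \<union> J" "insert k L = {k} \<union> L"
    using J K0(2) by (auto simp: L_def)
   have w2: "wedge_sign J ({k} \<union> L) = wedge_sign J {k} * wedge_sign J L"
    using wedge_sign_Un_right[OF fin(3,2,1) d(1)] .
   have w3: "wedge_sign ({k} \<union> J) L = wedge_sign {k} L * wedge_sign J L"
    using wedge_sign_Un_left[OF fin(3,1,2) d(2)] .
   have w4: "wedge_sign {k} J = (-1) ^ card J * wedge_sign J {k}"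
    using wedge_sign_swap[OF fin(3,1) d(2)] by simp
   have sq: "wedge_sign J {k} * (wedge_sign J {k} * x) = x" "wedge_sign {k} L * (wedge_sign {k} L * x) = x" for x
    using wedge_sign_square by (simp_all flip: mult.assoc)
   have c: "card ({k} \<union> J) = Suc (card J)" using k fin by simp
   have "s * (wedge_sign ({k} \<union> J) L * F ({k} \<union> J) * (wedge_sign {k} L * G ({k} \<union> L))) =
     (s * F ({k} \<union> J)) * (wedge_sign J L * G ({k} \<union> L))"
    unfolding w3 using sq by (simp add: mult_ac)
   also have "\<dots> = - (wedge_sign J ({k} \<union> L) * (wedge_sign {k} J * F ({k} \<union> J)) * G ({k} \<union> L))"
    unfolding s w2 w4 c using sq by (simp add: mult_ac)
   finally have t: "s * (wedge_sign ({k} \<union> J) L * F ({k} \<union> J) * (wedge_sign {k} L * G ({k} \<union> L))) =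
    - (wedge_sign J ({k} \<union> L) * (wedge_sign {k} J * F ({k} \<union> J)) * G ({k} \<union> L))" .
   have kk: "k : {k} \<union> L" "k : {k} \<union> J" by auto
   show "wedge_sign J (insert k K0 - J) * odd_partial k F J * G (insert k K0 - J) +
    s * (wedge_sign J (insert k K0 - J) * F J * odd_partial k G (insert k K0 - J)) +
    (wedge_sign (insert k J) (insert k K0 - insert k J) * odd_partial k F (insert k J) * G (insert k K0 - insert k J) +
    s * (wedge_sign (insert k J) (insert k K0 - insert k J) * F (insert k J) * odd_partial k G (insert k K0 - insert k J))) = 0"
    unfolding e(1,2) odd_partial_def by (simp only: k kk if_True if_False e(3,4) t)
  qed
  finally show ?thesis using True by (simp add: s_def odd_partial_def)
 qed
qed

text \<open>The even derivatives are cut off outside \<open>U\<close>, as membership in the carrier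
  requires; the odd ones vanish there because the coefficients do.\<close>

definition sf_partial :: "nat => (nat => real) set => nat => (nat set => (nat => real) => real) =>
  nat set => (nat => real) => real" where
 "sf_partial a U i f = (%I x. if i < a then (if x : U then partial_deriv i (f I) x else 0)
   else odd_partial (i - a) (%I. f I x) I)"

lemma partial_deriv_cong:
 assumes U: "openin (Euclidean_space a) U" "x : U" "i < a" and eq: "\<And>y. y : U ==> f y = g y"
 shows "partial_deriv i f x = partial_deriv i g x"
 unfolding partial_deriv_def
 by (rule deriv_cong_ev) (use eventually_upd_in[OF U] eq in \<open>auto elim!: eventually_mono\<close>)

lemma sf_smooth:
 assumes U: "openin (Euclidean_space a) U" and f: "f : carrier (superfunctions a b U)"
 shows "smooth_on a U (f I)"
proof (cases "I <= {..<b}")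
 case False
 then have "f I x = 0" for x using f by (simp add: sf_carrier)
 then have "f I = (%x. 0)" by (rule ext)
 then show ?thesis using smooth_on_const[OF U] by simp
qed (use f in \<open>simp add: sf_carrier\<close>)

lemma sf_outside: "f : carrier (superfunctions a b U) ==> \<not> (I <= {..<b} & x : U) ==> f I x = 0"
 by (simp add: sf_carrier)

lemma has_partial_sum:
 "(\<And>j. j : J ==> has_partial i U (F j) (F' j)) ==> has_partial i U (%x. \<Sum>j\<in>J. F j x) (%x. \<Sum>j\<in>J. F' j x)"
 unfolding has_partial_def by (auto intro!: DERIV_sum)

lemma sf_partial_even_Leibniz:
 assumes U: "openin (Euclidean_space a) U" and i: "i < a"
  and f: "f : carrier (superfunctions a b U)" and g: "g : carrier (superfunctions a b U)" and x: "x : U"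
 shows "partial_deriv i (%x. gmul (%I. f I x) (%I. g I x) K) x =
  gmul (%I. partial_deriv i (f I) x) (%I. g I x) K + gmul (%I. f I x) (%I. partial_deriv i (g I) x) K"
proof -
 have "has_partial i U (%x. wedge_sign I J * f I x * g J x)
   (%x. wedge_sign I J * partial_deriv i (f I) x * g J x + wedge_sign I J * f I x * partial_deriv i (g J) x)" for I J
 proof -
  have "has_partial i U (%x. wedge_sign I J * f I x) (%x. 0 * f I x + wedge_sign I J * partial_deriv i (f I) x)"
   by (rule has_partial_mult[OF _ smooth_on_has_partial[OF U sf_smooth[OF U f] i]]) (simp add: has_partial_def)
  then show ?thesis
   using has_partial_mult[OF _ smooth_on_has_partial[OF U sf_smooth[OF U g] i]] by simp
 qed
 then have "has_partial i U (%x. gmul (%I. f I x) (%I. g I x) K)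
   (%x. \<Sum>I\<in>Pow K. wedge_sign I (K - I) * partial_deriv i (f I) x * g (K - I) x +
    wedge_sign I (K - I) * f I x * partial_deriv i (g (K - I)) x)"
  unfolding gmul_def by (rule has_partial_sum)
 from has_partial_eq[OF this x] show ?thesis by (simp add: gmul_def sum.distrib)
qed

lemma lder_sf_partial:
 assumes U: "openin (Euclidean_space a) U" and i: "i < a + b"
 shows "lder (super_euclidean a b) (super_euclidean a b) U (%V. V) (%V f. f) (a \<le> i) (%V. sf_partial a V i)"
proof (rule lderI; unfold se_simps)
 fix V assume V: "openin (Euclidean_space a) V"
 let ?A = "superfunctions a b V"
 have closed: "sf_partial a V i f : carrier ?A" if f: "f : carrier ?A" for f
  unfolding sf_carrier
 proof (intro conjI allI impI)
  fix I :: "nat set" assume "I <= {..<b}"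
  show "smooth_on a V (sf_partial a V i f I)"
  proof (cases "i < a")
   case True
   show ?thesis
    by (rule smooth_on_cong[OF V, THEN iffD1, OF _ smooth_on_partial[OF V sf_smooth[OF V f] True]])
     (simp add: sf_partial_def True)
  next
   case False
   have "smooth_on a V (%x. wedge_sign {i - a} I * f (insert (i - a) I) x)"
    by (intro smooth_on_mult[OF V] smooth_on_const[OF V] sf_smooth[OF V f])
   then show ?thesis using False smooth_on_const[OF V, of 0]
    by (cases "i - a : I") (simp_all add: sf_partial_def odd_partial_def)
  qed
 next
  fix I x assume "\<not> (I <= {..<b} & x : V)"
  moreover have "f I = (%x. 0)" if "\<not> I <= {..<b}"
   by (rule ext) (rule sf_outside[OF f], use that in blast)
  ultimately have "f I x = 0" "x : V ==> f I = (%x. 0)" "f (insert (i - a) I) x = 0"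
   using sf_outside[OF f, of I x] sf_outside[OF f, of "insert (i - a) I" x] by blast+
  then show "sf_partial a V i f I x = 0" by (auto simp: sf_partial_def odd_partial_def partial_deriv_def)
 qed
 show "sf_partial a V i f : carrier ?A" if "f : carrier ?A" for f using closed[OF that] .
 show "sf_partial a V i (f +[?A] g) = sf_partial a V i f +[?A] sf_partial a V i g"
  if f: "f : carrier ?A" and g: "g : carrier ?A" for f g
 proof (intro ext)
  fix I x
  show "sf_partial a V i (f +[?A] g) I x = (sf_partial a V i f +[?A] sf_partial a V i g) I x"
  proof (cases "i < a & x : V")
   case True
   then have "((%t. f I (x(i := t))) has_real_derivative partial_deriv i (f I) x) (at (x i))"
    "((%t. g I (x(i := t))) has_real_derivative partial_deriv i (g I) x) (at (x i))"
    using smooth_on_has_partial[OF V sf_smooth[OF V f]] smooth_on_has_partial[OF V sf_smooth[OF V g]]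
    unfolding has_partial_def by blast+
   from DERIV_imp_deriv[OF DERIV_add[OF this]] show ?thesis
    using True by (simp add: sf_partial_def sf_simps partial_deriv_def)
  qed (auto simp: sf_partial_def sf_simps odd_partial_def distrib_left)
 qed
 show "sf_partial a V i (c \<odot>[?A] f) = c \<odot>[?A] sf_partial a V i f" if f: "f : carrier ?A" for c f
 proof (intro ext)
  fix I x
  show "sf_partial a V i (c \<odot>[?A] f) I x = (c \<odot>[?A] sf_partial a V i f) I x"
  proof (cases "i < a & x : V")
   case True
   then have "((%t. f I (x(i := t))) has_real_derivative partial_deriv i (f I) x) (at (x i))"
    using smooth_on_has_partial[OF V sf_smooth[OF V f]] unfolding has_partial_def by blast
   from DERIV_imp_deriv[OF DERIV_cmult[OF this, of c]] show ?thesis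
    using True by (simp add: sf_partial_def sf_simps partial_deriv_def)
  qed (auto simp: sf_partial_def sf_simps odd_partial_def)
 qed
 show "sf_partial a V i f : part ?A ((a \<le> i) \<noteq> q)" if f: "f : part ?A q" for q f
  unfolding sf_part
 proof (intro conjI allI impI)
  show "sf_partial a V i f : carrier ?A" using f closed by (simp add: sf_part)
  fix I :: "nat set" and x assume I: "odd (card I) \<noteq> ((a \<le> i) \<noteq> q)"
  have z: "f J y = 0" if "odd (card J) \<noteq> q" for J y using f that by (simp add: sf_part)
  show "sf_partial a V i f I x = 0"
  proof (cases "i < a")
   case True
   then have "f I = (%x. 0)" using z[of I] I by auto
   then show ?thesis using True by (simp add: sf_partial_def partial_deriv_def)
  next
   case False
   show ?thesis
   proof (cases "finite I")
    case True
    then show ?thesis using z[of "insert (i - a) I" x] I False by (auto simp: sf_partial_def odd_partial_def)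
   next
    case inf: False
    then have "\<not> insert (i - a) I <= {..<b}" using finite_subset[of "insert (i - a) I" "{..<b}"] by auto
    then have "f (insert (i - a) I) x = 0"
     by (intro sf_outside[OF f[unfolded sf_part, THEN conjunct1]]) blast
    then show ?thesis using False by (simp add: sf_partial_def odd_partial_def)
   qed
  qed
 qed
 show "sf_partial a V i (f *[?A] g) = (sf_partial a V i f *[?A] g) +[?A]
    signed ?A ((a \<le> i) & q) (f *[?A] sf_partial a V i g)"
  if f: "f : part ?A q" and g: "g : carrier ?A" for q f g
 proof -
  have fc: "f : carrier ?A" using f by (simp add: sf_part)
  have "f *[?A] sf_partial a V i g : carrier ?A" using sf_mult_closed[OF V fc closed[OF g]] .
  then have sg: "signed ?A s (f *[?A] sf_partial a V i g) =
    (%K x. (if s then -1 else 1) * gmul (%I. f I x) (%I. sf_partial a V i g I x) K)" for s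
   by (cases s) (simp_all add: signed_def sf_a_inv[OF V], simp_all add: sf_simps)
  show ?thesis
  proof (intro ext)
   fix K x
   show "sf_partial a V i (f *[?A] g) K x = ((sf_partial a V i f *[?A] g) +[?A]
    signed ?A ((a \<le> i) & q) (f *[?A] sf_partial a V i g)) K x"
   proof (cases "i < a")
    case True
    show ?thesis
    proof (cases "x : V")
     case xV: True
     then show ?thesis
      using True sf_partial_even_Leibniz[OF V True fc g xV, of K]
      unfolding sg by (simp add: sf_simps sf_partial_def)
    next
     case False
     then show ?thesis using True unfolding sg by (simp add: sf_simps sf_partial_def gmul_def)
    qed
   next
    case odd: False
    have e: "(%I. sf_partial a V i f I x) = odd_partial (i - a) (%I. f I x)" for f
     using odd by (auto simp: sf_partial_def)
    show ?thesis
    proof (cases "finite K")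
     case True
     show ?thesis
      using odd_partial_Leibniz[where F = "%I. f I x" and G = "%I. g I x" and q = q and k = "i - a", OF _ True] f odd
      unfolding sg unfolding sf_simps e by (simp add: sf_part sf_partial_def)
    next
     case False
     then show ?thesis using odd unfolding sg by (simp add: sf_simps sf_partial_def gmul_def odd_partial_def)
    qed
   qed
  qed
 qed
 show "sf_partial a V' i (%I x. if x : V' then f I x else 0) = (%I x. if x : V' then sf_partial a V i f I x else 0)"
  if V': "openin (Euclidean_space a) V'" "V' <= V" for V' f
 proof (intro ext)
  fix I x
  show "sf_partial a V' i (%I x. if x : V' then f I x else 0) I x = (if x : V' then sf_partial a V i f I x else 0)"
   using partial_deriv_cong[OF V'(1), of x i "%x. if x : V' then f I x else 0" "f I"] V'(2)
   by (auto simp: sf_partial_def odd_partial_def)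
 qed
qed

section \<open>Coordinates, inverses and the Hadamard lemma of the model\<close>

lemma std_coord_part:
 assumes U: "openin (Euclidean_space a) U" and i: "i < a + b"
 shows "std_coord a U i : part (superfunctions a b U) (a \<le> i)"
proof -
 have "smooth_on a U (std_coord a U i I)" for I
 proof -
  have "smooth_on a U (%x. if i < a then (if I = {} then x i else 0) else (if I = {i - a} then 1 else 0))"
   using smooth_on_const[OF U] smooth_on_coord[OF U] by (cases "i < a"; cases "I = {}") simp_all
  then show ?thesis by (rule smooth_on_cong[OF U, THEN iffD1, rotated]) (simp add: std_coord_def)
 qed
 then show ?thesis using i by (auto simp: sf_part sf_carrier std_coord_def)
qed

lemma sf_partial_std_coord:
 assumes U: "openin (Euclidean_space a) U" and i: "i < a + b" and j: "j < a + b"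
 shows "sf_partial a U i (std_coord a U j) =
   (if i = j then 1[superfunctions a b U] else 0[superfunctions a b U])"
proof (intro ext)
 fix I x
 show "sf_partial a U i (std_coord a U j) I x =
   (if i = j then 1[superfunctions a b U] else 0[superfunctions a b U]) I x"
 proof (cases "i < a")
  case True
  show ?thesis
  proof (cases "x : U")
   case x: True
   let ?g = "%x. if j < a then (if I = {} then x j else 0) else (if I = {j - a} then 1 else (0::real))"
   have "partial_deriv i (std_coord a U j I) x = partial_deriv i ?g x"
    by (rule partial_deriv_cong[OF U x True]) (simp add: std_coord_def)
   also have "\<dots> = (if i = j & I = {} then 1 else 0)"
    using True by (cases "j < a"; cases "I = {}"; cases "i = j") (simp_all add: partial_deriv_def)
   finally show ?thesis using True x by (simp add: sf_partial_def sf_simps)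
  qed (use True in \<open>simp add: sf_partial_def sf_simps\<close>)
 next
  case False
  then show ?thesis
   by (cases "I = {}") (auto simp: sf_partial_def odd_partial_def std_coord_def sf_simps)
 qed
qed

lemma sf_mult_apply: "(f *[superfunctions a b U] g) K x = gmul (%I. f I x) (%I. g I x) K"
 by (simp add: sf_simps)

lemma sf_minus:
 assumes U: "openin (Euclidean_space a) U" and g: "g : carrier (superfunctions a b U)"
 shows "f -[superfunctions a b U] g = (%I x. f I x - g I x)"
 unfolding a_minus_def sf_a_inv[OF U g] by (simp add: sf_simps)

text \<open>The inverse \<open>g0\<close> of the coefficient of degree 0 is an inverse up to an
  error 1 - f g0 without constant term. Replacing g by g + g0 (1 - f g) multiplies the error 1 - f g
  by 1 - f g0, which raises its degree by one. An error that vanishes up to degree \<open>b\<close>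
  is zero.\<close>

lemma sf_local_inverse:
 assumes V: "openin (Euclidean_space a) V" and p: "p : V" and f: "f : carrier (superfunctions a b V)"
  and nz: "f {} p \<noteq> 0"
 shows "unit_near (super_euclidean a b) p V f"
proof -
 define V' where "V' = {x : V. f {} x \<noteq> 0}"
 have "continuous_on V (f {})" using smooth_on_continuous[OF V sf_smooth[OF V f]] .
 then have "openin (top_of_set V) (V Int f {} -` (- {0}))"
  by (rule continuous_openin_preimage_gen) auto
 moreover have "V Int f {} -` (- {0}) = V'" by (auto simp: V'_def)
 ultimately have V': "openin (Euclidean_space a) V'" "V' <= V" "p : V'"
  using openin_trans_full[OF _ V] p nz subtopology_Euclidean_space_open[OF V] by (auto simp: V'_def)
 let ?A = "superfunctions a b V'"
 interpret superalg ?A using sf_superalgebra[OF V'(1)] by unfold_locales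
 define f' where "f' = (%I x. if x : V' then f I x else 0)"
 have f': "f' : carrier ?A" unfolding f'_def by (rule sf_restrict_closed[OF V V'(1,2) f])
 define g0 where "g0 = (%(I::nat set) x. if I = {} & x : V' then inverse (f {} x) else (0::real))"
 have "smooth_on a V' (g0 I)" for I
 proof -
  have "smooth_on a V' (%x. if I = {} then inverse (f {} x) else 0)"
   using smooth_on_inverse[OF V'(1) smooth_on_subset[OF sf_smooth[OF V f] V V'(1,2)]] smooth_on_const[OF V'(1), of 0]
   by (cases "I = {}") (auto simp: V'_def)
  then show ?thesis by (rule smooth_on_cong[OF V'(1), THEN iffD1, rotated]) (simp add: g0_def)
 qed
 then have g0: "g0 : carrier ?A" by (auto simp: sf_carrier g0_def)
 have r0: "(1[?A] -[?A] f' *[?A] g0) {} x = 0" for x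
  unfolding sf_minus[OF V'(1) m_closed[OF f' g0]]
  by (auto simp: sf_simps gmul_empty f'_def g0_def) (auto simp: V'_def)
 have "\<exists>g\<in>carrier ?A. \<forall>K x. finite K & card K < Suc n --> (1[?A] -[?A] f' *[?A] g) K x = 0" for n
 proof (induction n)
  case 0
  show ?case by (rule bexI[OF _ g0]) (use r0 in auto)
 next
  case (Suc n)
  then obtain g where g: "g : carrier ?A"
   and fl: "\<And>K x. finite K ==> card K < Suc n ==> (1[?A] -[?A] f' *[?A] g) K x = 0" by blast
  let ?g = "g +[?A] g0 *[?A] (1[?A] -[?A] f' *[?A] g)"
  have "1[?A] -[?A] f' *[?A] ?g = (1[?A] -[?A] f' *[?A] g0) *[?A] (1[?A] -[?A] f' *[?A] g)"
   using f' g g0 by (simp add: a_minus_def l_distr r_distr l_minus r_minus minus_add m_assoc a_ac)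
  then have "(1[?A] -[?A] f' *[?A] ?g) K x = 0" if "finite K" "card K < Suc (Suc n)" for K x
   using gmul_flat[of "%I. (1[?A] -[?A] f' *[?A] g0) I x" "Suc n"
     "%I. (1[?A] -[?A] f' *[?A] g) I x", OF r0 fl that]
   by (simp only: sf_mult_apply)
  then have "\<forall>K x. finite K & card K < Suc (Suc n) --> (1[?A] -[?A] f' *[?A] ?g) K x = 0"
   by (intro allI impI; elim conjE)
  moreover have "?g : carrier ?A" using f' g g0 by simp
  ultimately show ?case by (rule bexI)
 qed
 then obtain g where g: "g : carrier ?A"
  and fl: "\<And>K x. finite K ==> card K < Suc b ==> (1[?A] -[?A] f' *[?A] g) K x = 0" by metis
 have "1[?A] -[?A] f' *[?A] g = 0[?A]"
 proof (intro ext)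
  fix K x
  have c: "1[?A] -[?A] f' *[?A] g : carrier ?A" using f' g by simp
  show "(1[?A] -[?A] f' *[?A] g) K x = 0[?A] K x"
  proof (cases "K <= {..<b}")
   case True
   then have "finite K" "card K \<le> card {..<b}" using finite_subset[OF _ finite_lessThan] by (blast, intro card_mono) auto
   then show ?thesis using fl by (simp add: sf_simps)
  next
   case False
   then show ?thesis using sf_outside[OF c] by (simp add: sf_simps)
  qed
 qed
 then have "1[?A] = f' *[?A] g" using f' g by (simp add: minus_eq_zero_iff)
 then have "f' *[?A] g = 1[?A]" by (rule sym)
 then show ?thesis
  unfolding unit_near_def se_simps f'_def
  using V' g by (intro exI[of _ V'] exI[of _ g] conjI)
qed

lemma rsum_sf: "rsum (superfunctions a b U) F n I x = (\<Sum>i<n. F i I x)"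
 by (induction n) (simp_all add: sf_simps)

lemma gmul_body: "gmul (%I. if I = {} then c else 0) G K = (if finite K then c * G K else 0)"
proof -
 have "gmul (%I. if I = {} then c else 0) G K = gmul (%I. c * gone I) G K"
  by (rule arg_cong[of _ _ "%F. gmul F G K"]) (auto simp: gone_def)
 also have "\<dots> = c * gmul gone G K" by (rule gmul_smult)
 finally show ?thesis using gmul_gone_left[of K G] by (auto simp: gmul_def)
qed

lemma gmul_theta: "gmul (%I. if I = {k} then 1 else 0) G K =
  (if k : K & finite K then wedge_sign {k} (K - {k}) * G (K - {k}) else 0)"
proof (cases "finite K")
 case True
 have "gmul (%I. if I = {k} then 1 else 0) G K =
  (\<Sum>I\<in>Pow K. if I = {k} then wedge_sign {k} (K - {k}) * G (K - {k}) else 0)"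
  unfolding gmul_def by (rule sum.cong) auto
 then show ?thesis using True by (simp add: sum.delta)
qed (simp add: gmul_def)

lemma sum_split_add: "(\<Sum>i<a + (b::nat). F i) = (\<Sum>i<a. F i) + (\<Sum>k<b. F (a + k) :: real)"
 by (induction b) auto

text \<open>In the odd directions every monomial is divided by its first \<open>\<theta>\<close>.\<close>

lemma sf_Hadamard:
 assumes V: "openin (Euclidean_space a) V" "V <= U" and U: "openin (Euclidean_space a) U" and p: "p : V"
  and f: "f : carrier (superfunctions a b V)"
 shows "\<exists>V' c g. openin (Euclidean_space a) V' & p : V' & V' <= V &
   (\<forall>i<a + b. g i : carrier (superfunctions a b V')) &
   (%I x. if x : V' then f I x else 0) -[superfunctions a b V']
    (c \<odot>[superfunctions a b V'] 1[superfunctions a b V'] +[superfunctions a b V']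
    rsum (superfunctions a b V') (%i. ((%I x. if x : V' then std_coord a U i I x else 0) -[superfunctions a b V']
     ((if i < a then p i else 0) \<odot>[superfunctions a b V'] 1[superfunctions a b V']))
     *[superfunctions a b V'] g i) (a + b)) = 0[superfunctions a b V']"
proof -
 obtain \<epsilon> where \<epsilon>: "\<epsilon> > 0" "cube a p \<epsilon> <= V" using cube_exists[OF V(1) p] by blast
 define V' where "V' = cube a p \<epsilon>"
 have V': "openin (Euclidean_space a) V'" "V' <= V" unfolding V'_def using openin_cube \<epsilon>(2) by auto
 have pt: "p : topspace (Euclidean_space a)" using openin_subset[OF V(1)] p by auto
 then have pV': "p : V'" using \<epsilon>(1) by (simp add: V'_def cube_def)
 let ?A = "superfunctions a b V'"
 interpret superalg ?A using sf_superalgebra[OF V'(1)] by unfold_locales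
 have sm: "smooth_on a V' (f I)" for I using smooth_on_subset[OF sf_smooth[OF V(1) f] V(1) V'] .
 obtain G where G: "\<And>i. i < a ==> smooth_on a V' (G i)"
  "\<And>x. x : V' ==> f {} x = f {} p + (\<Sum>i<a. (x i - p i) * G i x)"
  using Hadamard_cube[OF pt sm[of "{}", unfolded V'_def]] unfolding V'_def by blast
 \<comment> \<open>Only the coefficient of 1 is expanded in the even coordinates. A monomial with
   nonempty index set \<open>K\<close> goes entirely to the odd coordinate \<open>Min K\<close>,
   which already stands in front, so that no sign appears.\<close>
 define g where "g i = (if i < a then (%I x. if I = {} & x : V' then G i x else 0)
   else (%J x. if (\<forall>j\<in>J. i - a < j) & x : V' then f (insert (i - a) J) x else 0))" for i
 have g: "g i : carrier ?A" if i: "i < a + b" for i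
 proof (cases "i < a")
  case True
  have "smooth_on a V' (g i I)" for I
  proof -
   have "smooth_on a V' (%x. if I = {} then G i x else 0)"
    using G(1)[OF True] smooth_on_const[OF V'(1), of 0] by (cases "I = {}") auto
   then show ?thesis by (rule smooth_on_cong[OF V'(1), THEN iffD1, rotated]) (simp add: g_def True)
  qed
  then show ?thesis using True by (auto simp: sf_carrier g_def)
 next
  case False
  have "smooth_on a V' (g i J)" for J
  proof -
   have "smooth_on a V' (%x. if \<forall>j\<in>J. i - a < j then f (insert (i - a) J) x else 0)"
   proof -
    define P where "P \<longleftrightarrow> (\<forall>j\<in>J. i - a < j)"
    show ?thesis
     unfolding P_def[symmetric] using sm smooth_on_const[OF V'(1), of 0] by (cases P) simp_all
   qed
   then show ?thesis by (rule smooth_on_cong[OF V'(1), THEN iffD1, rotated]) (simp add: g_def False)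
  qed
  moreover have "g i J x = 0" if "\<not> (J <= {..<b} & x : V')" for J x
   using that False sf_outside[OF f, of "insert (i - a) J" x] by (auto simp: g_def)
  ultimately show ?thesis by (auto simp: sf_carrier)
 qed
 let ?y = "%i I x. if x : V' then std_coord a U i I x else 0"
 let ?t = "%i. if i < a then p i else 0"
 have y: "?y i : carrier ?A" if "i < a + b" for i
  by (rule sf_restrict_closed[OF U V'(1)])
   (use V V' std_coord_part[OF U that] in \<open>auto simp: sf_part\<close>)
 define T where "T = (%i. (?y i -[?A] (?t i \<odot>[?A] 1[?A])) *[?A] g i)"
 have T: "T i : carrier ?A" if "i < a + b" for i unfolding T_def using y[OF that] g[OF that] by simp
 have T1: "T i K x = (x i - p i) * g i K x" if i: "i < a" and x: "x : V'" and K: "finite K" for i K x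
 proof -
  have "(%I. (?y i -[?A] (?t i \<odot>[?A] 1[?A])) I x) = (%I. if I = {} then x i - p i else 0)"
  proof -
   have xU: "x : U" using x V V' by auto
   show ?thesis
    unfolding sf_minus[OF V'(1) smult_closed[OF one_closed]] using i x xU
    by (intro ext) (simp add: std_coord_def sf_simps)
  qed
  then show ?thesis unfolding T_def sf_simps(1) using K by (simp add: gmul_body)
 qed
 have T2: "T (a + k) K x = (if k : K & (\<forall>j\<in>K - {k}. k < j) then f K x else 0)"
  if x: "x : V'" and K: "finite K" for k K x
 proof -
  have "(%I. (?y (a + k) -[?A] (?t (a + k) \<odot>[?A] 1[?A])) I x) = (%I. if I = {k} then 1 else 0)"
  proof -
   have xU: "x : U" using x V V' by auto
   show ?thesis
    unfolding sf_minus[OF V'(1) smult_closed[OF one_closed]] using x xU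
    by (intro ext) (simp add: std_coord_def sf_simps)
  qed
  then have "T (a + k) K x = (if k : K & finite K then wedge_sign {k} (K - {k}) * g (a + k) (K - {k}) x else 0)"
   unfolding T_def sf_simps(1) by (simp add: gmul_theta)
  moreover have "wedge_sign {k} (K - {k}) = 1" if h: "\<forall>j\<in>K - {k}. k < j"
  proof -
   have "\<not> j < k" if j: "j : K - {k}" for j using bspec[OF h j] by simp
   then have "{(i, j). i : {k} & j : K - {k} & j < i} = {}" by auto
   then show ?thesis by (simp only: wedge_sign_def card.empty power_0)
  qed
  ultimately show ?thesis using x K by (auto simp: g_def insert_absorb)
 qed
 have sc: "f {} p \<odot>[?A] 1[?A] +[?A] rsum ?A T (a + b) : carrier ?A" using T by (simp add: rsum_closed)
 have fr: "(%I x. if x : V' then f I x else 0) : carrier ?A" by (rule sf_restrict_closed[OF V(1) V' f])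
 have "(if x : V' then f K x else 0) = (f {} p \<odot>[?A] 1[?A] +[?A] rsum ?A T (a + b)) K x" for K x
 proof (cases "K <= {..<b} & x : V'")
  case False
  then show ?thesis using sf_outside[OF fr, of K x] sf_outside[OF sc, of K x] by simp
 next
  case True
  then have x: "x : V'" and K: "K <= {..<b}" "finite K" using finite_subset by auto
  have "rsum ?A T (a + b) K x = (\<Sum>i<a. (x i - p i) * g i K x) +
    (\<Sum>k<b. if k : K & (\<forall>j\<in>K - {k}. k < j) then f K x else 0)"
   unfolding rsum_sf sum_split_add using T1[OF _ x K(2)] T2[OF x K(2)] by simp
  moreover have "(\<Sum>k<b. if k : K & (\<forall>j\<in>K - {k}. k < j) then f K x else 0) = (if K = {} then 0 else f K x)"
  proof (cases "K = {}")
   case False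
   have "k : K & (\<forall>j\<in>K - {k}. k < j) \<longleftrightarrow> k = Min K" for k
    using K(2) False by (metis DiffD1 DiffD2 DiffI Min_in Min_le insertI1 linorder_not_less order_le_less singletonD)
   moreover have "Min K < b" using K False Min_in by blast
   ultimately show ?thesis using False by (simp add: sum.delta)
  qed simp
  moreover have "(\<Sum>i<a. (x i - p i) * g i K x) = (if K = {} then f {} x - f {} p else 0)"
   using G(2)[OF x] x by (simp add: g_def)
  ultimately show ?thesis using x by (auto simp: sf_simps)
 qed
 then have "(%I x. if x : V' then f I x else 0) = f {} p \<odot>[?A] 1[?A] +[?A] rsum ?A T (a + b)" by blast
 then have "(%I x. if x : V' then f I x else 0) -[?A] (f {} p \<odot>[?A] 1[?A] +[?A] rsum ?A T (a + b)) = 0[?A]"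
  using fr sc by (simp add: minus_eq_zero_iff)
 then show ?thesis
  using V' pV' g unfolding T_def by (intro exI[of _ V'] exI[of _ "f {} p"] exI[of _ g]) simp
qed

section \<open>Charts\<close>

lemma srestrict_simps [simp]:
 "spc (srestrict M U) = subtopology (spc M) U" "sec (srestrict M U) = sec M" "rst (srestrict M U) = rst M"
 by (simp_all add: srestrict_def)

lemma smor_id_simps: "pull smor_id V f = f" "umap smor_id x = x" "umap smor_id = (%x. x)" "pull smor_id V = (%f. f)"
 by (simp_all add: smor_id_def)

lemma preim_smor_id: "V <= topspace (spc M) ==> preim M smor_id V = V"
 by (auto simp: preim_def smor_id_def)

lemma lder_cong_S:
 assumes D: "lder N W U S h p D"
  and S: "\<And>V. oset N V ==> V <= U ==> S' V = S V"
  and h: "\<And>V g. oset N V ==> V <= U ==> g : Sec N V ==> h' V g = h V g"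
  and N: "superringed_space N"
 shows "lder N W U S' h' p D"
proof -
 interpret sspace N using N by unfold_locales
 show ?thesis
 proof (rule lderI)
  fix V assume V: "oset N V" "V <= U"
  interpret superalg "sec N V" using alg[OF V(1)] .
  note D' = lder_closed[OF D V] lder_add[OF D V] lder_smult[OF D V] lder_parity[OF D V] lder_Leibniz[OF D V]
  note c = h[OF V] S[OF V]
  show "g : Sec N V ==> D V g : Sec W (S' V)" for g using D'(1) c by simp
  show "f : Sec N V ==> g : Sec N V ==>
    D V (f +[sec N V] g) = D V f +[sec W (S' V)] D V g" for f g using D'(2) c by simp
  show "g : Sec N V ==> D V (c \<odot>[sec N V] g) = c \<odot>[sec W (S' V)] D V g" for c g using D'(3) S[OF V] by simp
  show "g : Part N V q ==> D V g : Part W (S' V) (p \<noteq> q)" for q g using D'(4) c by simp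
  show "f : Part N V q ==> g : Sec N V ==>
    D V (f *[sec N V] g) = (D V f *[sec W (S' V)] h' V g) +[sec W (S' V)]
     signed (sec W (S' V)) (p & q) (h' V f *[sec W (S' V)] D V g)" for q f g using D'(5) c by simp
  show "D V' (rst N V V' g) = rst W (S' V) (S' V') (D V g)"
   if V': "oset N V'" "V' <= V" and g: "g : Sec N V" for V' g
   using lder_rst[OF D V V' g] S[OF V] S[OF V'(1)] V V' by auto
 qed
qed

definition is_chart :: "nat => nat => ('p, 's) superspace => 'p set => (nat => real) set =>
  ('p, nat => real, 's, nat set => (nat => real) => real) smor => bool" where
 "is_chart a b M U0 U' \<phi> \<longleftrightarrow> oset M U0 & openin (Euclidean_space a) U' &
   smor_iso (srestrict M U0) (srestrict (super_euclidean a b) U') \<phi>"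

locale chart = sspace M for M :: "('p, 's) superspace" +
 fixes a b U0 U' \<phi> assumes chart: "is_chart a b M U0 U' \<phi>"
begin

definition pre :: "(nat => real) set => 'p set" where "pre V' = {x : U0. umap \<phi> x : V'}"

text \<open>The coordinate expression of a section. \<open>smor_iso\<close> provides bijective
  pull-backs rather than an inverse morphism, hence \<open>inv_into\<close>.\<close>

definition \<tau> :: "'p set => 's => nat set => (nat => real) => real" where
 "\<tau> V f = inv_into (carrier (superfunctions a b (umap \<phi> ` V))) (pull \<phi> (umap \<phi> ` V)) f"

abbreviation "E \<equiv> super_euclidean a b"
abbreviation "u \<equiv> umap \<phi>"

lemma U0: "opn U0" and U': "openin (Euclidean_space a) U'"
 and iso: "smor_iso (srestrict M U0) (srestrict E U') \<phi>"
 using chart by (simp_all add: is_chart_def)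

lemma U0_sub: "U0 <= topspace (spc M)" using openin_subset[OF U0] .

lemma preim_eq: "preim (srestrict M U0) \<phi> V' = pre V'"
 using U0_sub by (auto simp: preim_def pre_def)

lemma homeo: "homeomorphic_map (subtopology (spc M) U0) (subtopology (Euclidean_space a) U') u"
 using iso by (simp add: smor_iso_def)

lemma topspaces: "topspace (subtopology (spc M) U0) = U0" "topspace (subtopology (Euclidean_space a) U') = U'"
 using U0_sub openin_subset[OF U'] by auto

lemma u_img: "u ` U0 = U'" and u_inj: "inj_on u U0"
 using homeomorphic_imp_surjective_map[OF homeo] homeomorphic_imp_injective_map[OF homeo] topspaces by auto

lemma smor: "smorphism (srestrict M U0) (srestrict E U') \<phi>"
 using iso by (simp add: smor_iso_def)

lemma shm: "shmor E M U' pre u (pull \<phi>)"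
proof (rule shmorI)
 have o: "openin (spc (srestrict E U')) V" if "oset E V" "V <= U'" for V
  using that openin_open_subtopology[OF U'] by simp
 show "oset E U'" using U' by simp
 show "u q : U'" if "q : pre U'" for q using that by (simp add: pre_def)
 fix V assume V: "oset E V" "V <= U'"
 have "openin (subtopology (spc M) U0) (preim (srestrict M U0) \<phi> V)"
  unfolding preim_def
  using openin_continuous_map_preimage[OF smor[unfolded smorphism_def, THEN conjunct1] o[OF V]] by simp
 then show "oset M (pre V)" unfolding preim_eq using openin_open_subtopology[OF U0] by simp
 show "pre V = {q : pre U'. u q : V}" using V by (auto simp: pre_def)
 show "superalgebra_hom (sec E V) (sec M (pre V)) (pull \<phi> V)"
  using smor[unfolded smorphism_def, THEN conjunct2, THEN conjunct1, rule_format, OF o[OF V]] by (simp add: preim_eq)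
 fix V' g assume V': "oset E V'" "V' <= V" and g: "g : Sec E V"
 have "V' <= U'" using V V' by auto
 then show "pull \<phi> V' (rst E V V' g) = rst M (pre V) (pre V') (pull \<phi> V g)"
  using smor[unfolded smorphism_def, THEN conjunct2, THEN conjunct2, rule_format, of V V' g] o[OF V] o[OF V'(1)] V' g
  by (simp add: preim_eq)
qed

sublocale lm: lmor E M U' pre u "pull \<phi>"
 by unfold_locales (use superringed_super_euclidean shm in auto)

lemma bij: "openin (Euclidean_space a) V' ==> V' <= U' ==>
  bij_betw (pull \<phi> V') (carrier (superfunctions a b V')) (Sec M (pre V'))"
 using iso openin_open_subtopology[OF U'] by (simp add: smor_iso_def preim_eq)

lemma img:
 assumes "opn V" "V <= U0"
 shows "openin (Euclidean_space a) (u ` V)" "u ` V <= U'" "pre (u ` V) = V"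
proof -
 have "openin (subtopology (spc M) U0) V" using assms openin_open_subtopology[OF U0] by simp
 then have "openin (subtopology (Euclidean_space a) U') (u ` V)"
  using homeomorphic_imp_open_map[OF homeo] unfolding open_map_def by blast
 then show "openin (Euclidean_space a) (u ` V)" "u ` V <= U'" using openin_open_subtopology[OF U'] by auto
 show "pre (u ` V) = V"
  using assms(2) u_inj by (auto simp: pre_def inj_on_def)
qed

context
 fixes V assumes V: "opn V" "V <= U0"
begin

lemma pull_hom: "superalg_hom (superfunctions a b (u ` V)) (sec M V) (pull \<phi> (u ` V))"
 using lm.hh[of "u ` V"] img[OF V] by simp

lemma \<tau>_closed: "f : Sec M V ==> \<tau> V f : carrier (superfunctions a b (u ` V))"
 and pull_\<tau>: "f : Sec M V ==> pull \<phi> (u ` V) (\<tau> V f) = f"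
 and \<tau>_pull: "g : carrier (superfunctions a b (u ` V)) ==> \<tau> V (pull \<phi> (u ` V) g) = g"
proof -
 have b: "bij_betw (pull \<phi> (u ` V)) (carrier (superfunctions a b (u ` V))) (Sec M V)"
  using bij[OF img(1,2)[OF V]] img(3)[OF V] by simp
 show "f : Sec M V ==> \<tau> V f : carrier (superfunctions a b (u ` V))"
  unfolding \<tau>_def using b by (metis bij_betw_imp_surj_on inv_into_into)
 show "f : Sec M V ==> pull \<phi> (u ` V) (\<tau> V f) = f"
  unfolding \<tau>_def using b by (metis bij_betw_imp_surj_on f_inv_into_f)
 show "g : carrier (superfunctions a b (u ` V)) ==> \<tau> V (pull \<phi> (u ` V) g) = g"
  unfolding \<tau>_def using b by (metis bij_betw_imp_inj_on inv_into_f_f)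
qed

text \<open>That the inverse preserves the operations follows from injectivity. Only parity needs an
  argument: the pull-back of the component of \<open>\<tau> V f\<close> of the wrong parity is zero,
  by uniqueness of the decomposition of \<open>f\<close>, hence so is the component.\<close>

lemma \<tau>_hom: "superalg_hom (sec M V) (superfunctions a b (u ` V)) (\<tau> V)"
proof -
 interpret p: superalg_hom "superfunctions a b (u ` V)" "sec M V" "pull \<phi> (u ` V)" using pull_hom .
 have eq: "\<tau> V f = g" if "g : carrier (superfunctions a b (u ` V))" "pull \<phi> (u ` V) g = f" for f g
  using \<tau>_pull that by metis
 have "superalgebra_hom (sec M V) (superfunctions a b (u ` V)) (\<tau> V)"
  unfolding superalgebra_hom_def
 proof (intro conjI allI ballI ring_hom_memI)
  show "f : Sec M V ==> \<tau> V f : carrier (superfunctions a b (u ` V))" for f using \<tau>_closed .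
  show "\<tau> V (f *[sec M V] g) = \<tau> V f *[superfunctions a b (u ` V)] \<tau> V g"
   if "f : Sec M V" "g : Sec M V" for f g
   by (rule eq) (use that \<tau>_closed pull_\<tau> p.mult in auto)
  show "\<tau> V (f +[sec M V] g) = \<tau> V f +[superfunctions a b (u ` V)] \<tau> V g"
   if "f : Sec M V" "g : Sec M V" for f g
   by (rule eq) (use that \<tau>_closed pull_\<tau> p.add in auto)
  show "\<tau> V 1[sec M V] = 1[superfunctions a b (u ` V)]" by (rule eq) (use p.one in auto)
  show "\<tau> V (c \<odot>[sec M V] f) = c \<odot>[superfunctions a b (u ` V)] \<tau> V f" if "f : Sec M V" for c f
   by (rule eq) (use that \<tau>_closed pull_\<tau> p.smult in auto)
  show "\<tau> V f : part (superfunctions a b (u ` V)) p" if f: "f : Part M V p" for p f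
  proof -
   have fc: "f : Sec M V" using f by (rule p.B.part_closed)
   obtain g0 g1 where g: "g0 : part (superfunctions a b (u ` V)) False" "g1 : part (superfunctions a b (u ` V)) True"
    "\<tau> V f = g0 +[superfunctions a b (u ` V)] g1" using p.A.decomp[OF \<tau>_closed[OF fc]] .
   note gc = p.A.part_closed[OF g(1)] p.A.part_closed[OF g(2)]
   have e: "pull \<phi> (u ` V) g0 +[sec M V] pull \<phi> (u ` V) g1 = f"
    using pull_\<tau>[OF fc] p.add[OF gc] g(3) by simp
   show ?thesis
   proof (cases p)
    case True
    have "pull \<phi> (u ` V) g0 = 0[sec M V]"
     by (rule p.B.decomp_unique(1)[OF p.parity[OF g(1)] p.parity[OF g(2)] p.B.part_zero])
      (use f e True fc in auto)
    then have "g0 = 0[superfunctions a b (u ` V)]" using \<tau>_pull gc p.zero p.A.zero_closed by metis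
    then show ?thesis using g gc True by simp
   next
    case False
    have "pull \<phi> (u ` V) g1 = 0[sec M V]"
     by (rule p.B.decomp_unique(2)[OF p.parity[OF g(1)] p.parity[OF g(2)] _ p.B.part_zero])
      (use f e False fc in auto)
    then have "g1 = 0[superfunctions a b (u ` V)]" using \<tau>_pull gc p.zero p.A.zero_closed by metis
    then show ?thesis using g gc False by simp
   qed
  qed
 qed
 then show ?thesis using p.A.superalg_axioms p.B.superalg_axioms by (simp add: superalg_hom_def superalg_hom_axioms_def)
qed

lemma pull_rst:
 assumes "opn V'" "V' <= V" "g : carrier (superfunctions a b (u ` V))"
 shows "pull \<phi> (u ` V') (rst E (u ` V) (u ` V') g) = rst M V V' (pull \<phi> (u ` V) g)"
proof -
 have "V' <= U0" using assms V by auto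
 then show ?thesis
  using lm.h_rst[of "u ` V" "u ` V'" g] img[OF V] img[OF assms(1)] assms by (simp add: image_mono)
qed

lemma \<tau>_rst:
 assumes "opn V'" "V' <= V" "f : Sec M V"
 shows "\<tau> V' (rst M V V' f) = rst E (u ` V) (u ` V') (\<tau> V f)"
proof -
 have V': "opn V'" "V' <= U0" using assms V by auto
 have "bij_betw (pull \<phi> (u ` V')) (carrier (superfunctions a b (u ` V'))) (Sec M V')"
  using bij[OF img(1,2)[OF V']] img(3)[OF V'] by simp
 moreover have "rst E (u ` V) (u ` V') (\<tau> V f) : carrier (superfunctions a b (u ` V'))"
  unfolding se_simps
  by (rule sf_restrict_closed[OF img(1)[OF V] img(1)[OF V'] image_mono[OF assms(2)] \<tau>_closed[OF assms(3)]])
 moreover have "pull \<phi> (u ` V') (rst E (u ` V) (u ` V') (\<tau> V f)) = rst M V V' f"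
  using pull_rst[OF assms(1,2) \<tau>_closed[OF assms(3)]] pull_\<tau>[OF assms(3)] by simp
 ultimately show ?thesis unfolding \<tau>_def[of V'] by (metis bij_betw_imp_inj_on inv_into_f_f)
qed

end

text \<open>Coefficients at the image of \<open>x\<close> under the chart. The section may be
  defined on any open set around \<open>x\<close>, not only inside the chart, so it is restricted to
  the chart first.\<close>

definition ev :: "'p => 'p set => 's => nat set => real" where
 "ev x V f I = \<tau> (V Int U0) (rst M V (V Int U0) f) I (u x)"

lemma ev_sub: "opn V ==> V <= U0 ==> f : Sec M V ==> ev x V f I = \<tau> V f I (u x)"
 by (simp add: ev_def inf.absorb1)

lemma evalat_chart:
 assumes x: "x : U0"
 shows "evalat b M x (ev x)"
 unfolding evalat_def
proof (intro allI impI)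
 fix V assume V: "opn V & x : V"
 let ?V = "V Int U0"
 have W: "opn ?V" "?V <= U0" "?V <= V" using V U0 by auto
 have x: "x : ?V" using V x by simp
 interpret r: superalg_hom "sec M V" "sec M ?V" "rst M V ?V" using rst V W by blast
 interpret t: superalg_hom "sec M ?V" "superfunctions a b (u ` ?V)" "\<tau> ?V" using \<tau>_hom[OF W(1,2)] .
 have unit: "unit_near M x V f" if f: "f : Sec M V" and nz: "ev x V f {} \<noteq> 0" for f
 proof -
  let ?g = "\<tau> ?V (rst M V ?V f)"
  have g: "?g : carrier (superfunctions a b (u ` ?V))" using f by simp
  have "unit_near E (u x) (u ` ?V) ?g"
   by (rule sf_local_inverse[OF img(1)[OF W(1,2)] _ g]) (use x nz in \<open>auto simp: ev_def\<close>)
  then have "unit_near M x (pre (u ` ?V)) (pull \<phi> (u ` ?V) ?g)"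
   by (intro lm.unit_near_h) (use img[OF W(1,2)] x g in auto)
  then have "unit_near M x ?V (rst M V ?V f)" using img(3)[OF W(1,2)] pull_\<tau>[OF W(1,2)] f by simp
  then obtain V' h where V': "opn V'" "x : V'" "V' <= ?V" "h : Sec M V'"
   "rst M ?V V' (rst M V ?V f) *[sec M V'] h = 1[sec M V']" unfolding unit_near_def by blast
  moreover have "rst M ?V V' (rst M V ?V f) = rst M V V' f" using rst_rst[of V ?V V' f] V W V' f by blast
  ultimately have "rst M V V' f *[sec M V'] h = 1[sec M V']" by simp
  then show ?thesis
   unfolding unit_near_def using V'(1,2,4) order_trans[OF V'(3) W(3)]
   by (intro exI[of _ V'] exI[of _ h] conjI)
 qed
 show "(\<forall>f\<in>Sec M V. \<forall>g\<in>Sec M V.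
    ev x V (f +[sec M V] g) = (%I. ev x V f I + ev x V g I) & ev x V (f *[sec M V] g) = gmul (ev x V f) (ev x V g)) &
   (\<forall>c. \<forall>f\<in>Sec M V. ev x V (c \<odot>[sec M V] f) = (%I. c * ev x V f I)) &
   ev x V 1[sec M V] = gone &
   (\<forall>f\<in>Sec M V. ev x V f {} \<noteq> 0 --> unit_near M x V f) &
   (\<forall>f\<in>Sec M V. \<forall>I. \<not> I <= {..<b} --> ev x V f I = 0) &
   (\<forall>V'. opn V' & x : V' & V' <= V --> (\<forall>f\<in>Sec M V. ev x V' (rst M V V' f) = ev x V f))"
 proof (intro conjI ballI allI impI unit)
  fix f g assume f: "f : Sec M V" and g: "g : Sec M V"
  show "ev x V (f +[sec M V] g) = (%I. ev x V f I + ev x V g I)"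
   using f g by (intro ext) (simp add: ev_def r.add t.add, simp add: sf_simps)
  show "ev x V (f *[sec M V] g) = gmul (ev x V f) (ev x V g)"
   using f g by (intro ext) (simp add: ev_def[abs_def] r.mult t.mult, simp add: sf_simps)
 next
  show "ev x V (c \<odot>[sec M V] f) = (%I. c * ev x V f I)" if "f : Sec M V" for c f
   using that by (intro ext) (simp add: ev_def r.smult t.smult, simp add: sf_simps)
  show "ev x V 1[sec M V] = gone"
   using x by (intro ext) (simp add: ev_def r.one t.one, simp add: sf_simps gone_def)
  show "ev x V f I = 0" if "f : Sec M V" "\<not> I <= {..<b}" for f I
   unfolding ev_def by (rule sf_outside[of _ a b "u ` ?V"]) (use that in auto)
  show "ev x V' (rst M V V' f) = ev x V f" if V': "opn V' & x : V' & V' <= V" and f: "f : Sec M V" for V' f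
  proof
   fix I
   have o: "opn (V' Int U0)" "V' Int U0 <= ?V" "V' Int U0 <= V'" "V' Int U0 <= V" using V' U0 by auto
   have "rst M V' (V' Int U0) (rst M V V' f) = rst M V (V' Int U0) f"
    by (rule rst_rst) (use o V V' f in auto)
   also have "\<dots> = rst M ?V (V' Int U0) (rst M V ?V f)" by (rule rst_rst[symmetric]) (use o V W f in auto)
   finally have "rst M V' (V' Int U0) (rst M V V' f) = rst M ?V (V' Int U0) (rst M V ?V f)" .
   then show "ev x V' (rst M V V' f) I = ev x V f I"
    unfolding ev_def using \<tau>_rst[OF W(1,2) o(1,2) r.closed[OF f]] V' x by simp
  qed
 qed
qed

lemma evals_chart: "evals b M U0 ev"
 unfolding evals_def
proof (intro conjI ballI allI impI U0 evalat_chart)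
 fix V f assume V: "opn V & V <= U0" and f: "f : Sec M V" and z: "\<forall>x\<in>V. \<forall>I. ev x V f I = 0"
 have W: "opn V" "V <= U0" using V by auto
 interpret p: superalg_hom "superfunctions a b (u ` V)" "sec M V" "pull \<phi> (u ` V)" using pull_hom[OF W] .
 have "\<tau> V f = 0[superfunctions a b (u ` V)]"
 proof (intro ext)
  fix I y
  show "\<tau> V f I y = 0[superfunctions a b (u ` V)] I y"
  proof (cases "y : u ` V")
   case True
   then show ?thesis using z ev_sub[OF W f] by (auto simp: sf_simps)
  next
   case False
   then show ?thesis using sf_outside[OF \<tau>_closed[OF W f]] by (simp add: sf_simps)
  qed
 qed
 then show "f = 0[sec M V]" using pull_\<tau>[OF W f] p.zero by simp
qed

definition crd :: "'p set => nat => 's" where "crd V i = pull \<phi> (u ` V) (std_coord a (u ` V) i)"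

definition crd_field :: "nat => ('p, 's, 's) sder" where
 "crd_field i V f = pull \<phi> (u ` V) (sf_partial a (u ` V) i (\<tau> V f))"

lemma lder_crd_field:
 assumes i: "i < a + b"
 shows "lder M M U0 (%V. V) (%V f. f) (a \<le> i) (crd_field i)"
proof (rule lderI)
 fix V assume V: "opn V" "V <= U0"
 let ?A = "superfunctions a b (u ` V)"
 note D = lder_sf_partial[OF img(1)[OF V] i]
 have o: "oset E (u ` V)" using img(1)[OF V] by simp
 note D' = lder_closed[OF D o order_refl, unfolded se_simps] lder_add[OF D o order_refl, unfolded se_simps]
  lder_smult[OF D o order_refl, unfolded se_simps] lder_parity[OF D o order_refl, unfolded se_simps]
  lder_Leibniz[OF D o order_refl, unfolded se_simps]
 interpret p: superalg_hom ?A "sec M V" "pull \<phi> (u ` V)" using pull_hom[OF V] .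
 interpret t: superalg_hom "sec M V" ?A "\<tau> V" using \<tau>_hom[OF V] .
 show "crd_field i V g : Sec M V" if "g : Sec M V" for g
  unfolding crd_field_def by (intro p.closed D'(1) t.closed that)
 show "crd_field i V (f +[sec M V] g) = crd_field i V f +[sec M V] crd_field i V g"
  if "f : Sec M V" "g : Sec M V" for f g
  using that D'(1,2) by (simp add: crd_field_def t.add p.add)
 show "crd_field i V (c \<odot>[sec M V] g) = c \<odot>[sec M V] crd_field i V g" if "g : Sec M V" for c g
  using that D'(1,3) by (simp add: crd_field_def t.smult p.smult)
 show "crd_field i V g : Part M V ((a \<le> i) \<noteq> q)" if "g : Part M V q" for q g
  unfolding crd_field_def by (intro p.parity D'(4) t.parity that)
 show "crd_field i V (f *[sec M V] g) = (crd_field i V f *[sec M V] g) +[sec M V]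
     signed (sec M V) ((a \<le> i) & q) (f *[sec M V] crd_field i V g)"
  if f: "f : Part M V q" and g: "g : Sec M V" for q f g
  using p.B.part_closed[OF f] g t.parity[OF f] D'(1)[OF t.closed] D'(5)[OF t.parity[OF f] t.closed[OF g]]
  by (simp add: crd_field_def t.mult p.mult p.add p.signed pull_\<tau>[OF V])
 show "crd_field i V' (rst M V V' g) = rst M V V' (crd_field i V g)"
  if V': "opn V'" "V' <= V" and g: "g : Sec M V" for V' g
 proof -
  have "V' <= U0" using V V' by auto
  then have o': "oset E (u ` V')" "u ` V' <= u ` V" using img(1)[OF V'(1)] V' by auto
  show ?thesis
   unfolding crd_field_def \<tau>_rst[OF V V' g] using lder_rst[OF D o order_refl o' ] t.closed[OF g]
    pull_rst[OF V V' D'(1)[OF t.closed[OF g]]] by simp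
 qed
qed

context
 fixes V assumes V: "opn V" "V <= U0"
begin

lemma std_closed: "i < a + b ==> std_coord a (u ` V) i : carrier (superfunctions a b (u ` V))"
 using std_coord_part[OF img(1)[OF V]] by (simp add: sf_part)

lemma crd_part: "i < a + b ==> crd V i : Part M V (a \<le> i)"
 unfolding crd_def using superalg_hom.parity[OF pull_hom[OF V]] std_coord_part[OF img(1)[OF V]] by blast

lemma \<tau>_crd: "i < a + b ==> \<tau> V (crd V i) = std_coord a (u ` V) i"
 unfolding crd_def by (rule \<tau>_pull[OF V std_closed])

lemma crd_field_crd: "i < a + b ==> j < a + b ==>
  crd_field i V (crd V j) = (if i = j then 1[sec M V] else 0[sec M V])"
 using sf_partial_std_coord[OF img(1)[OF V], of i b j]
  superalg_hom.one[OF pull_hom[OF V]] superalg_hom.zero[OF pull_hom[OF V]]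
 by (auto simp: crd_field_def \<tau>_crd)

text \<open>\<open>sf_Hadamard\<close> transported by the chart. The values of the coordinates at
  \<open>p\<close> are the components of \<open>u p\<close> for the even and 0 for the odd
  ones.\<close>

lemma had_crd:
 assumes p: "p : V"
 shows "had M V (a + b) (%i. a \<le> i) (crd V) p (%V. {0[sec M V]})"
 unfolding had_def
proof (intro exI[of _ "%i. if i < a then u p i else 0"] conjI allI impI)
 fix i assume i: "i < a + b"
 interpret s: superalg "sec M V" using alg[OF V(1)] .
 have yc: "crd V i : Sec M V" using crd_part[OF i] by (rule s.part_closed)
 have pU: "p : U0" using p V by auto
 have "ev p V (crd V i) {} = (if i < a then u p i else 0)"
  using ev_sub[OF V yc] \<tau>_crd[OF i] p by (simp add: std_coord_def)
 then show "value_is M p V (crd V i) (if i < a then u p i else 0)"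
  using value_is_iff[OF srs evalat_chart[OF pU] V(1) p yc] by simp
next
 fix V1 f assume V1: "opn V1 & V1 <= V & p : V1 & f : Sec M V1"
 then have W: "opn V1" "V1 <= U0" "V1 <= V" "p : V1" "f : Sec M V1" using V by auto
 let ?U = "u ` V"
 obtain V2 c g where V2: "openin (Euclidean_space a) V2" "u p : V2" "V2 <= u ` V1"
  and g: "\<And>i. i < a + b ==> g i : carrier (superfunctions a b V2)"
  and eq: "(%I x. if x : V2 then \<tau> V1 f I x else 0) -[superfunctions a b V2]
    (c \<odot>[superfunctions a b V2] 1[superfunctions a b V2] +[superfunctions a b V2]
    rsum (superfunctions a b V2) (%i. ((%I x. if x : V2 then std_coord a ?U i I x else 0) -[superfunctions a b V2]
     ((if i < a then u p i else 0) \<odot>[superfunctions a b V2] 1[superfunctions a b V2]))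
     *[superfunctions a b V2] g i) (a + b)) = 0[superfunctions a b V2]"
  using sf_Hadamard[OF img(1)[OF W(1,2)] image_mono[OF W(3)] img(1)[OF V] imageI[OF W(4)] \<tau>_closed[OF W(1,2,5)]]
  by (elim exE conjE) (rule that; simp)
 let ?A = "superfunctions a b V2"
 have V2': "V2 <= U'" "V2 <= ?U" using V2(3) img(2)[OF W(1,2)] image_mono[OF W(3), of u] by blast+
 define V3 where "V3 = pre V2"
 have V3: "opn V3" unfolding V3_def using lm.S_open[of V2] V2 V2' by simp
 have sub: "V3 <= V1"
 proof -
  have "V3 <= pre (u ` V1)" unfolding V3_def pre_def using V2(3) by auto
  then show ?thesis using img(3)[OF W(1,2)] by simp
 qed
 have pV3: "p : V3" using V2(2) W by (auto simp: V3_def pre_def)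
 interpret h: superalg_hom ?A "sec M V3" "pull \<phi> V2"
  unfolding V3_def using lm.hh[of V2] V2 V2' by simp
 have e1: "pull \<phi> V2 (%I x. if x : V2 then \<tau> V1 f I x else 0) = rst M V1 V3 f"
  using lm.h_rst[of "u ` V1" V2 "\<tau> V1 f"] img[OF W(1,2)] V2 \<tau>_closed[OF W(1,2,5)] pull_\<tau>[OF W(1,2,5)]
  by (simp add: V3_def)
 have e2: "pull \<phi> V2 (%I x. if x : V2 then std_coord a ?U i I x else 0) = rst M V V3 (crd V i)" if "i < a + b" for i
  using lm.h_rst[of ?U V2 "std_coord a ?U i"] img[OF V] V2 V2' std_closed[OF that] by (simp add: V3_def crd_def)
 have c1: "(%I x. if x : V2 then \<tau> V1 f I x else 0) : carrier ?A"
  by (rule sf_restrict_closed[OF img(1)[OF W(1,2)] V2(1,3) \<tau>_closed[OF W(1,2,5)]])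
 have c2: "(%I x. if x : V2 then std_coord a ?U i I x else 0) : carrier ?A" if "i < a + b" for i
  by (rule sf_restrict_closed[OF img(1)[OF V] V2(1) V2'(2) std_closed[OF that]])
 define T where "T i = ((%I x. if x : V2 then std_coord a ?U i I x else 0) -[?A]
     ((if i < a then u p i else 0) \<odot>[?A] 1[?A])) *[?A] g i" for i
 have T: "T i : carrier ?A" if "i < a + b" for i
  unfolding T_def by (intro h.A.m_closed h.A.minus_closed h.A.smult_closed h.A.one_closed c2[OF that] g[OF that])
 have hT: "pull \<phi> V2 (T i) = (rst M V V3 (crd V i) -[sec M V3] ((if i < a then u p i else 0) \<odot>[sec M V3] 1[sec M V3]))
   *[sec M V3] pull \<phi> V2 (g i)" if "i < a + b" for i
 proof -
  have "pull \<phi> V2 (T i) = pull \<phi> V2 ((%I x. if x : V2 then std_coord a ?U i I x else 0) -[?A]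
     ((if i < a then u p i else 0) \<odot>[?A] 1[?A])) *[sec M V3] pull \<phi> V2 (g i)"
   unfolding T_def
   by (intro h.mult h.A.minus_closed h.A.smult_closed h.A.one_closed c2[OF that] g[OF that])
  also have "pull \<phi> V2 ((%I x. if x : V2 then std_coord a ?U i I x else 0) -[?A]
     ((if i < a then u p i else 0) \<odot>[?A] 1[?A])) = rst M V V3 (crd V i) -[sec M V3]
     ((if i < a then u p i else 0) \<odot>[sec M V3] 1[sec M V3])"
   unfolding h.minus[OF c2[OF that] h.A.smult_closed[OF h.A.one_closed]] e2[OF that]
    h.smult[OF h.A.one_closed] h.one ..
  finally show ?thesis .
 qed
 have Tr: "rsum ?A T (a + b) : carrier ?A" by (rule h.A.rsum_closed[OF T])
 have hr: "pull \<phi> V2 (rsum ?A T (a + b)) = rsum (sec M V3) (%i. pull \<phi> V2 (T i)) (a + b)"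
  by (rule h.rsum[OF T])
 have "(%I x. if x : V2 then \<tau> V1 f I x else 0) -[?A] (c \<odot>[?A] 1[?A] +[?A] rsum ?A T (a + b)) = 0[?A]"
  using eq unfolding T_def[abs_def] .
 then have "pull \<phi> V2 ((%I x. if x : V2 then \<tau> V1 f I x else 0) -[?A] (c \<odot>[?A] 1[?A] +[?A] rsum ?A T (a + b))) = 0[sec M V3]"
  by (simp only: h.zero)
 then have "rst M V1 V3 f -[sec M V3] (c \<odot>[sec M V3] 1[sec M V3] +[sec M V3]
   rsum (sec M V3) (%i. pull \<phi> V2 (T i)) (a + b)) = 0[sec M V3]"
  unfolding h.minus[OF c1 h.A.a_closed[OF h.A.smult_closed[OF h.A.one_closed] Tr]] e1
   h.add[OF h.A.smult_closed[OF h.A.one_closed] Tr] h.smult[OF h.A.one_closed] h.one hr .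
 also have "rsum (sec M V3) (%i. pull \<phi> V2 (T i)) (a + b) = rsum (sec M V3)
   (%i. (rst M V V3 (crd V i) -[sec M V3] ((if i < a then u p i else 0) \<odot>[sec M V3] 1[sec M V3]))
   *[sec M V3] pull \<phi> V2 (g i)) (a + b)"
  by (rule rsum_cong) (rule hT)
 finally show "\<exists>V' c g. opn V' & p : V' & V' <= V1 & (\<forall>i<a + b. g i : Sec M V') &
   rst M V1 V' f -[sec M V'] (c \<odot>[sec M V'] 1[sec M V'] +[sec M V']
    rsum (sec M V') (%i. (rst M V V' (crd V i) -[sec M V']
     ((if i < a then u p i else 0) \<odot>[sec M V'] 1[sec M V'])) *[sec M V'] g i) (a + b))
   : {0[sec M V']}"
  using V3 sub pV3 g by (intro exI[of _ V3] exI[of _ c] exI[of _ "%i. pull \<phi> V2 (g i)"]) (simp add: h.closed)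
qed simp

lemma good_coords_crd: "good_coords a b M V (crd V) crd_field"
 unfolding good_coords_def
 by (intro conjI allI impI ballI V(1) crd_part lder_mono[OF lder_crd_field V(2)] crd_field_crd had_crd)

lemma coordinates_crd: "coordinates a b M V (crd V)"
 unfolding coordinates_def
proof (intro conjI V(1) exI[of _ "u ` V"] exI[of _ \<phi>] allI impI)
 show "openin (Euclidean_space a) (u ` V)" using img[OF V] by simp
 show "crd V i = pull \<phi> (u ` V) (std_coord a (u ` V) i)" for i by (simp add: crd_def)
 have h: "homeomorphic_map (subtopology (spc M) V) (subtopology (Euclidean_space a) (u ` V)) u"
 proof -
  have "homeomorphic_map (subtopology (subtopology (spc M) U0) V) (subtopology (subtopology (Euclidean_space a) U') (u ` V)) u"
   by (rule homeomorphic_map_subtopologies[OF homeo])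
    (use V img[OF V] topspaces in \<open>simp add: inf.absorb2 inf.absorb1\<close>)
  then show ?thesis using V img[OF V] by (simp add: subtopology_subtopology inf.absorb2)
 qed
 have pe: "preim (srestrict M V) \<phi> V' = pre V'" if "V' <= u ` V" for V'
 proof -
  have "pre V' <= pre (u ` V)" using that by (auto simp: pre_def)
  then have "pre V' <= V" using img(3)[OF V] by simp
  moreover have "preim (srestrict M V) \<phi> V' = {x : V. u x : V'}"
   using V U0_sub by (auto simp: preim_def)
  ultimately show ?thesis using V(2) unfolding pre_def by blast
 qed
 have o: "openin (Euclidean_space a) V' & V' <= U' & V' <= u ` V" if "openin (subtopology (Euclidean_space a) (u ` V)) V'" for V'
  using that openin_open_subtopology[OF img(1)[OF V]] img(2)[OF V] by auto
 show "smor_iso (srestrict M V) (srestrict E (u ` V)) \<phi>"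
  unfolding smor_iso_def smorphism_def srestrict_simps se_simps
 proof (intro conjI allI impI ballI h)
  show "continuous_map (subtopology (spc M) V) (subtopology (Euclidean_space a) (u ` V)) u"
   using homeomorphic_imp_continuous_map[OF h] .
  fix V' assume "openin (subtopology (Euclidean_space a) (u ` V)) V'"
  note V' = o[OF this]
  show "superalgebra_hom (superfunctions a b V') (sec M (preim (srestrict M V) \<phi> V')) (pull \<phi> V')"
   using lm.hhom[of V'] V' pe by simp
  show "bij_betw (pull \<phi> V') (carrier (superfunctions a b V')) (Sec M (preim (srestrict M V) \<phi> V'))"
   using bij[of V'] V' pe by simp
 next
  fix V1 V2 g assume *: "openin (subtopology (Euclidean_space a) (u ` V)) V1 &
   openin (subtopology (Euclidean_space a) (u ` V)) V2 & V2 <= V1" and g: "g : carrier (superfunctions a b V1)"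
  show "pull \<phi> V2 (%I x. if x : V2 then g I x else 0) =
    rst M (preim (srestrict M V) \<phi> V1) (preim (srestrict M V) \<phi> V2) (pull \<phi> V1 g)"
   using lm.h_rst[of V1 V2 g] * g o pe by simp
 qed
qed

text \<open>\<open>Pbar_of\<close> ties the map on derivations along a morphism to \<open>PN\<close>
  only on fields of the kind \<open>coordinate_fields\<close>; hence the fields of the chart are
  also needed in normalized form.\<close>

lemma coordinate_fields_crd: "coordinate_fields a b M V (crd V) (%i. normal_der M V (crd_field i))"
 unfolding coordinate_fields_def
proof (intro conjI allI impI coordinates_crd)
 fix i assume i: "i < a + b"
 have e: "lder M M V (preim M smor_id) (pull smor_id) (a \<le> i) (crd_field i)"
 proof (rule lder_cong_S[OF lder_mono[OF lder_crd_field[OF i] V(2)] _ _ srs])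
  show "preim M smor_id V' = V'" if "opn V'" for V' using preim_smor_id[OF openin_subset[OF that]] .
 qed (simp add: smor_id_def)
 have "lder M M V (preim M smor_id) (pull smor_id) (a \<le> i) (normal_der M V (crd_field i))"
  by (rule lder_cong[OF _ srs e]) (simp add: normal_der_def)
 moreover have "normal_der M V (normal_der M V (crd_field i)) = normal_der M V (crd_field i)"
  by (auto simp: normal_der_def intro!: ext)
 ultimately show "normal_der M V (crd_field i) : tpart M V (a \<le> i)"
  by (simp add: tangent_sheaf_def der_sheaf_def Let_def homogeneous_ders_iff)
 fix j assume j: "j < a + b"
 have "crd V j : Sec M V" using crd_part[OF j] superalg.part_closed[OF alg[OF V(1)]] by blast
 then show "normal_der M V (crd_field i) V (crd V j) = (if i = j then 1[sec M V] else 0[sec M V])"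
  using crd_field_crd[OF i j] V(1) by (simp add: normal_der_def)
qed

end

text \<open>A bump function of the model is supported in a compact cube, whose image
  \<open>C\<close> in \<open>M\<close> is compact and therefore closed, as \<open>M\<close> is
  Hausdorff. So the function can be glued with 0 on the complement of \<open>C\<close> to a section
  on all of \<open>M\<close>.\<close>

lemma bump:
 assumes H: "Hausdorff_space (spc M)" and V: "opn V" "x : V" "V <= U0"
 shows "\<exists>\<beta> C. \<beta> : Part M (topspace (spc M)) False & closedin (spc M) C & C <= V &
   rst M (topspace (spc M)) (topspace (spc M) - C) \<beta> = 0[sec M (topspace (spc M) - C)] &
   unit_near M x (topspace (spc M)) \<beta>"
proof -
 note W = V(1,3)
 let ?p = "u x" and ?X = "topspace (spc M)"
 have p: "?p : u ` V" using V(2) by simp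
 obtain \<epsilon> where \<epsilon>: "\<epsilon> > 0" "cube a ?p \<epsilon> <= u ` V" using cube_exists[OF img(1)[OF W] p] by blast
 \<comment> \<open>Half the radius, so that the closed cube \<open>K\<close> which carries the bump
   function still lies inside the chart.\<close>
 define d where "d = \<epsilon> / 2"
 have d: "0 < d" "d < \<epsilon>" using \<epsilon>(1) by (auto simp: d_def)
 define K where "K = {z : topspace (Euclidean_space a). \<forall>i<a. \<bar>z i - ?p i\<bar> \<le> d}"
 have K: "K <= u ` V" using \<epsilon>(2) d unfolding K_def cube_def by force
 \<comment> \<open>\<open>K\<close> is a product of compact intervals in the first \<open>a\<close>
   coordinates and of the point 0 in all others, hence compact by Tychonoff's theorem.\<close>
 have "compactin (powertop_real UNIV) (Pi\<^sub>E UNIV (%i. if i < a then {?p i - d..?p i + d} else {0}))"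
  unfolding compactin_PiE by auto
 moreover have "Pi\<^sub>E UNIV (%i. if i < a then {?p i - d..?p i + d} else {0}) = K"
 proof (intro equalityI subsetI)
  fix z assume z: "z : Pi\<^sub>E UNIV (%i. if i < a then {?p i - d..?p i + d} else {0})"
  have "\<bar>z i - ?p i\<bar> \<le> d" if "i < a" for i using PiE_mem[OF z, of i] that by (auto simp: abs_le_iff)
  moreover have "z i = 0" if "i \<ge> a" for i using PiE_mem[OF z, of i] that by simp
  ultimately show "z : K" by (simp add: K_def topspace_Euclidean_space)
 next
  fix z assume "z : K"
  then have "z i : (if i < a then {?p i - d..?p i + d} else {0})" for i
   by (cases "i < a") (auto simp: K_def topspace_Euclidean_space abs_le_iff)
  then show "z : Pi\<^sub>E UNIV (%i. if i < a then {?p i - d..?p i + d} else {0})" by auto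
 qed
 ultimately have "compactin (Euclidean_space a) K"
  unfolding Euclidean_space_def compactin_subtopology by (auto simp: K_def topspace_Euclidean_space)
 then have cK: "compactin (subtopology (Euclidean_space a) U') K"
  using K img(2)[OF W] unfolding compactin_subtopology by auto
 obtain w where w: "homeomorphic_maps (subtopology (spc M) U0) (subtopology (Euclidean_space a) U') u w"
  using homeo homeomorphic_map_maps by blast
 define C where "C = w ` K"
 have wu: "w (u z) = z" if "z : U0" for z using w that topspaces unfolding homeomorphic_maps_def by auto
 have "compactin (subtopology (spc M) U0) C"
  unfolding C_def using image_compactin[OF cK] w unfolding homeomorphic_maps_def by blast
 then have "compactin (spc M) C" by (simp add: compactin_subtopology)
 then have C: "closedin (spc M) C" by (rule compactin_imp_closedin[OF H])
 have CV: "C <= V"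
 proof
  fix z assume "z : C"
  then obtain y where "y : K" "z = w y" by (auto simp: C_def)
  then obtain v where "v : V" "y = u v" using K by auto
  then show "z : V" using wu W \<open>z = w y\<close> by auto
 qed
 have uC: "u z : K ==> z : C" if "z : U0" for z using wu[OF that] unfolding C_def by (metis imageI)
 let ?A = "superfunctions a b (u ` V)"
 define s where "s = (%(I::nat set) z. if I = {} & z : u ` V then bump a ?p d z else 0)"
 have "smooth_on a (u ` V) (s I)" for I
 proof -
  have "smooth_on a (u ` V) (%z. if I = {} then bump a ?p d z else 0)"
   using smooth_on_bump[OF img(1)[OF W], of ?p d] smooth_on_const[OF img(1)[OF W], of 0] by (cases "I = {}") simp_all
  then show ?thesis by (rule smooth_on_cong[OF img(1)[OF W], THEN iffD1, rotated]) (simp add: s_def)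
 qed
 then have s: "s : part ?A False" by (auto simp: sf_part sf_carrier s_def)
 interpret pl: superalg_hom ?A "sec M V" "pull \<phi> (u ` V)" using pull_hom[OF W] .
 define \<beta>0 where "\<beta>0 = pull \<phi> (u ` V) s"
 have \<beta>0: "\<beta>0 : Part M V False" unfolding \<beta>0_def by (rule pl.parity[OF s])
 have oC: "opn (?X - C)" using C by (rule openin_diff[OF openin_topspace])
 let ?VC = "V Int (?X - C)"
 have o2: "opn ?VC" "?VC <= V" "?VC <= ?X - C" using W(1) oC by auto
 have z0: "rst M V ?VC \<beta>0 = 0[sec M ?VC]"
 proof -
  have "rst E (u ` V) (u ` ?VC) s = 0[superfunctions a b (u ` ?VC)]"
  proof (intro ext)
   fix I y
   have "bump a ?p d y = 0" if y: "y : u ` ?VC"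
   proof -
    obtain v where v: "v : V" "v \<notin> C" "y = u v" using y by auto
    then have "y \<notin> K" using uC[of v] W by auto
    moreover have "y : topspace (Euclidean_space a)" using v openin_subset[OF img(1)[OF W]] by auto
    ultimately obtain i where "i < a" "\<not> \<bar>y i - ?p i\<bar> \<le> d" by (auto simp: K_def)
    then show ?thesis using bump_zero[OF d(1), of i a y ?p] by simp
   qed
   then show "rst E (u ` V) (u ` ?VC) s I y = 0[superfunctions a b (u ` ?VC)] I y"
    by (simp add: s_def sf_simps)
  qed
  moreover have "?VC <= U0" using o2 W by auto
  ultimately show ?thesis
   unfolding \<beta>0_def using pull_rst[OF W o2(1,2) pl.A.part_closed[OF s]] superalg_hom.zero[OF pull_hom[OF o2(1)]]
   by simp
 qed
 define S where "S = (%Q. if Q = V then \<beta>0 else 0[sec M Q])"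
 have cov: "\<Union>{V, ?X - C} = ?X" using CV openin_subset[OF W(1)] by auto
 have zr: "rst M Q Q' 0[sec M Q] = 0[sec M Q']" if "opn Q" "opn Q'" "Q' <= Q" for Q Q'
  using superalg_hom.zero[OF rst[OF that]] .
 have "\<exists>f\<in>Sec M (\<Union>{V, ?X - C}). \<forall>Q\<in>{V, ?X - C}. rst M (\<Union>{V, ?X - C}) Q f = S Q"
 proof (rule glue)
  fix Q assume Q: "Q : {V, ?X - C}"
  show o: "opn Q" using Q W oC by auto
  interpret q: superalg "sec M Q" using alg[OF o] .
  show "S Q : Sec M Q" using pl.B.part_closed[OF \<beta>0] by (simp add: S_def)
  fix Q' assume Q': "Q' : {V, ?X - C}"
  show "rst M Q (Q Int Q') (S Q) = rst M Q' (Q Int Q') (S Q')"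
  proof (cases "Q = Q'")
   case False
   have vc: "(?X - C) Int V = ?VC" by auto
   have z1: "rst M (?X - C) ?VC 0[sec M (?X - C)] = 0[sec M ?VC]" by (rule zr[OF oC o2(1,3)])
   from False Q Q' consider "Q = V" "Q' = ?X - C" | "Q' = V" "Q = ?X - C" by auto
   then show ?thesis
   proof cases
    case 1
    then have "S Q = \<beta>0" "S Q' = 0[sec M (?X - C)]" using False by (auto simp: S_def)
    then show ?thesis using 1 z0 z1 by simp
   next
    case 2
    then have "S Q' = \<beta>0" "S Q = 0[sec M (?X - C)]" using False by (auto simp: S_def)
    then show ?thesis using 2 z0 z1 vc by simp
   qed
  qed simp
 qed
 then obtain \<beta> where \<beta>: "\<beta> : Sec M ?X" "rst M ?X V \<beta> = \<beta>0" "rst M ?X (?X - C) \<beta> = S (?X - C)"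
  unfolding cov by (auto simp: S_def)
 have oX: "opn ?X" by simp
 \<comment> \<open>The two sets of the cover may coincide. Then \<open>S\<close> assigns
   \<open>\<beta>0\<close> to both, which is zero there by \<open>z0\<close>.\<close>
 have vz: "rst M ?X (?X - C) \<beta> = 0[sec M (?X - C)]"
 proof (cases "?X - C = V")
  case True
  then have "?VC = V" by auto
  then have "\<beta>0 = 0[sec M V]" using z0 W pl.B.part_closed[OF \<beta>0] by simp
  then show ?thesis using \<beta>(3) True by (simp add: S_def)
 qed (use \<beta>(3) in \<open>simp add: S_def\<close>)
 have "\<beta> : Part M ?X False"
 proof (rule part_local[OF oX \<beta>(1)])
  fix z assume "z : ?X"
  then consider "z : V" | "z : ?X - C" using CV by auto
  then show "\<exists>Q. opn Q & z : Q & Q <= ?X & rst M ?X Q \<beta> : Part M Q False"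
  proof cases
   case 1
   then show ?thesis using W \<beta>(2) \<beta>0 openin_subset[OF W(1)] by auto
  next
   case 2
   then show ?thesis using oC vz superalg.part_zero[OF alg[OF oC]] by (intro exI[of _ "?X - C"]) auto
  qed
 qed
 moreover have "unit_near M x ?X \<beta>"
 proof -
  have xU: "x : U0" using V by auto
  have "ev x V \<beta>0 {} = bump a ?p d ?p"
   using ev_sub[OF W, of \<beta>0 x "{}"] \<tau>_pull[OF W, of s] s p pl.B.part_closed[OF \<beta>0]
   by (simp add: \<beta>0_def s_def pl.A.part_closed)
  then have "ev x V (rst M ?X V \<beta>) {} \<noteq> 0" using bump_pos[OF d(1)] \<beta>(2) by simp
  then have "ev x ?X \<beta> {} \<noteq> 0"
   using evalat_rst[OF evalat_chart[OF xU] oX _ W(1) V(2) _ \<beta>(1)] V openin_subset[OF W(1)] by auto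
  then show ?thesis
   using evalat_unit[OF evalat_chart[OF xU] oX _ \<beta>(1)] V openin_subset[OF W(1)] by auto
 qed
 ultimately show ?thesis using C CV vz by blast
qed

end

text \<open>The chart condition by itself; the Hausdorff property is assumed separately where bump
  functions are constructed.\<close>

definition locally_super :: "nat => nat => ('p, 's) superspace => bool" where
 "locally_super a b M \<longleftrightarrow> superringed_space M &
   (\<forall>x\<in>topspace (spc M). \<exists>U U' \<phi>. x : U & is_chart a b M U U' \<phi>)"

lemma supermanifold_locally_super: "supermanifold a b M ==> locally_super a b M"
 unfolding supermanifold_def locally_super_def is_chart_def by blast

lemma locally_super_euclidean: "locally_super a b (super_euclidean a b)"
proof -
 let ?E = "super_euclidean a b" and ?X = "topspace (Euclidean_space a)"
 have pre: "preim (srestrict ?E ?X) smor_id V = V" if "openin (Euclidean_space a) V" for V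
  using openin_subset[OF that] by (auto simp: preim_def smor_id_def)
 have "smor_iso (srestrict ?E ?X) (srestrict ?E ?X) smor_id"
  unfolding smor_iso_def smorphism_def srestrict_simps se_simps smor_id_simps
  by (auto simp: pre superalgebra_hom_def ring_hom_def bij_betw_def inj_on_def
    homeomorphic_map_id[unfolded id_def])
 then have "is_chart a b ?E ?X ?X smor_id" by (simp add: is_chart_def)
 then show ?thesis unfolding locally_super_def using superringed_super_euclidean by auto
qed

lemma locally_super_has_evals: "locally_super a b M ==> has_evals b M"
 unfolding has_evals_def
proof
 fix x assume M: "locally_super a b M" and "x : topspace (spc M)"
 then obtain U U' \<phi> where U: "x : U" "is_chart a b M U U' \<phi>" unfolding locally_super_def by blast
 interpret chart M a b U U' \<phi> by unfold_locales (use M U in \<open>auto simp: locally_super_def\<close>)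
 show "\<exists>U e. x : U & evals b M U e" using evals_chart U by blast
qed

lemma locally_super_coords:
 assumes M: "locally_super a b M" and V: "oset M V" "x : V"
 shows "\<exists>U y e. oset M U & x : U & U <= V & good_coords a b M U y e &
   coordinate_fields a b M U y (%i. normal_der M U (e i))"
proof -
 obtain U U' \<phi> where U: "x : U" "is_chart a b M U U' \<phi>"
  using M V openin_subset[OF V(1)] unfolding locally_super_def by blast
 interpret chart M a b U U' \<phi> by unfold_locales (use M U in \<open>auto simp: locally_super_def\<close>)
 have W: "opn (V Int U)" "V Int U <= U" using V U0 by auto
 show ?thesis using good_coords_crd[OF W] coordinate_fields_crd[OF W] W V U by blast
qed

lemma locally_super_bump:
 assumes M: "locally_super a b M" and H: "Hausdorff_space (spc M)" and V: "oset M V" "x : V"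
 shows "\<exists>\<beta> C. \<beta> : Part M (topspace (spc M)) False & closedin (spc M) C & C <= V &
   rst M (topspace (spc M)) (topspace (spc M) - C) \<beta> = 0[sec M (topspace (spc M) - C)] &
   unit_near M x (topspace (spc M)) \<beta>"
proof -
 obtain U U' \<phi> where U: "x : U" "is_chart a b M U U' \<phi>"
  using M V openin_subset[OF V(1)] unfolding locally_super_def by blast
 interpret chart M a b U U' \<phi> by unfold_locales (use M U in \<open>auto simp: locally_super_def\<close>)
 have W: "opn (V Int U)" "x : V Int U" "V Int U <= U" using V U0 U by auto
 show ?thesis using bump[OF H W] by blast
qed

section \<open>Sheaves of derivations\<close>

lemma normal_der_apply:
 "oset N V ==> V <= U ==> g : Sec N V ==> normal_der N U D V g = D V g"
 by (simp add: normal_der_def)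

lemma normal_der_cong:
 "(\<And>V g. oset N V ==> V <= U ==> g : Sec N V ==> D V g = E V g) ==>
  normal_der N U D = normal_der N U E"
 by (auto simp: normal_der_def intro!: ext)

lemma normal_der_idem: "normal_der N U (normal_der N U D) = normal_der N U D"
 by (auto simp: normal_der_def intro!: ext)

lemma normal_der_eqI:
 assumes "normal_der N U D = D" "normal_der N U E = E"
  and "\<And>V g. oset N V ==> V <= U ==> g : Sec N V ==> D V g = E V g"
 shows "D = E"
 using normal_der_cong[of N U D E, OF assms(3)] assms(1,2) by simp

lemma gder_mono: "gder N W U S h D ==> U' <= U ==> gder N W U' S h D"
 unfolding gder_def using lder_mono by (metis order_trans)

lemma gder_cong:
 "gder N W U S h D ==> (\<And>V g. oset N V ==> V <= U ==> g : Sec N V ==> E V g = D V g) ==>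
  gder N W U S h E"
 unfolding gder_def by metis

lemma gder_cong_S:
 assumes D: "gder N W U S h D"
  and S: "\<And>V. oset N V ==> V <= U ==> S' V = S V"
  and h: "\<And>V g. oset N V ==> V <= U ==> g : Sec N V ==> h' V g = h V g"
  and N: "superringed_space N"
 shows "gder N W U S' h' D"
proof -
 obtain D0 D1 where D0: "lder N W U S h False D0" and D1: "lder N W U S h True D1"
  and eq: "\<And>V f. oset N V ==> V <= U ==> f : Sec N V ==> D V f = D0 V f +[sec W (S V)] D1 V f"
  using D unfolding gder_def by blast
 show ?thesis
  unfolding gder_def
 proof (intro exI conjI allI impI)
  show "lder N W U S' h' False D0" by (rule lder_cong_S[OF D0 S h N])
  show "lder N W U S' h' True D1" by (rule lder_cong_S[OF D1 S h N])
  show "D V f = D0 V f +[sec W (S' V)] D1 V f"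
   if "oset N V & V <= U & f : Sec N V" for V f
   using that eq[of V f] S[of V] by simp
 qed
qed

context lmor begin

lemma gder_lder: "lder N W U S h p D ==> gder N W U S h D"
proof -
 assume D: "lder N W U S h p D"
 have c: "D V f = D V f +[sec W (S V)] 0[sec W (S V)]" "D V f = 0[sec W (S V)] +[sec W (S V)] D V f"
  if "oset N V" "V <= U" "f : Sec N V" for V f
 proof -
  interpret superalg_hom "sec N V" "sec W (S V)" "h V" using hh[OF that(1,2)] .
  show "D V f = D V f +[sec W (S V)] 0[sec W (S V)]" "D V f = 0[sec W (S V)] +[sec W (S V)] D V f"
   using lder_closed[OF D that] by simp_all
 qed
 show ?thesis
 proof (cases p)
  case True
  show ?thesis
   unfolding gder_def
   by (intro exI[of _ "%V g. 0[sec W (S V)]"] exI[of _ D] conjI allI impI lder_zero)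
    (use D True c in simp_all)
 next
  case False
  show ?thesis
   unfolding gder_def
   by (intro exI[of _ D] exI[of _ "%V g. 0[sec W (S V)]"] conjI allI impI lder_zero)
    (use D False c in simp_all)
 qed
qed

lemma
 assumes D: "gder N W U S h D" and V: "oset N V" "V <= U" and f: "f : Sec N V"
 shows gder_closed: "D V f : Sec W (S V)"
  and gder_add_arg: "g : Sec N V ==> D V (f +[sec N V] g) = D V f +[sec W (S V)] D V g"
  and gder_minus_arg: "g : Sec N V ==> D V (f -[sec N V] g) = D V f -[sec W (S V)] D V g"
  and gder_zero_arg: "D V 0[sec N V] = 0[sec W (S V)]"
  and gder_rst: "oset N V' ==> V' <= V ==> D V' (rst N V V' f) = rst W (S V) (S V') (D V f)"
proof -
 obtain D0 D1 where D0: "lder N W U S h False D0" and D1: "lder N W U S h True D1"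
  and eq: "\<And>V f. oset N V ==> V <= U ==> f : Sec N V ==> D V f = D0 V f +[sec W (S V)] D1 V f"
  using D unfolding gder_def by blast
 interpret superalg_hom "sec N V" "sec W (S V)" "h V" using hh[OF V] .
 note c0 = lder_closed[OF D0 V] and c1 = lder_closed[OF D1 V]
 show cl: "D V f : Sec W (S V)" using eq[OF V f] c0 c1 f by simp
 show add': "D V (f +[sec N V] g) = D V f +[sec W (S V)] D V g" if g: "g : Sec N V" for g
  unfolding eq[OF V f] eq[OF V g] eq[OF V A.a_closed[OF f g]] lder_add[OF D0 V f g] lder_add[OF D1 V f g]
  using c0[OF f] c1[OF f] c0[OF g] c1[OF g] by (simp add: B.a_ac)
 show z: "D V 0[sec N V] = 0[sec W (S V)]"
  using eq[OF V A.zero_closed] lder_zero_arg[OF D0 V] lder_zero_arg[OF D1 V] by simp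
 show "D V (f -[sec N V] g) = D V f -[sec W (S V)] D V g" if g: "g : Sec N V"
  unfolding eq[OF V f] eq[OF V g] eq[OF V A.minus_closed[OF f g]] lder_minus_arg[OF D0 V f g] lder_minus_arg[OF D1 V f g]
  using c0[OF f] c1[OF f] c0[OF g] c1[OF g] by (simp add: a_minus_def B.minus_add B.a_ac)
 show "D V' (rst N V V' f) = rst W (S V) (S V') (D V f)" if V': "oset N V'" "V' <= V"
 proof -
  have V'U: "V' <= U" using V V' by auto
  interpret r: superalg_hom "sec W (S V)" "sec W (S V')" "rst W (S V) (S V')"
   by (rule W.rst[OF S_open[OF V] S_open[OF V'(1) V'U] S_mono[OF V V']])
  show ?thesis
   unfolding eq[OF V f] eq[OF V'(1) V'U N.rst_closed[OF V(1) V' f]] lder_rst[OF D0 V V' f] lder_rst[OF D1 V V' f]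
   using r.add c0[OF f] c1[OF f] by simp
 qed
qed

lemma gder_plus:
 assumes D: "gder N W U S h D" and E: "gder N W U S h E"
 shows "gder N W U S h (%V g. D V g +[sec W (S V)] E V g)"
proof -
 obtain D0 D1 where D0: "lder N W U S h False D0" and D1: "lder N W U S h True D1"
  and eq: "\<And>V f. oset N V ==> V <= U ==> f : Sec N V ==> D V f = D0 V f +[sec W (S V)] D1 V f"
  using D unfolding gder_def by blast
 obtain E0 E1 where E0: "lder N W U S h False E0" and E1: "lder N W U S h True E1"
  and eq': "\<And>V f. oset N V ==> V <= U ==> f : Sec N V ==> E V f = E0 V f +[sec W (S V)] E1 V f"
  using E unfolding gder_def by blast
 show ?thesis
  unfolding gder_def
 proof (intro exI conjI allI impI)
  show "lder N W U S h False (%V g. D0 V g +[sec W (S V)] E0 V g)" by (rule lder_plus[OF D0 E0])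
  show "lder N W U S h True (%V g. D1 V g +[sec W (S V)] E1 V g)" by (rule lder_plus[OF D1 E1])
  fix V f assume *: "oset N V & V <= U & f : Sec N V"
  then have V: "oset N V" "V <= U" and f: "f : Sec N V" by auto
  interpret superalg_hom "sec N V" "sec W (S V)" "h V" using hh[OF V] .
  show "D V f +[sec W (S V)] E V f =
    D0 V f +[sec W (S V)] E0 V f +[sec W (S V)] (D1 V f +[sec W (S V)] E1 V f)"
   unfolding eq[OF V f] eq'[OF V f]
   using lder_closed[OF D0 V f] lder_closed[OF D1 V f] lder_closed[OF E0 V f] lder_closed[OF E1 V f]
   by (simp add: B.a_ac)
 qed
qed

text \<open>Splitting both \<open>c\<close> and \<open>D\<close> into homogeneous parts leaves four
  products, to which \<open>lder_scale\<close> applies.\<close>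

lemma gder_scale:
 assumes D: "gder N W U S h D" and c: "c : Sec W (S U)"
 shows "gder N W U S h (%V g. rst W (S U) (S V) c *[sec W (S V)] D V g)"
proof -
 interpret B: superalg "sec W (S U)" using W.alg[OF S_open[OF U_open order_refl]] .
 obtain D0 D1 where D0: "lder N W U S h False D0" and D1: "lder N W U S h True D1"
  and eq: "\<And>V f. oset N V ==> V <= U ==> f : Sec N V ==> D V f = D0 V f +[sec W (S V)] D1 V f"
  using D unfolding gder_def by blast
 obtain c0 c1 where c01: "c0 : Part W (S U) False" "c1 : Part W (S U) True" "c = c0 +[sec W (S U)] c1"
  using B.decomp[OF c] .
 have "gder N W U S h (%V g. (rst W (S U) (S V) c0 *[sec W (S V)] D0 V g +[sec W (S V)]
   rst W (S U) (S V) c0 *[sec W (S V)] D1 V g) +[sec W (S V)]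
   (rst W (S U) (S V) c1 *[sec W (S V)] D0 V g +[sec W (S V)] rst W (S U) (S V) c1 *[sec W (S V)] D1 V g))"
  by (rule gder_plus[OF gder_plus[OF gder_lder[OF lder_scale[OF D0 c01(1)]] gder_lder[OF lder_scale[OF D1 c01(1)]]]
    gder_plus[OF gder_lder[OF lder_scale[OF D0 c01(2)]] gder_lder[OF lder_scale[OF D1 c01(2)]]]])
 then show ?thesis
 proof (rule gder_cong)
  fix V f assume V: "oset N V" "V <= U" and f: "f : Sec N V"
  interpret r: superalg_hom "sec W (S U)" "sec W (S V)" "rst W (S U) (S V)"
   by (rule W.rst[OF S_open[OF U_open order_refl] S_open[OF V] S_mono[OF U_open order_refl V]])
  have rc: "rst W (S U) (S V) c0 : Sec W (S V)" "rst W (S U) (S V) c1 : Sec W (S V)"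
   using c01 by (auto simp: B.part_closed)
  show "rst W (S U) (S V) c *[sec W (S V)] D V f =
   (rst W (S U) (S V) c0 *[sec W (S V)] D0 V f +[sec W (S V)]
   rst W (S U) (S V) c0 *[sec W (S V)] D1 V f) +[sec W (S V)]
   (rst W (S U) (S V) c1 *[sec W (S V)] D0 V f +[sec W (S V)] rst W (S U) (S V) c1 *[sec W (S V)] D1 V f)"
   unfolding eq[OF V f] c01(3) r.add[OF B.part_closed[OF c01(1)] B.part_closed[OF c01(2)]]
   using rc lder_closed[OF D0 V f] lder_closed[OF D1 V f] by (simp add: r.B.l_distr r.B.r_distr r.B.a_ac)
 qed
qed

end

lemma gder_comp_pre:
 assumes N: "superringed_space N" "superringed_space M"
  and 1: "shmor N M U S1 u1 h1" and S: "S1 U <= Q" and D: "gder M W Q S2 h2 D"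
 shows "gder N W U (%V. S2 (S1 V)) (%V f. h2 (S1 V) (h1 V f)) (%V f. D (S1 V) (h1 V f))"
proof -
 interpret N: sspace N using N(1) by unfold_locales
 interpret M: sspace M using N(2) by unfold_locales
 interpret lmor N M U S1 u1 h1 using 1 by unfold_locales
 obtain D0 D1 where D0: "lder M W Q S2 h2 False D0" and D1: "lder M W Q S2 h2 True D1"
  and eq: "\<And>V f. oset M V ==> V <= Q ==> f : Sec M V ==> D V f = D0 V f +[sec W (S2 V)] D1 V f"
  using D unfolding gder_def by blast
 show ?thesis
  unfolding gder_def
 proof (intro exI conjI allI impI)
  show "lder N W U (%V. S2 (S1 V)) (%V f. h2 (S1 V) (h1 V f)) False (%V f. D0 (S1 V) (h1 V f))"
   by (rule lder_comp_pre[OF N 1 S D0])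
  show "lder N W U (%V. S2 (S1 V)) (%V f. h2 (S1 V) (h1 V f)) True (%V f. D1 (S1 V) (h1 V f))"
   by (rule lder_comp_pre[OF N 1 S D1])
  fix V f assume *: "oset N V & V <= U & f : Sec N V"
  then have V: "oset N V" "V <= U" and f: "f : Sec N V" by auto
  show "D (S1 V) (h1 V f) = D0 (S1 V) (h1 V f) +[sec W (S2 (S1 V))] D1 (S1 V) (h1 V f)"
   by (rule eq[OF S_open[OF V] order_trans[OF S_mono[OF U_open order_refl V] S] superalg_hom.closed[OF hh[OF V] f]])
 qed
qed

lemma der_simps:
 "mspc (der_sheaf N M \<psi>) = spc N" "mbase (der_sheaf N M \<psi>) U = sec M (preim M \<psi> U)"
 "mrst (der_sheaf N M \<psi>) U U' D = normal_der N U' D"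
 "part (msec (der_sheaf N M \<psi>) U) = homogeneous_ders N M \<psi> U"
 "D +[msec (der_sheaf N M \<psi>) U] E = normal_der N U (%V g. D V g +[sec M (preim M \<psi> V)] E V g)"
 "0[msec (der_sheaf N M \<psi>) U] = normal_der N U (%V g. 0[sec M (preim M \<psi> V)])"
 "c \<odot>[msec (der_sheaf N M \<psi>) U] D = normal_der N U (%V g.
   rst M (preim M \<psi> U) (preim M \<psi> V) c *[sec M (preim M \<psi> V)] D V g)"
 by (simp_all add: der_sheaf_def Let_def)

text \<open>Separates the normalization of a section of the sheaf from its content, so that the
  calculus of \<open>gder\<close> applies and \<open>normal_der_eqI\<close> settles
  equality.\<close>

lemma der_carrier_iff:
 assumes N: "superringed_space N"
 shows "D : carrier (msec (der_sheaf N M \<psi>) U) \<longleftrightarrow>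
  normal_der N U D = D & gder N M U (preim M \<psi>) (pull \<psi>) D"
proof
 assume "D : carrier (msec (der_sheaf N M \<psi>) U)"
 then obtain D0 D1 where D: "D = normal_der N U (%V g. D0 V g +[sec M (preim M \<psi> V)] D1 V g)"
  "D0 : homogeneous_ders N M \<psi> U False" "D1 : homogeneous_ders N M \<psi> U True"
  by (auto simp: der_sheaf_def Let_def)
 have "normal_der N U D = D" unfolding D(1) by (rule normal_der_idem)
 moreover have "gder N M U (preim M \<psi>) (pull \<psi>) D"
  unfolding gder_def
  by (intro exI[of _ D0] exI[of _ D1] conjI allI impI)
   (use D(2,3) in \<open>simp_all add: homogeneous_ders_iff D(1) normal_der_apply\<close>)
 ultimately show "normal_der N U D = D & gder N M U (preim M \<psi>) (pull \<psi>) D" ..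
next
 assume D: "normal_der N U D = D & gder N M U (preim M \<psi>) (pull \<psi>) D"
 then obtain D0 D1 where D0: "lder N M U (preim M \<psi>) (pull \<psi>) False D0" and D1: "lder N M U (preim M \<psi>) (pull \<psi>) True D1"
  and eq: "\<And>V f. oset N V ==> V <= U ==> f : Sec N V ==> D V f = D0 V f +[sec M (preim M \<psi> V)] D1 V f"
  unfolding gder_def by blast
 have h: "normal_der N U D0 : homogeneous_ders N M \<psi> U False" "normal_der N U D1 : homogeneous_ders N M \<psi> U True"
  unfolding homogeneous_ders_iff
  using lder_cong[OF _ N D0, of "normal_der N U D0"] lder_cong[OF _ N D1, of "normal_der N U D1"]
  by (simp_all add: normal_der_idem normal_der_apply)
 have "D = normal_der N U (%V g. normal_der N U D0 V g +[sec M (preim M \<psi> V)] normal_der N U D1 V g)"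
  by (rule trans[OF conjunct1[OF D, symmetric]], rule normal_der_cong) (simp add: eq normal_der_apply)
 then show "D : carrier (msec (der_sheaf N M \<psi>) U)"
  using h by (auto simp: der_sheaf_def Let_def)
qed

text \<open>A map into the parity change is additive and satisfies P(c v) = \<open>grade_inv\<close>
  c P(v), by the twisted action in \<open>parity_change\<close>. Hence it is known on
  \<open>X\<close> as soon as it is known on the \<open>F i\<close>.\<close>

lemma even_hom_expand:
 assumes N: "superringed_space N" and M: "superringed_space M" and \<psi>: "smorphism M N \<psi>"
  and P: "even_sheaf_hom (der_sheaf N M \<psi>) (parity_change_sheaf (der_sheaf N M \<psi>)) P"
  and U: "oset N U"
  and c: "\<And>i. i < k ==> c i : Sec M (preim M \<psi> U)"
  and F: "\<And>i. i < k ==> F i : carrier (msec (der_sheaf N M \<psi>) U)"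
  and X: "normal_der N U X = X"
  and eq: "\<And>V g. oset N V ==> V <= U ==> g : Sec N V ==>
   X V g = rsum (sec M (preim M \<psi> V)) (%i. rst M (preim M \<psi> U) (preim M \<psi> V) (c i) *[sec M (preim M \<psi> V)] F i V g) k"
  and V: "oset N V" "V <= U" "g : Sec N V"
 shows "P U X V g = rsum (sec M (preim M \<psi> V)) (%i. rst M (preim M \<psi> U) (preim M \<psi> V)
   (grade_inv (sec M (preim M \<psi> U)) (c i)) *[sec M (preim M \<psi> V)] P U (F i) V g) k"
proof -
 interpret N: sspace N using N by unfold_locales
 interpret M: sspace M using M by unfold_locales
 interpret lmor N M U "preim M \<psi>" "umap \<psi>" "pull \<psi>"
  using shmor_smorphism[OF \<psi> U] by unfold_locales
 let ?T = "msec (der_sheaf N M \<psi>) U" and ?A = "sec M (preim M \<psi> U)"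
 interpret A: superalg ?A using M.alg[OF S_open[OF U order_refl]] .
 note carr = der_carrier_iff[OF N, of _ M \<psi> U]
 have P': "\<And>v. v : carrier ?T ==> P U v : carrier ?T"
  "\<And>v w. v : carrier ?T ==> w : carrier ?T ==> P U (v +[?T] w) = P U v +[?T] P U w"
  "\<And>f v. f : carrier ?A ==> v : carrier ?T ==> P U (f \<odot>[?T] v) = grade_inv ?A f \<odot>[?T] P U v"
  using P U unfolding even_sheaf_hom_def by (auto simp: der_simps parity_change_sheaf_def parity_change_def)
 have add: "v +[?T] w : carrier ?T" if "v : carrier ?T" "w : carrier ?T" for v w
  using that gder_plus gder_cong[OF gder_plus, of v w] unfolding carr der_simps
  by (auto simp: normal_der_idem normal_der_apply)
 have scale: "f \<odot>[?T] v : carrier ?T" if "f : carrier ?A" "v : carrier ?T" for f v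
  using that gder_cong[OF gder_scale, of v f] unfolding carr der_simps
  by (auto simp: normal_der_idem normal_der_apply)
 have zero: "0[?T] : carrier ?T"
  using gder_cong[OF gder_lder[OF lder_zero]] unfolding carr der_simps
  by (auto simp: normal_der_idem normal_der_apply)
 have null: "0[?A] \<odot>[?T] v = 0[?T]" if v: "v : carrier ?T" for v
  unfolding der_simps
 proof (rule normal_der_cong)
  fix V g assume V: "oset N V" "V <= U" and g: "g : Sec N V"
  interpret r: superalg_hom ?A "sec M (preim M \<psi> V)" "rst M (preim M \<psi> U) (preim M \<psi> V)"
   by (rule M.rst[OF S_open[OF U order_refl] S_open[OF V] S_mono[OF U order_refl V]])
  show "rst M (preim M \<psi> U) (preim M \<psi> V) 0[?A] *[sec M (preim M \<psi> V)] v V g = 0[sec M (preim M \<psi> V)]"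
   using gder_closed[OF _ V g, of v] v unfolding carr by (simp add: r.zero)
 qed
 \<comment> \<open>From linearity with the coefficient 0 rather than from additivity, which would
   require cancellation in the module.\<close>
 have Pz: "P U 0[?T] = 0[?T]"
  using P'(3)[OF A.zero_closed zero] null[OF zero] null[OF P'(1)[OF zero]] by simp
 have ev: "(rsum ?T G l) V g = rsum (sec M (preim M \<psi> V)) (%i. G i V g) l"
  if "oset N V" "V <= U" "g : Sec N V" for G l V g
  by (induction l) (simp_all add: der_simps normal_der_apply[OF that])
 have nr: "normal_der N U (rsum ?T G l) = rsum ?T G l" for G l
  by (cases l) (simp_all add: der_simps normal_der_idem)
 have "X = rsum ?T (%i. c i \<odot>[?T] F i) k"
 proof (rule normal_der_eqI[OF X nr])
  fix V g assume V: "oset N V" "V <= U" "g : Sec N V"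
  show "X V g = rsum ?T (%i. c i \<odot>[?T] F i) k V g"
   unfolding ev[OF V] eq[OF V] by (simp add: der_simps normal_der_apply[OF V])
 qed
 then have "P U X = P U (rsum ?T (%i. c i \<odot>[?T] F i) k)" by simp
 also have "\<dots> = rsum ?T (%i. P U (c i \<odot>[?T] F i)) k"
  by (rule rsum_additive[of "P U" ?T ?T "carrier ?T"]) (use Pz P'(2) zero add scale c F in auto)
 also have "\<dots> = rsum ?T (%i. grade_inv ?A (c i) \<odot>[?T] P U (F i)) k"
  by (rule rsum_cong) (use P'(3) c F in auto)
 finally show ?thesis unfolding ev[OF V, symmetric] by (simp add: ev[OF V] der_simps normal_der_apply[OF V])
qed

lemma smorphism_id: "superringed_space M ==> smorphism M M smor_id"
proof -
 assume M: "superringed_space M"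
 have p: "preim M smor_id V = V" if "oset M V" for V using preim_smor_id[OF openin_subset[OF that]] .
 show ?thesis
  unfolding smorphism_def smor_id_simps by (auto simp: p superalgebra_hom_def ring_hom_def)
qed

section \<open>Vector fields and their \<Pi>-symmetries\<close>

abbreviation vfields :: "('p, 's) superspace => 'p set => ('p, 's, 's) sder set" where
 "vfields M U \<equiv> carrier (msec (tangent_sheaf M) U)"

lemma vfields_iff:
 assumes M: "superringed_space M"
 shows "X : vfields M U \<longleftrightarrow> normal_der M U X = X & gder M M U (%V. V) (%V f. f) X"
proof -
 have p: "preim M smor_id V = V" if "oset M V" for V using preim_smor_id[OF openin_subset[OF that]] .
 have "gder M M U (preim M smor_id) (pull smor_id) X \<longleftrightarrow> gder M M U (%V. V) (%V f. f) X"
  using gder_cong_S[where S' = "%V. V" and h' = "%V f. f" and S = "preim M smor_id" and h = "pull smor_id" and D = X, OF _ _ _ M]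
   gder_cong_S[where S = "%V. V" and h = "%V f. f" and S' = "preim M smor_id" and h' = "pull smor_id" and D = X, OF _ _ _ M]
   p by (auto simp: smor_id_simps)
 then show ?thesis unfolding tangent_sheaf_def der_carrier_iff[OF M] by simp
qed

lemma hom_vfields_iff:
 assumes M: "superringed_space M"
 shows "X : tpart M U p \<longleftrightarrow> normal_der M U X = X & lder M M U (%V. V) (%V f. f) p X"
proof -
 have p: "preim M smor_id V = V" if "oset M V" for V using preim_smor_id[OF openin_subset[OF that]] .
 have "lder M M U (preim M smor_id) (pull smor_id) p X \<longleftrightarrow> lder M M U (%V. V) (%V f. f) p X"
  using lder_cong_S[where S' = "%V. V" and h' = "%V f. f" and S = "preim M smor_id" and h = "pull smor_id" and D = X, OF _ _ _ M]
   lder_cong_S[where S = "%V. V" and h = "%V f. f" and S' = "preim M smor_id" and h' = "pull smor_id" and D = X, OF _ _ _ M]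
   p by (auto simp: smor_id_simps)
 then show ?thesis unfolding tangent_sheaf_def der_simps homogeneous_ders_iff by simp
qed

locale pisym = sspace M for M :: "('p, 's) superspace" +
 fixes P assumes Pi: "Pi_symmetry (tangent_sheaf M) P"
begin

lemma pre_id: "opn V ==> preim M smor_id V = V" using preim_smor_id[OF openin_subset] .

lemma even_hom: "even_sheaf_hom (der_sheaf M M smor_id) (parity_change_sheaf (der_sheaf M M smor_id)) P"
 using Pi by (simp add: Pi_symmetry_def tangent_sheaf_def)

text \<open>The clauses of \<open>Pi_symmetry\<close> for the tangent sheaf, rid of the preimages
  under \<open>smor_id\<close>. These equal \<open>V\<close> for open \<open>V\<close>, and
  normalization makes other sets irrelevant.\<close>

lemma
 assumes U: "opn U"
 shows P_closed: "X : vfields M U ==> P U X : vfields M U"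
  and P_add: "X : vfields M U ==> Y : vfields M U ==>
   P U (normal_der M U (%V f. X V f +[sec M V] Y V f)) = normal_der M U (%V f. P U X V f +[sec M V] P U Y V f)"
  and P_scale: "c : Sec M U ==> X : vfields M U ==>
   P U (normal_der M U (%V f. rst M U V c *[sec M V] X V f)) =
   normal_der M U (%V f. rst M U V (grade_inv (sec M U) c) *[sec M V] P U X V f)"
  and P_part: "X : tpart M U p ==> P U X : tpart M U (\<not> p)"
  and P_rst: "opn U' ==> U' <= U ==> X : vfields M U ==> P U' (normal_der M U' X) = normal_der M U' (P U X)"
  and P_P: "X : vfields M U ==> P U (P U X) = X"
proof -
 have n: "normal_der M U (%V f. X V f +[sec M (preim M smor_id V)] Y V f) = normal_der M U (%V f. X V f +[sec M V] Y V f)"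
  "normal_der M U (%V f. rst M U (preim M smor_id V) c *[sec M (preim M smor_id V)] X V f) =
   normal_der M U (%V f. rst M U V c *[sec M V] X V f)" for X Y c
  by (rule normal_der_cong, simp add: pre_id U)+
 note 0 = Pi[unfolded Pi_symmetry_def tangent_sheaf_def even_sheaf_hom_def der_simps parity_change_sheaf_def]
 show "X : vfields M U ==> P U X : vfields M U"
  "X : tpart M U p ==> P U X : tpart M U (\<not> p)"
  "X : vfields M U ==> P U (P U X) = X"
  using 0 U by (auto simp: der_simps parity_change_def tangent_sheaf_def)
 show "X : vfields M U ==> Y : vfields M U ==>
   P U (normal_der M U (%V f. X V f +[sec M V] Y V f)) = normal_der M U (%V f. P U X V f +[sec M V] P U Y V f)"
  using 0 U by (auto simp: der_simps parity_change_def tangent_sheaf_def n)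
 show "c : Sec M U ==> X : vfields M U ==>
   P U (normal_der M U (%V f. rst M U V c *[sec M V] X V f)) =
   normal_der M U (%V f. rst M U V (grade_inv (sec M U) c) *[sec M V] P U X V f)"
  using 0 U by (auto simp: der_simps parity_change_def tangent_sheaf_def n pre_id)
 show "opn U' ==> U' <= U ==> X : vfields M U ==> P U' (normal_der M U' X) = normal_der M U' (P U X)"
  using 0 U by (auto simp: der_simps parity_change_def tangent_sheaf_def)
qed

lemma lm_id: "opn U ==> lmor M M U (%V. V) (%x. x) (%V f. f)"
 by unfold_locales (rule shmor_ident[OF srs])

text \<open>\<open>even_hom_expand\<close>, applied to the expansion of \<open>X\<close> in the
  coordinate fields.\<close>

lemma P_coords:
 assumes M: "locally_super a b M" and G: "good_coords a b M U y e" and X: "X : vfields M U"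
  and V: "opn V" "V <= U" "f : Sec M V"
 shows "P U X V f = rsum (sec M V) (%i. rst M U V (grade_inv (sec M U) (X U (y i))) *[sec M V]
   P U (normal_der M U (e i)) V f) (a + b)"
proof -
 have U: "opn U" using G by (simp add: good_coords_def)
 interpret lm: lmor M M U "%V. V" "%x. x" "%V f. f" by (rule lm_id[OF U])
 have X': "normal_der M U X = X" "gder M M U (%V. V) (%V f. f) X" using X by (simp_all add: vfields_iff[OF srs])
 note G' = G[unfolded good_coords_def, THEN conjunct2, THEN conjunct1, rule_format]
 interpret A: superalg "sec M U" using alg[OF U] .
 have e: "lder M M U (%V. V) (%V f. f) (a \<le> i) (e i)" and y: "y i : Sec M U" if "i < a + b" for i
  using G'[OF that] by (auto intro: A.part_closed)
 have F: "normal_der M U (e i) : carrier (msec (der_sheaf M M smor_id) U)" if "i < a + b" for i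
  using vfields_iff[OF srs, of "normal_der M U (e i)" U] gder_cong[OF lm.gder_lder[OF e[OF that]], of "normal_der M U (e i)"]
  by (simp add: tangent_sheaf_def normal_der_idem normal_der_apply)
 have "P U X V f = rsum (sec M (preim M smor_id V)) (%i. rst M (preim M smor_id U) (preim M smor_id V)
   (grade_inv (sec M (preim M smor_id U)) (X U (y i))) *[sec M (preim M smor_id V)] P U (normal_der M U (e i)) V f) (a + b)"
 proof (rule even_hom_expand[OF srs srs smorphism_id[OF srs] even_hom U _ F X'(1) _ V])
  show "X U (y i) : Sec M (preim M smor_id U)" if "i < a + b" for i
   using lm.gder_closed[OF X'(2) U order_refl y[OF that]] by (simp add: pre_id[OF U])
  fix V g assume V: "opn V" "V <= U" and g: "g : Sec M V"
  show "X V g = rsum (sec M (preim M smor_id V)) (%i. rst M (preim M smor_id U) (preim M smor_id V) (X U (y i))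
    *[sec M (preim M smor_id V)] normal_der M U (e i) V g) (a + b)"
   using lm.gder_expand[OF G X'(2) locally_super_has_evals[OF M] V g]
   by (simp add: pre_id V U normal_der_apply[OF V g])
 qed
 then show ?thesis by (simp add: pre_id V U)
qed

end

text \<open>The field \<beta>X on \<open>Q\<close> agrees with the field 0 off \<open>C\<close> on
  the overlap, as \<beta> vanishes there. For each \<open>f\<close> the two values are glued to a
  section, and the laws of a derivation are checked on the two sets of the cover. Since \<beta> is
  even, the parity is that of \<open>X\<close>.\<close>

lemma lder_extend_zero:
 assumes M: "superringed_space M" and \<beta>: "\<beta> : Part M (topspace (spc M)) False"
  and C: "closedin (spc M) C" "C <= Q" and Q: "oset M Q"
  and z: "rst M (topspace (spc M)) (topspace (spc M) - C) \<beta> = 0[sec M (topspace (spc M) - C)]"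
  and X: "lder M M Q (%V. V) (%V f. f) p X"
 shows "\<exists>X'. lder M M (topspace (spc M)) (%V. V) (%V f. f) p X' &
  (\<forall>V f. oset M V & V <= Q & f : Sec M V -->
    X' V f = rst M (topspace (spc M)) V \<beta> *[sec M V] X V f)"
proof -
 interpret sspace M using M by unfold_locales
 let ?X = "topspace (spc M)"
 let ?R = "?X - C"
 have oX: "opn ?X" by simp
 have oR: "opn ?R" using C(1) by (rule openin_diff[OF openin_topspace])
 interpret lQ: lmor M M Q "%V. V" "%x. x" "%V f. f" by unfold_locales (rule shmor_ident[OF srs Q])
 interpret lR: lmor M M ?R "%V. V" "%x. x" "%V f. f" by unfold_locales (rule shmor_ident[OF srs oR])
 interpret AX: superalg "sec M ?X" using alg[OF oX] .
 have QX: "Q <= ?X" using openin_subset[OF Q] .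
 have \<beta>c: "\<beta> : Sec M ?X" using \<beta> by auto
 define Y where "Y V f = rst M ?X V \<beta> *[sec M V] X V f" for V f
 have Y: "lder M M Q (%V. V) (%V f. f) p Y"
 proof -
  have b: "rst M ?X Q \<beta> : Part M Q False" using superalg_hom.parity[OF rst[OF oX Q QX] \<beta>] .
  have "lder M M Q (%V. V) (%V f. f) p (%V g. rst M Q V (rst M ?X Q \<beta>) *[sec M V] X V g)"
   using lQ.lder_scale[OF X b] by simp
  then show ?thesis
   by (rule lder_cong[rotated 2]) (use rst_rst[OF oX Q _ QX _ \<beta>c] srs in \<open>simp_all add: Y_def\<close>)
 qed
 have Yz: "Y V f = 0[sec M V]" if V: "opn V" "V <= Q" "V <= ?R" and f: "f : Sec M V" for V f
 proof -
  interpret superalg "sec M V" using alg[OF V(1)] .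
  have "rst M ?X V \<beta> = rst M ?R V (rst M ?X ?R \<beta>)" by (rule rst_rst[symmetric]) (use oR V \<beta>c in auto)
  also have "\<dots> = 0[sec M V]" unfolding z using superalg_hom.zero[OF rst[OF oR V(1,3)]] .
  finally show ?thesis using lder_closed[OF X V(1,2) f] by (simp add: Y_def)
 qed
 have ex: "\<exists>k\<in>Sec M V. rst M V (V Int Q) k = Y (V Int Q) (rst M V (V Int Q) f) & rst M V (V Int ?R) k = 0[sec M (V Int ?R)]"
  if V: "opn V" and f: "f : Sec M V" for V f
 proof -
  have o: "opn (V Int Q)" "opn (V Int ?R)" "V Int Q <= V" "V Int ?R <= V" using V Q oR by auto
  have VX: "V <= ?X" using openin_subset[OF V] .
  have cov: "\<Union>{V Int Q, V Int ?R} = V" using C VX by auto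
  define s where "s B = (if B = V Int Q then Y (V Int Q) (rst M V (V Int Q) f) else 0[sec M B])" for B
  have fQ: "rst M V (V Int Q) f : Sec M (V Int Q)" using o V f by simp
  have sQ: "s (V Int Q) = Y (V Int Q) (rst M V (V Int Q) f)" by (simp add: s_def)
  have sR: "s (V Int ?R) = 0[sec M (V Int ?R)]"
   unfolding s_def using Yz[OF o(1) _ _ fQ] by auto
  let ?I = "V Int Q Int (V Int ?R)"
  have oI: "opn ?I" "?I <= V Int Q" "?I <= V Int ?R" "?I <= Q" "?I <= ?R" using o by auto
  have comp: "rst M (V Int Q) ?I (s (V Int Q)) = rst M (V Int ?R) ?I (s (V Int ?R))"
  proof -
   have "rst M (V Int Q) ?I (s (V Int Q)) = Y ?I (rst M (V Int Q) ?I (rst M V (V Int Q) f))"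
    unfolding sQ using lder_rst[OF Y o(1) _ oI(1,2) fQ] by simp
   also have "\<dots> = 0[sec M ?I]"
    by (rule Yz[OF oI(1,4,5)]) (use o(1) oI(1,2) fQ in \<open>rule rst_closed\<close>)
   also have "\<dots> = rst M (V Int ?R) ?I (s (V Int ?R))"
    unfolding sR using superalg_hom.zero[OF rst[OF o(2) oI(1,3)]] by simp
   finally show ?thesis .
  qed
  have "\<exists>k\<in>Sec M (\<Union>{V Int Q, V Int ?R}). \<forall>B\<in>{V Int Q, V Int ?R}. rst M (\<Union>{V Int Q, V Int ?R}) B k = s B"
  proof (rule glue)
   fix B assume B: "B : {V Int Q, V Int ?R}"
   show oB: "opn B" using B o by auto
   interpret superalg "sec M B" using alg[OF oB] .
   show "s B : Sec M B"
   proof (cases "B = V Int Q")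
    case True
    then show ?thesis using sQ lder_closed[OF Y o(1) _ fQ] by simp
   qed (simp add: s_def)
   fix B' assume B': "B' : {V Int Q, V Int ?R}"
   from B B' consider "B = B'" | "B = V Int Q" "B' = V Int ?R" | "B' = V Int Q" "B = V Int ?R" by auto
   then show "rst M B (B Int B') (s B) = rst M B' (B Int B') (s B')"
   proof cases
    case 1 then show ?thesis by simp
   next
    case 2 then show ?thesis using comp by simp
   next
    case 3
    then have "B Int B' = ?I" by auto
    then show ?thesis using comp 3 by simp
   qed
  qed
  then show ?thesis unfolding cov using sQ sR by auto
 qed
 define X' where "X' V f = (SOME k. k : Sec M V & rst M V (V Int Q) k = Y (V Int Q) (rst M V (V Int Q) f) &
   rst M V (V Int ?R) k = 0[sec M (V Int ?R)])" for V f
 have X': "X' V f : Sec M V" "rst M V (V Int Q) (X' V f) = Y (V Int Q) (rst M V (V Int Q) f)"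
  "rst M V (V Int ?R) (X' V f) = 0[sec M (V Int ?R)]" if "opn V" "f : Sec M V" for V f
  using someI_ex[OF ex[OF that, unfolded Bex_def]] unfolding X'_def[symmetric] by auto
 have loc: "k = l" if V: "opn V" and k: "k : Sec M V" "l : Sec M V"
  and e: "rst M V (V Int Q) k = rst M V (V Int Q) l" "rst M V (V Int ?R) k = rst M V (V Int ?R) l" for V k l
 proof (rule sec_eqI[OF V k])
  fix x assume "x : V"
  then consider "x : V Int Q" | "x : V Int ?R" using C openin_subset[OF V] by auto
  then show "\<exists>B. opn B & x : B & B <= V & rst M V B k = rst M V B l"
  proof cases
   case 1
   then show ?thesis using e(1) V Q by (intro exI[of _ "V Int Q"]) auto
  next
   case 2
   then show ?thesis using e(2) V oR by (intro exI[of _ "V Int ?R"]) auto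
  qed
 qed
 have "lder M M ?X (%V. V) (%V f. f) p X'"
 proof (rule lderI)
  fix V assume V: "opn V"
  have o: "opn (V Int Q)" "opn (V Int ?R)" "V Int Q <= V" "V Int ?R <= V" "V Int Q <= Q" using V Q oR by auto
  interpret q: superalg_hom "sec M V" "sec M (V Int Q)" "rst M V (V Int Q)" using rst[OF V o(1,3)] .
  interpret r: superalg_hom "sec M V" "sec M (V Int ?R)" "rst M V (V Int ?R)" using rst[OF V o(2,4)] .
  note c = X'(1)[OF V] and xq = X'(2)[OF V] and xr = X'(3)[OF V]
  note YV = lder_closed[OF Y o(1,5)] lder_add[OF Y o(1,5)] lder_smult[OF Y o(1,5)] lder_parity[OF Y o(1,5)] lder_Leibniz[OF Y o(1,5)]
  show "X' V g : Sec M V" if "g : Sec M V" for g using c that .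
  show "X' V (f +[sec M V] g) = X' V f +[sec M V] X' V g"
   if f: "f : Sec M V" and g: "g : Sec M V" for f g
   by (rule loc[OF V c]) (use f g c xq xr YV(2) in \<open>simp_all add: q.add r.add\<close>)
  show "X' V (k \<odot>[sec M V] g) = k \<odot>[sec M V] X' V g" if g: "g : Sec M V" for k g
  proof (rule loc[OF V c])
   have "k \<odot>[sec M (V Int ?R)] 0[sec M (V Int ?R)] = 0[sec M (V Int ?R)]"
    using r.B.smult_mult_right[OF r.B.zero_closed r.B.zero_closed, of k] r.B.l_null[of "k \<odot>[sec M (V Int ?R)] 0[sec M (V Int ?R)]"] by simp
   then show "rst M V (V Int ?R) (X' V (k \<odot>[sec M V] g)) = rst M V (V Int ?R) (k \<odot>[sec M V] X' V g)"
    using g c xr by (simp add: r.smult)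
  qed (use g c xq YV(3) in \<open>simp_all add: q.smult\<close>)
  show "X' V (f *[sec M V] g) = (X' V f *[sec M V] g) +[sec M V] signed (sec M V) (p & s) (f *[sec M V] X' V g)"
   if f: "f : Part M V s" and g: "g : Sec M V" for s f g
  proof (rule loc[OF V c])
   have fc: "f : Sec M V" using f by auto
   show "f *[sec M V] g : Sec M V" "X' V f *[sec M V] g +[sec M V] signed (sec M V) (p & s) (f *[sec M V] X' V g) : Sec M V"
    using fc g c by auto
   show "rst M V (V Int Q) (X' V (f *[sec M V] g)) =
    rst M V (V Int Q) (X' V f *[sec M V] g +[sec M V] signed (sec M V) (p & s) (f *[sec M V] X' V g))"
    using fc g c xq YV(5)[OF q.parity[OF f]] by (simp add: q.mult q.add q.signed)
   show "rst M V (V Int ?R) (X' V (f *[sec M V] g)) =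
    rst M V (V Int ?R) (X' V f *[sec M V] g +[sec M V] signed (sec M V) (p & s) (f *[sec M V] X' V g))"
    using fc g c xr by (simp add: r.mult r.add r.signed) (simp add: signed_def)
  qed
  show "X' V g : Part M V (p \<noteq> s)" if g: "g : Part M V s" for s g
  proof (rule part_local[OF V c])
   show gc: "g : Sec M V" using g by auto
   fix x assume "x : V"
   then consider "x : V Int Q" | "x : V Int ?R" using C openin_subset[OF V] by auto
   then show "\<exists>B. opn B & x : B & B <= V & rst M V B (X' V g) : Part M B (p \<noteq> s)"
   proof cases
    case 1
    have "rst M V (V Int Q) (X' V g) : Part M (V Int Q) (p \<noteq> s)"
     unfolding xq[OF gc] by (rule YV(4)[OF q.parity[OF g]])
    then show ?thesis using 1 o by blast
   next
    case 2
    have "rst M V (V Int ?R) (X' V g) : Part M (V Int ?R) (p \<noteq> s)"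
     unfolding xr[OF gc] by (rule r.B.part_zero)
    then show ?thesis using 2 o by blast
   qed
  qed
  show "X' V' (rst M V V' g) = rst M V V' (X' V g)" if V': "opn V'" "V' <= V" and g: "g : Sec M V" for V' g
  proof (rule loc[OF V'(1) X'(1)[OF V'(1)]])
   have g': "rst M V V' g : Sec M V'" using V V' g by simp
   show "rst M V V' g : Sec M V'" "rst M V V' (X' V g) : Sec M V'" using V V' g c by auto
   have o': "opn (V' Int Q)" "opn (V' Int ?R)" "V' Int Q <= V Int Q" "V' Int ?R <= V Int ?R" using V' Q oR by auto
   have "rst M V' (V' Int Q) (X' V' (rst M V V' g)) = Y (V' Int Q) (rst M V' (V' Int Q) (rst M V V' g))"
    by (rule X'(2)[OF V'(1) g'])
   also have "rst M V' (V' Int Q) (rst M V V' g) = rst M V (V' Int Q) g" by (rule rst_rst) (use V V' o' g in auto)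
   also have "rst M V (V' Int Q) g = rst M (V Int Q) (V' Int Q) (rst M V (V Int Q) g)"
    by (rule rst_rst[symmetric]) (use V o o' g in auto)
   also have "Y (V' Int Q) \<dots> = rst M (V Int Q) (V' Int Q) (Y (V Int Q) (rst M V (V Int Q) g))"
    by (rule lder_rst[OF Y o(1,5) o'(1,3) q.closed[OF g]])
   also have "\<dots> = rst M (V Int Q) (V' Int Q) (rst M V (V Int Q) (X' V g))" unfolding xq[OF g] ..
   also have "\<dots> = rst M V (V' Int Q) (X' V g)" by (rule rst_rst) (use V o o' c[OF g] in auto)
   also have "\<dots> = rst M V' (V' Int Q) (rst M V V' (X' V g))" by (rule rst_rst[symmetric]) (use V V' o' c[OF g] in auto)
   finally show "rst M V' (V' Int Q) (X' V' (rst M V V' g)) = rst M V' (V' Int Q) (rst M V V' (X' V g))" .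
   have "rst M V' (V' Int ?R) (rst M V V' (X' V g)) = rst M V (V' Int ?R) (X' V g)"
    by (rule rst_rst) (use V V' o' c[OF g] in auto)
   also have "\<dots> = rst M (V Int ?R) (V' Int ?R) (rst M V (V Int ?R) (X' V g))"
    by (rule rst_rst[symmetric]) (use V o o' c[OF g] in auto)
   also have "\<dots> = 0[sec M (V' Int ?R)]"
    unfolding xr[OF g] using superalg_hom.zero[OF rst[OF o(2) o'(2,4)]] .
   finally show "rst M V' (V' Int ?R) (X' V' (rst M V V' g)) = rst M V' (V' Int ?R) (rst M V V' (X' V g))"
    using X'(3)[OF V'(1) g'] by simp
  qed
 qed
 moreover have "X' V f = rst M ?X V \<beta> *[sec M V] X V f" if V: "opn V" "V <= Q" and f: "f : Sec M V" for V f
  using X'(1,2)[OF V(1) f] V f by (simp add: inf.absorb1 Y_def)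
 ultimately show ?thesis by blast
qed

section \<open>Vector fields along a morphism of \<open>\<Pi>\<close>-symmetric superspaces\<close>

context superalg begin

lemma even_central: "x : part A False ==> y : carrier A ==> x \<otimes> y = y \<otimes> x"
proof -
 assume x: "x : part A False" and y: "y : carrier A"
 obtain y0 y1 where y01: "y0 : part A False" "y1 : part A True" "y = y0 \<oplus> y1" using decomp[OF y] .
 have "x \<otimes> y0 = y0 \<otimes> x" "x \<otimes> y1 = y1 \<otimes> x"
  using supercomm[OF x y01(1)] supercomm[OF x y01(2)] by (simp_all add: signed_def)
 then show "x \<otimes> y = y \<otimes> x"
  using part_closed[OF x] part_closed[OF y01(1)] part_closed[OF y01(2)] unfolding y01(3) by (simp add: l_distr r_distr)
qed

lemma grade_inv_one: "grade_inv A \<one> = \<one>"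
 using grade_inv_part[OF one_even] by (simp add: signed_def)

end

lemma unit_near_mono:
 assumes M: "superringed_space M" and V: "oset M V" and V': "oset M V'" "V' <= V" "x : V'"
  and f: "f : Sec M V" and un: "unit_near M x V f"
 shows "unit_near M x V' (rst M V V' f)"
proof -
 interpret sspace M using M by unfold_locales
 obtain B g where B: "opn B" "x : B" "B <= V" "g : Sec M B" "rst M V B f *[sec M B] g = 1[sec M B]"
  using un unfolding unit_near_def by blast
 have o: "opn (B Int V')" "B Int V' <= B" "B Int V' <= V'" "B Int V' <= V" using B V' by auto
 interpret r: superalg_hom "sec M B" "sec M (B Int V')" "rst M B (B Int V')" using rst[OF B(1) o(1,2)] .
 have fB: "rst M V B f : Sec M B" using V B f by simp
 have "rst M B (B Int V') (rst M V B f) = rst M V (B Int V') f" by (rule rst_rst) (use V B o f in auto)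
 moreover have "rst M V' (B Int V') (rst M V V' f) = rst M V (B Int V') f" by (rule rst_rst) (use V V' o f in auto)
 moreover have "rst M B (B Int V') (rst M V B f) *[sec M (B Int V')] rst M B (B Int V') g = 1[sec M (B Int V')]"
  using r.mult[OF fB B(4)] B(5) r.one by simp
 ultimately show ?thesis
  unfolding unit_near_def using o B V' r.closed[OF B(4)]
  by (intro exI[of _ "B Int V'"] exI[of _ "rst M B (B Int V') g"]) simp
qed

lemma value_is_mono:
 assumes M: "superringed_space M" and V: "oset M V" and V': "oset M V'" "V' <= V" "x : V'"
  and f: "f : Sec M V" and v: "value_is M x V f c"
 shows "value_is M x V' (rst M V V' f) c"
 unfolding value_is_def
proof (intro allI impI)
 interpret sspace M using M by unfold_locales
 interpret superalg_hom "sec M V" "sec M V'" "rst M V V'" using rst[OF V V'(1,2)] .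
 fix r assume "r \<noteq> c"
 then have "unit_near M x V (f -[sec M V] (r \<odot>[sec M V] 1[sec M V]))" using v unfolding value_is_def by blast
 from unit_near_mono[OF M V V' _ this] f
 show "unit_near M x V' (rst M V V' f -[sec M V'] (r \<odot>[sec M V'] 1[sec M V']))"
  by (simp add: minus smult one)
qed

lemma had_mono:
 assumes M: "superringed_space N" and U: "oset N U" and U': "oset N U'" "U' <= U" "p : U'"
  and y: "\<And>i. i < r ==> y i : Sec N U" and H: "had N U r \<pi> y p K"
 shows "had N U' r \<pi> (%i. rst N U U' (y i)) p K"
proof -
 interpret sspace N using M by unfold_locales
 obtain t where t': "\<forall>i<r. value_is N p U (y i) (t i) & (\<pi> i --> t i = 0)"
  and ex: "\<forall>V f. oset N V & V <= U & p : V & f : Sec N V -->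
    (\<exists>V' c g. oset N V' & p : V' & V' <= V & (\<forall>i<r. g i : Sec N V') &
     rst N V V' f -[sec N V'] (c \<odot>[sec N V'] 1[sec N V'] +[sec N V']
      rsum (sec N V') (%i. (rst N U V' (y i) -[sec N V'] (t i \<odot>[sec N V'] 1[sec N V'])) *[sec N V'] g i) r)
     : K V')"
  using H[unfolded had_def] by (elim exE conjE) (rule that)
 show ?thesis
  unfolding had_def
 proof (intro exI[of _ t] conjI allI impI)
  fix i assume i: "i < r"
  show "value_is N p U' (rst N U U' (y i)) (t i)"
   using value_is_mono[OF M U U' y[OF i]] t' i by blast
  show "\<pi> i ==> t i = 0" using t' i by blast
 next
  fix V f assume V: "opn V & V <= U' & p : V & f : Sec N V"
  then have VU: "opn V & V <= U & p : V & f : Sec N V" using U' by auto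
  from ex[rule_format, OF VU] obtain V' c g where V': "opn V'" "p : V'" "V' <= V" "\<forall>i<r. g i : Sec N V'"
   and k: "rst N V V' f -[sec N V'] (c \<odot>[sec N V'] 1[sec N V'] +[sec N V']
      rsum (sec N V') (%i. (rst N U V' (y i) -[sec N V'] (t i \<odot>[sec N V'] 1[sec N V'])) *[sec N V'] g i) r)
     : K V'"
   by (elim exE conjE) (rule that)
  have "rst N U' V' (rst N U U' (y i)) = rst N U V' (y i)" if "i < r" for i
   by (rule rst_rst) (use U U' V V' y that in auto)
  then have "rsum (sec N V') (%i. (rst N U' V' (rst N U U' (y i)) -[sec N V'] (t i \<odot>[sec N V'] 1[sec N V'])) *[sec N V'] g i) r =
   rsum (sec N V') (%i. (rst N U V' (y i) -[sec N V'] (t i \<odot>[sec N V'] 1[sec N V'])) *[sec N V'] g i) r"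
   by (intro rsum_cong) simp
  then show "\<exists>V' c g. opn V' & p : V' & V' <= V & (\<forall>i<r. g i : Sec N V') &
     rst N V V' f -[sec N V'] (c \<odot>[sec N V'] 1[sec N V'] +[sec N V']
      rsum (sec N V') (%i. (rst N U' V' (rst N U U' (y i)) -[sec N V'] (t i \<odot>[sec N V'] 1[sec N V'])) *[sec N V'] g i) r)
     : K V'"
   using V' k by (intro exI[of _ V'] exI[of _ c] exI[of _ g]) (simp only: simp_thms)
 qed
qed

lemma
 assumes "good_coords a b N U y e"
 shows good_coords_open: "oset N U"
  and good_coords_part: "i < a + b ==> y i : Part N U (a \<le> i)"
  and good_coords_lder: "i < a + b ==> lder N N U (%V. V) (%V f. f) (a \<le> i) (e i)"
  and good_coords_delta: "i < a + b ==> j < a + b ==> e i U (y j) = (if i = j then 1[sec N U] else 0[sec N U])"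
  and good_coords_had: "p : U ==> had N U (a + b) (%i. a \<le> i) y p (%V. {0[sec N V]})"
 using assms unfolding good_coords_def by blast+

lemma good_coords_mono:
 assumes N: "superringed_space N" and G: "good_coords a b N U y e" and U': "oset N U'" "U' <= U"
 shows "good_coords a b N U' (%i. rst N U U' (y i)) e"
 unfolding good_coords_def
proof (intro conjI allI impI ballI U')
 interpret sspace N using N by unfold_locales
 note U = good_coords_open[OF G]
 interpret r: superalg_hom "sec N U" "sec N U'" "rst N U U'" using rst[OF U U'] .
 have y: "y i : Sec N U" if "i < a + b" for i using good_coords_part[OF G that] by auto
 show "rst N U U' (y i) : Part N U' (a \<le> i)" if "i < a + b" for i using r.parity good_coords_part[OF G that] .
 show "lder N N U' (%V. V) (%V f. f) (a \<le> i) (e i)" if "i < a + b" for i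
  using lder_mono[OF good_coords_lder[OF G that] U'(2)] .
 show "e i U' (rst N U U' (y j)) = (if i = j then 1[sec N U'] else 0[sec N U'])" if "i < a + b" "j < a + b" for i j
  using lder_rst[OF good_coords_lder[OF G that(1)] U order_refl U' y[OF that(2)]] good_coords_delta[OF G that] r.one r.zero
  by simp
 show "had N U' (a + b) (%i. a \<le> i) (%i. rst N U U' (y i)) p (%V. {0[sec N V]})" if "p : U'" for p
  by (rule had_mono[OF N U U' that y good_coords_had[OF G]]) (use that U' in auto)
qed

text \<open>The relation between \<open>P\<^sub>M\<close> and \<open>P\<^sub>N\<close> holds for vector fields defined on small open subsets of \<open>M\<close>,
 not only for those on preimages of open subsets of \<open>N\<close>, since \<open>M\<close> has bump functions.\<close>

lemma Pi_formula:
 assumes M: "locally_super a b M" and H: "Hausdorff_space (spc M)" and PM: "Pi_symmetry (tangent_sheaf M) PM"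
  and N: "locally_super a' b' N" and PN: "Pi_symmetry (tangent_sheaf N) PN"
  and \<psi>: "Pi_morphism M PM N PN \<psi>"
  and G: "good_coords a' b' N U y e" and CF: "coordinate_fields a' b' N U y (%i. normal_der N U (e i))"
  and Q: "oset M Q" "Q <= preim M \<psi> U" and X: "X : vfields M Q" and g: "g : Sec N U"
 shows "PM Q X Q (rst M (preim M \<psi> U) Q (pull \<psi> U g)) = rsum (sec M Q)
  (%i. grade_inv (sec M Q) (X Q (rst M (preim M \<psi> U) Q (pull \<psi> U (y i)))) *[sec M Q]
   rst M (preim M \<psi> U) Q (pull \<psi> U (PN U (normal_der N U (e i)) U g))) (a' + b')"
  (is "?L = ?R")
proof -
 have M': "superringed_space M" and N': "superringed_space N" using M N by (auto simp: locally_super_def)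
 interpret M: pisym M PM using M' PM by unfold_locales
 interpret N: pisym N PN using N' PN by unfold_locales
 have sm: "smorphism M N \<psi>" using \<psi> by (simp add: Pi_morphism_def)
 note U = good_coords_open[OF G]
 interpret l: lmor N M U "preim M \<psi>" "umap \<psi>" "pull \<psi>" using shmor_smorphism[OF sm U] by unfold_locales
 interpret lQ: lmor M M Q "%V. V" "%x. x" "%V f. f" by (rule M.lm_id[OF Q(1)])
 let ?P = "preim M \<psi> U" and ?T = "topspace (spc M)" and ?k = "a' + b'"
 have oP: "oset M ?P" using l.S_open[OF U order_refl] .
 have oT: "oset M ?T" by simp
 have sub: "?P <= ?T" "Q <= ?T" using openin_subset[OF oP] Q by auto
 interpret h: superalg_hom "sec N U" "sec M ?P" "pull \<psi> U" using l.hh[OF U order_refl] .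
 interpret r: superalg_hom "sec M ?P" "sec M Q" "rst M ?P Q" using M.rst[OF oP Q] .
 have y: "y i : Sec N U" if "i < ?k" for i using good_coords_part[OF G that] by (auto intro: h.A.part_closed)
 define E where "E i = normal_der N U (e i)" for i
 interpret lN: lmor N N U "%V. V" "%x. x" "%V f. f" by (rule N.lm_id[OF U])
 have E: "E i : vfields N U" if "i < ?k" for i
  using gder_cong[OF lN.gder_lder[OF good_coords_lder[OF G that]], of "E i"]
  by (simp add: vfields_iff[OF N'] E_def normal_der_idem normal_der_apply)
 have PE: "PN U (E i) : vfields N U" if "i < ?k" for i using N.P_closed[OF U E[OF that]] .
 have PEc: "PN U (E i) V f : Sec N V" if "i < ?k" "oset N V" "V <= U" "f : Sec N V" for i V f
  using lN.gder_closed[OF _ that(2-4)] PE[OF that(1)] by (simp add: vfields_iff[OF N'])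
 have PX: "PM Q X : vfields M Q" using M.P_closed[OF Q(1) X] .
 have gX: "gder M M Q (%V. V) (%V f. f) X" "gder M M Q (%V. V) (%V f. f) (PM Q X)"
  using X PX by (simp_all add: vfields_iff[OF M'])
 have Lc: "?L : Sec M Q" by (rule lQ.gder_closed[OF gX(2) Q(1) order_refl]) (use g in auto)
 have Xc: "X Q (rst M ?P Q (pull \<psi> U (y i))) : Sec M Q" if "i < ?k" for i
  by (rule lQ.gder_closed[OF gX(1) Q(1) order_refl]) (use y[OF that] in auto)
 have term_c: "rst M ?P Q (pull \<psi> U (PN U (E i) U g)) : Sec M Q" if "i < ?k" for i
  using PEc[OF that U order_refl g] by simp
 have Rc: "?R : Sec M Q" unfolding E_def[symmetric] by (rule r.B.rsum_closed) (use Xc term_c in auto)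
 show ?thesis
 proof (rule M.sec_eqI[OF Q(1) Lc Rc])
  fix x assume x: "x : Q"
  obtain \<beta> C where \<beta>: "\<beta> : Part M ?T False" and C: "closedin (spc M) C" "C <= Q"
   and z: "rst M ?T (?T - C) \<beta> = 0[sec M (?T - C)]" and un: "unit_near M x ?T \<beta>"
   using locally_super_bump[OF M H Q(1) x] by blast
  interpret AT: superalg "sec M ?T" using M.alg[OF oT] .
  have \<beta>c: "\<beta> : Sec M ?T" using \<beta> by auto
  obtain X0 X1 where X0: "lder M M Q (%V. V) (%V f. f) False X0" and X1: "lder M M Q (%V. V) (%V f. f) True X1"
   and X01: "\<And>V f. oset M V ==> V <= Q ==> f : Sec M V ==> X V f = X0 V f +[sec M V] X1 V f"
   using gX(1) unfolding gder_def by blast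
  obtain Y0 where Y0: "lder M M ?T (%V. V) (%V f. f) False Y0"
   "\<And>V f. oset M V ==> V <= Q ==> f : Sec M V ==> Y0 V f = rst M ?T V \<beta> *[sec M V] X0 V f"
   using lder_extend_zero[OF M' \<beta> C Q(1) z X0] by blast
  obtain Y1 where Y1: "lder M M ?T (%V. V) (%V f. f) True Y1"
   "\<And>V f. oset M V ==> V <= Q ==> f : Sec M V ==> Y1 V f = rst M ?T V \<beta> *[sec M V] X1 V f"
   using lder_extend_zero[OF M' \<beta> C Q(1) z X1] by blast
  interpret lT: lmor M M ?T "%V. V" "%x. x" "%V f. f" by (rule M.lm_id[OF oT])
  interpret lP: lmor M M ?P "%V. V" "%x. x" "%V f. f" by (rule M.lm_id[OF oP])
  \<comment> \<open>The field \<beta>X, extended by zero. It lives on the whole preimage of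
    \<open>U\<close>, so the morphism condition applies to it.\<close>
  define Y where "Y = normal_der M ?P (%V f. Y0 V f +[sec M V] Y1 V f)"
  have "gder M M ?P (%V. V) (%V f. f) (%V f. Y0 V f +[sec M V] Y1 V f)"
   by (rule gder_mono[OF lT.gder_plus[OF lT.gder_lder[OF Y0(1)] lT.gder_lder[OF Y1(1)]] sub(1)])
  then have gY: "gder M M ?P (%V. V) (%V f. f) Y" by (rule gder_cong) (simp add: Y_def normal_der_apply)
  then have Y: "Y : vfields M ?P" by (simp add: vfields_iff[OF M'] Y_def normal_der_idem)
  have YX: "Y V f = rst M ?T V \<beta> *[sec M V] X V f" if V: "oset M V" "V <= Q" and f: "f : Sec M V" for V f
  proof -
   interpret superalg "sec M V" using M.alg[OF V(1)] .
   have "V <= ?P" "V <= ?T" using V Q(2) sub by auto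
   then show ?thesis
    unfolding Y_def normal_der_apply[OF V(1) \<open>V <= ?P\<close> f] using Y0(2)[OF V f] Y1(2)[OF V f] X01[OF V f]
     M.rst_closed[OF oT V(1) \<open>V <= ?T\<close> \<beta>c] lder_closed[OF X0 V f] lder_closed[OF X1 V f]
    by (simp add: r_distr)
  qed
  define Yt where "Yt = tangent_map M N \<psi> U Y"
  have nYt: "normal_der N U Yt = Yt" by (simp add: Yt_def tangent_map_def normal_der_idem)
  have Yt: "Yt V f = Y (preim M \<psi> V) (pull \<psi> V f)" if "oset N V" "V <= U" "f : Sec N V" for V f
   unfolding Yt_def tangent_map_def by (rule normal_der_apply[OF that])
  have gYt: "gder N M U (preim M \<psi>) (pull \<psi>) Yt"
   by (rule gder_cong[OF gder_comp_pre[OF N' M' l.sh order_refl gY] Yt])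
  obtain Pb where Pb: "Pbar_of M N \<psi> PN Pb"
   "Pb U (tangent_map M N \<psi> U Y) = tangent_map M N \<psi> U (PM ?P Y)"
   using \<psi> U Y unfolding Pi_morphism_def by blast
  have Pbh: "even_sheaf_hom (der_sheaf N M \<psi>) (parity_change_sheaf (der_sheaf N M \<psi>)) Pb"
   using Pb(1) by (simp add: Pbar_of_def Let_def)
  define F where "F i = along N \<psi> U (E i)" for i
  have F_ap: "F i V f = pull \<psi> V (e i V f)" if "oset N V" "V <= U" "f : Sec N V" for i V f
   unfolding F_def along_def E_def by (simp add: normal_der_apply[OF that])
  have F: "F i : carrier (msec (der_sheaf N M \<psi>) U)" if i: "i < ?k" for i
  proof -
   have "gder N M U (preim M \<psi>) (pull \<psi>) (%V f. pull \<psi> V (e i V f))"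
    using l.gder_lder[OF lder_comp_post[OF N' N' M' shmor_ident[OF N' U] l.sh order_refl good_coords_lder[OF G i]]] .
   then have "gder N M U (preim M \<psi>) (pull \<psi>) (F i)" by (rule gder_cong) (rule F_ap)
   then show ?thesis unfolding der_carrier_iff[OF N'] by (simp add: F_def along_def normal_der_idem)
  qed
  \<comment> \<open>The characterization of \<open>Pb\<close> on multiples of coordinate fields,
    with coefficient 1.\<close>
  have PF: "Pb U (F i) U g = pull \<psi> U (PN U (E i) U g)" if i: "i < ?k" for i
  proof -
   have o1: "1[sec M ?P] \<odot>[msec (der_sheaf N M \<psi>) U] v = v"
    if v: "normal_der N U v = v" "\<And>V f. oset N V ==> V <= U ==> f : Sec N V ==> v V f : Sec M (preim M \<psi> V)" for v
    unfolding der_simps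
   proof (rule normal_der_eqI[OF normal_der_idem v(1)])
    fix V f assume V: "oset N V" "V <= U" "f : Sec N V"
    interpret rr: superalg_hom "sec M ?P" "sec M (preim M \<psi> V)" "rst M ?P (preim M \<psi> V)"
     by (rule M.rst[OF oP l.S_open[OF V(1,2)] l.S_mono[OF U order_refl V(1,2)]])
    show "normal_der N U (%V g. rst M ?P (preim M \<psi> V) 1[sec M ?P] *[sec M (preim M \<psi> V)] v V g) V f = v V f"
     using v(2)[OF V] by (simp add: normal_der_apply[OF V] rr.one)
   qed
   have "Pb U (1[sec M ?P] \<odot>[msec (der_sheaf N M \<psi>) U] F i) =
     1[sec M ?P] \<odot>[msec (parity_change_sheaf (der_sheaf N M \<psi>)) U] along N \<psi> U (PN U (E i))"
    unfolding F_def E_def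
    by (rule Pb(1)[unfolded Pbar_of_def Let_def, THEN conjunct2, rule_format, OF CF i]) (simp add: der_simps)
   also have "\<dots> = 1[sec M ?P] \<odot>[msec (der_sheaf N M \<psi>) U] along N \<psi> U (PN U (E i))"
    by (simp add: parity_change_sheaf_def parity_change_def der_simps h.B.grade_inv_one)
   also have "\<dots> = along N \<psi> U (PN U (E i))"
   proof (rule o1)
    show "normal_der N U (along N \<psi> U (PN U (E i))) = along N \<psi> U (PN U (E i))"
     by (simp add: along_def normal_der_idem)
    fix V f assume V: "oset N V" "V <= U" "f : Sec N V"
    show "along N \<psi> U (PN U (E i)) V f : Sec M (preim M \<psi> V)"
     unfolding along_def normal_der_apply[OF V]
     by (rule superalg_hom.closed[OF l.hh[OF V(1,2)] PEc[OF i V]])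
   qed
   also have "1[sec M ?P] \<odot>[msec (der_sheaf N M \<psi>) U] F i = F i"
    by (rule o1) (use F[OF i] l.gder_closed in \<open>auto simp: der_carrier_iff[OF N']\<close>)
   finally show ?thesis by (simp add: along_def normal_der_apply[OF U order_refl g])
  qed
  have c: "Yt U (y i) : Sec M ?P" if "i < ?k" for i using l.gder_closed[OF gYt U order_refl y[OF that]] .
  have "Pb U Yt U g = rsum (sec M ?P) (%i. rst M ?P ?P (grade_inv (sec M ?P) (Yt U (y i))) *[sec M ?P] Pb U (F i) U g) ?k"
  proof (rule even_hom_expand[OF N' M' sm Pbh U c F nYt _ U order_refl g])
   fix V f assume V: "oset N V" "V <= U" "f : Sec N V"
   show "Yt V f = rsum (sec M (preim M \<psi> V)) (%i. rst M ?P (preim M \<psi> V) (Yt U (y i)) *[sec M (preim M \<psi> V)] F i V f) ?k"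
    unfolding F_ap[OF V] by (rule l.gder_expand[OF G gYt locally_super_has_evals[OF M] V])
  qed
  also have "\<dots> = rsum (sec M ?P) (%i. grade_inv (sec M ?P) (Yt U (y i)) *[sec M ?P] pull \<psi> U (PN U (E i) U g)) ?k"
   by (rule rsum_cong) (use PF c oP in simp)
  also have "Pb U Yt U g = PM ?P Y ?P (pull \<psi> U g)"
   unfolding Yt_def Pb(2) unfolding tangent_map_def by (rule normal_der_apply[OF U order_refl g])
  finally have eq1: "PM ?P Y ?P (pull \<psi> U g) =
    rsum (sec M ?P) (%i. grade_inv (sec M ?P) (Yt U (y i)) *[sec M ?P] pull \<psi> U (PN U (E i) U g)) ?k" .
  define b where "b = rst M ?T Q \<beta>"
  have b: "b : Part M Q False" unfolding b_def using superalg_hom.parity[OF M.rst[OF oT Q(1) sub(2)] \<beta>] .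
  then have bc: "b : Sec M Q" by auto
  \<comment> \<open>The cut-off function is even, so it passes through \<open>PM\<close> and
    \<open>grade_inv\<close> without a sign and factors out on both sides.\<close>
  have gb: "grade_inv (sec M Q) b = b" using r.B.grade_inv_part[OF b] by (simp add: signed_def)
  have bV: "rst M Q V b = rst M ?T V \<beta>" if "oset M V" "V <= Q" for V
   unfolding b_def by (rule M.rst_rst) (use that Q sub \<beta>c oT in auto)
  have nY: "normal_der M Q Y = normal_der M Q (%V f. rst M Q V b *[sec M V] X V f)"
   by (rule normal_der_cong) (simp add: YX bV)
  have "rst M ?P Q (PM ?P Y ?P (pull \<psi> U g)) = PM ?P Y Q (rst M ?P Q (pull \<psi> U g))"
   using lP.gder_rst[OF _ oP order_refl _ Q, of "PM ?P Y" "pull \<psi> U g"] M.P_closed[OF oP Y] g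
   by (simp add: vfields_iff[OF M'])
  also have "\<dots> = normal_der M Q (PM ?P Y) Q (rst M ?P Q (pull \<psi> U g))"
   by (rule normal_der_apply[symmetric]) (use Q g in auto)
  also have "normal_der M Q (PM ?P Y) = PM Q (normal_der M Q Y)" by (rule M.P_rst[OF oP Q Y, symmetric])
  also have "\<dots> = normal_der M Q (%V f. rst M Q V b *[sec M V] PM Q X V f)"
   unfolding nY M.P_scale[OF Q(1) bc X] gb ..
  also have "\<dots> Q (rst M ?P Q (pull \<psi> U g)) = b *[sec M Q] ?L"
  proof -
   have "rst M ?P Q (pull \<psi> U g) : Sec M Q" using g by simp
   then show ?thesis using bc Q by (simp add: normal_der_apply)
  qed
  finally have l1: "rst M ?P Q (PM ?P Y ?P (pull \<psi> U g)) = b *[sec M Q] ?L" .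
  have Yy: "rst M ?P Q (Yt U (y i)) = b *[sec M Q] X Q (rst M ?P Q (pull \<psi> U (y i)))" if i: "i < ?k" for i
  proof -
   have p: "pull \<psi> U (y i) : Sec M ?P" using y[OF i] by simp
   have "rst M ?P Q (Yt U (y i)) = Y Q (rst M ?P Q (pull \<psi> U (y i)))"
    unfolding Yt[OF U order_refl y[OF i]] using lP.gder_rst[OF gY oP order_refl p Q] by simp
   also have "\<dots> = b *[sec M Q] X Q (rst M ?P Q (pull \<psi> U (y i)))"
    using YX[OF Q(1) order_refl, of "rst M ?P Q (pull \<psi> U (y i))"] p by (simp add: b_def)
   finally show ?thesis .
  qed
  have "rst M ?P Q (PM ?P Y ?P (pull \<psi> U g)) = rsum (sec M Q) (%i. rst M ?P Q (grade_inv (sec M ?P) (Yt U (y i)) *[sec M ?P]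
    pull \<psi> U (PN U (E i) U g))) ?k"
   unfolding eq1 by (rule r.rsum) (use c PEc[OF _ U order_refl g] in auto)
  also have "\<dots> = rsum (sec M Q) (%i. b *[sec M Q] (grade_inv (sec M Q) (X Q (rst M ?P Q (pull \<psi> U (y i)))) *[sec M Q]
    rst M ?P Q (pull \<psi> U (PN U (E i) U g)))) ?k"
  proof (rule rsum_cong)
   fix i assume i: "i < ?k"
   show "rst M ?P Q (grade_inv (sec M ?P) (Yt U (y i)) *[sec M ?P] pull \<psi> U (PN U (E i) U g)) =
    b *[sec M Q] (grade_inv (sec M Q) (X Q (rst M ?P Q (pull \<psi> U (y i)))) *[sec M Q]
    rst M ?P Q (pull \<psi> U (PN U (E i) U g)))"
    using c[OF i] PEc[OF i U order_refl g] Xc[OF i] term_c[OF i] bc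
    by (simp add: r.mult r.grade_inv Yy[OF i] r.B.grade_inv_mult gb r.B.m_assoc)
  qed
  also have "\<dots> = b *[sec M Q] ?R"
   unfolding E_def[symmetric] by (rule r.B.rsum_mult_left[symmetric]) (use Xc term_c bc in auto)
  finally have eq2: "b *[sec M Q] ?L = b *[sec M Q] ?R" unfolding l1 .
  \<comment> \<open>Near \<open>x\<close> the cut-off function is invertible and can be cancelled
    from \<open>eq2\<close>.\<close>
  have "unit_near M x Q b" unfolding b_def by (rule unit_near_mono[OF M' oT Q(1) sub(2) x \<beta>c un])
  then obtain V k where V: "oset M V" "x : V" "V <= Q" "k : Sec M V"
   "rst M Q V b *[sec M V] k = 1[sec M V]" unfolding unit_near_def by blast
  interpret v: superalg_hom "sec M Q" "sec M V" "rst M Q V" using M.rst[OF Q(1) V(1,3)] .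
  have k1: "k *[sec M V] rst M Q V b = 1[sec M V]" using v.B.even_central[OF v.parity[OF b] V(4)] V(5) by simp
  have K: "rst M Q V A = k *[sec M V] rst M Q V (b *[sec M Q] A)" if A: "A : Sec M Q" for A
   using k1 A bc V(4) by (simp add: v.mult v.B.m_assoc[symmetric])
  have "rst M Q V ?L = rst M Q V ?R" by (simp only: K[OF Lc] K[OF Rc] eq2)
  then show "\<exists>V. oset M V & x : V & V <= Q & rst M Q V ?L = rst M Q V ?R"
   by (intro exI[of _ V] conjI V(1-3))
 qed
qed

section \<open>Lifting along morphisms that are surjective on stalks\<close>

definition stalk_surj :: "('p, 's) superspace => ('q, 't) superspace => ('p, 'q, 's, 't) smor => bool" where
 "stalk_surj Z N \<phi> \<longleftrightarrow> (\<forall>V s x. oset Z V & s : Sec Z V & x : V -->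
   (\<exists>U f. oset N U & umap \<phi> x : U & preim Z \<phi> U <= V & f : Sec N U &
    pull \<phi> U f = rst Z V (preim Z \<phi> U) s))"

text \<open>Surjectivity on stalks lifts one section near one point. A finite family is lifted over
  a common neighbourhood, which shrinks with each member; this suffices for coefficients with
  respect to coordinates.\<close>

lemma lift_family:
 assumes Z: "superringed_space Z" and N: "superringed_space N" and \<phi>: "smorphism Z N \<phi>" and st: "stalk_surj Z N \<phi>"
  and V: "oset Z V" "x : V" and Q: "oset N Q" "umap \<phi> x : Q"
  and J: "finite J" and s: "\<And>i. i : J ==> s i : Sec Z V"
 shows "\<exists>U f. oset N U & umap \<phi> x : U & U <= Q & preim Z \<phi> U <= V &
   (\<forall>i\<in>J. f i : Sec N U & pull \<phi> U (f i) = rst Z V (preim Z \<phi> U) (s i))"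
proof -
 interpret Z: sspace Z using Z by unfold_locales
 interpret N: sspace N using N by unfold_locales
 have lm: "lmor N Z U (preim Z \<phi>) (umap \<phi>) (pull \<phi>)" if "oset N U" for U
  using shmor_smorphism[OF \<phi> that] by unfold_locales
 have one: "\<exists>U f. oset N U & umap \<phi> x : U & U <= Q & preim Z \<phi> U <= V & f : Sec N U &
   pull \<phi> U f = rst Z V (preim Z \<phi> U) s" if s: "s : Sec Z V" and Q: "oset N Q" "umap \<phi> x : Q" for s Q
 proof -
  obtain U f where U: "oset N U" "umap \<phi> x : U" "preim Z \<phi> U <= V" "f : Sec N U"
   "pull \<phi> U f = rst Z V (preim Z \<phi> U) s"
   using st[unfolded stalk_surj_def, rule_format, OF conjI[OF V(1) conjI[OF s V(2)]]] by (elim exE conjE) (rule that)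
  interpret lmor N Z U "preim Z \<phi>" "umap \<phi>" "pull \<phi>" by (rule lm[OF U(1)])
  have o: "oset N (U Int Q)" "U Int Q <= U" using U Q by auto
  have sub: "preim Z \<phi> (U Int Q) <= preim Z \<phi> U" using S_mono[OF U(1) order_refl o] .
  have "pull \<phi> (U Int Q) (rst N U (U Int Q) f) = rst Z (preim Z \<phi> U) (preim Z \<phi> (U Int Q)) (rst Z V (preim Z \<phi> U) s)"
   unfolding U(5)[symmetric] by (rule h_rst[OF U(1) o order_refl U(4)])
  also have "\<dots> = rst Z V (preim Z \<phi> (U Int Q)) s"
   by (rule Z.rst_rst) (use V S_open[OF U(1) order_refl] S_open[OF o] U(3) sub s in auto)
  finally show ?thesis
   using U Q o sub by (intro exI[of _ "U Int Q"] exI[of _ "rst N U (U Int Q) f"]) auto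
 qed
 show ?thesis
  using J s
 proof (induction J rule: finite_induct)
  case empty
  interpret superalg "sec Z V" using Z.alg[OF V(1)] .
  show ?case using one[OF zero_closed Q] by auto
 next
  case (insert i J)
  obtain U f where U: "oset N U" "umap \<phi> x : U" "U <= Q" "preim Z \<phi> U <= V"
   and f: "\<And>i. i : J ==> f i : Sec N U" "\<And>i. i : J ==> pull \<phi> U (f i) = rst Z V (preim Z \<phi> U) (s i)"
   using insert by (metis insertI2)
  obtain U' k where U': "oset N U'" "umap \<phi> x : U'" "U' <= U" "preim Z \<phi> U' <= V" "k : Sec N U'"
   "pull \<phi> U' k = rst Z V (preim Z \<phi> U') (s i)" using one[OF insert.prems(1)[of i, OF insertI1] U(1,2)] by blast
  interpret lmor N Z U "preim Z \<phi>" "umap \<phi>" "pull \<phi>" by (rule lm[OF U(1)])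
  define F where "F l = (if l = i then k else rst N U U' (f l))" for l
  have "F l : Sec N U' & pull \<phi> U' (F l) = rst Z V (preim Z \<phi> U') (s l)" if "l : insert i J" for l
  proof (cases "l = i")
   case False
   then have l: "l : J" using that by simp
   have "pull \<phi> U' (rst N U U' (f l)) = rst Z (preim Z \<phi> U) (preim Z \<phi> U') (rst Z V (preim Z \<phi> U) (s l))"
    unfolding f(2)[OF l, symmetric] by (rule h_rst[OF U(1) U'(1,3) order_refl f(1)[OF l]])
   also have "\<dots> = rst Z V (preim Z \<phi> U') (s l)"
    by (rule Z.rst_rst) (use V S_open[OF U(1) order_refl] S_open[OF U'(1,3)] U(4) S_mono[OF U(1) order_refl U'(1,3)] insert.prems l in auto)
   finally show ?thesis using False U U' f(1)[OF l] by (simp add: F_def)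
  qed (use U' in \<open>simp add: F_def\<close>)
  then show ?case using U U' by (intro exI[of _ U'] exI[of _ F]) auto
 qed
qed

text \<open>Pull-backs preserve parity, so by uniqueness of the decomposition the component of the
  required parity of any lift is itself a lift.\<close>

lemma lift_family_part:
 assumes Z: "superringed_space Z" and N: "superringed_space N" and \<phi>: "smorphism Z N \<phi>" and st: "stalk_surj Z N \<phi>"
  and V: "oset Z V" "x : V" and Q: "oset N Q" "umap \<phi> x : Q"
  and J: "finite J" and s: "\<And>i. i : J ==> s i : Part Z V (\<pi> i)"
 shows "\<exists>U f. oset N U & umap \<phi> x : U & U <= Q & preim Z \<phi> U <= V &
   (\<forall>i\<in>J. f i : Part N U (\<pi> i) & pull \<phi> U (f i) = rst Z V (preim Z \<phi> U) (s i))"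
proof -
 interpret Z: sspace Z using Z by unfold_locales
 interpret N: sspace N using N by unfold_locales
 have sc: "s i : Sec Z V" if "i : J" for i using superalg.part_closed[OF Z.alg[OF V(1)] s[OF that]] .
 have lift: "\<exists>U f. oset N U & umap \<phi> x : U & U <= Q & preim Z \<phi> U <= V &
   (\<forall>i\<in>J. f i : Sec N U & pull \<phi> U (f i) = rst Z V (preim Z \<phi> U) (s i))"
  by (rule lift_family[OF Z N \<phi> st V Q J sc])
 obtain U f where U: "oset N U" "umap \<phi> x : U" "U <= Q" "preim Z \<phi> U <= V"
  and f': "\<forall>i\<in>J. f i : Sec N U & pull \<phi> U (f i) = rst Z V (preim Z \<phi> U) (s i)"
  using lift by (elim exE conjE) (rule that)
 note f = bspec[OF f']
 interpret l: lmor N Z U "preim Z \<phi>" "umap \<phi>" "pull \<phi>" using shmor_smorphism[OF \<phi> U(1)] by unfold_locales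
 interpret h: superalg_hom "sec N U" "sec Z (preim Z \<phi> U)" "pull \<phi> U" using l.hh[OF U(1) order_refl] .
 interpret r: superalg_hom "sec Z V" "sec Z (preim Z \<phi> U)" "rst Z V (preim Z \<phi> U)"
  using Z.rst[OF V(1) l.S_open[OF U(1) order_refl] U(4)] .
 have "\<exists>k. k : Part N U (\<pi> i) & pull \<phi> U k = rst Z V (preim Z \<phi> U) (s i)" if i: "i : J" for i
 proof -
  obtain f0 f1 where f01: "f0 : Part N U False" "f1 : Part N U True" "f i = f0 +[sec N U] f1"
   using h.A.decomp f[OF i] by blast
  note fc = h.A.part_closed[OF f01(1)] h.A.part_closed[OF f01(2)]
  let ?s = "rst Z V (preim Z \<phi> U) (s i)"
  have sp: "?s : Part Z (preim Z \<phi> U) (\<pi> i)" using r.parity s[OF i] .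
  have e: "pull \<phi> U f0 +[sec Z (preim Z \<phi> U)] pull \<phi> U f1 = ?s" using f[OF i] f01(3) h.add[OF fc] by simp
  show ?thesis
  proof (cases "\<pi> i")
   case True
   have "pull \<phi> U f1 = ?s"
    by (rule h.B.decomp_unique(2)[OF h.parity[OF f01(1)] h.parity[OF f01(2)] h.B.part_zero])
     (use sp True e h.B.part_closed in auto)
   then show ?thesis using f01 True by auto
  next
   case False
   have "pull \<phi> U f0 = ?s"
    by (rule h.B.decomp_unique(1)[OF h.parity[OF f01(1)] h.parity[OF f01(2)] _ h.B.part_zero])
     (use sp False e h.B.part_closed in auto)
   then show ?thesis using f01 False by auto
  qed
 qed
 then obtain k where "\<And>i. i : J ==> k i : Part N U (\<pi> i) & pull \<phi> U (k i) = rst Z V (preim Z \<phi> U) (s i)" by metis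
 then show ?thesis using U by blast
qed

text \<open>The Hadamard expansion of the pull-back of \<open>f\<close> on \<open>Z\<close> is
  lifted term by term to \<open>N\<close>. The lifted expansion represents \<open>f\<close> only up
  to a function whose pull-back is zero, which accounts for the parameter K of
  \<open>had\<close>.\<close>

lemma had_lift:
 assumes Z: "locally_super k l Z" and N: "locally_super a b N" and \<phi>: "smorphism Z N \<phi>" and st: "stalk_surj Z N \<phi>"
  and Z1: "oset Z Z1" and U: "oset N U" "preim Z \<phi> U <= Z1" and z: "z : preim Z \<phi> U"
  and y: "\<And>i. i < r ==> y i : Sec Z Z1" and y': "\<And>i. i < r ==> y' i : Sec N U"
  and yy: "\<And>i. i < r ==> pull \<phi> U (y' i) = rst Z Z1 (preim Z \<phi> U) (y i)"
  and H: "had Z Z1 r \<pi> y z (%V. {0[sec Z V]})"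
 shows "had N U r \<pi> y' (umap \<phi> z) (%V. {f : Sec N V. pull \<phi> V f = 0[sec Z (preim Z \<phi> V)]})"
proof -
 have Z': "superringed_space Z" and N': "superringed_space N" using Z N by (auto simp: locally_super_def)
 interpret Z: sspace Z using Z' by unfold_locales
 interpret N: sspace N using N' by unfold_locales
 interpret lm: lmor N Z U "preim Z \<phi>" "umap \<phi>" "pull \<phi>" using shmor_smorphism[OF \<phi> U(1)] by unfold_locales
 let ?p = "umap \<phi> z" and ?ZU = "preim Z \<phi> U"
 have pU: "?p : U" using lm.u_in[OF z] .
 have oZU: "oset Z ?ZU" using lm.S_open[OF U(1) order_refl] .
 obtain t where t': "\<forall>i<r. value_is Z z Z1 (y i) (t i) & (\<pi> i --> t i = 0)"
  and ex: "\<forall>V f. oset Z V & V <= Z1 & z : V & f : Sec Z V -->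
    (\<exists>V' c g. oset Z V' & z : V' & V' <= V & (\<forall>i<r. g i : Sec Z V') &
     rst Z V V' f -[sec Z V'] (c \<odot>[sec Z V'] 1[sec Z V'] +[sec Z V']
      rsum (sec Z V') (%i. (rst Z Z1 V' (y i) -[sec Z V'] (t i \<odot>[sec Z V'] 1[sec Z V'])) *[sec Z V'] g i) r)
     : {0[sec Z V']})"
  using H[unfolded had_def] by (elim exE conjE) (rule that)
 have "z : topspace (spc Z)" using z openin_subset[OF oZU] by auto
 then obtain UZ eZ where eZ: "evalat l Z z (eZ z)" "z : UZ"
  using locally_super_has_evals[OF Z] unfolding has_evals_def evals_def by blast
 have "?p : topspace (spc N)" using pU openin_subset[OF U(1)] by auto
 then obtain UY eN where eN: "evalat b N ?p (eN ?p)" "?p : UY"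
  using locally_super_has_evals[OF N] unfolding has_evals_def evals_def by blast
 \<comment> \<open>The value of \<open>y' i\<close> at the image point exists in a chart of
   \<open>N\<close>. It passes to the pull-back, which is \<open>y i\<close>, and values on
   \<open>Z\<close> are unique.\<close>
 have val: "value_is N ?p U (y' i) (t i)" if i: "i < r" for i
 proof -
  define c where "c = eN ?p U (y' i) {}"
  have v: "value_is N ?p U (y' i) c" using value_is_iff[OF N' eN(1) U(1) pU y'[OF i]] c_def by simp
  have c1: "rst Z Z1 ?ZU (y i) : Sec Z ?ZU" using y[OF i] Z1 oZU U(2) by simp
  have "value_is Z z ?ZU (rst Z Z1 ?ZU (y i)) c"
   using lm.value_is_h[OF U(1) order_refl z y'[OF i] v] yy[OF i] by simp
  moreover have "value_is Z z ?ZU (rst Z Z1 ?ZU (y i)) (t i)"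
   using value_is_mono[OF Z' Z1 oZU U(2) z y[OF i]] t' i by blast
  ultimately have "c = t i" using value_is_iff[OF Z' eZ(1) oZU z c1] by simp
  then show ?thesis using v by simp
 qed
 show ?thesis
  unfolding had_def
 proof (intro exI[of _ t] conjI allI impI val)
  show "t i = 0" if "i < r" "\<pi> i" for i using t' that by blast
  fix V f assume "oset N V & V <= U & ?p : V & f : Sec N V"
  then have V: "oset N V" "V <= U" and pV: "?p : V" and f: "f : Sec N V" by auto
  let ?S = "preim Z \<phi> V"
  have oS: "oset Z ?S" using lm.S_open[OF V] .
  have SU: "?S <= ?ZU" using lm.S_mono[OF U(1) order_refl V] .
  have zS: "z : ?S" using lm.S_mem[OF U(1) order_refl V z pV] .
  interpret hV: superalg_hom "sec N V" "sec Z ?S" "pull \<phi> V" using lm.hh[OF V] .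
  have "oset Z ?S & ?S <= Z1 & z : ?S & pull \<phi> V f : Sec Z ?S" using oS SU U(2) zS f by auto
  from ex[rule_format, OF this] obtain Z' c g where Z': "oset Z Z'" "z : Z'" "Z' <= ?S"
   and g: "\<forall>i<r. g i : Sec Z Z'"
   and eq: "rst Z ?S Z' (pull \<phi> V f) -[sec Z Z'] (c \<odot>[sec Z Z'] 1[sec Z Z'] +[sec Z Z']
      rsum (sec Z Z') (%i. (rst Z Z1 Z' (y i) -[sec Z Z'] (t i \<odot>[sec Z Z'] 1[sec Z Z'])) *[sec Z Z'] g i) r)
     : {0[sec Z Z']}"
   by (elim exE conjE) (rule that)
  obtain V' G where V': "oset N V'" "?p : V'" "V' <= V" "preim Z \<phi> V' <= Z'"
   and G': "\<forall>i\<in>{..<r}. G i : Sec N V' & pull \<phi> V' (G i) = rst Z Z' (preim Z \<phi> V') (g i)"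
  proof -
   have "\<exists>V' G. oset N V' & ?p : V' & V' <= V & preim Z \<phi> V' <= Z' &
     (\<forall>i\<in>{..<r}. G i : Sec N V' & pull \<phi> V' (G i) = rst Z Z' (preim Z \<phi> V') (g i))"
    by (rule lift_family[OF Z.srs N.srs \<phi> st Z'(1,2) V(1) pV]) (use g in auto)
   then show thesis by (elim exE conjE) (rule that)
  qed
  have G: "G i : Sec N V'" "pull \<phi> V' (G i) = rst Z Z' (preim Z \<phi> V') (g i)" if "i < r" for i
   using bspec[OF G', of i] that by auto
  have V'U: "V' <= U" using V' V by auto
  let ?A = "sec N V'" and ?S' = "preim Z \<phi> V'"
  have oS': "oset Z ?S'" using lm.S_open[OF V'(1) V'U] .
  interpret h: superalg_hom ?A "sec Z ?S'" "pull \<phi> V'" using lm.hh[OF V'(1) V'U] .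
  interpret q: superalg_hom "sec Z Z'" "sec Z ?S'" "rst Z Z' ?S'" using Z.rst[OF Z'(1) oS' V'(4)] .
  have sub: "?S' <= ?S" "Z' <= Z1" using V'(4) Z'(3) SU U(2) by auto
  define w where "w i = rst N U V' (y' i)" for i
  have wc: "w i : carrier ?A" if "i < r" for i unfolding w_def using y'[OF that] U(1) V'(1) V'U by simp
  have hw: "pull \<phi> V' (w i) = rst Z Z' ?S' (rst Z Z1 Z' (y i))" if i: "i < r" for i
  proof -
   have "pull \<phi> V' (w i) = rst Z ?ZU ?S' (rst Z Z1 ?ZU (y i))"
    unfolding w_def yy[OF i, symmetric] by (rule lm.h_rst[OF U(1) V'(1) V'U order_refl y'[OF i]])
   also have "\<dots> = rst Z Z1 ?S' (y i)" by (rule Z.rst_rst) (use Z1 oZU oS' U(2) sub SU y[OF i] in auto)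
   also have "\<dots> = rst Z Z' ?S' (rst Z Z1 Z' (y i))" by (rule Z.rst_rst[symmetric]) (use Z1 Z' oS' sub V'(4) y[OF i] in auto)
   finally show ?thesis .
  qed
  have f1: "rst N V V' f : carrier ?A" using f V V' by simp
  have hf: "pull \<phi> V' (rst N V V' f) = rst Z Z' ?S' (rst Z ?S Z' (pull \<phi> V f))"
  proof -
   have "pull \<phi> V' (rst N V V' f) = rst Z ?S ?S' (pull \<phi> V f)" by (rule lm.h_rst[OF V(1) V'(1,3) V(2) f])
   also have "\<dots> = rst Z Z' ?S' (rst Z ?S Z' (pull \<phi> V f))"
    by (rule Z.rst_rst[symmetric]) (use oS Z' oS' V'(4) f in auto)
   finally show ?thesis .
  qed
  have yZ: "rst Z Z1 Z' (y i) : Sec Z Z'" if "i < r" for i using y[OF that] Z1 Z'(1) sub by simp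
  define B where "B i = (w i -[?A] (t i \<odot>[?A] 1[?A])) *[?A] G i" for i
  define D where "D i = (rst Z Z1 Z' (y i) -[sec Z Z'] (t i \<odot>[sec Z Z'] 1[sec Z Z'])) *[sec Z Z'] g i" for i
  have Bc: "B i : carrier ?A" and Dc: "D i : Sec Z Z'" and BD: "pull \<phi> V' (B i) = rst Z Z' ?S' (D i)"
   if i: "i < r" for i
   using wc[OF i] G[OF i] yZ[OF i] g i hw[OF i]
   by (simp_all add: B_def D_def h.mult h.minus h.smult h.one q.mult q.minus q.smult q.one)
  have rc: "rsum ?A B r : carrier ?A" "rsum (sec Z Z') D r : Sec Z Z'"
   using Bc Dc by (auto intro: h.A.rsum_closed q.A.rsum_closed)
  have hB: "pull \<phi> V' (rsum ?A B r) = rst Z Z' ?S' (rsum (sec Z Z') D r)"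
  proof -
   have "pull \<phi> V' (rsum ?A B r) = rsum (sec Z ?S') (%i. pull \<phi> V' (B i)) r" by (rule h.rsum[OF Bc])
   also have "\<dots> = rsum (sec Z ?S') (%i. rst Z Z' ?S' (D i)) r" by (rule rsum_cong[OF BD])
   also have "\<dots> = rst Z Z' ?S' (rsum (sec Z Z') D r)" by (rule q.rsum[OF Dc, symmetric])
   finally show ?thesis .
  qed
  have f2: "rst Z ?S Z' (pull \<phi> V f) : Sec Z Z'" using f oS Z' by simp
  have eq': "rst Z ?S Z' (pull \<phi> V f) -[sec Z Z'] (c \<odot>[sec Z Z'] 1[sec Z Z'] +[sec Z Z'] rsum (sec Z Z') D r) = 0[sec Z Z']"
   using eq unfolding D_def[abs_def] by simp
  have "pull \<phi> V' (rst N V V' f -[?A] (c \<odot>[?A] 1[?A] +[?A] rsum ?A B r)) =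
    rst Z Z' ?S' (rst Z ?S Z' (pull \<phi> V f) -[sec Z Z'] (c \<odot>[sec Z Z'] 1[sec Z Z'] +[sec Z Z'] rsum (sec Z Z') D r))"
   using f1 f2 rc by (simp add: h.minus h.add h.smult h.one q.minus q.add q.smult q.one hf hB)
  also have "\<dots> = 0[sec Z ?S']" unfolding eq' by (rule q.zero)
  finally have "rst N V V' f -[?A] (c \<odot>[?A] 1[?A] +[?A] rsum ?A B r) \<in>
    {f : carrier ?A. pull \<phi> V' f = 0[sec Z ?S']}" using f1 rc by simp
  then show "\<exists>V' c g. oset N V' & ?p : V' & V' <= V & (\<forall>i<r. g i : Sec N V') &
     rst N V V' f -[sec N V'] (c \<odot>[sec N V'] 1[sec N V'] +[sec N V']
      rsum (sec N V') (%i. (rst N U V' (y' i) -[sec N V'] (t i \<odot>[sec N V'] 1[sec N V'])) *[sec N V'] g i) r)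
     : {f : Sec N V'. pull \<phi> V' f = 0[sec Z (preim Z \<phi> V')]}"
   unfolding B_def[abs_def] w_def using V' G(1)
   by (intro exI[of _ V'] exI[of _ c] exI[of _ G]) (simp only: simp_thms, simp)
 qed
qed

text \<open>Multiples by -1 provide negatives, so \<open>J\<close> is an ideal that contains the
  generators.\<close>

lemma (in superalg) genideal_induct:
 assumes x: "x : Idl S" and J: "J <= carrier A" "\<zero> : J" and S: "S <= J"
  and add: "\<And>x y. x : J ==> y : J ==> x \<oplus> y : J"
  and mult: "\<And>c x. c : carrier A ==> x : J ==> c \<otimes> x : J" "\<And>c x. c : carrier A ==> x : J ==> x \<otimes> c : J"
 shows "x : J"
proof -
 have minus: "\<ominus> x : J" if "x : J" for x
  using mult(1)[of "\<ominus> \<one>" x] that J by (auto simp: l_minus)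
 have "subgroup J (add_monoid A)"
  by unfold_locales (use J add minus in \<open>auto simp: a_inv_def\<close>)
 then have "ideal J A" by (rule idealI[OF ring_axioms]) (use mult in auto)
 then show ?thesis using genideal_minimal[OF _ S] x by blast
qed

lemma smor_lmor:
 assumes "superringed_space Z" "superringed_space N" "smorphism Z N \<phi>" "oset N U"
 shows "lmor N Z U (preim Z \<phi>) (umap \<phi>) (pull \<phi>)"
 using assms(1,2) shmor_smorphism[OF assms(3,4)] by unfold_locales

text \<open>For \<open>f\<close> that is not homogeneous, the sign of the Leibniz rule of an odd
  derivation becomes the grading involution.\<close>

lemma (in lmor) lder_Leibniz':
 assumes D: "lder N W U S h p D" and V: "oset N V" "V <= U"
  and f: "f : Sec N V" and g: "g : Sec N V"
 shows "D V (f *[sec N V] g) = D V f *[sec W (S V)] h V g +[sec W (S V)]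
  h V (if p then grade_inv (sec N V) f else f) *[sec W (S V)] D V g"
proof -
 interpret superalg_hom "sec N V" "sec W (S V)" "h V" using hh[OF V] .
 obtain f0 f1 where f01: "f0 : Part N V False" "f1 : Part N V True" and e: "f = f0 +[sec N V] f1"
  using A.decomp[OF f] .
 note fc = A.part_closed[OF f01(1)] A.part_closed[OF f01(2)]
 note L = lder_Leibniz[OF D V f01(1) g] lder_Leibniz[OF D V f01(2) g]
 have "D V (f *[sec N V] g) = D V (f0 *[sec N V] g) +[sec W (S V)] D V (f1 *[sec N V] g)"
  using lder_add[OF D V] fc g unfolding e by (simp add: A.l_distr)
 then show ?thesis
  unfolding L unfolding e lder_add[OF D V fc] A.grade_inv_decomp[OF f01]
  using lder_closed[OF D V fc(1)] lder_closed[OF D V fc(2)] lder_closed[OF D V g] closed[OF g] fc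
  by (cases p) (simp_all add: signed_def add minus a_minus_def uminus B.l_distr B.l_minus B.a_ac)
qed

lemma (in superalg) grade_inv_rsum:
 "(\<And>i. i < k ==> f i : carrier A) ==> grade_inv A (rsum A f k) = rsum A (%i. grade_inv A (f i)) k"
 by (rule rsum_additive[of _ _ _ "carrier A"]) (auto simp: grade_inv_add)

text \<open>The derivations \<open>E n\<close>, pull-back followed by \<open>D n\<close>, are
  determined by their values on the coordinates of \<open>N\<close>. Lifting these finitely many
  values to coefficients \<open>A\<close> and setting X_n to be the sum of the A(n,i) e_i gives
  fields on \<open>N\<close>; after pull-back, \<open>lder_expand\<close> identifies them with
  \<open>E n\<close>. The lemma extends coordinate fields of Z to N as well as fields of W to
  M.\<close>

lemma lift_derivations:
 fixes m :: nat
 assumes Z: "superringed_space Z" "has_evals b' Z" and N: "superringed_space N"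
  and \<phi>: "smorphism Z N \<phi>" and st: "stalk_surj Z N \<phi>"
  and G: "good_coords c d N U y e" and z: "z : preim Z \<phi> U"
  and V: "preim Z \<phi> U <= V" and D: "\<And>i. i < m ==> lder Z Z V (%V. V) (%V f. f) (\<pi> i) (D i)"
 shows "\<exists>U' X. oset N U' & umap \<phi> z : U' & U' <= U &
   (\<forall>i<m. lder N N U' (%V. V) (%V f. f) (\<pi> i) (X i) &
    (\<forall>B f. oset N B & B <= U' & f : Sec N B -->
     pull \<phi> B (X i B f) = D i (preim Z \<phi> B) (pull \<phi> B f)))"
proof -
 interpret Z: sspace Z using Z by unfold_locales
 interpret N: sspace N using N by unfold_locales
 note U = good_coords_open[OF G]
 interpret l: lmor N Z U "preim Z \<phi>" "umap \<phi>" "pull \<phi>" by (rule smor_lmor[OF Z(1) N \<phi> U])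
 define E where "E i B f = D i (preim Z \<phi> B) (pull \<phi> B f)" for i B f
 have E: "lder N Z U (preim Z \<phi>) (pull \<phi>) (\<pi> i) (E i)" if "i < m" for i
  unfolding E_def[abs_def] by (rule lder_comp_pre[OF N Z(1) l.sh V D[OF that]])
 have oP: "oset Z (preim Z \<phi> U)" by (rule l.S_open[OF U order_refl])
 let ?J = "{..<m} \<times> {..<c + d}"
 have s: "E (fst x) U (y (snd x)) : Part Z (preim Z \<phi> U) (\<pi> (fst x) \<noteq> (c \<le> snd x))" if "x : ?J" for x
  by (rule lder_parity[OF E U order_refl good_coords_part[OF G]]) (use that in auto)
 have fin: "finite ?J" by simp
 have "\<exists>U' A. oset N U' & umap \<phi> z : U' & U' <= U & preim Z \<phi> U' <= preim Z \<phi> U &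
   (\<forall>x\<in>?J. A x : Part N U' (\<pi> (fst x) \<noteq> (c \<le> snd x)) &
    pull \<phi> U' (A x) = rst Z (preim Z \<phi> U) (preim Z \<phi> U') (E (fst x) U (y (snd x))))"
  by (rule lift_family_part[OF Z(1) N \<phi> st oP z U l.u_in[OF z] fin s])
 then obtain U' A where U': "oset N U'" "umap \<phi> z : U'" "U' <= U"
  and A': "\<forall>x\<in>?J. A x : Part N U' (\<pi> (fst x) \<noteq> (c \<le> snd x)) &
    pull \<phi> U' (A x) = rst Z (preim Z \<phi> U) (preim Z \<phi> U') (E (fst x) U (y (snd x)))"
  by (elim exE conjE) (rule that)
 have Ap: "A (n, i) : Part N U' (\<pi> n \<noteq> (c \<le> i))"
  and pA: "pull \<phi> U' (A (n, i)) = E n U' (rst N U U' (y i))" if n: "n < m" and i: "i < c + d" for n i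
 proof -
  have x: "(n, i) : ?J" using n i by simp
  have yc: "y i : Sec N U" using superalg.part_closed[OF N.alg[OF U] good_coords_part[OF G i]] .
  show "A (n, i) : Part N U' (\<pi> n \<noteq> (c \<le> i))" using bspec[OF A' x, THEN conjunct1] by simp
  show "pull \<phi> U' (A (n, i)) = E n U' (rst N U U' (y i))"
   using bspec[OF A' x, THEN conjunct2] lder_rst[OF E[OF n] U order_refl U'(1,3) yc] by simp
 qed
 interpret lN: lmor N N U' "%V. V" "%x. x" "%V f. f" by unfold_locales (rule shmor_ident[OF N U'(1)])
 interpret l': lmor N Z U' "preim Z \<phi>" "umap \<phi>" "pull \<phi>" by (rule smor_lmor[OF Z(1) N \<phi> U'(1)])
 have G': "good_coords c d N U' (%i. rst N U U' (y i)) e" by (rule good_coords_mono[OF N G U'(1,3)])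
 define X where "X n B f = rsum (sec N B) (%i. rst N U' B (A (n, i)) *[sec N B] e i B f) (c + d)" for n B f
 have X: "lder N N U' (%V. V) (%V f. f) (\<pi> n) (X n)" if n: "n < m" for n
  unfolding X_def[abs_def]
 proof (rule lN.lder_rsum)
  fix i assume i: "i < c + d"
  have "((\<pi> n \<noteq> (c \<le> i)) \<noteq> (c \<le> i)) = \<pi> n" by auto
  then show "lder N N U' (%V. V) (%V f. f) (\<pi> n) (%V f. rst N U' V (A (n, i)) *[sec N V] e i V f)"
   using lN.lder_scale[OF good_coords_lder[OF G' i] Ap[OF n i]] by simp
 qed
 have "pull \<phi> B (X n B f) = E n B f" if n: "n < m" and B: "oset N B" "B <= U'" and f: "f : Sec N B" for n B f
 proof -
  interpret h: superalg_hom "sec N B" "sec Z (preim Z \<phi> B)" "pull \<phi> B" by (rule l'.hh[OF B])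
  have Ac: "A (n, i) : Sec N U'" if "i < c + d" for i using superalg.part_closed[OF N.alg[OF U'(1)] Ap[OF n that]] .
  have rA: "rst N U' B (A (n, i)) : Sec N B" if "i < c + d" for i using N.rst_closed[OF U'(1) B Ac[OF that]] .
  have ec: "e i B f : Sec N B" if "i < c + d" for i using lder_closed[OF good_coords_lder[OF G' that] B f] .
  have "pull \<phi> B (X n B f) = rsum (sec Z (preim Z \<phi> B)) (%i. pull \<phi> B (rst N U' B (A (n, i)) *[sec N B] e i B f)) (c + d)"
   unfolding X_def by (rule h.rsum) (use rA ec in auto)
  also have "\<dots> = rsum (sec Z (preim Z \<phi> B)) (%i. rst Z (preim Z \<phi> U') (preim Z \<phi> B) (E n U' (rst N U U' (y i)))
    *[sec Z (preim Z \<phi> B)] pull \<phi> B (e i B f)) (c + d)"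
  proof (rule rsum_cong)
   fix i assume i: "i < c + d"
   show "pull \<phi> B (rst N U' B (A (n, i)) *[sec N B] e i B f) =
    rst Z (preim Z \<phi> U') (preim Z \<phi> B) (E n U' (rst N U U' (y i))) *[sec Z (preim Z \<phi> B)] pull \<phi> B (e i B f)"
    unfolding h.mult[OF rA[OF i] ec[OF i]] l'.h_rst[OF U'(1) B order_refl Ac[OF i]] pA[OF n i] ..
  qed
  also have "\<dots> = E n B f"
   by (rule l'.lder_expand[OF G' lder_mono[OF E[OF n] U'(3)] Z(2) B f, symmetric])
  finally show ?thesis .
 qed
 then show ?thesis
  using X unfolding E_def by (intro exI[of _ U'] exI[of _ X] conjI U' allI impI) simp_all
qed

text \<open>Fields \<open>Va a\<close> near a point of \<open>Z\<close> which are tangent to \<open>Z\<close> and restrict there to the coordinate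
 fields of the coordinates \<open>zt a\<close>; the \<open>g i\<close> vanish on \<open>Z\<close>. \<open>Pi_zt\<close> says that \<open>P\<^sub>N (Va a) (g i)\<close> vanishes
 on \<open>Z\<close>.\<close>

locale tangent_frame =
 fixes N :: "('q, 't) superspace" and Z :: "('z, 'v) superspace" and j PN and c d k l r :: nat
  and U g U2 y e U3 zt Va
 assumes U3: "oset N U3" "U3 <= U2" "U2 <= U"
  and good: "good_coords c d N U2 y e"
  and fields: "coordinate_fields c d N U2 y (%i. normal_der N U2 (e i))"
  and zt: "\<And>a. a < k + l ==> zt a : Part N U3 (k \<le> a)"
  and Va: "\<And>a. a < k + l ==> lder N N U3 (%V. V) (%V f. f) (k \<le> a) (Va a)"
  and Va_ker: "\<And>a V f. a < k + l ==> oset N V ==> V <= U3 ==> f : Sec N V ==>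
   pull j V f = 0[sec Z (preim Z j V)] ==> pull j V (Va a V f) = 0[sec Z (preim Z j V)]"
  and Va_zt: "\<And>a b. a < k + l ==> b < k + l ==>
   pull j U3 (Va a U3 (zt b)) = (if a = b then 1[sec Z (preim Z j U3)] else 0[sec Z (preim Z j U3)])"
  and had_zt: "\<And>z. z : preim Z j U3 ==> had N U3 (k + l) (%a. k \<le> a) zt (umap j z)
   (%V. {f : Sec N V. pull j V f = 0[sec Z (preim Z j V)]})"
  and Pi_zt: "\<And>a i. a < k + l ==> i < r ==> pull j U3 (rsum (sec N U3) (%n.
   grade_inv (sec N U3) (Va a U3 (rst N U2 U3 (y n))) *[sec N U3]
   rst N U2 U3 (PN U2 (normal_der N U2 (e n)) U2 (rst N U U2 (g i)))) (c + d)) = 0[sec Z (preim Z j U3)]"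

text \<open>\<open>zt\<close> and \<open>Va\<close> are lifts of coordinates and coordinate fields
  of \<open>Z\<close>. Since \<open>Va a\<close> restricts to the field \<open>eZ a\<close> of
  \<open>Z\<close>, it preserves the functions vanishing on \<open>Z\<close>. For
  \<open>Pi_zt\<close>, the restriction of the sum to \<open>Z\<close> is by
  \<open>Pi_formula\<close> for \<open>j\<close> the value of \<open>PZ (eZ a)\<close> at the
  restriction of \<open>g i\<close>, which is zero.\<close>

lemma tangent_frame_exists:
 assumes N: "locally_super c d N" "Pi_symmetry (tangent_sheaf N) PN"
  and Z: "locally_super k l Z" "Hausdorff_space (spc Z)" "Pi_symmetry (tangent_sheaf Z) PZ"
  and j: "Pi_morphism Z PZ N PN j" and st: "stalk_surj Z N j"
  and U: "oset N U" and z: "z : preim Z j U"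
  and g: "\<And>i. i < r ==> g i : Sec N U" "\<And>i. i < r ==> pull j U (g i) = 0[sec Z (preim Z j U)]"
 shows "\<exists>U2 y e U3 zt Va. umap j z : U3 & tangent_frame N Z j PN c d k l r U g U2 y e U3 zt Va"
proof -
 have N': "superringed_space N" and Z': "superringed_space Z" using N Z by (auto simp: locally_super_def)
 interpret N: pisym N PN using N' N by unfold_locales
 interpret Z: pisym Z PZ using Z' Z by unfold_locales
 have sm: "smorphism Z N j" using j by (simp add: Pi_morphism_def)
 note lm = smor_lmor[OF Z' N' sm]
 interpret l: lmor N Z U "preim Z j" "umap j" "pull j" by (rule lm[OF U])
 note oP = l.S_open[OF U order_refl]
 obtain Z1 yZ eZ where Z1: "oset Z Z1" "z : Z1" "Z1 <= preim Z j U"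
  and GZ: "good_coords k l Z Z1 yZ eZ" using locally_super_coords[OF Z(1) oP z] by blast
 \<comment> \<open>Of the nested neighbourhoods, \<open>U1\<close> carries lifted coordinates of
   \<open>Z\<close>, \<open>U2\<close> coordinates of \<open>N\<close>, and \<open>U3\<close> the
   lifted fields.\<close>
 have "\<exists>U1 f. oset N U1 & umap j z : U1 & U1 <= U & preim Z j U1 <= Z1 &
   (\<forall>a\<in>{..<k + l}. f a : Part N U1 (k \<le> a) & pull j U1 (f a) = rst Z Z1 (preim Z j U1) (yZ a))"
  by (rule lift_family_part[OF Z' N' sm st Z1(1,2) U l.u_in[OF z]]) (use good_coords_part[OF GZ] in auto)
 then obtain U1 zu where U1: "oset N U1" "umap j z : U1" "U1 <= U" "preim Z j U1 <= Z1"
  and zu': "\<forall>a\<in>{..<k + l}. zu a : Part N U1 (k \<le> a) & pull j U1 (zu a) = rst Z Z1 (preim Z j U1) (yZ a)"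
  by (elim exE conjE) (rule that)
 have zu: "zu a : Part N U1 (k \<le> a)" "pull j U1 (zu a) = rst Z Z1 (preim Z j U1) (yZ a)" if "a < k + l" for a
  using bspec[OF zu', of a] that by auto
 obtain U2 y e where U2: "oset N U2" "umap j z : U2" "U2 <= U1"
  and G: "good_coords c d N U2 y e" and CF: "coordinate_fields c d N U2 y (%i. normal_der N U2 (e i))"
  using locally_super_coords[OF N(1) U1(1,2)] by blast
 interpret l1: lmor N Z U1 "preim Z j" "umap j" "pull j" by (rule lm[OF U1(1)])
 interpret l2: lmor N Z U2 "preim Z j" "umap j" "pull j" by (rule lm[OF U2(1)])
 have z2: "z : preim Z j U2" using l.S_mem[OF U order_refl U2(1) _ z U2(2)] U2(3) U1(3) by blast
 have P2: "preim Z j U2 <= Z1" using l1.S_mono[OF U1(1) order_refl U2(1,3)] U1(4) by blast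
 have "\<exists>U3 Va. oset N U3 & umap j z : U3 & U3 <= U2 &
   (\<forall>a<k + l. lder N N U3 (%V. V) (%V f. f) (k \<le> a) (Va a) &
    (\<forall>B f. oset N B & B <= U3 & f : Sec N B -->
     pull j B (Va a B f) = eZ a (preim Z j B) (pull j B f)))"
  by (rule lift_derivations[OF Z' locally_super_has_evals[OF Z(1)] N' sm st G z2 P2 good_coords_lder[OF GZ]])
 then obtain U3 Va where U3: "oset N U3" "umap j z : U3" "U3 <= U2"
  and Va': "\<forall>a<k + l. lder N N U3 (%V. V) (%V f. f) (k \<le> a) (Va a) &
    (\<forall>B f. oset N B & B <= U3 & f : Sec N B -->
     pull j B (Va a B f) = eZ a (preim Z j B) (pull j B f))"
  by (elim exE conjE) (rule that)
 have Va: "lder N N U3 (%V. V) (%V f. f) (k \<le> a) (Va a)" if "a < k + l" for a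
  using Va'[rule_format, OF that, THEN conjunct1] .
 have pVa: "pull j B (Va a B f) = eZ a (preim Z j B) (pull j B f)"
  if "a < k + l" "oset N B" "B <= U3" "f : Sec N B" for a B f
  using Va'[rule_format, OF that(1), THEN conjunct2, rule_format, OF conjI[OF that(2) conjI[OF that(3,4)]]] .
 interpret l3: lmor N Z U3 "preim Z j" "umap j" "pull j" by (rule lm[OF U3(1)])
 let ?Q = "preim Z j U3"
 note oQ = l3.S_open[OF U3(1) order_refl]
 have sub: "U3 <= U1" "U2 <= U" "?Q <= preim Z j U2" "?Q <= Z1" "?Q <= preim Z j U1"
  using U3 U2 U1 l2.S_mono[OF U2(1) order_refl U3(1,3)] P2 l1.S_mono[OF U1(1) order_refl U3(1)] by auto
 interpret l1Z: lmor Z Z Z1 "%V. V" "%x. x" "%V f. f" by (rule Z.lm_id[OF Z1(1)])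
 interpret lQ: lmor Z Z ?Q "%V. V" "%x. x" "%V f. f" by (rule Z.lm_id[OF oQ])
 interpret h3: superalg_hom "sec N U3" "sec Z ?Q" "pull j U3" by (rule l3.hh[OF U3(1) order_refl])
 interpret r1: superalg_hom "sec N U1" "sec N U3" "rst N U1 U3" by (rule N.rst[OF U1(1) U3(1) sub(1)])
 interpret rZ: superalg_hom "sec Z Z1" "sec Z ?Q" "rst Z Z1 ?Q" by (rule Z.rst[OF Z1(1) oQ sub(4)])
 define zt where "zt a = rst N U1 U3 (zu a)" for a
 have yZc: "yZ a : Sec Z Z1" if "a < k + l" for a using good_coords_part[OF GZ that] by (auto intro: rZ.A.part_closed)
 have zuc: "zu a : Sec N U1" if "a < k + l" for a using zu(1)[OF that] by (auto intro: r1.A.part_closed)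
 have zt: "zt a : Part N U3 (k \<le> a)" if "a < k + l" for a unfolding zt_def by (rule r1.parity[OF zu(1)[OF that]])
 have jzt: "pull j U3 (zt a) = rst Z Z1 ?Q (yZ a)" if a: "a < k + l" for a
 proof -
  have "pull j U3 (zt a) = rst Z (preim Z j U1) ?Q (rst Z Z1 (preim Z j U1) (yZ a))"
   unfolding zt_def zu(2)[OF a, symmetric] by (rule l1.h_rst[OF U1(1) U3(1) sub(1) order_refl zuc[OF a]])
  also have "\<dots> = rst Z Z1 ?Q (yZ a)"
   by (rule Z.rst_rst[OF Z1(1) l1.S_open[OF U1(1) order_refl] oQ U1(4) sub(5) yZc[OF a]])
  finally show ?thesis .
 qed
 have "tangent_frame N Z j PN c d k l r U g U2 y e U3 zt Va"
 proof (rule tangent_frame.intro[OF U3(1,3) sub(2) G CF zt Va])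
  fix a V f assume a: "a < k + l" and V: "oset N V" "V <= U3" and f: "f : Sec N V"
   and 0: "pull j V f = 0[sec Z (preim Z j V)]"
  have "preim Z j V <= Z1" using l3.S_mono[OF U3(1) order_refl V] sub(4) by blast
  then show "pull j V (Va a V f) = 0[sec Z (preim Z j V)]"
   unfolding pVa[OF a V f] 0 by (rule l1Z.lder_zero_arg[OF good_coords_lder[OF GZ a] l3.S_open[OF V]])
 next
  fix a b assume ab: "a < k + l" "b < k + l"
  have "pull j U3 (Va a U3 (zt b)) = eZ a ?Q (rst Z Z1 ?Q (yZ b))"
   unfolding pVa[OF ab(1) U3(1) order_refl h3.A.part_closed[OF zt[OF ab(2)]]] jzt[OF ab(2)] ..
  also have "\<dots> = rst Z Z1 ?Q (eZ a Z1 (yZ b))"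
   by (rule lder_rst[OF good_coords_lder[OF GZ ab(1)] Z1(1) order_refl oQ sub(4) yZc[OF ab(2)]])
  also have "\<dots> = (if a = b then 1[sec Z ?Q] else 0[sec Z ?Q])"
   unfolding good_coords_delta[OF GZ ab] by (simp add: rZ.one rZ.zero)
  finally show "pull j U3 (Va a U3 (zt b)) = (if a = b then 1[sec Z ?Q] else 0[sec Z ?Q])" .
 next
  fix x assume x: "x : ?Q"
  show "had N U3 (k + l) (%a. k \<le> a) zt (umap j x) (%V. {f : Sec N V. pull j V f = 0[sec Z (preim Z j V)]})"
   by (rule had_lift[OF Z(1) N(1) sm st Z1(1) U3(1) sub(4) x yZc h3.A.part_closed[OF zt] jzt good_coords_had[OF GZ]])
    (use x sub(4) in auto)
 next
  fix a i assume a: "a < k + l" and i: "i < r"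
  define X where "X = normal_der Z ?Q (eZ a)"
  have X: "X : vfields Z ?Q"
   using gder_cong[OF lQ.gder_lder[OF lder_mono[OF good_coords_lder[OF GZ a] sub(4)]], of X]
   by (simp add: vfields_iff[OF Z'] X_def normal_der_idem normal_der_apply)
  have PX: "gder Z Z ?Q (%V. V) (%V f. f) (PZ ?Q X)" using Z.P_closed[OF oQ X] by (simp add: vfields_iff[OF Z'])
  let ?g = "rst N U U2 (g i)" and ?P2 = "preim Z j U2"
  have gc: "?g : Sec N U2" by (rule N.rst_closed[OF U U2(1) sub(2) g(1)[OF i]])
  have jr: "rst Z ?P2 ?Q (pull j U2 f) = pull j U3 (rst N U2 U3 f)" if "f : Sec N U2" for f
   by (rule l2.h_rst[OF U2(1) U3(1,3) order_refl that, symmetric])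
  have g0: "pull j U3 (rst N U2 U3 ?g) = 0[sec Z ?Q]"
  proof -
   have s: "U3 <= U" using U3(3) sub(2) by blast
   have "rst N U2 U3 ?g = rst N U U3 (g i)" by (rule N.rst_rst[OF U U2(1) U3(1) sub(2) U3(3) g(1)[OF i]])
   then have "pull j U3 (rst N U2 U3 ?g) = rst Z (preim Z j U) ?Q (pull j U (g i))"
    using l.h_rst[OF U U3(1) s order_refl g(1)[OF i]] by simp
   also have "\<dots> = 0[sec Z ?Q]"
    unfolding g(2)[OF i] by (rule superalg_hom.zero[OF Z.rst[OF oP oQ l.S_mono[OF U order_refl U3(1) s]]])
   finally show ?thesis .
  qed
  define C where "C n = rst N U2 U3 (PN U2 (normal_der N U2 (e n)) U2 ?g)" for n
  define Y where "Y n = rst N U2 U3 (y n)" for n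
  interpret lN: lmor N N U2 "%V. V" "%x. x" "%V f. f" by (rule N.lm_id[OF U2(1)])
  have yc: "y n : Sec N U2" if "n < c + d" for n
   using superalg.part_closed[OF N.alg[OF U2(1)] good_coords_part[OF G that]] .
  have Yc: "Y n : Sec N U3" if "n < c + d" for n unfolding Y_def by (rule N.rst_closed[OF U2(1) U3(1,3) yc[OF that]])
  have Pc: "PN U2 (normal_der N U2 (e n)) U2 ?g : Sec N U2" if n: "n < c + d" for n
  proof -
   have "normal_der N U2 (e n) : vfields N U2"
    using gder_cong[OF lN.gder_lder[OF good_coords_lder[OF G n]], of "normal_der N U2 (e n)"]
    by (simp add: vfields_iff[OF N'] normal_der_idem normal_der_apply)
   from N.P_closed[OF U2(1) this] have "gder N N U2 (%V. V) (%V f. f) (PN U2 (normal_der N U2 (e n)))"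
    by (simp add: vfields_iff[OF N'])
   then show ?thesis by (rule lN.gder_closed[OF _ U2(1) order_refl gc])
  qed
  have Cc: "C n : Sec N U3" if "n < c + d" for n unfolding C_def by (rule N.rst_closed[OF U2(1) U3(1,3) Pc[OF that]])
  have VY: "Va a U3 (Y n) : Sec N U3" if "n < c + d" for n by (rule lder_closed[OF Va[OF a] U3(1) order_refl Yc[OF that]])
  have XY: "X ?Q (pull j U3 (Y n)) = pull j U3 (Va a U3 (Y n))" if "n < c + d" for n
   unfolding pVa[OF a U3(1) order_refl Yc[OF that]] X_def by (rule normal_der_apply) (use oQ Yc[OF that] in auto)
  have "pull j U3 (rsum (sec N U3) (%n. grade_inv (sec N U3) (Va a U3 (Y n)) *[sec N U3] C n) (c + d)) =
   rsum (sec Z ?Q) (%n. pull j U3 (grade_inv (sec N U3) (Va a U3 (Y n)) *[sec N U3] C n)) (c + d)"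
   by (rule h3.rsum) (use VY Cc in auto)
  also have "\<dots> = rsum (sec Z ?Q) (%n. grade_inv (sec Z ?Q) (X ?Q (rst Z ?P2 ?Q (pull j U2 (y n)))) *[sec Z ?Q]
    rst Z ?P2 ?Q (pull j U2 (PN U2 (normal_der N U2 (e n)) U2 ?g))) (c + d)"
  proof (rule rsum_cong)
   fix n assume n: "n < c + d"
   show "pull j U3 (grade_inv (sec N U3) (Va a U3 (Y n)) *[sec N U3] C n) =
    grade_inv (sec Z ?Q) (X ?Q (rst Z ?P2 ?Q (pull j U2 (y n)))) *[sec Z ?Q]
    rst Z ?P2 ?Q (pull j U2 (PN U2 (normal_der N U2 (e n)) U2 ?g))"
    unfolding jr[OF yc[OF n]] jr[OF Pc[OF n]] C_def[symmetric] Y_def[symmetric] XY[OF n]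
     h3.mult[OF h3.A.grade_inv_closed[OF VY[OF n]] Cc[OF n]] h3.grade_inv[OF VY[OF n]] ..
  qed
  also have "\<dots> = PZ ?Q X ?Q (rst Z ?P2 ?Q (pull j U2 ?g))"
   by (rule Pi_formula[OF Z(1,2,3) N(1,2) j G CF oQ sub(3) X gc, symmetric])
  also have "\<dots> = 0[sec Z ?Q]"
   unfolding jr[OF gc] g0 by (rule lQ.gder_zero_arg[OF PX oQ order_refl h3.B.zero_closed])
  finally show "pull j U3 (rsum (sec N U3) (%n. grade_inv (sec N U3) (Va a U3 (rst N U2 U3 (y n))) *[sec N U3]
   rst N U2 U3 (PN U2 (normal_der N U2 (e n)) U2 ?g)) (c + d)) = 0[sec Z ?Q]"
   unfolding C_def Y_def .
 qed
 then show ?thesis using U3(2) by blast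
qed

section \<open>Preimages\<close>

context sspace begin

lemma lmor_ident: "opn U ==> lmor M M U (%V. V) (%x. x) (%V f. f)"
 by unfold_locales (rule shmor_ident[OF srs])

lemma vfields_part:
 assumes U: "opn U" and X: "X : tpart M U p"
 shows "X : vfields M U"
 using X lmor.gder_lder[OF lmor_ident[OF U], of p X] by (simp add: vfields_iff[OF srs] hom_vfields_iff[OF srs])

lemma normal_der_part:
 assumes "lder M M U (%V. V) (%V f. f) p X"
 shows "normal_der M U X : tpart M U p"
 using lder_cong[OF _ srs assms, of "normal_der M U X"]
 by (simp add: hom_vfields_iff[OF srs] normal_der_idem normal_der_apply)

lemma normal_der_vfields:
 assumes "gder M M U (%V. V) (%V f. f) X"
 shows "normal_der M U X : vfields M U"
 using gder_cong[OF assms, of "normal_der M U X"]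
 by (simp add: vfields_iff[OF srs] normal_der_idem normal_der_apply)

lemma vfields_decomp:
 assumes X: "X : vfields M U"
 obtains X0 X1 where "X0 : tpart M U False" "X1 : tpart M U True"
  "X = normal_der M U (%V f. X0 V f +[sec M V] X1 V f)"
proof -
 have n: "normal_der M U X = X" and g: "gder M M U (%V. V) (%V f. f) X"
  using X by (simp_all add: vfields_iff[OF srs])
 obtain X0 X1 where X0: "lder M M U (%V. V) (%V f. f) False X0" and X1: "lder M M U (%V. V) (%V f. f) True X1"
  and eq: "\<And>V f. opn V ==> V <= U ==> f : Sec M V ==> X V f = X0 V f +[sec M V] X1 V f"
  using g unfolding gder_def by blast
 have "X = normal_der M U (%V f. normal_der M U X0 V f +[sec M V] normal_der M U X1 V f)"
  by (rule normal_der_eqI[OF n normal_der_idem]) (simp add: normal_der_apply eq)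
 then show ?thesis using that normal_der_part[OF X0] normal_der_part[OF X1] by blast
qed

end

lemma (in pisym) P_field_closed:
 assumes G: "good_coords c d M U y e" and n: "n < c + d" and g: "g : Sec M U"
 shows "P U (normal_der M U (e n)) U g : Sec M U"
proof -
 note U = good_coords_open[OF G]
 interpret lmor M M U "%V. V" "%x. x" "%V f. f" by (rule lm_id[OF U])
 have "P U (normal_der M U (e n)) : vfields M U"
  by (rule P_closed[OF U normal_der_vfields[OF gder_lder[OF good_coords_lder[OF G n]]]])
 then show ?thesis using gder_closed[OF _ U order_refl g] by (simp add: vfields_iff[OF srs])
qed

text \<open>Generation of the kernel is stated at the points of the image of \<open>\<phi>\<close>,
  in germ form: the combination is found over some smaller neighbourhood.\<close>

definition locally_generated ::
 "('p, 's) superspace => ('q, 't) superspace => ('p, 'q, 's, 't) smor => 'q set => nat => (nat => 't) => bool" where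
 "locally_generated Z N \<phi> U r G \<longleftrightarrow>
   (\<forall>i<r. G i : Sec N U & pull \<phi> U (G i) = 0[sec Z (preim Z \<phi> U)]) &
   (\<forall>V f z. oset N V & V <= U & f : Sec N V & pull \<phi> V f = 0[sec Z (preim Z \<phi> V)] &
     z : preim Z \<phi> V -->
    (\<exists>V'. oset N V' & umap \<phi> z : V' & V' <= V &
     rst N V V' f : Idl\<^bsub>sec N V'\<^esub> ((%i. rst N U V' (G i)) ` {..<r})))"

text \<open>The set \<open>V\<close> need not lie in \<open>U\<close>, and the neighbourhood can be
  confined to a given \<open>Q\<close>: restrict \<open>f\<close> to \<open>V Int Q\<close>
  first.\<close>

lemma locally_generated_near:
 assumes Z: "superringed_space Z" and N: "superringed_space N" and \<phi>: "smorphism Z N \<phi>"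
  and lg: "locally_generated Z N \<phi> U r G"
  and V: "oset N V" and f: "f : Sec N V" and 0: "pull \<phi> V f = 0[sec Z (preim Z \<phi> V)]"
  and z: "z : preim Z \<phi> V" and Q: "oset N Q" "Q <= U" "umap \<phi> z : Q"
 shows "\<exists>V'. oset N V' & umap \<phi> z : V' & V' <= V & V' <= Q &
  rst N V V' f : Idl\<^bsub>sec N V'\<^esub> ((%i. rst N U V' (G i)) ` {..<r})"
proof -
 interpret lmor N Z V "preim Z \<phi>" "umap \<phi>" "pull \<phi>" by (rule smor_lmor[OF Z N \<phi> V])
 have o: "oset N (V Int Q)" "V Int Q <= V" "V Int Q <= U" using V Q by auto
 note oS = S_open[OF V order_refl] S_open[OF o(1,2)] S_mono[OF V order_refl o(1,2)]
 have fc: "rst N V (V Int Q) f : Sec N (V Int Q)" by (rule N.rst_closed[OF V o(1,2) f])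
 have 1: "pull \<phi> (V Int Q) (rst N V (V Int Q) f) = 0[sec Z (preim Z \<phi> (V Int Q))]"
  unfolding h_rst[OF V o(1,2) order_refl f] 0 by (rule superalg_hom.zero[OF W.rst[OF oS]])
 have zQ: "z : preim Z \<phi> (V Int Q)" using z Q(3) by (simp add: preim_def)
 obtain V' where V': "oset N V'" "umap \<phi> z : V'" "V' <= V Int Q"
  "rst N (V Int Q) V' (rst N V (V Int Q) f) : Idl\<^bsub>sec N V'\<^esub> ((%i. rst N U V' (G i)) ` {..<r})"
  using lg[unfolded locally_generated_def, THEN conjunct2, rule_format,
   OF conjI[OF o(1) conjI[OF o(3) conjI[OF fc conjI[OF 1 zQ]]]]] by (elim exE conjE) (rule that)
 have "rst N (V Int Q) V' (rst N V (V Int Q) f) = rst N V V' f" by (rule N.rst_rst[OF V o(1) V'(1) o(2) V'(3) f])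
 then show ?thesis using V' by (intro exI[of _ V'] conjI) auto
qed

text \<open>The situation \<open>W = \<Psi>\<^sup>-\<^sup>1(Z)\<close>, with inclusions \<open>j : Z \<rightarrow> N\<close> and \<open>\<iota> : W \<rightarrow> M\<close>.\<close>

locale preimage =
 fixes M :: "('p, 's) superspace" and N :: "('q, 't) superspace" and Z :: "('z, 'v) superspace"
  and W :: "('w, 'u) superspace" and PM PN PZ \<Psi> j \<iota> and a b c d k l b' :: nat
 assumes M: "locally_super a b M" "Hausdorff_space (spc M)" "Pi_symmetry (tangent_sheaf M) PM"
  and N: "locally_super c d N" "Pi_symmetry (tangent_sheaf N) PN"
  and Z: "locally_super k l Z" "Hausdorff_space (spc Z)" "Pi_symmetry (tangent_sheaf Z) PZ"
  and W: "superringed_space W" "has_evals b' W"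
  and \<Psi>: "Pi_morphism M PM N PN \<Psi>" and j: "Pi_morphism Z PZ N PN j" and \<iota>: "smorphism W M \<iota>"
  and surj: "stalk_surj Z N j" "stalk_surj W M \<iota>"
  and opens: "\<And>V. oset W V ==> \<exists>Q. oset M Q & V = preim W \<iota> Q"
  and over: "\<And>w. w : topspace (spc W) ==> \<exists>z\<in>topspace (spc Z). umap j z = umap \<Psi> (umap \<iota> w)"
  and equations: "\<And>w. w : topspace (spc W) ==> \<exists>U r g. oset N U & umap \<Psi> (umap \<iota> w) : U &
   locally_generated Z N j U r g & locally_generated W M \<iota> (preim M \<Psi> U) r (%i. pull \<Psi> U (g i))"

sublocale preimage \<subseteq> M: pisym M PM using M by unfold_locales (auto simp: locally_super_def)
sublocale preimage \<subseteq> N: pisym N PN using N by unfold_locales (auto simp: locally_super_def)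
sublocale preimage \<subseteq> Z: sspace Z using Z by unfold_locales (auto simp: locally_super_def)
sublocale preimage \<subseteq> W: sspace W using W by unfold_locales

context preimage begin

abbreviation (input) pre where "pre V \<equiv> preim W \<iota> V"

lemma sm: "smorphism M N \<Psi>" "smorphism Z N j" using \<Psi> j by (simp_all add: Pi_morphism_def)

lemmas lmor_\<Psi> = smor_lmor[OF M.srs N.srs sm(1)]
lemmas lmor_j = smor_lmor[OF Z.srs N.srs sm(2)]
lemmas lmor_\<iota> = smor_lmor[OF W.srs M.srs \<iota>]

lemma pre_\<iota>:
 assumes "M.opn V"
 shows pre_\<iota>_open: "W.opn (pre V)" and hom_\<iota>: "superalg_hom (sec M V) (sec W (pre V)) (pull \<iota> V)"
 using lmor.S_open[OF lmor_\<iota>[OF assms] assms order_refl] lmor.hh[OF lmor_\<iota>[OF assms] assms order_refl] .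

lemma pre_\<iota>_mono: "V <= V' ==> pre V <= pre V'" by (auto simp: preim_def)

lemma pre_\<iota>_u: "w : pre V \<longleftrightarrow> w : topspace (spc W) & umap \<iota> w : V" by (simp add: preim_def)

lemma pull_\<iota>_rst: "M.opn V ==> M.opn V' ==> V' <= V ==> f : Sec M V ==>
  pull \<iota> V' (rst M V V' f) = rst W (pre V) (pre V') (pull \<iota> V f)"
 using lmor.h_rst[OF lmor_\<iota>] by blast

text \<open>This says that \<Psi> maps W into Z also on the level of sheaves. Near a point of Z
  below a point of W, \<open>f\<close> lies in the ideal generated by the equations
  \<open>g i\<close> of Z, and the pull-backs of these to W vanish because they are the equations of
  W.\<close>

lemma ker_pull:
 assumes V: "N.opn V" and f: "f : Sec N V" and 0: "pull j V f = 0[sec Z (preim Z j V)]"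
 shows "pull \<iota> (preim M \<Psi> V) (pull \<Psi> V f) = 0[sec W (pre (preim M \<Psi> V))]"
proof -
 define S where "S B = pre (preim M \<Psi> B)" for B
 define h where "h B x = pull \<iota> (preim M \<Psi> B) (pull \<Psi> B x)" for B x
 have \<theta>: "lmor N W B S (%x. umap \<Psi> (umap \<iota> x)) h" if B: "N.opn B" for B
 proof -
  have o: "M.opn (preim M \<Psi> B)" by (rule lmor.S_open[OF lmor_\<Psi>[OF B] B order_refl])
  show ?thesis
   unfolding S_def[abs_def] h_def[abs_def]
   by unfold_locales
    (rule shmor_comp[OF N.srs M.srs W.srs shmor_smorphism[OF sm(1) B] shmor_smorphism[OF \<iota> o] order_refl])
 qed
 interpret l: lmor N W V S "%x. umap \<Psi> (umap \<iota> x)" h by (rule \<theta>[OF V])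
 interpret hV: superalg_hom "sec N V" "sec W (S V)" "h V" by (rule l.hh[OF V order_refl])
 have "h V f = 0[sec W (S V)]"
 proof (rule W.sec_eqI[OF l.S_open[OF V order_refl] hV.closed[OF f] hV.B.zero_closed])
  fix w assume w: "w : S V"
  then have wt: "w : topspace (spc W)" and wV: "umap \<Psi> (umap \<iota> w) : V" by (auto simp: S_def preim_def)
  obtain U r g where U: "N.opn U" "umap \<Psi> (umap \<iota> w) : U" and lg: "locally_generated Z N j U r g"
   "locally_generated W M \<iota> (preim M \<Psi> U) r (%i. pull \<Psi> U (g i))" using equations[OF wt] by blast
  obtain z where z: "z : topspace (spc Z)" "umap j z = umap \<Psi> (umap \<iota> w)" using over[OF wt] by blast
  have zV: "z : preim Z j V" "umap j z : U" using z wV U by (auto simp: preim_def)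
  obtain V' where V': "N.opn V'" "umap j z : V'" "V' <= V" "V' <= U"
   and id: "rst N V V' f : Idl\<^bsub>sec N V'\<^esub> ((%i. rst N U V' (g i)) ` {..<r})"
   using locally_generated_near[OF Z.srs N.srs sm(2) lg(1) V f 0 zV(1) U(1) order_refl zV(2)] by blast
  interpret lU: lmor N W U S "%x. umap \<Psi> (umap \<iota> x)" h by (rule \<theta>[OF U(1)])
  interpret hV': superalg_hom "sec N V'" "sec W (S V')" "h V'" by (rule l.hh[OF V'(1,3)])
  have gU: "g i : Sec N U" "h U (g i) = 0[sec W (S U)]" if "i < r" for i
   using lg that by (simp_all add: locally_generated_def h_def S_def)
  have "rst N V V' f : {x : Sec N V'. h V' x = 0[sec W (S V')]}"
  proof (rule hV'.A.genideal_induct[OF id])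
   have "h V' (rst N U V' (g i)) = 0[sec W (S V')]" if i: "i < r" for i
    unfolding lU.h_rst[OF U(1) V'(1,4) order_refl gU(1)[OF i]] gU(2)[OF i]
    by (rule superalg_hom.zero[OF W.rst[OF lU.S_open[OF U(1) order_refl] l.S_open[OF V'(1,3)] lU.S_mono[OF U(1) order_refl V'(1,4)]]])
   then show "(%i. rst N U V' (g i)) ` {..<r} <= {x : Sec N V'. h V' x = 0[sec W (S V')]}"
    using gU(1) N.rst_closed[OF U(1) V'(1,4)] by auto
  qed (auto simp: hV'.add hV'.mult hV'.zero)
  then have "rst W (S V) (S V') (h V f) = 0[sec W (S V')]" using l.h_rst[OF V V'(1,3) order_refl f] by simp
  also have "\<dots> = rst W (S V) (S V') 0[sec W (S V)]"
   by (rule superalg_hom.zero[OF W.rst[OF l.S_open[OF V order_refl] l.S_open[OF V'(1,3)] l.S_mono[OF V order_refl V'(1,3)]], symmetric])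
  finally have e: "rst W (S V) (S V') (h V f) = rst W (S V) (S V') 0[sec W (S V)]" .
  have "w : S V'" using wt V'(2) z(2) w by (auto simp: S_def preim_def)
  then show "\<exists>B. W.opn B & w : B & B <= S V & rst W (S V) B (h V f) = rst W (S V) B 0[sec W (S V)]"
   using l.S_open[OF V'(1,3)] l.S_mono[OF V order_refl V'(1,3)] e by (intro exI[of _ "S V'"] conjI)
 qed
 then show ?thesis unfolding h_def S_def .
qed

lemma rst_pull_\<Psi>:
 assumes U: "N.opn U" and V: "N.opn V" "V <= U" and Q: "M.opn Q" "Q <= preim M \<Psi> V" and f: "f : Sec N U"
 shows "rst M (preim M \<Psi> V) Q (pull \<Psi> V (rst N U V f)) = rst M (preim M \<Psi> U) Q (pull \<Psi> U f)"
proof -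
 interpret l: lmor N M U "preim M \<Psi>" "umap \<Psi>" "pull \<Psi>" by (rule lmor_\<Psi>[OF U])
 interpret h: superalg_hom "sec N U" "sec M (preim M \<Psi> U)" "pull \<Psi> U" by (rule l.hh[OF U order_refl])
 show ?thesis
  unfolding l.h_rst[OF U V order_refl f]
  by (rule M.rst_rst[OF l.S_open[OF U order_refl] l.S_open[OF V] Q(1) l.S_mono[OF U order_refl V] Q(2) h.closed[OF f]])
qed

text \<open>\<open>X\<close> preserves the ideal of W in M, so that it induces a derivation on
  W.\<close>

definition tangential :: "'p set => ('p, 's, 's) sder => bool" where
 "tangential B X \<longleftrightarrow> (\<forall>V f. M.opn V & V <= B & f : Sec M V & pull \<iota> V f = 0[sec W (pre V)] -->
   pull \<iota> V (X V f) = 0[sec W (pre V)])"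

lemma tangentialD:
 "tangential B X ==> M.opn V ==> V <= B ==> f : Sec M V ==> pull \<iota> V f = 0[sec W (pre V)] ==>
   pull \<iota> V (X V f) = 0[sec W (pre V)]"
 unfolding tangential_def by (erule allE, erule allE, erule mp) (intro conjI)

text \<open>Restricted to \<open>W\<close>, the derivation \<open>X \<circ> \<Psi>\<^sup>*\<close> is a combination of the frame fields \<open>Va a\<close>, to which
 \<open>Pi_zt\<close> applies.\<close>

lemma Pi_tangent_generator:
 assumes F: "tangent_frame N Z j PN c d k l r U g U2 y e U3 zt Va"
  and U: "N.opn U" and g: "\<And>i. i < r ==> g i : Sec N U"
  and Q: "M.opn Q" "Q <= preim M \<Psi> U3" and X: "X : tpart M Q p"
  and t: "tangential Q X" and i: "i < r"
 shows "pull \<iota> Q (PM Q X Q (rst M (preim M \<Psi> U) Q (pull \<Psi> U (g i)))) = 0[sec W (pre Q)]"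
proof -
 interpret F: tangent_frame N Z j PN c d k l r U g U2 y e U3 zt Va by (rule F)
 note U3 = F.U3(1) note U2 = good_coords_open[OF F.good]
 define S where "S V = Q Int preim M \<Psi> V" for V
 define \<rho> where "\<rho> V f = rst M (preim M \<Psi> V) (S V) (pull \<Psi> V f)" for V f
 define T where "T V = pre (S V)" for V
 define h where "h V f = pull \<iota> (S V) (\<rho> V f)" for V f
 \<comment> \<open>Pull back by \<Psi>, apply \<open>X\<close>, restrict to W: a derivation from
   functions on N to functions on W along \<open>h\<close>, which is the pull-back to W.\<close>
 define \<delta> where "\<delta> V f = pull \<iota> (S V) (X (S V) (\<rho> V f))" for V f
 have oP: "M.opn (preim M \<Psi> V)" if "N.opn V" for V by (rule lmor.S_open[OF lmor_\<Psi>[OF that] that order_refl])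
 have oS: "M.opn (S V)" if "N.opn V" for V using oP[OF that] Q(1) by (auto simp: S_def)
 have S3: "S U3 = Q" using Q(2) by (auto simp: S_def)
 then have sQ: "S U3 <= Q" by simp
 have TQ: "T U3 = pre Q" by (simp add: T_def S3)
 have s1: "shmor N M U3 S (umap \<Psi>) \<rho>"
  unfolding S_def[abs_def] \<rho>_def[abs_def]
  by (rule shmor_comp[OF N.srs M.srs M.srs shmor_smorphism[OF sm(1) U3] shmor_restrict[OF M.srs Q(1) oP[OF U3]] order_refl])
 interpret l1: lmor N M U3 S "umap \<Psi>" \<rho> by unfold_locales (rule s1)
 note s\<iota> = shmor_smorphism[OF \<iota> Q(1)]
 have s2: "shmor N W U3 T (%x. umap \<Psi> (umap \<iota> x)) h"
  unfolding T_def[abs_def] h_def[abs_def] by (rule shmor_comp[OF N.srs M.srs W.srs s1 s\<iota> sQ])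
 interpret l2: lmor N W U3 T "%x. umap \<Psi> (umap \<iota> x)" h by unfold_locales (rule s2)
 have lX: "lder M M Q (%V. V) (%V f. f) p X" using X by (simp add: hom_vfields_iff[OF M.srs])
 have dX: "lder N M U3 S \<rho> p (%V f. X (S V) (\<rho> V f))" by (rule lder_comp_pre[OF N.srs M.srs s1 sQ lX])
 have d\<delta>: "lder N W U3 T h p \<delta>"
  unfolding T_def[abs_def] h_def[abs_def] \<delta>_def[abs_def]
  by (rule lder_comp_post[OF N.srs M.srs W.srs s1 s\<iota> sQ dX])
 have hker: "h V f = 0[sec W (T V)]"
  if V: "N.opn V" "V <= U3" and f: "f : Sec N V" and 0: "pull j V f = 0[sec Z (preim Z j V)]" for V f
 proof -
  have sub: "S V <= preim M \<Psi> V" by (auto simp: S_def)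
  have fc: "pull \<Psi> V f : Sec M (preim M \<Psi> V)"
   by (rule superalg_hom.closed[OF lmor.hh[OF lmor_\<Psi>[OF V(1)] V(1) order_refl] f])
  have "h V f = rst W (pre (preim M \<Psi> V)) (T V) (pull \<iota> (preim M \<Psi> V) (pull \<Psi> V f))"
   unfolding h_def \<rho>_def T_def by (rule pull_\<iota>_rst[OF oP[OF V(1)] oS[OF V(1)] sub fc])
  also have "\<dots> = 0[sec W (T V)]"
   unfolding ker_pull[OF V(1) f 0] T_def
   by (rule superalg_hom.zero[OF W.rst[OF pre_\<iota>_open[OF oP[OF V(1)]] pre_\<iota>_open[OF oS[OF V(1)]] pre_\<iota>_mono[OF sub]]])
  finally show ?thesis .
 qed
 interpret h3: superalg_hom "sec N U3" "sec W (T U3)" "h U3" by (rule l2.hh[OF U3 order_refl])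
 interpret j3: superalg_hom "sec N U3" "sec Z (preim Z j U3)" "pull j U3" by (rule lmor.hh[OF lmor_j[OF U3] U3 order_refl])
 interpret hQ: superalg_hom "sec M Q" "sec W (T U3)" "pull \<iota> Q" unfolding TQ by (rule hom_\<iota>[OF Q(1)])
 \<comment> \<open>Functions on N with the same restriction to Z have the same pull-back to
   W.\<close>
 have heq: "h U3 f = h U3 f'"
  if f: "f : Sec N U3" "f' : Sec N U3" and e: "pull j U3 f = pull j U3 f'" for f f'
 proof -
  have "h U3 (f -[sec N U3] f') = 0[sec W (T U3)]"
   by (rule hker[OF U3 order_refl]) (use f e in \<open>simp_all add: j3.minus\<close>)
  then show ?thesis using f by (simp add: h3.minus h3.B.minus_eq_zero_iff)
 qed
 have zc: "zt a : Sec N U3" if "a < k + l" for a using F.zt[OF that] by (auto intro: h3.A.part_closed)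
 have \<delta>c: "\<delta> U3 (zt a) : Part W (T U3) (p \<noteq> (k \<le> a))" if "a < k + l" for a
  by (rule lder_parity[OF d\<delta> U3 order_refl F.zt[OF that]])
 note \<delta>cc = h3.B.part_closed[OF \<delta>c]
 have lV: "lder N W U3 T h (k \<le> a) (%V f. h V (Va a V f))" if "a < k + l" for a
  by (rule lder_comp_post[OF N.srs N.srs W.srs shmor_ident[OF N.srs U3] s2 order_refl F.Va[OF that]])
 define E where "E V f = rsum (sec W (T V)) (%a. rst W (T U3) (T V) (\<delta> U3 (zt a)) *[sec W (T V)] h V (Va a V f)) (k + l)" for V f
 have dE: "lder N W U3 T h p E"
  unfolding E_def[abs_def]
 proof (rule l2.lder_rsum)
  fix a assume a: "a < k + l"
  have "((p \<noteq> (k \<le> a)) \<noteq> (k \<le> a)) = p" by auto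
  then show "lder N W U3 T h p (%V f. rst W (T U3) (T V) (\<delta> U3 (zt a)) *[sec W (T V)] h V (Va a V f))"
   using l2.lder_scale[OF lV[OF a] \<delta>c[OF a]] by simp
 qed
 \<comment> \<open>Uniqueness modulo the functions vanishing on Z. \<open>\<delta>\<close> kills
   these because \<open>X\<close> is tangential, \<open>E\<close> because the \<open>Va a\<close>
   preserve them; on the \<open>zt b\<close> both agree by duality, and \<open>had_zt\<close> is the
   Hadamard lemma required.\<close>
 have \<delta>E: "\<delta> U3 f = E U3 f" if f: "f : Sec N U3" for f
 proof (rule l2.lder_eq[OF d\<delta> dE F.zt _ _ _ W(2) U3 order_refl f])
  fix b assume b: "b < k + l"
  have hb: "h U3 (Va a U3 (zt b)) = (if a = b then 1[sec W (T U3)] else 0[sec W (T U3)])" if a: "a < k + l" for a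
  proof -
   have "h U3 (Va a U3 (zt b)) = h U3 (if a = b then 1[sec N U3] else 0[sec N U3])"
    by (rule heq[OF lder_closed[OF F.Va[OF a] U3 order_refl zc[OF b]]])
     (use F.Va_zt[OF a b] in \<open>simp_all add: j3.one j3.zero\<close>)
   then show ?thesis by (simp add: h3.one h3.zero)
  qed
  have "E U3 (zt b) = rsum (sec W (T U3)) (%a. if a = b then \<delta> U3 (zt b) else 0[sec W (T U3)]) (k + l)"
   unfolding E_def
   by (rule rsum_cong) (use hb \<delta>cc W.rst_id[OF l2.S_open[OF U3 order_refl] \<delta>cc] in auto)
  also have "\<dots> = \<delta> U3 (zt b)" using h3.B.rsum_single[OF b] \<delta>cc[OF b] by simp
  finally show "\<delta> U3 (zt b) = E U3 (zt b)" ..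
 next
  fix V x assume V: "N.opn V" "V <= U3" and "x : {f : Sec N V. pull j V f = 0[sec Z (preim Z j V)]}"
  then have x: "x : Sec N V" and 0: "pull j V x = 0[sec Z (preim Z j V)]" by auto
  interpret hV: superalg_hom "sec N V" "sec W (T V)" "h V" by (rule l2.hh[OF V])
  have "S V <= Q" by (auto simp: S_def)
  then have "\<delta> V x = 0[sec W (T V)]"
   unfolding \<delta>_def T_def
   by (rule tangentialD[OF t oS[OF V(1)] _ superalg_hom.closed[OF l1.hh[OF V] x]])
    (use hker[OF V x 0] in \<open>simp add: h_def T_def\<close>)
  moreover have "E V x = 0[sec W (T V)]"
   unfolding E_def
  proof (rule hV.B.rsum_zero)
   fix a assume a: "a < k + l"
   have "h V (Va a V x) = 0[sec W (T V)]"
    by (rule hker[OF V lder_closed[OF F.Va[OF a] V x] F.Va_ker[OF a V x 0]])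
   moreover have "rst W (T U3) (T V) (\<delta> U3 (zt a)) : Sec W (T V)"
    by (rule W.rst_closed[OF l2.S_open[OF U3 order_refl] l2.S_open[OF V] l2.S_mono[OF U3 order_refl V] \<delta>cc[OF a]])
   ultimately show "rst W (T U3) (T V) (\<delta> U3 (zt a)) *[sec W (T V)] h V (Va a V x) = 0[sec W (T V)]" by simp
  qed
  ultimately show "\<delta> V x = E V x" by simp
 next
  fix w assume w: "w : T U3"
  then have wt: "w : topspace (spc W)" by (simp add: T_def preim_def)
  obtain z where z: "z : topspace (spc Z)" "umap j z = umap \<Psi> (umap \<iota> w)" using over[OF wt] by blast
  have "z : preim Z j U3" using z l2.u_in[OF w] by (simp add: preim_def)
  from F.had_zt[OF this] show "had N U3 (k + l) (%a. k \<le> a) zt (umap \<Psi> (umap \<iota> w))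
    (%V. {f : Sec N V. pull j V f = 0[sec Z (preim Z j V)]})" unfolding z(2) .
 qed
 have Q2: "Q <= preim M \<Psi> U2" using Q(2) F.U3(2) by (auto simp: preim_def)
 define G where "G = rst N U U2 (g i)"
 have Gc: "G : Sec N U2" unfolding G_def by (rule N.rst_closed[OF U U2 F.U3(3) g[OF i]])
 define C where "C n = rst N U2 U3 (PN U2 (normal_der N U2 (e n)) U2 G)" for n
 define Y where "Y n = rst N U2 U3 (y n)" for n
 have yc: "y n : Sec N U2" if "n < c + d" for n
  using superalg.part_closed[OF N.alg[OF U2] good_coords_part[OF F.good that]] .
 note Bc = N.P_field_closed[OF F.good _ Gc]
 have Yc: "Y n : Sec N U3" "C n : Sec N U3" if "n < c + d" for n
  unfolding Y_def C_def using N.rst_closed[OF U2 U3 F.U3(2)] yc[OF that] Bc[OF that] by auto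
 have \<rho>r: "rst M (preim M \<Psi> U2) Q (pull \<Psi> U2 f) = \<rho> U3 (rst N U2 U3 f)" if "f : Sec N U2" for f
  unfolding \<rho>_def S3 by (rule rst_pull_\<Psi>[OF U2 U3 F.U3(2) Q that, symmetric])
 have XY: "X Q (\<rho> U3 (Y n)) : Sec M Q" "\<rho> U3 (C n) : Sec M Q" if "n < c + d" for n
  using lder_closed[OF dX U3 order_refl Yc(1)[OF that]] superalg_hom.closed[OF l1.hh[OF U3 order_refl] Yc(2)[OF that]] by (simp_all add: S3)
 have VY: "Va a U3 (Y n) : Sec N U3" if "a < k + l" "n < c + d" for a n
  by (rule lder_closed[OF F.Va[OF that(1)] U3 order_refl Yc(1)[OF that(2)]])
 define H where "H a n = grade_inv (sec N U3) (Va a U3 (Y n)) *[sec N U3] C n" for a n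
 have Hc: "H a n : Sec N U3" if "a < k + l" "n < c + d" for a n
  using VY[OF that] Yc(2)[OF that(2)] by (simp add: H_def)
 define \<Delta> where "\<Delta> a = grade_inv (sec W (T U3)) (\<delta> U3 (zt a))" for a
 have \<Delta>c: "\<Delta> a : Sec W (T U3)" if "a < k + l" for a using \<delta>cc[OF that] by (simp add: \<Delta>_def)
 have "PM Q X Q (rst M (preim M \<Psi> U) Q (pull \<Psi> U (g i))) = PM Q X Q (rst M (preim M \<Psi> U2) Q (pull \<Psi> U2 G))"
  unfolding G_def rst_pull_\<Psi>[OF U U2 F.U3(3) Q(1) Q2 g[OF i]] ..
 also have "\<dots> = rsum (sec M Q) (%n. grade_inv (sec M Q) (X Q (rst M (preim M \<Psi> U2) Q (pull \<Psi> U2 (y n)))) *[sec M Q]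
   rst M (preim M \<Psi> U2) Q (pull \<Psi> U2 (PN U2 (normal_der N U2 (e n)) U2 G))) (c + d)"
  by (rule Pi_formula[OF M N \<Psi> F.good F.fields Q(1) Q2 M.vfields_part[OF Q(1) X] Gc])
 also have "\<dots> = rsum (sec M Q) (%n. grade_inv (sec M Q) (X Q (\<rho> U3 (Y n))) *[sec M Q] \<rho> U3 (C n)) (c + d)"
  by (rule rsum_cong) (simp add: \<rho>r yc Bc Y_def C_def)
 finally have "pull \<iota> Q (PM Q X Q (rst M (preim M \<Psi> U) Q (pull \<Psi> U (g i)))) =
  pull \<iota> Q (rsum (sec M Q) (%n. grade_inv (sec M Q) (X Q (\<rho> U3 (Y n))) *[sec M Q] \<rho> U3 (C n)) (c + d))" by simp
 also have "\<dots> = rsum (sec W (T U3)) (%n. pull \<iota> Q (grade_inv (sec M Q) (X Q (\<rho> U3 (Y n))) *[sec M Q] \<rho> U3 (C n))) (c + d)"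
  by (rule hQ.rsum) (use XY in auto)
 also have "\<dots> = rsum (sec W (T U3)) (%n. rsum (sec W (T U3)) (%a. \<Delta> a *[sec W (T U3)] h U3 (H a n)) (k + l)) (c + d)"
 proof (rule rsum_cong)
  fix n assume n: "n < c + d"
  have Vc: "h U3 (Va a U3 (Y n)) : Sec W (T U3)" if "a < k + l" for a using VY[OF that n] by simp
  have hC: "h U3 (C n) : Sec W (T U3)" using Yc(2)[OF n] by simp
  have "pull \<iota> Q (grade_inv (sec M Q) (X Q (\<rho> U3 (Y n))) *[sec M Q] \<rho> U3 (C n)) =
    grade_inv (sec W (T U3)) (\<delta> U3 (Y n)) *[sec W (T U3)] h U3 (C n)"
   using XY[OF n] by (simp add: hQ.mult hQ.grade_inv \<delta>_def h_def S3)
  also have "\<delta> U3 (Y n) = rsum (sec W (T U3)) (%a. \<delta> U3 (zt a) *[sec W (T U3)] h U3 (Va a U3 (Y n))) (k + l)"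
   unfolding \<delta>E[OF Yc(1)[OF n]] unfolding E_def
   by (rule rsum_cong) (simp add: W.rst_id[OF l2.S_open[OF U3 order_refl] \<delta>cc])
  also have "grade_inv (sec W (T U3)) \<dots> = rsum (sec W (T U3)) (%a. \<Delta> a *[sec W (T U3)] grade_inv (sec W (T U3)) (h U3 (Va a U3 (Y n)))) (k + l)"
   by (rule trans[OF h3.B.grade_inv_rsum rsum_cong]) (simp_all add: h3.B.grade_inv_mult \<delta>cc Vc \<Delta>_def)
  also have "\<dots> *[sec W (T U3)] h U3 (C n) = rsum (sec W (T U3)) (%a. \<Delta> a *[sec W (T U3)]
    grade_inv (sec W (T U3)) (h U3 (Va a U3 (Y n))) *[sec W (T U3)] h U3 (C n)) (k + l)"
   by (rule h3.B.rsum_mult_right[OF _ hC]) (use \<Delta>c Vc in auto)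
  also have "\<dots> = rsum (sec W (T U3)) (%a. \<Delta> a *[sec W (T U3)] h U3 (H a n)) (k + l)"
   by (rule rsum_cong) (use \<Delta>c Vc hC VY n Yc(2)[OF n] in \<open>simp add: H_def h3.mult h3.grade_inv h3.B.m_assoc\<close>)
  finally show "pull \<iota> Q (grade_inv (sec M Q) (X Q (\<rho> U3 (Y n))) *[sec M Q] \<rho> U3 (C n)) =
    rsum (sec W (T U3)) (%a. \<Delta> a *[sec W (T U3)] h U3 (H a n)) (k + l)" .
 qed
 \<comment> \<open>After the exchange of sums, the inner sum over the coordinates of N is for each
   \<open>a\<close> the pull-back of the sum in \<open>Pi_zt\<close>. That sum vanishes on Z, hence
   on W by \<open>hker\<close>.\<close>
 also have "\<dots> = rsum (sec W (T U3)) (%a. rsum (sec W (T U3)) (%n. \<Delta> a *[sec W (T U3)] h U3 (H a n)) (c + d)) (k + l)"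
  by (rule h3.B.rsum_swap) (use \<Delta>c Hc in auto)
 also have "\<dots> = 0[sec W (T U3)]"
 proof (rule h3.B.rsum_zero)
  fix a assume a: "a < k + l"
  have "rsum (sec W (T U3)) (%n. \<Delta> a *[sec W (T U3)] h U3 (H a n)) (c + d) =
   \<Delta> a *[sec W (T U3)] rsum (sec W (T U3)) (%n. h U3 (H a n)) (c + d)"
   by (rule h3.B.rsum_mult_left[symmetric]) (use \<Delta>c Hc a in auto)
  also have "rsum (sec W (T U3)) (%n. h U3 (H a n)) (c + d) = h U3 (rsum (sec N U3) (H a) (c + d))"
   by (rule h3.rsum[symmetric]) (use Hc a in auto)
  also have "\<dots> = 0[sec W (T U3)]"
  proof (rule hker[OF U3 order_refl])
   show "rsum (sec N U3) (H a) (c + d) : Sec N U3" by (rule h3.A.rsum_closed) (use Hc a in auto)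
   show "pull j U3 (rsum (sec N U3) (H a) (c + d)) = 0[sec Z (preim Z j U3)]"
    using F.Pi_zt[OF a i] unfolding H_def[abs_def] Y_def C_def G_def .
  qed
  finally show "rsum (sec W (T U3)) (%n. \<Delta> a *[sec W (T U3)] h U3 (H a n)) (c + d) = 0[sec W (T U3)]"
   using \<Delta>c[OF a] by simp
 qed
 finally show ?thesis unfolding TQ .
qed

end

context preimage begin

section \<open>Invariance of tangential fields under the \<Pi>-symmetry\<close>

lemma tangential_mono:
 assumes t: "tangential B X" and B': "B' <= B"
 shows "tangential B' (normal_der M B' X)"
 unfolding tangential_def
proof (intro allI impI, elim conjE)
 fix V f assume V: "M.opn V" "V <= B'" and f: "f : Sec M V" and 0: "pull \<iota> V f = 0[sec W (pre V)]"
 show "pull \<iota> V (normal_der M B' X V f) = 0[sec W (pre V)]"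
  unfolding normal_der_apply[OF V f] by (rule tangentialD[OF t V(1) _ f 0]) (use V B' in auto)
qed

text \<open>Near a point, let \<open>J\<close> consist of the functions in the ideal of W which
  \<open>PM B X\<close> maps into this ideal. By the Leibniz rule \<open>J\<close> is an ideal, and
  it contains the pulled back equations by \<open>Pi_tangent_generator\<close>. These generate the
  ideal of W, so nothing of it is missing from \<open>J\<close>.\<close>

lemma tangential_P_part:
 assumes B: "M.opn B" and X: "X : tpart M B p" and t: "tangential B X"
 shows "tangential B (PM B X)"
 unfolding tangential_def
proof (intro allI impI, elim conjE)
 fix V f assume V: "M.opn V" "V <= B" and f: "f : Sec M V" and 0: "pull \<iota> V f = 0[sec W (pre V)]"
 have PX: "lder M M B (%V. V) (%V f. f) (\<not> p) (PM B X)"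
  using M.P_part[OF B X] by (simp add: hom_vfields_iff[OF M.srs])
 interpret lB: lmor M M B "%V. V" "%x. x" "%V f. f" by (rule M.lm_id[OF B])
 interpret hV: superalg_hom "sec M V" "sec W (pre V)" "pull \<iota> V" by (rule hom_\<iota>[OF V(1)])
 note PXf = lder_closed[OF PX V f]
 show "pull \<iota> V (PM B X V f) = 0[sec W (pre V)]"
 proof (rule W.sec_eqI[OF pre_\<iota>_open[OF V(1)] hV.closed[OF PXf] hV.B.zero_closed])
  fix w assume w: "w : pre V"
  then have wt: "w : topspace (spc W)" and wV: "umap \<iota> w : V" by (auto simp: preim_def)
  then have wM: "umap \<iota> w : topspace (spc M)" using openin_subset[OF V(1)] by blast
  obtain U r g where U: "N.opn U" "umap \<Psi> (umap \<iota> w) : U" and lg: "locally_generated Z N j U r g"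
   "locally_generated W M \<iota> (preim M \<Psi> U) r (%i. pull \<Psi> U (g i))" using equations[OF wt] by blast
  obtain z where z: "z : topspace (spc Z)" "umap j z = umap \<Psi> (umap \<iota> w)" using over[OF wt] by blast
  have zU: "z : preim Z j U" using z U by (simp add: preim_def)
  have gU: "g i : Sec N U" "pull j U (g i) = 0[sec Z (preim Z j U)]"
   "pull \<Psi> U (g i) : Sec M (preim M \<Psi> U)" if "i < r" for i
   using lg that by (simp_all add: locally_generated_def)
  have "\<exists>U2 y e U3 zt Va. umap j z : U3 & tangent_frame N Z j PN c d k l r U g U2 y e U3 zt Va"
   by (rule tangent_frame_exists[OF N Z j surj(1) U(1) zU gU(1,2)])
  then obtain U2 y e U3 zt Va where zU3: "umap j z : U3" and F: "tangent_frame N Z j PN c d k l r U g U2 y e U3 zt Va"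
   by (elim exE conjE) (rule that)
  note U3 = tangent_frame.U3[OF F]
  let ?Q = "preim M \<Psi> U3"
  have Q: "M.opn ?Q" "?Q <= preim M \<Psi> U" "umap \<iota> w : ?Q"
   using lmor.S_open[OF lmor_\<Psi>[OF U3(1)] U3(1) order_refl] U3 zU3 z(2) wM by (auto simp: preim_def)
  obtain V' where V': "M.opn V'" "umap \<iota> w : V'" "V' <= V" "V' <= ?Q"
   and id: "rst M V V' f : Idl\<^bsub>sec M V'\<^esub> ((%i. rst M (preim M \<Psi> U) V' (pull \<Psi> U (g i))) ` {..<r})"
   using locally_generated_near[OF W.srs M.srs \<iota> lg(2) V(1) f 0 w Q] by blast
  have V'B: "V' <= B" using V'(3) V(2) by blast
  interpret h: superalg_hom "sec M V'" "sec W (pre V')" "pull \<iota> V'" by (rule hom_\<iota>[OF V'(1)])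
  interpret r: superalg_hom "sec M (preim M \<Psi> U)" "sec M V'" "rst M (preim M \<Psi> U) V'"
   by (rule M.rst[OF lmor.S_open[OF lmor_\<Psi>[OF U(1)] U(1) order_refl] V'(1)]) (use V'(4) Q(2) in blast)
  define X' where "X' = normal_der M V' X"
  have X': "X' : tpart M V' p"
   unfolding X'_def by (rule M.normal_der_part[OF lder_mono[OF _ V'B]]) (use X in \<open>simp add: hom_vfields_iff[OF M.srs]\<close>)
  have PX': "PM V' X' = normal_der M V' (PM B X)"
   unfolding X'_def by (rule M.P_rst[OF B V'(1) V'B M.vfields_part[OF B X]])
  define J where "J = {x : Sec M V'. pull \<iota> V' x = 0[sec W (pre V')] &
    pull \<iota> V' (PM B X V' x) = 0[sec W (pre V')]}"
  note Pc = lder_closed[OF PX V'(1) V'B] and L = lB.lder_Leibniz'[OF PX V'(1) V'B]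
  have "rst M V V' f : J"
  proof (rule h.A.genideal_induct[OF id])
   show "J <= Sec M V'" by (auto simp: J_def)
   show "0[sec M V'] : J" by (simp add: J_def h.zero lB.lder_zero_arg[OF PX V'(1) V'B])
   show "x +[sec M V'] x' : J" if "x : J" "x' : J" for x x'
    using that Pc by (simp add: J_def h.add lder_add[OF PX V'(1) V'B])
   show "c *[sec M V'] x : J" if c: "c : Sec M V'" and x: "x : J" for c x
   proof -
    define c' where "c' = (if \<not> p then grade_inv (sec M V') c else c)"
    have "c' : Sec M V'" using c by (simp add: c'_def)
    then show ?thesis
     using c x Pc[OF c] Pc[of x] L[OF c, of x] unfolding c'_def[symmetric] by (simp add: J_def h.mult h.add)
   qed
   show "x *[sec M V'] c : J" if c: "c : Sec M V'" and x: "x : J" for c x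
   proof -
    define x' where "x' = (if \<not> p then grade_inv (sec M V') x else x)"
    have "x' : Sec M V'" "pull \<iota> V' x' = 0[sec W (pre V')]"
     using x by (simp_all add: x'_def J_def h.grade_inv)
    then show ?thesis
     using c x Pc[OF c] Pc[of x] L[OF _ c, of x] unfolding x'_def[symmetric] by (simp add: J_def h.mult h.add)
   qed
   have "rst M (preim M \<Psi> U) V' (pull \<Psi> U (g i)) : J" if i: "i < r" for i
   proof -
    have gc: "rst M (preim M \<Psi> U) V' (pull \<Psi> U (g i)) : Sec M V'" using gU(3)[OF i] by simp
    have "pull \<iota> V' (rst M (preim M \<Psi> U) V' (pull \<Psi> U (g i))) =
      rst W (pre (preim M \<Psi> U)) (pre V') (pull \<iota> (preim M \<Psi> U) (pull \<Psi> U (g i)))"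
     by (rule pull_\<iota>_rst[OF lmor.S_open[OF lmor_\<Psi>[OF U(1)] U(1) order_refl] V'(1) _ gU(3)[OF i]])
      (use V'(4) Q(2) in blast)
    also have "\<dots> = 0[sec W (pre V')]"
    proof -
     have "pre V' <= pre (preim M \<Psi> U)" by (rule pre_\<iota>_mono) (use V'(4) Q(2) in blast)
     from superalg_hom.zero[OF W.rst[OF pre_\<iota>_open[OF lmor.S_open[OF lmor_\<Psi>[OF U(1)] U(1) order_refl]] pre_\<iota>_open[OF V'(1)] this]]
     show ?thesis using lg(2) i by (simp add: locally_generated_def)
    qed
    finally have 1: "pull \<iota> V' (rst M (preim M \<Psi> U) V' (pull \<Psi> U (g i))) = 0[sec W (pre V')]" .
    have "pull \<iota> V' (PM V' X' V' (rst M (preim M \<Psi> U) V' (pull \<Psi> U (g i)))) = 0[sec W (pre V')]"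
     by (rule Pi_tangent_generator[OF F U(1) gU(1) V'(1,4) X' tangential_mono[OF t V'B, folded X'_def] i])
    then have "pull \<iota> V' (PM B X V' (rst M (preim M \<Psi> U) V' (pull \<Psi> U (g i)))) = 0[sec W (pre V')]"
     unfolding PX' normal_der_apply[OF V'(1) order_refl gc] .
    then show ?thesis using 1 gc by (simp add: J_def)
   qed
   then show "(%i. rst M (preim M \<Psi> U) V' (pull \<Psi> U (g i))) ` {..<r} <= J" by auto
  qed
  then have J0: "pull \<iota> V' (PM B X V' (rst M V V' f)) = 0[sec W (pre V')]" by (simp add: J_def)
  have "rst W (pre V) (pre V') (pull \<iota> V (PM B X V f)) = 0[sec W (pre V')]"
   unfolding pull_\<iota>_rst[OF V(1) V'(1,3) PXf, symmetric] lder_rst[OF PX V V'(1,3) f, symmetric] by (rule J0)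
  also have "\<dots> = rst W (pre V) (pre V') 0[sec W (pre V)]"
   by (rule superalg_hom.zero[OF W.rst[OF pre_\<iota>_open[OF V(1)] pre_\<iota>_open[OF V'(1)] pre_\<iota>_mono[OF V'(3)]], symmetric])
  finally show "\<exists>V'. W.opn V' & w : V' & V' <= pre V & rst W (pre V) V' (pull \<iota> V (PM B X V f)) =
    rst W (pre V) V' 0[sec W (pre V)]"
   using pre_\<iota>_open[OF V'(1)] pre_\<iota>_mono[OF V'(3)] wt V'(2)
   by (intro exI[of _ "pre V'"] conjI) (simp_all add: pre_\<iota>_u)
 qed
qed

text \<open>The homogeneous parts of a tangential field are tangential: on a homogeneous function of
  the ideal their values restrict to sections of W of opposite parities with sum 0, so both restrict
  to 0. The ideal itself contains the homogeneous parts of its elements.\<close>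

lemma tangential_P:
 assumes B: "M.opn B" and X: "X : vfields M B" and t: "tangential B X"
 shows "tangential B (PM B X)"
proof -
 obtain X0 X1 where X0: "X0 : tpart M B False" and X1: "X1 : tpart M B True"
  and eq: "X = normal_der M B (%V f. X0 V f +[sec M V] X1 V f)" by (rule M.vfields_decomp[OF X])
 have l0: "lder M M B (%V. V) (%V f. f) False X0" and l1: "lder M M B (%V. V) (%V f. f) True X1"
  using X0 X1 by (simp_all add: hom_vfields_iff[OF M.srs])
 have both: "pull \<iota> V (X0 V f) = 0[sec W (pre V)] & pull \<iota> V (X1 V f) = 0[sec W (pre V)]"
  if V: "M.opn V" "V <= B" and f: "f : Sec M V" and 0: "pull \<iota> V f = 0[sec W (pre V)]" for V f
 proof -
  interpret h: superalg_hom "sec M V" "sec W (pre V)" "pull \<iota> V" by (rule hom_\<iota>[OF V(1)])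
  let ?z = "0[sec W (pre V)]"
  have hom: "pull \<iota> V (X0 V x) = ?z & pull \<iota> V (X1 V x) = ?z"
   if x: "x : Part M V s" and x0: "pull \<iota> V x = ?z" for x s
  proof -
   have xc: "x : Sec M V" using x by (rule h.A.part_closed)
   note p = lder_parity[OF l0 V x] lder_parity[OF l1 V x]
   have "pull \<iota> V (X V x) = ?z" by (rule tangentialD[OF t V xc x0])
   then have e: "pull \<iota> V (X0 V x) +[sec W (pre V)] pull \<iota> V (X1 V x) = ?z"
    unfolding eq normal_der_apply[OF V xc] using p by (simp add: h.add h.A.part_closed)
   have q: "pull \<iota> V (X0 V x) : Part W (pre V) s" "pull \<iota> V (X1 V x) : Part W (pre V) (\<not> s)"
    using h.parity[OF p(1)] h.parity[OF p(2)] by simp_all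
   show ?thesis
   proof (cases s)
    case True
    then show ?thesis
     using h.B.decomp_unique[of "pull \<iota> V (X1 V x)" "pull \<iota> V (X0 V x)" ?z ?z] q e h.B.a_comm h.B.part_closed by auto
   next
    case False
    then show ?thesis
     using h.B.decomp_unique[of "pull \<iota> V (X0 V x)" "pull \<iota> V (X1 V x)" ?z ?z] q e by auto
   qed
  qed
  obtain f0 f1 where f0: "f0 : Part M V False" and f1: "f1 : Part M V True" and fe: "f = f0 +[sec M V] f1"
   using h.A.decomp[OF f] .
  note fc = h.A.part_closed[OF f0] h.A.part_closed[OF f1]
  have "pull \<iota> V f0 +[sec W (pre V)] pull \<iota> V f1 = ?z +[sec W (pre V)] ?z" using 0 fe h.add[OF fc] by simp
  from h.B.decomp_unique[OF h.parity[OF f0] h.parity[OF f1] h.B.part_zero h.B.part_zero this]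
  have "pull \<iota> V f0 = ?z" "pull \<iota> V f1 = ?z" .
  note z = hom[OF f0 this(1)] hom[OF f1 this(2)]
  show ?thesis
   unfolding fe lder_add[OF l0 V fc] lder_add[OF l1 V fc]
   using z lder_closed[OF l0 V] lder_closed[OF l1 V] fc by (simp add: h.add)
 qed
 have t0: "tangential B X0" unfolding tangential_def by (intro allI impI, elim conjE) (rule both[THEN conjunct1])
 have t1: "tangential B X1" unfolding tangential_def by (intro allI impI, elim conjE) (rule both[THEN conjunct2])
 note v = M.vfields_part[OF B X0] M.vfields_part[OF B X1]
 note T = tangential_P_part[OF B X0 t0] tangential_P_part[OF B X1 t1]
 interpret lB: lmor M M B "%V. V" "%x. x" "%V f. f" by (rule M.lm_id[OF B])
 show ?thesis
  unfolding tangential_def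
 proof (intro allI impI, elim conjE)
  fix V f assume V: "M.opn V" "V <= B" and f: "f : Sec M V" and 0: "pull \<iota> V f = 0[sec W (pre V)]"
  interpret h: superalg_hom "sec M V" "sec W (pre V)" "pull \<iota> V" by (rule hom_\<iota>[OF V(1)])
  have c: "PM B X0 V f : Sec M V" "PM B X1 V f : Sec M V"
   using lB.gder_closed[OF _ V f] M.P_closed[OF B v(1)] M.P_closed[OF B v(2)] by (auto simp: vfields_iff[OF M.srs])
  show "pull \<iota> V (PM B X V f) = 0[sec W (pre V)]"
   unfolding eq M.P_add[OF B v] normal_der_apply[OF V f] h.add[OF c]
    tangentialD[OF T(1) V f 0] tangentialD[OF T(2) V f 0] by simp
 qed
qed

text \<open>In coordinates, \<open>PM B X\<close> is the sum of the fields PM(e_i) with coefficients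
  X(y_i), up to signs, and these coefficients lie in the ideal of W. This is behind the independence
  of the extension in \<open>extends_P_cong\<close>.\<close>

lemma pull_P_zero:
 assumes B: "M.opn B" and X: "X : vfields M B"
  and 0: "\<And>V f. M.opn V ==> V <= B ==> f : Sec M V ==> pull \<iota> V (X V f) = 0[sec W (pre V)]"
  and V: "M.opn V" "V <= B" and f: "f : Sec M V"
 shows "pull \<iota> V (PM B X V f) = 0[sec W (pre V)]"
proof -
 interpret lB: lmor M M B "%V. V" "%x. x" "%V f. f" by (rule M.lm_id[OF B])
 interpret hV: superalg_hom "sec M V" "sec W (pre V)" "pull \<iota> V" by (rule hom_\<iota>[OF V(1)])
 have PX: "gder M M B (%V. V) (%V f. f) (PM B X)" using M.P_closed[OF B X] by (simp add: vfields_iff[OF M.srs])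
 have gX: "gder M M B (%V. V) (%V f. f) X" using X by (simp add: vfields_iff[OF M.srs])
 note PXf = lB.gder_closed[OF PX V f]
 show ?thesis
 proof (rule W.sec_eqI[OF pre_\<iota>_open[OF V(1)] hV.closed[OF PXf] hV.B.zero_closed])
  fix w assume w: "w : pre V"
  then have wt: "w : topspace (spc W)" and wV: "umap \<iota> w : V" by (auto simp: preim_def)
  obtain U y e where U: "M.opn U" "umap \<iota> w : U" "U <= V" and G: "good_coords a b M U y e"
   using locally_super_coords[OF M(1) V(1) wV] by blast
  have UB: "U <= B" using U(3) V(2) by blast
  interpret h: superalg_hom "sec M U" "sec W (pre U)" "pull \<iota> U" by (rule hom_\<iota>[OF U(1)])
  have y: "y i : Sec M U" if "i < a + b" for i using good_coords_part[OF G that] by (auto intro: h.A.part_closed)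
  have fU: "rst M V U f : Sec M U" by (rule M.rst_closed[OF V(1) U(1,3) f])
  define X' where "X' = normal_der M U X"
  have X': "X' : vfields M U" unfolding X'_def by (rule M.normal_der_vfields[OF gder_mono[OF gX UB]])
  have Xy: "X' U (y i) : Sec M U" "pull \<iota> U (X' U (y i)) = 0[sec W (pre U)]" if "i < a + b" for i
   unfolding X'_def normal_der_apply[OF U(1) order_refl y[OF that]]
   using 0[OF U(1) UB y[OF that]] lB.gder_closed[OF gX U(1) UB y[OF that]] by simp_all
  note Pc = M.P_field_closed[OF G _ fU]
  have t: "pull \<iota> U (rst M U U (grade_inv (sec M U) (X' U (y i))) *[sec M U] PM U (normal_der M U (e i)) U (rst M V U f)) =
   0[sec W (pre U)]" if "i < a + b" for i
   using Xy[OF that] Pc[OF that] U(1) by (simp add: h.mult h.grade_inv)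
  have "pull \<iota> U (PM B X U (rst M V U f)) = pull \<iota> U (PM U X' U (rst M V U f))"
   unfolding X'_def M.P_rst[OF B U(1) UB X] normal_der_apply[OF U(1) order_refl fU] ..
  also have "\<dots> = rsum (sec W (pre U)) (%i. pull \<iota> U (rst M U U (grade_inv (sec M U) (X' U (y i))) *[sec M U]
    PM U (normal_der M U (e i)) U (rst M V U f))) (a + b)"
   unfolding M.P_coords[OF M(1) G X' U(1) order_refl fU] by (rule h.rsum) (use Xy Pc U(1) in simp)
  also have "\<dots> = 0[sec W (pre U)]" by (rule h.B.rsum_zero) (rule t)
  finally have "rst W (pre V) (pre U) (pull \<iota> V (PM B X V f)) = 0[sec W (pre U)]"
   unfolding pull_\<iota>_rst[OF V(1) U(1,3) PXf, symmetric] lB.gder_rst[OF PX V f U(1,3), symmetric] .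
  also have "\<dots> = rst W (pre V) (pre U) 0[sec W (pre V)]"
   by (rule superalg_hom.zero[OF W.rst[OF pre_\<iota>_open[OF V(1)] pre_\<iota>_open[OF U(1)] pre_\<iota>_mono[OF U(3)]], symmetric])
  finally show "\<exists>V'. W.opn V' & w : V' & V' <= pre V & rst W (pre V) V' (pull \<iota> V (PM B X V f)) =
    rst W (pre V) V' 0[sec W (pre V)]"
   using pre_\<iota>_open[OF U(1)] pre_\<iota>_mono[OF U(3)] wt U(2)
   by (intro exI[of _ "pre U"] conjI) (simp_all add: pre_\<iota>_u)
 qed
qed

section \<open>Vector fields of M extending those of W\<close>

definition extends :: "'p set => ('p, 's, 's) sder => ('w, 'u, 'u) sder => bool" where
 "extends B X v \<longleftrightarrow> X : vfields M B & (\<forall>V f. M.opn V & V <= B & f : Sec M V -->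
   pull \<iota> V (X V f) = v (pre V) (pull \<iota> V f))"

lemma extendsD:
 assumes "extends B X v"
 shows extends_vfields: "X : vfields M B"
  and extends_eq: "M.opn V ==> V <= B ==> f : Sec M V ==> pull \<iota> V (X V f) = v (pre V) (pull \<iota> V f)"
 using assms unfolding extends_def by simp_all

lemma extends_mono:
 assumes X: "extends B X v" and B': "B' <= B"
 shows "extends B' (normal_der M B' X) v"
 unfolding extends_def
proof (intro conjI allI impI, goal_cases)
 case 1
 have "gder M M B (%V. V) (%V f. f) X" using extends_vfields[OF X] by (simp add: vfields_iff[OF M.srs])
 then show ?case by (rule M.normal_der_vfields[OF gder_mono[OF _ B']])
next
 case (2 V f)
 then have V: "M.opn V" "V <= B'" "f : Sec M V" by auto
 show ?case unfolding normal_der_apply[OF V] by (rule extends_eq[OF X]) (use V B' in auto)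
qed

text \<open>\<open>lift_derivations\<close> for a family with the single member \<open>v\<close>.
  Its hypothesis on domains is met because the open set \<open>U\<close> of W is the preimage of an
  open set of M.\<close>

lemma extends_part_exists:
 assumes U: "W.opn U" and v: "v : tpart W U p" and w: "w : U"
 shows "\<exists>B X. M.opn B & umap \<iota> w : B & pre B <= U & X : tpart M B p & extends B X v"
proof -
 have lv: "lder W W U (%V. V) (%V f. f) p v" using v by (simp add: hom_vfields_iff[OF W.srs])
 obtain B0 where B0: "M.opn B0" "U = pre B0" using opens[OF U] by blast
 have wB: "umap \<iota> w : B0" "w : topspace (spc W)" using w unfolding B0(2) by (auto simp: preim_def)
 obtain U1 y e where U1: "M.opn U1" "umap \<iota> w : U1" "U1 <= B0" and G: "good_coords a b M U1 y e"
  using locally_super_coords[OF M(1) B0(1) wB(1)] by blast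
 have w1: "w : pre U1" using wB(2) U1(2) by (simp add: preim_def)
 have sub: "pre U1 <= U" unfolding B0(2) by (rule pre_\<iota>_mono[OF U1(3)])
 have "\<exists>B X. M.opn B & umap \<iota> w : B & B <= U1 & (\<forall>i<1::nat. lder M M B (%V. V) (%V f. f) p (X i) &
    (\<forall>V f. M.opn V & V <= B & f : Sec M V --> pull \<iota> V (X i V f) = v (pre V) (pull \<iota> V f)))"
  by (rule lift_derivations[OF W M.srs \<iota> surj(2) G w1 sub lv])
 then obtain B X where B: "M.opn B" "umap \<iota> w : B" "B <= U1"
  and X': "\<forall>i<1::nat. lder M M B (%V. V) (%V f. f) p (X i) &
    (\<forall>V f. M.opn V & V <= B & f : Sec M V --> pull \<iota> V (X i V f) = v (pre V) (pull \<iota> V f))"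
  by (elim exE conjE) (rule that)
 note X = X'[rule_format, OF zero_less_one]
 have p: "normal_der M B (X 0) : tpart M B p" by (rule M.normal_der_part[OF X[THEN conjunct1]])
 have "extends B (normal_der M B (X 0)) v"
  unfolding extends_def
 proof (intro conjI allI impI M.vfields_part[OF B(1) p], elim conjE)
  fix V f assume V: "M.opn V" "V <= B" "f : Sec M V"
  show "pull \<iota> V (normal_der M B (X 0) V f) = v (pre V) (pull \<iota> V f)"
   unfolding normal_der_apply[OF V]
   by (rule X[THEN conjunct2, rule_format, OF conjI[OF V(1) conjI[OF V(2,3)]]])
 qed
 then show ?thesis
  using B p sub pre_\<iota>_mono[OF B(3)] by (intro exI[of _ B] exI[of _ "normal_der M B (X 0)"] conjI) auto
qed

end

section \<open>The induced \<open>\<Pi>\<close>-symmetry\<close>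

context sspace begin

lemma vfields_closed:
 assumes "opn U" "X : vfields M U" "opn V" "V <= U" "f : Sec M V"
 shows "X V f : Sec M V"
 using lmor.gder_closed[OF lmor_ident[OF assms(1)] _ assms(3-5), of X] assms(2) by (simp add: vfields_iff[OF srs])

lemma vfields_add:
 assumes U: "opn U" and X: "X : vfields M U" "Y : vfields M U"
 shows "normal_der M U (%V f. X V f +[sec M V] Y V f) : vfields M U"
 by (rule normal_der_vfields[OF lmor.gder_plus[OF lmor_ident[OF U]]]) (use X in \<open>simp_all add: vfields_iff[OF srs]\<close>)

lemma vfields_scale:
 assumes U: "opn U" and X: "X : vfields M U" and c: "c : Sec M U"
 shows "normal_der M U (%V f. rst M U V c *[sec M V] X V f) : vfields M U"
 by (rule normal_der_vfields[OF lmor.gder_scale[OF lmor_ident[OF U] _ c]]) (use X in \<open>simp add: vfields_iff[OF srs]\<close>)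

lemma Pi_symmetryI:
 assumes closed: "\<And>U X. opn U ==> X : vfields M U ==> P U X : vfields M U"
  and add: "\<And>U X Y. opn U ==> X : vfields M U ==> Y : vfields M U ==>
   P U (normal_der M U (%V f. X V f +[sec M V] Y V f)) = normal_der M U (%V f. P U X V f +[sec M V] P U Y V f)"
  and scale: "\<And>U c X. opn U ==> c : Sec M U ==> X : vfields M U ==>
   P U (normal_der M U (%V f. rst M U V c *[sec M V] X V f)) =
   normal_der M U (%V f. rst M U V (grade_inv (sec M U) c) *[sec M V] P U X V f)"
  and part: "\<And>U X p. opn U ==> X : tpart M U p ==> P U X : tpart M U (\<not> p)"
  and rst: "\<And>U U' X. opn U ==> opn U' ==> U' <= U ==> X : vfields M U ==> P U' (normal_der M U' X) = normal_der M U' (P U X)"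
  and PP: "\<And>U X. opn U ==> X : vfields M U ==> P U (P U X) = X"
 shows "Pi_symmetry (tangent_sheaf M) P"
proof -
 have p: "preim M smor_id V = V" if "opn V" for V using preim_smor_id[OF openin_subset[OF that]] .
 have n: "normal_der M U (%V f. X V f +[sec M (preim M smor_id V)] Y V f) = normal_der M U (%V f. X V f +[sec M V] Y V f)"
  for U and X Y :: "('p, 's, 's) sder" by (rule normal_der_cong) (simp add: p)
 have n': "normal_der M U (%V f. rst M U (preim M smor_id V) c *[sec M (preim M smor_id V)] X V f) =
   normal_der M U (%V f. rst M U V c *[sec M V] X V f)" if "opn U" for U c and X :: "('p, 's, 's) sder"
  by (rule normal_der_cong) (simp add: p)
 note unf = tangent_sheaf_def der_simps parity_change_sheaf_def parity_change_def
 show ?thesis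
  unfolding Pi_symmetry_def even_sheaf_hom_def
 proof (intro conjI allI impI ballI, goal_cases)
  case (1 U X) then show ?case using closed[of U X] by (simp add: unf)
 next
  case (2 U X Y) then show ?case using add[of U X Y] by (simp add: unf n)
 next
  case (3 U c X) then show ?case using scale[of U c X] by (simp add: unf p n')
 next
  case (4 U s X) then show ?case using part[of U X s] by (simp add: unf)
 next
  case (5 U U' X) then show ?case using rst[of U U' X] by (simp add: unf)
 next
  case (6 U X) then show ?case using PP[of U X] by (simp add: unf)
 qed
qed

end

context preimage begin

lemma extends_add:
 assumes B: "M.opn B" "pre B <= U" and X: "extends B X v" and Y: "extends B Y v'"
 shows "extends B (normal_der M B (%V f. X V f +[sec M V] Y V f)) (normal_der W U (%V g. v V g +[sec W V] v' V g))"
 unfolding extends_def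
proof (intro conjI allI impI M.vfields_add[OF B(1) extends_vfields[OF X] extends_vfields[OF Y]], elim conjE)
 fix V f assume V: "M.opn V" "V <= B" and f: "f : Sec M V"
 interpret h: superalg_hom "sec M V" "sec W (pre V)" "pull \<iota> V" by (rule hom_\<iota>[OF V(1)])
 have s: "pre V <= U" using pre_\<iota>_mono[OF V(2)] B(2) by blast
 show "pull \<iota> V (normal_der M B (%V f. X V f +[sec M V] Y V f) V f) =
  normal_der W U (%V g. v V g +[sec W V] v' V g) (pre V) (pull \<iota> V f)"
  unfolding normal_der_apply[OF V f] normal_der_apply[OF pre_\<iota>_open[OF V(1)] s h.closed[OF f]]
   h.add[OF M.vfields_closed[OF B(1) extends_vfields[OF X] V f] M.vfields_closed[OF B(1) extends_vfields[OF Y] V f]]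
   extends_eq[OF X V f] extends_eq[OF Y V f] ..
qed

lemma extends_scale:
 assumes B: "M.opn B" "pre B <= U" and U: "W.opn U" and X: "extends B X v"
  and c: "t : Sec W U" and x: "x : Sec M B" "pull \<iota> B x = rst W U (pre B) t"
 shows "extends B (normal_der M B (%V f. rst M B V x *[sec M V] X V f)) (normal_der W U (%V g. rst W U V t *[sec W V] v V g))"
 unfolding extends_def
proof (intro conjI allI impI M.vfields_scale[OF B(1) extends_vfields[OF X] x(1)], elim conjE)
 fix V f assume V: "M.opn V" "V <= B" and f: "f : Sec M V"
 interpret h: superalg_hom "sec M V" "sec W (pre V)" "pull \<iota> V" by (rule hom_\<iota>[OF V(1)])
 have s: "pre V <= U" using pre_\<iota>_mono[OF V(2)] B(2) by blast
 have r: "pull \<iota> V (rst M B V x) = rst W U (pre V) t"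
  unfolding pull_\<iota>_rst[OF B(1) V x(1)] x(2)
  by (rule W.rst_rst[OF U pre_\<iota>_open[OF B(1)] pre_\<iota>_open[OF V(1)] B(2) pre_\<iota>_mono[OF V(2)] c])
 show "pull \<iota> V (normal_der M B (%V f. rst M B V x *[sec M V] X V f) V f) =
  normal_der W U (%V g. rst W U V t *[sec W V] v V g) (pre V) (pull \<iota> V f)"
  unfolding normal_der_apply[OF V f] normal_der_apply[OF pre_\<iota>_open[OF V(1)] s h.closed[OF f]]
   h.mult[OF M.rst_closed[OF B(1) V x(1)] M.vfields_closed[OF B(1) extends_vfields[OF X] V f]] extends_eq[OF X V f] r ..
qed

text \<open>A homogeneous field gets an extension of its own parity; otherwise the two parts are
  extended separately and added over the intersection of their domains. The proviso is part of the
  existence claim so that the same extension can be used in either case.\<close>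

lemma extends_exists:
 assumes U: "W.opn U" and v: "v : vfields W U" and w: "w : U"
 shows "\<exists>B X. M.opn B & umap \<iota> w : B & pre B <= U & extends B X v &
  (v : tpart W U p --> X : tpart M B p)"
proof (cases "v : tpart W U p")
 case True
 then show ?thesis using extends_part_exists[OF U True w] by blast
next
 case False
 obtain v0 v1 where v0: "v0 : tpart W U False" and v1: "v1 : tpart W U True"
  and eq: "v = normal_der W U (%V f. v0 V f +[sec W V] v1 V f)" by (rule W.vfields_decomp[OF v])
 obtain B0 X0 where B0: "M.opn B0" "umap \<iota> w : B0" "pre B0 <= U" "extends B0 X0 v0"
  using extends_part_exists[OF U v0 w] by blast
 obtain B1 X1 where B1: "M.opn B1" "umap \<iota> w : B1" "extends B1 X1 v1"
  using extends_part_exists[OF U v1 w] by blast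
 let ?B = "B0 Int B1"
 have B: "M.opn ?B" "pre ?B <= U" using B0 B1 pre_\<iota>_mono[of ?B B0] by auto
 have "extends ?B (normal_der M ?B (%V f. normal_der M ?B X0 V f +[sec M V] normal_der M ?B X1 V f)) v"
  unfolding eq by (rule extends_add[OF B extends_mono[OF B0(4)] extends_mono[OF B1(3)]]) auto
 then show ?thesis using False B B0 B1 by blast
qed

lemma lift_section:
 assumes V: "W.opn V" and g: "g : Sec W V" and w: "w : V" and Q: "M.opn Q" "umap \<iota> w : Q"
 shows "\<exists>B f. M.opn B & umap \<iota> w : B & B <= Q & pre B <= V & f : Sec M B &
  pull \<iota> B f = rst W V (pre B) g & (g : Part W V q --> f : Part M B q)"
proof (cases "g : Part W V q")
 case True
 have "\<exists>B f. M.opn B & umap \<iota> w : B & B <= Q & pre B <= V &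
   (\<forall>i\<in>{0::nat}. f i : Part M B q & pull \<iota> B (f i) = rst W V (pre B) g)"
  by (rule lift_family_part[OF W.srs M.srs \<iota> surj(2) V w Q]) (use True in auto)
 then obtain B f where B: "M.opn B" "umap \<iota> w : B" "B <= Q" "pre B <= V"
  "f (0::nat) : Part M B q" "pull \<iota> B (f 0) = rst W V (pre B) g" by auto
 then show ?thesis using superalg.part_closed[OF M.alg[OF B(1)] B(5)] by blast
next
 case False
 have "\<exists>B f. M.opn B & umap \<iota> w : B & B <= Q & pre B <= V &
   (\<forall>i\<in>{0::nat}. f i : Sec M B & pull \<iota> B (f i) = rst W V (pre B) g)"
  by (rule lift_family[OF W.srs M.srs \<iota> surj(2) V w Q]) (use g in auto)
 then show ?thesis using False by auto
qed

text \<open>The local data from which the value at \<open>g\<close> of the field to be defined is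
  computed: over \<open>B\<close>, a field extending \<open>v\<close> and a function lifting
  \<open>g\<close>.\<close>

definition represents :: "('w, 'u, 'u) sder => 'w set => 'u => 'p set => ('p, 's, 's) sder => 's => bool" where
 "represents v V g B X f \<longleftrightarrow> M.opn B & pre B <= V & extends B X v & f : Sec M B &
   pull \<iota> B f = rst W V (pre B) g"

lemma representsD:
 assumes "represents v V g B X f"
 shows rep_open: "M.opn B" and rep_sub: "pre B <= V" and rep_ext: "extends B X v" and rep_sec: "f : Sec M B"
  and rep_pull: "pull \<iota> B f = rst W V (pre B) g"
 using assms unfolding represents_def by simp_all

lemma representsI:
 "M.opn B ==> pre B <= V ==> extends B X v ==> f : Sec M B ==>
  pull \<iota> B f = rst W V (pre B) g ==> represents v V g B X f"
 unfolding represents_def by simp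

text \<open>Two fields and two sections are represented over the same \<open>B\<close>, since sums,
  products and scalings have to be compared there. Homogeneity of the first field and of the first
  section is retained.\<close>

lemma represents_exists:
 assumes U: "W.opn U" and v: "v : vfields W U" "v' : vfields W U" and V: "W.opn V" "V <= U"
  and g: "g : Sec W V" "g' : Sec W V" and w: "w : V"
 shows "\<exists>B X X' f f'. umap \<iota> w : B & represents v V g B X f & represents v' V g' B X' f' &
  (v : tpart W U p --> X : tpart M B p) &
  (g : Part W V q --> f : Part M B q)"
proof -
 have wU: "w : U" using w V by blast
 obtain B1 X where B1: "M.opn B1" "umap \<iota> w : B1" "extends B1 X v"
  "v : tpart W U p --> X : tpart M B1 p"
  using extends_exists[OF U v(1) wU] by blast
 obtain B2 X' where B2: "M.opn B2" "umap \<iota> w : B2" "extends B2 X' v'"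
  using extends_exists[OF U v(2) wU] by blast
 have Q: "M.opn (B1 Int B2)" "umap \<iota> w : B1 Int B2" using B1 B2 by auto
 obtain B3 f where B3: "M.opn B3" "umap \<iota> w : B3" "B3 <= B1 Int B2" "pre B3 <= V" "f : Sec M B3"
  "pull \<iota> B3 f = rst W V (pre B3) g" "g : Part W V q --> f : Part M B3 q"
  using lift_section[OF V(1) g(1) w Q] by blast
 obtain B f' where B: "M.opn B" "umap \<iota> w : B" "B <= B3" "pre B <= V" "f' : Sec M B"
  "pull \<iota> B f' = rst W V (pre B) g'"
  using lift_section[OF V(1) g(2) w B3(1,2)] by blast
 have sub: "B <= B1" "B <= B2" using B(3) B3(3) by auto
 have r: "pull \<iota> B (rst M B3 B f) = rst W V (pre B) g"
  unfolding pull_\<iota>_rst[OF B3(1) B(1,3) B3(5)] B3(6)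
  by (rule W.rst_rst[OF V(1) pre_\<iota>_open[OF B3(1)] pre_\<iota>_open[OF B(1)] B3(4) pre_\<iota>_mono[OF B(3)] g(1)])
 have "represents v V g B (normal_der M B X) (rst M B3 B f)"
  by (rule representsI[OF B(1,4) extends_mono[OF B1(3) sub(1)] M.rst_closed[OF B3(1) B(1,3) B3(5)] r])
 moreover have "represents v' V g' B (normal_der M B X') f'"
  by (rule representsI[OF B(1,4) extends_mono[OF B2(3) sub(2)] B(5,6)])
 moreover have "normal_der M B X : tpart M B p" if "v : tpart W U p"
  by (rule M.normal_der_part[OF lder_mono[OF _ sub(1)]]) (use B1(4) that in \<open>simp add: hom_vfields_iff[OF M.srs]\<close>)
 moreover have "rst M B3 B f : Part M B q" if "g : Part W V q"
  by (rule superalg_hom.parity[OF M.rst[OF B3(1) B(1,3)]]) (use B3(7) that in simp)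
 ultimately show ?thesis
  using B(2) by (intro exI[of _ B] exI[of _ "normal_der M B X"] exI[of _ "normal_der M B X'"]
    exI[of _ "rst M B3 B f"] exI[of _ f'] conjI impI)
qed

lemma W_eqI:
 assumes V: "W.opn V" and h: "h : Sec W V" "h' : Sec W V"
  and loc: "\<And>w. w : V ==> \<exists>B. M.opn B & umap \<iota> w : B & pre B <= V &
   rst W V (pre B) h = rst W V (pre B) h'"
 shows "h = h'"
proof (rule W.sec_eqI[OF V h])
 fix w assume w: "w : V"
 obtain B where B: "M.opn B" "umap \<iota> w : B" "pre B <= V" "rst W V (pre B) h = rst W V (pre B) h'"
  using loc[OF w] by (elim exE conjE) (rule that)
 have "w : pre B" using B(2) w openin_subset[OF V] by (auto simp: pre_\<iota>_u)
 then show "\<exists>V'. W.opn V' & w : V' & V' <= V & rst W V V' h = rst W V V' h'"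
  by (intro exI[of _ "pre B"] conjI pre_\<iota>_open[OF B(1)] B(3,4))
qed

text \<open>The difference of two extensions takes values in the ideal of W, so
  \<open>pull_P_zero\<close> applies to it.\<close>

lemma extends_P_cong:
 assumes B: "M.opn B" and X: "extends B X v" "extends B X' v" and V: "M.opn V" "V <= B" and f: "f : Sec M V"
 shows "pull \<iota> V (PM B X V f) = pull \<iota> V (PM B X' V f)"
proof -
 note v = extends_vfields[OF X(1)] extends_vfields[OF X(2)]
 interpret A: superalg "sec M B" using M.alg[OF B] .
 have m: "-[sec M B] 1[sec M B] : Sec M B" by simp
 \<comment> \<open>The difference is composed from a sum and a multiple, for which closure of vector
   fields and additivity of \<open>PM\<close> are available.\<close>
 define Y where "Y = normal_der M B (%V f. X V f +[sec M V]
  normal_der M B (%V f. rst M B V (-[sec M B] 1[sec M B]) *[sec M V] X' V f) V f)"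
 have Y: "Y : vfields M B" unfolding Y_def by (rule M.vfields_add[OF B v(1) M.vfields_scale[OF B v(2) m]])
 have Yv: "Y V f = X V f -[sec M V] X' V f" if V: "M.opn V" "V <= B" and f: "f : Sec M V" for V f
 proof -
  interpret r: superalg_hom "sec M B" "sec M V" "rst M B V" by (rule M.rst[OF B V])
  show ?thesis
   unfolding Y_def normal_der_apply[OF V f] using M.vfields_closed[OF B v(2) V f]
   by (simp add: r.uminus r.one r.B.l_minus a_minus_def)
 qed
 have "X = normal_der M B (%V f. X' V f +[sec M V] Y V f)"
 proof (rule normal_der_eqI[OF _ normal_der_idem])
  show "normal_der M B X = X" using v(1) by (simp add: vfields_iff[OF M.srs])
  fix V f assume V: "M.opn V" "V <= B" and f: "f : Sec M V"
  interpret superalg "sec M V" using M.alg[OF V(1)] .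
  show "X V f = normal_der M B (%V f. X' V f +[sec M V] Y V f) V f"
   unfolding normal_der_apply[OF V f] Yv[OF V f]
   using M.vfields_closed[OF B v(1) V f] M.vfields_closed[OF B v(2) V f] by (simp add: add_minus')
 qed
 then have "PM B X = normal_der M B (%V f. PM B X' V f +[sec M V] PM B Y V f)" using M.P_add[OF B v(2) Y] by simp
 then have e: "PM B X V f = PM B X' V f +[sec M V] PM B Y V f" using normal_der_apply[OF V f] by simp
 interpret h: superalg_hom "sec M V" "sec W (pre V)" "pull \<iota> V" by (rule hom_\<iota>[OF V(1)])
 have 0: "pull \<iota> V (PM B Y V f) = 0[sec W (pre V)]"
 proof (rule pull_P_zero[OF B Y _ V f])
  fix V f assume V: "M.opn V" "V <= B" and f: "f : Sec M V"
  interpret h: superalg_hom "sec M V" "sec W (pre V)" "pull \<iota> V" by (rule hom_\<iota>[OF V(1)])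
  note c = M.vfields_closed[OF B v(1) V f] M.vfields_closed[OF B v(2) V f]
  show "pull \<iota> V (Y V f) = 0[sec W (pre V)]"
   unfolding Yv[OF V f] h.minus[OF c] extends_eq[OF X(1) V f]
   using h.closed[OF c(2)] extends_eq[OF X(2) V f] by simp
 qed
 show ?thesis
  unfolding e h.add[OF M.vfields_closed[OF B M.P_closed[OF B v(2)] V f] M.vfields_closed[OF B M.P_closed[OF B Y] V f]] 0
  using M.vfields_closed[OF B M.P_closed[OF B v(2)] V f] by simp
qed

text \<open>On the intersection the fields may be exchanged by \<open>extends_P_cong\<close>. The
  functions differ by an element of the ideal of W; as \<open>X\<close> extends a field of W it is
  tangential, hence so is its image under \<open>PM\<close>, which therefore cannot tell the
  functions apart on W.\<close>

lemma represents_cong: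
 assumes U: "W.opn U" and v: "v : vfields W U" and V: "W.opn V" "V <= U" and g: "g : Sec W V"
  and r: "represents v V g B X f" and r': "represents v V g B' X' f'"
 shows "rst W (pre B) (pre (B Int B')) (pull \<iota> B (PM B X B f)) =
  rst W (pre B') (pre (B Int B')) (pull \<iota> B' (PM B' X' B' f'))"
proof -
 let ?C = "B Int B'"
 have C: "M.opn ?C" "?C <= B" "?C <= B'" using rep_open[OF r] rep_open[OF r'] by auto
 interpret h: superalg_hom "sec M ?C" "sec W (pre ?C)" "pull \<iota> ?C" by (rule hom_\<iota>[OF C(1)])
 have step: "rst W (pre D) (pre ?C) (pull \<iota> D (PM D Y D x)) = pull \<iota> ?C (PM ?C (normal_der M ?C Y) ?C (rst M D ?C x))"
  and eq: "pull \<iota> ?C (rst M D ?C x) = rst W V (pre ?C) g"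
  if q: "represents v V g D Y x" and CD: "?C <= D" for D Y x
 proof -
  note D = rep_open[OF q] and x = rep_sec[OF q] and Y = extends_vfields[OF rep_ext[OF q]]
  interpret l: lmor M M D "%V. V" "%x. x" "%V f. f" by (rule M.lm_id[OF D])
  have PY: "gder M M D (%V. V) (%V f. f) (PM D Y)" using M.P_closed[OF D Y] by (simp add: vfields_iff[OF M.srs])
  have xc: "rst M D ?C x : Sec M ?C" by (rule M.rst_closed[OF D C(1) CD x])
  show "rst W (pre D) (pre ?C) (pull \<iota> D (PM D Y D x)) = pull \<iota> ?C (PM ?C (normal_der M ?C Y) ?C (rst M D ?C x))"
   unfolding M.P_rst[OF D C(1) CD Y] normal_der_apply[OF C(1) order_refl xc] l.gder_rst[OF PY D order_refl x C(1) CD]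
   by (rule pull_\<iota>_rst[OF D C(1) CD l.gder_closed[OF PY D order_refl x], symmetric])
  show "pull \<iota> ?C (rst M D ?C x) = rst W V (pre ?C) g"
   unfolding pull_\<iota>_rst[OF D C(1) CD x] rep_pull[OF q]
   by (rule W.rst_rst[OF V(1) pre_\<iota>_open[OF D] pre_\<iota>_open[OF C(1)] rep_sub[OF q] pre_\<iota>_mono[OF CD] g])
 qed
 let ?X = "normal_der M ?C X" and ?x = "rst M B ?C f" and ?x' = "rst M B' ?C f'"
 have xc: "?x : Sec M ?C" "?x' : Sec M ?C"
  using M.rst_closed[OF rep_open[OF r] C(1,2) rep_sec[OF r]] M.rst_closed[OF rep_open[OF r'] C(1,3) rep_sec[OF r']] .
 note X = extends_mono[OF rep_ext[OF r] C(2)] and X' = extends_mono[OF rep_ext[OF r'] C(3)]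
 have CU: "pre ?C <= U" using pre_\<iota>_mono[OF C(2)] rep_sub[OF r] V(2) by blast
 have "tangential ?C ?X"
  unfolding tangential_def
 proof (intro allI impI, elim conjE)
  fix B f assume B: "M.opn B" "B <= ?C" and f: "f : Sec M B" and 0: "pull \<iota> B f = 0[sec W (pre B)]"
  interpret A: superalg "sec W (pre B)" using W.alg[OF pre_\<iota>_open[OF B(1)]] .
  have "pre B <= U" using pre_\<iota>_mono[OF B(2)] CU by blast
  from lmor.gder_zero_arg[OF W.lmor_ident[OF U] _ pre_\<iota>_open[OF B(1)] this A.zero_closed, of v]
  show "pull \<iota> B (?X B f) = 0[sec W (pre B)]"
   unfolding extends_eq[OF X B f] 0 using v by (simp add: vfields_iff[OF W.srs])
 qed
 note t = tangential_P[OF C(1) extends_vfields[OF X] this]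
 have PX: "gder M M ?C (%V. V) (%V f. f) (PM ?C ?X)" using M.P_closed[OF C(1) extends_vfields[OF X]] by (simp add: vfields_iff[OF M.srs])
 note Pc = lmor.gder_closed[OF M.lm_id[OF C(1)] PX C(1) order_refl]
 have "pull \<iota> ?C (PM ?C ?X ?C (?x -[sec M ?C] ?x')) = 0[sec W (pre ?C)]"
  by (rule tangentialD[OF t C(1) order_refl]) (use xc eq[OF r C(2)] eq[OF r' C(3)] h.closed[OF xc(2)] in \<open>simp_all add: h.minus\<close>)
 then have "pull \<iota> ?C (PM ?C ?X ?C ?x) = pull \<iota> ?C (PM ?C ?X ?C ?x')"
  unfolding lmor.gder_minus_arg[OF M.lm_id[OF C(1)] PX C(1) order_refl xc]
  using Pc[OF xc(1)] Pc[OF xc(2)] by (simp add: h.minus h.B.minus_eq_zero_iff)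
 then show ?thesis
  unfolding step[OF r C(2)] step[OF r' C(3)] extends_P_cong[OF C(1) X' X C(1) order_refl xc(2)] .
qed

text \<open>The condition ranges over all representatives, so that each later computation may choose
  one suited to it.\<close>

definition Pi_value :: "('w, 'u, 'u) sder => 'w set => 'u => 'u => bool" where
 "Pi_value v V g h \<longleftrightarrow> h : Sec W V &
   (\<forall>B X f. represents v V g B X f --> rst W V (pre B) h = pull \<iota> B (PM B X B f))"

text \<open>\<open>represents_cong\<close> is the compatibility on intersections that the sheaf
  axiom requires.\<close>

lemma Pi_value_exists:
 assumes U: "W.opn U" and v: "v : vfields W U" and V: "W.opn V" "V <= U" and g: "g : Sec W V"
 shows "\<exists>h. Pi_value v V g h"
proof -
 define \<U> where "\<U> = {pre B |B. \<exists>X f. represents v V g B X f}"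
 \<comment> \<open>Gluing takes a family indexed by the sets of the cover. Different
   \<open>B\<close> can have the same preimage in W, so a representative is chosen for each set;
   \<open>s\<close> below shows that the choice does not matter.\<close>
 define s where "s S = (SOME t. \<exists>B X f. represents v V g B X f & S = pre B & t = pull \<iota> B (PM B X B f))" for S
 note cong = represents_cong[OF U v V g]
 have c: "pull \<iota> B (PM B X B f) : Sec W (pre B)" if r: "represents v V g B X f" for B X f
  by (rule superalg_hom.closed[OF hom_\<iota>[OF rep_open[OF r]] M.vfields_closed[OF rep_open[OF r] M.P_closed[OF rep_open[OF r]
   extends_vfields[OF rep_ext[OF r]]] rep_open[OF r] order_refl rep_sec[OF r]]])
 have Int: "pre (B Int B') = pre B Int pre B'" for B B' by (auto simp: preim_def)
 have s: "s (pre B) = pull \<iota> B (PM B X B f)" if r: "represents v V g B X f" for B X f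
 proof -
  have "\<exists>t B' X' f'. represents v V g B' X' f' & pre B = pre B' & t = pull \<iota> B' (PM B' X' B' f')"
   using r by blast
  from someI_ex[OF this, folded s_def] obtain B' X' f' where r': "represents v V g B' X' f'"
   and e: "pre B = pre B'" "s (pre B) = pull \<iota> B' (PM B' X' B' f')" by (elim exE conjE) (rule that)
  have "rst W (pre B) (pre B) (pull \<iota> B (PM B X B f)) =
   rst W (pre B) (pre B) (pull \<iota> B' (PM B' X' B' f'))"
   using cong[OF r r'] unfolding Int e(1)[symmetric] by simp
  then show ?thesis using c[OF r] c[OF r'] pre_\<iota>_open[OF rep_open[OF r]] e by simp
 qed
 have cov: "\<Union>\<U> = V"
 proof
  show "\<Union>\<U> <= V" unfolding \<U>_def using rep_sub by blast
  show "V <= \<Union>\<U>"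
  proof
   fix w assume w: "w : V"
   then obtain B X f where B: "umap \<iota> w : B" "represents v V g B X f"
    using represents_exists[OF U v v V g g w] by blast
   have "w : pre B" using B(1) w openin_subset[OF V(1)] by (auto simp: pre_\<iota>_u)
   then show "w : \<Union>\<U>" using B(2) unfolding \<U>_def by blast
  qed
 qed
 have "\<exists>h\<in>Sec W (\<Union>\<U>). \<forall>S\<in>\<U>. rst W (\<Union>\<U>) S h = s S"
 proof (rule W.glue)
  fix S assume "S : \<U>"
  then obtain B X f where r: "represents v V g B X f" and S: "S = pre B" unfolding \<U>_def by blast
  show "W.opn S" unfolding S by (rule pre_\<iota>_open[OF rep_open[OF r]])
  show "s S : Sec W S" unfolding S s[OF r] by (rule c[OF r])
  fix S' assume "S' : \<U>"
  then obtain B' X' f' where r': "represents v V g B' X' f'" and S': "S' = pre B'" unfolding \<U>_def by blast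
  show "rst W S (S Int S') (s S) = rst W S' (S Int S') (s S')"
   using cong[OF r r'] unfolding S S' s[OF r] s[OF r'] Int .
 qed
 then obtain h where h: "h : Sec W V" "\<And>S. S : \<U> ==> rst W V S h = s S" unfolding cov by blast
 have "Pi_value v V g h"
  unfolding Pi_value_def
 proof (intro conjI allI impI h(1))
  fix B X f assume r: "represents v V g B X f"
  then have "pre B : \<U>" unfolding \<U>_def by blast
  then show "rst W V (pre B) h = pull \<iota> B (PM B X B f)" unfolding h(2)[OF \<open>pre B : \<U>\<close>] by (intro s[OF r])
 qed
 then show ?thesis ..
qed

section \<open>The operator on vector fields of W and its laws\<close>

definition PW :: "'w set => ('w, 'u, 'u) sder => ('w, 'u, 'u) sder" where
 "PW U v = normal_der W U (%V g. SOME h. Pi_value v V g h)"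

context
 fixes U v assumes U: "W.opn U" and v: "v : vfields W U"
begin

lemma
 assumes V: "W.opn V" "V <= U" and g: "g : Sec W V"
 shows PW_closed: "PW U v V g : Sec W V"
  and PW_eq: "represents v V g B X f ==> rst W V (pre B) (PW U v V g) = pull \<iota> B (PM B X B f)"
 using someI_ex[OF Pi_value_exists[OF U v V g]] unfolding PW_def normal_der_apply[OF V g] Pi_value_def by simp_all

text \<open>An extension of the image of \<open>v\<close> is thus obtained by applying
  \<open>PM\<close> to an extension of \<open>v\<close>. In \<open>PW_PW\<close> this reduces the
  involution property to that of \<open>PM\<close>.\<close>

lemma extends_PW:
 assumes B: "M.opn B" "pre B <= U" and X: "extends B X v"
 shows "extends B (PM B X) (PW U v)"
 unfolding extends_def
proof (intro conjI allI impI M.P_closed[OF B(1) extends_vfields[OF X]], elim conjE)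
 fix V f assume V: "M.opn V" "V <= B" and f: "f : Sec M V"
 let ?V = "pre V"
 have o: "W.opn ?V" "?V <= U" using pre_\<iota>_open[OF V(1)] pre_\<iota>_mono[OF V(2)] B(2) by auto
 have gc: "pull \<iota> V f : Sec W ?V" by (rule superalg_hom.closed[OF hom_\<iota>[OF V(1)] f])
 have r: "represents v ?V (pull \<iota> V f) V (normal_der M V X) f"
  by (rule representsI[OF V(1) order_refl extends_mono[OF X V(2)] f]) (simp add: W.rst_id[OF o(1) gc])
 show "pull \<iota> V (PM B X V f) = PW U v ?V (pull \<iota> V f)"
  using PW_eq[OF o gc r] W.rst_id[OF o(1) PW_closed[OF o gc]]
  by (simp add: M.P_rst[OF B(1) V extends_vfields[OF X]] normal_der_apply[OF V(1) order_refl f])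
qed

end

end

context preimage begin

lemma represents_same_field:
 "represents v V g B X f ==> represents v' V g' B X' f' ==> represents v V g' B X f'"
 unfolding represents_def by simp

lemma
 assumes V: "W.opn V" and g: "g : Sec W V" "g' : Sec W V"
  and r: "represents v V g B X f" and r': "represents v V g' B X f'"
 shows represents_add: "represents v V (g +[sec W V] g') B X (f +[sec M B] f')"
  and represents_mult: "represents v V (g *[sec W V] g') B X (f *[sec M B] f')"
  and represents_smult: "represents v V (t \<odot>[sec W V] g) B X (t \<odot>[sec M B] f)"
proof -
 interpret r: superalg_hom "sec W V" "sec W (pre B)" "rst W V (pre B)"
  by (rule W.rst[OF V pre_\<iota>_open[OF rep_open[OF r]] rep_sub[OF r]])
 interpret h: superalg_hom "sec M B" "sec W (pre B)" "pull \<iota> B" by (rule hom_\<iota>[OF rep_open[OF r]])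
 note f = rep_sec[OF r] rep_sec[OF r'] and p = rep_pull[OF r] rep_pull[OF r']
 note I = representsI[OF rep_open[OF r] rep_sub[OF r] rep_ext[OF r]]
 show "represents v V (g +[sec W V] g') B X (f +[sec M B] f')"
  "represents v V (g *[sec W V] g') B X (f *[sec M B] f')"
  "represents v V (t \<odot>[sec W V] g) B X (t \<odot>[sec M B] f)"
  by (rule I, use f g p in \<open>simp_all add: h.add r.add h.mult r.mult h.smult r.smult\<close>)+
qed

text \<open>Each law of a derivation of parity \<open>\<not> p\<close> is checked on sets
  \<open>pre B\<close>, where \<open>PW U v\<close> is the restriction of \<open>PM B X\<close> with
  \<open>X\<close> homogeneous of parity \<open>p\<close>. There it is the corresponding law on M,
  restricted to W.\<close>

lemma PW_part:
 assumes U: "W.opn U" and v: "v : tpart W U p"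
 shows "PW U v : tpart W U (\<not> p)"
proof -
 note vf = W.vfields_part[OF U v]
 note closed = PW_closed[OF U vf] and eq = PW_eq[OF U vf]
 have ex: "\<exists>B X f f'. umap \<iota> w : B & represents v V g B X f & represents v V g' B X f' &
   X : tpart M B p & (g : Part W V q --> f : Part M B q)"
  if V: "W.opn V" "V <= U" "g : Sec W V" "g' : Sec W V" "w : V" for V g g' w q
 proof -
  obtain B X X' f f' where r: "umap \<iota> w : B" "represents v V g B X f" "represents v V g' B X' f'"
   and X: "v : tpart W U p --> X : tpart M B p"
   and f: "g : Part W V q --> f : Part M B q"
   using represents_exists[OF U vf vf V, of p q] by (elim exE conjE) (rule that)
  show ?thesis
   by (intro exI[of _ B] exI[of _ X] exI[of _ f] exI[of _ f'] conjI r(1,2) represents_same_field[OF r(2,3)] mp[OF X v] f)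
 qed
 have P: "lder M M B (%V. V) (%V f. f) (\<not> p) (PM B X)" if "represents v V g B X f" "X : tpart M B p" for V g B X f
  using M.P_part[OF rep_open[OF that(1)] that(2)] by (simp add: hom_vfields_iff[OF M.srs])
 have "lder W W U (%V. V) (%V f. f) (\<not> p) (PW U v)"
 proof (rule lderI)
  fix V assume V: "W.opn V" "V <= U"
  interpret A: superalg "sec W V" by (rule W.alg[OF V(1)])
  note c = closed[OF V] and e = eq[OF V]
  show "PW U v V g : Sec W V" if "g : Sec W V" for g by (rule c[OF that])
  show "PW U v V (f +[sec W V] g) = PW U v V f +[sec W V] PW U v V g"
   if f: "f : Sec W V" and g: "g : Sec W V" for f g
  proof (rule W_eqI[OF V(1) c[OF A.a_closed[OF f g]] A.a_closed[OF c[OF f] c[OF g]]])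
   fix w assume "w : V"
   then obtain B X x y where w: "umap \<iota> w : B" and r: "represents v V f B X x" "represents v V g B X y"
    and X: "X : tpart M B p" using ex[OF V f g] by blast
   note B = rep_open[OF r(1)] and BV = rep_sub[OF r(1)]
   interpret h: superalg_hom "sec M B" "sec W (pre B)" "pull \<iota> B" by (rule hom_\<iota>[OF B])
   interpret rr: superalg_hom "sec W V" "sec W (pre B)" "rst W V (pre B)" by (rule W.rst[OF V(1) pre_\<iota>_open[OF B] BV])
   note L = P[OF r(1) X] and s = rep_sec[OF r(1)] rep_sec[OF r(2)]
   have "rst W V (pre B) (PW U v V (f +[sec W V] g)) = rst W V (pre B) (PW U v V f +[sec W V] PW U v V g)"
    unfolding e[OF A.a_closed[OF f g] represents_add[OF V(1) f g r]] rr.add[OF c[OF f] c[OF g]] e[OF f r(1)] e[OF g r(2)]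
     lder_add[OF L B order_refl s] h.add[OF lder_closed[OF L B order_refl s(1)] lder_closed[OF L B order_refl s(2)]] ..
   then show "\<exists>B. M.opn B & umap \<iota> w : B & pre B <= V &
     rst W V (pre B) (PW U v V (f +[sec W V] g)) = rst W V (pre B) (PW U v V f +[sec W V] PW U v V g)"
    using w B BV by (intro exI[of _ B] conjI)
  qed
  show "PW U v V (t \<odot>[sec W V] g) = t \<odot>[sec W V] PW U v V g" if g: "g : Sec W V" for t g
  proof (rule W_eqI[OF V(1) c[OF A.smult_closed[OF g]] A.smult_closed[OF c[OF g]]])
   fix w assume "w : V"
   then obtain B X x where w: "umap \<iota> w : B" and r: "represents v V g B X x"
    and X: "X : tpart M B p" using ex[OF V g g] by blast
   note B = rep_open[OF r] and BV = rep_sub[OF r]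
   interpret h: superalg_hom "sec M B" "sec W (pre B)" "pull \<iota> B" by (rule hom_\<iota>[OF B])
   interpret rr: superalg_hom "sec W V" "sec W (pre B)" "rst W V (pre B)" by (rule W.rst[OF V(1) pre_\<iota>_open[OF B] BV])
   note L = P[OF r X] and s = rep_sec[OF r]
   have "rst W V (pre B) (PW U v V (t \<odot>[sec W V] g)) = rst W V (pre B) (t \<odot>[sec W V] PW U v V g)"
    unfolding e[OF A.smult_closed[OF g] represents_smult[OF V(1) g g r r]] rr.smult[OF c[OF g]] e[OF g r]
     lder_smult[OF L B order_refl s] h.smult[OF lder_closed[OF L B order_refl s]] ..
   then show "\<exists>B. M.opn B & umap \<iota> w : B & pre B <= V &
     rst W V (pre B) (PW U v V (t \<odot>[sec W V] g)) = rst W V (pre B) (t \<odot>[sec W V] PW U v V g)"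
    using w B BV by (intro exI[of _ B] conjI)
  qed
  show "PW U v V g : Part W V ((\<not> p) \<noteq> q)" if g: "g : Part W V q" for q g
  proof (rule W.part_local[OF V(1) c[OF A.part_closed[OF g]]])
   fix w assume w: "w : V"
   then obtain B X x where wB: "umap \<iota> w : B" and r: "represents v V g B X x"
    and X: "X : tpart M B p" and x: "x : Part M B q"
    using ex[OF V A.part_closed[OF g] A.part_closed[OF g], of w q] g by blast
   note B = rep_open[OF r]
   have "rst W V (pre B) (PW U v V g) : Part W (pre B) ((\<not> p) \<noteq> q)"
    unfolding e[OF A.part_closed[OF g] r] by (rule superalg_hom.parity[OF hom_\<iota>[OF B] lder_parity[OF P[OF r X] B order_refl x]])
   then show "\<exists>V'. W.opn V' & w : V' & V' <= V & rst W V V' (PW U v V g) : Part W V' ((\<not> p) \<noteq> q)"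
    using pre_\<iota>_open[OF B] rep_sub[OF r] wB w openin_subset[OF V(1)]
    by (intro exI[of _ "pre B"] conjI) (auto simp: pre_\<iota>_u)
  qed
  show "PW U v V (f *[sec W V] g) = (PW U v V f *[sec W V] g) +[sec W V]
     signed (sec W V) (\<not> p & q) (f *[sec W V] PW U v V g)"
   if f: "f : Part W V q" and g: "g : Sec W V" for q f g
  proof -
   have fc: "f : Sec W V" using f by (rule A.part_closed)
   have c2: "PW U v V f *[sec W V] g : Sec W V" "f *[sec W V] PW U v V g : Sec W V"
    using c[OF fc] c[OF g] fc g by simp_all
   show ?thesis
   proof (rule W_eqI[OF V(1) c[OF A.m_closed[OF fc g]] A.a_closed[OF c2(1) A.signed_closed[OF c2(2)]]])
    fix w assume "w : V"
    then obtain B X x y where w: "umap \<iota> w : B" and r: "represents v V f B X x" "represents v V g B X y"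
     and X: "X : tpart M B p" and x: "x : Part M B q" using ex[OF V fc g] f by blast
    note B = rep_open[OF r(1)] and BV = rep_sub[OF r(1)]
    interpret h: superalg_hom "sec M B" "sec W (pre B)" "pull \<iota> B" by (rule hom_\<iota>[OF B])
    interpret rr: superalg_hom "sec W V" "sec W (pre B)" "rst W V (pre B)" by (rule W.rst[OF V(1) pre_\<iota>_open[OF B] BV])
    note L = P[OF r(1) X] and s = rep_sec[OF r(1)] rep_sec[OF r(2)]
    note Lc = lder_closed[OF L B order_refl s(1)] lder_closed[OF L B order_refl s(2)]
    have "rst W V (pre B) (PW U v V (f *[sec W V] g)) =
     rst W V (pre B) (PW U v V f *[sec W V] g +[sec W V] signed (sec W V) (\<not> p & q) (f *[sec W V] PW U v V g))"
     unfolding e[OF A.m_closed[OF fc g] represents_mult[OF V(1) fc g r]] lder_Leibniz[OF L B order_refl x s(2)]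
      rr.add[OF c2(1) A.signed_closed[OF c2(2)]] rr.signed[OF c2(2)] rr.mult[OF c[OF fc] g] rr.mult[OF fc c[OF g]]
      e[OF fc r(1)] e[OF g r(2)]
     using Lc s by (simp add: h.add h.signed h.mult rep_pull[OF r(1)] rep_pull[OF r(2)])
    then show "\<exists>B. M.opn B & umap \<iota> w : B & pre B <= V & rst W V (pre B) (PW U v V (f *[sec W V] g)) =
     rst W V (pre B) (PW U v V f *[sec W V] g +[sec W V] signed (sec W V) (\<not> p & q) (f *[sec W V] PW U v V g))"
     using w B BV by (intro exI[of _ B] conjI)
   qed
  qed
  show "PW U v V' (rst W V V' g) = rst W V V' (PW U v V g)"
   if V': "W.opn V'" "V' <= V" and g: "g : Sec W V" for V' g
  proof -
   have V'U: "V' <= U" using V' V by auto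
   have gc: "rst W V V' g : Sec W V'" by (rule W.rst_closed[OF V(1) V' g])
   show ?thesis
   proof (rule W_eqI[OF V'(1) closed[OF V'(1) V'U gc] W.rst_closed[OF V(1) V' c[OF g]]])
    fix w assume "w : V'"
    then obtain B X x where w: "umap \<iota> w : B" and r: "represents v V' (rst W V V' g) B X x"
     using ex[OF V'(1) V'U gc gc] by blast
    note B = rep_open[OF r] and BV = rep_sub[OF r]
    have rr: "rst W V' (pre B) (rst W V V' y) = rst W V (pre B) y" if "y : Sec W V" for y
     by (rule W.rst_rst[OF V(1) V'(1) pre_\<iota>_open[OF B] V'(2) BV that])
    have r': "represents v V g B X x"
     by (rule representsI[OF B order_trans[OF BV V'(2)] rep_ext[OF r] rep_sec[OF r]]) (simp add: rep_pull[OF r] rr[OF g])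
    have "rst W V' (pre B) (PW U v V' (rst W V V' g)) = rst W V' (pre B) (rst W V V' (PW U v V g))"
     unfolding eq[OF V'(1) V'U gc r] rr[OF c[OF g]] e[OF g r'] ..
    then show "\<exists>B. M.opn B & umap \<iota> w : B & pre B <= V' &
     rst W V' (pre B) (PW U v V' (rst W V V' g)) = rst W V' (pre B) (rst W V V' (PW U v V g))"
     using w B BV by (intro exI[of _ B] conjI)
   qed
  qed
 qed
 then show ?thesis by (simp add: hom_vfields_iff[OF W.srs] PW_def normal_der_idem)
qed

lemma PW_normal: "normal_der W U (PW U v) = PW U v" by (simp add: PW_def normal_der_idem)

text \<open>Equality may be checked over sets on which everything is represented at once. The second
  field \<open>v'\<close> is there for sums and the second section \<open>t\<close> for scalar
  factors; 1 and a repeated \<open>v\<close> fill the slots otherwise.\<close>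

lemma PW_eqI:
 assumes U: "W.opn U" and E: "normal_der W U D = D" "normal_der W U E = E"
  and v: "v : vfields W U" "v' : vfields W U"
  and c: "\<And>V g. W.opn V ==> V <= U ==> g : Sec W V ==>
   D V g : Sec W V & E V g : Sec W V & t V : Sec W V"
  and eq: "\<And>V g B X X' f f'. W.opn V ==> V <= U ==> g : Sec W V ==>
   represents v V g B X f ==> represents v' V (t V) B X' f' ==>
   rst W V (pre B) (D V g) = rst W V (pre B) (E V g)"
 shows "D = E"
proof (rule normal_der_eqI[OF E])
 fix V g assume V: "W.opn V" "V <= U" and g: "g : Sec W V"
 show "D V g = E V g"
 proof (rule W_eqI[OF V(1)])
  show "D V g : Sec W V" "E V g : Sec W V" using c[OF V g] by auto
  fix w assume w: "w : V"
  have tc: "t V : Sec W V" using c[OF V g] by simp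
  obtain B X X' f f' where wB: "umap \<iota> w : B" and r: "represents v V g B X f" "represents v' V (t V) B X' f'"
   using represents_exists[OF U v V g tc w, of True True] by (elim exE conjE) (rule that)
  show "\<exists>B. M.opn B & umap \<iota> w : B & pre B <= V & rst W V (pre B) (D V g) = rst W V (pre B) (E V g)"
   by (intro exI[of _ B] conjI rep_open[OF r(1)] wB rep_sub[OF r(1)] eq[OF V g r])
 qed
qed

lemma PW_add:
 assumes U: "W.opn U" and v: "v : vfields W U" "v' : vfields W U"
 shows "PW U (normal_der W U (%V g. v V g +[sec W V] v' V g)) = normal_der W U (%V g. PW U v V g +[sec W V] PW U v' V g)"
  (is "PW U ?v = ?E")
proof (rule PW_eqI[OF U PW_normal normal_der_idem v, where t = "%V. 1[sec W V]"])
 note vv = W.vfields_add[OF U v]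
 fix V g assume V: "W.opn V" "V <= U" and g: "g : Sec W V"
 interpret A: superalg "sec W V" by (rule W.alg[OF V(1)])
 note c = PW_closed[OF U v(1) V g] PW_closed[OF U v(2) V g]
 show "PW U ?v V g : Sec W V & ?E V g : Sec W V & 1[sec W V] : Sec W V"
  unfolding normal_der_apply[OF V g] using PW_closed[OF U vv V g] c by simp
 fix B X X' f f' assume r: "represents v V g B X f" and r1: "represents v' V 1[sec W V] B X' f'"
 have r': "represents v' V g B X' f" by (rule represents_same_field[OF r1 r])
 note B = rep_open[OF r] and BV = rep_sub[OF r] and f = rep_sec[OF r]
 have BU: "pre B <= U" using BV V(2) by blast
 interpret h: superalg_hom "sec M B" "sec W (pre B)" "pull \<iota> B" by (rule hom_\<iota>[OF B])
 interpret rr: superalg_hom "sec W V" "sec W (pre B)" "rst W V (pre B)" by (rule W.rst[OF V(1) pre_\<iota>_open[OF B] BV])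
 note X = extends_vfields[OF rep_ext[OF r]] extends_vfields[OF rep_ext[OF r']]
 have r2: "represents ?v V g B (normal_der M B (%V f. X V f +[sec M V] X' V f)) f"
  by (rule representsI[OF B BV extends_add[OF B BU rep_ext[OF r] rep_ext[OF r']] f rep_pull[OF r]])
 show "rst W V (pre B) (PW U ?v V g) = rst W V (pre B) (?E V g)"
  unfolding PW_eq[OF U vv V g r2] normal_der_apply[OF V g] rr.add[OF c] PW_eq[OF U v(1) V g r] PW_eq[OF U v(2) V g r']
   M.P_add[OF B X] normal_der_apply[OF B order_refl f]
  by (rule h.add) (rule M.vfields_closed[OF B M.P_closed[OF B] B order_refl f], rule X)+
qed

lemma PW_vfields:
 assumes U: "W.opn U" and v: "v : vfields W U"
 shows "PW U v : vfields W U"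
proof -
 obtain v0 v1 where v0: "v0 : tpart W U False" and v1: "v1 : tpart W U True"
  and eq: "v = normal_der W U (%V f. v0 V f +[sec W V] v1 V f)" by (rule W.vfields_decomp[OF v])
 note p = PW_part[OF U v0] PW_part[OF U v1]
 show ?thesis
  unfolding eq PW_add[OF U W.vfields_part[OF U v0] W.vfields_part[OF U v1]]
  by (rule W.vfields_add[OF U W.vfields_part[OF U p(1)] W.vfields_part[OF U p(2)]])
qed

text \<open>The scalar is lifted to a function \<open>f'\<close> together with \<open>g\<close>, so
  that f' X extends the scaled field; the sign is the one in \<open>P_scale\<close> for
  \<open>PM\<close>, and \<open>grade_inv\<close> commutes with pull-backs.\<close>

lemma PW_scale:
 assumes U: "W.opn U" and t: "t : Sec W U" and v: "v : vfields W U"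
 shows "PW U (normal_der W U (%V g. rst W U V t *[sec W V] v V g)) =
  normal_der W U (%V g. rst W U V (grade_inv (sec W U) t) *[sec W V] PW U v V g)"
  (is "PW U ?v = ?E")
proof (rule PW_eqI[OF U PW_normal normal_der_idem v v, where t = "%V. rst W U V t"])
 note vv = W.vfields_scale[OF U v t]
 fix V g assume V: "W.opn V" "V <= U" and g: "g : Sec W V"
 interpret rU: superalg_hom "sec W U" "sec W V" "rst W U V" by (rule W.rst[OF U V])
 note c = PW_closed[OF U v V g]
 have gt: "rst W U V (grade_inv (sec W U) t) = grade_inv (sec W V) (rst W U V t)" by (rule rU.grade_inv[OF t])
 show "PW U ?v V g : Sec W V & ?E V g : Sec W V & rst W U V t : Sec W V"
  unfolding normal_der_apply[OF V g] using PW_closed[OF U vv V g] c t by simp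
 fix B X X' f f' assume r: "represents v V g B X f" and r': "represents v V (rst W U V t) B X' f'"
 note B = rep_open[OF r] and BV = rep_sub[OF r] and f = rep_sec[OF r] and f' = rep_sec[OF r'] and X = extends_vfields[OF rep_ext[OF r]]
 have BU: "pre B <= U" using BV V(2) by blast
 interpret h: superalg_hom "sec M B" "sec W (pre B)" "pull \<iota> B" by (rule hom_\<iota>[OF B])
 interpret rr: superalg_hom "sec W V" "sec W (pre B)" "rst W V (pre B)" by (rule W.rst[OF V(1) pre_\<iota>_open[OF B] BV])
 have pf: "pull \<iota> B f' = rst W U (pre B) t"
  unfolding rep_pull[OF r'] by (rule W.rst_rst[OF U V(1) pre_\<iota>_open[OF B] V(2) BV t])
 have r2: "represents ?v V g B (normal_der M B (%V f. rst M B V f' *[sec M V] X V f)) f"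
  by (rule representsI[OF B BV extends_scale[OF B BU U rep_ext[OF r] t f' pf] f rep_pull[OF r]])
 have PXc: "PM B X B f : Sec M B" by (rule M.vfields_closed[OF B M.P_closed[OF B X] B order_refl f])
 have gf: "grade_inv (sec M B) f' : Sec M B" using f' by simp
 show "rst W V (pre B) (PW U ?v V g) = rst W V (pre B) (?E V g)"
  unfolding PW_eq[OF U vv V g r2] normal_der_apply[OF V g] gt rr.mult[OF rU.B.grade_inv_closed[OF rU.closed[OF t]] c] PW_eq[OF U v V g r]
   M.P_scale[OF B f' X] normal_der_apply[OF B order_refl f] M.rst_id[OF B gf] h.mult[OF gf PXc] h.grade_inv[OF f']
   rr.grade_inv[OF rU.closed[OF t]] rep_pull[OF r'] ..
qed

text \<open>Over a set whose preimage lies in the smaller domain, an extension of the restricted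
  field is an extension of \<open>v\<close> itself, so both sides are computed from the same
  data.\<close>

lemma PW_rst:
 assumes U: "W.opn U" and U': "W.opn U'" "U' <= U" and v: "v : vfields W U"
 shows "PW U' (normal_der W U' v) = normal_der W U' (PW U v)"
proof -
 have gv: "gder W W U (%V. V) (%V f. f) v" using v by (simp add: vfields_iff[OF W.srs])
 have v': "normal_der W U' v : vfields W U'" by (rule W.normal_der_vfields[OF gder_mono[OF gv U'(2)]])
 show ?thesis
 proof (rule PW_eqI[OF U'(1) PW_normal normal_der_idem v' v', where t = "%V. 1[sec W V]"])
  fix V g assume V: "W.opn V" "V <= U'" and g: "g : Sec W V"
  have VU: "V <= U" using V U' by auto
  interpret A: superalg "sec W V" by (rule W.alg[OF V(1)])
  show "PW U' (normal_der W U' v) V g : Sec W V & normal_der W U' (PW U v) V g : Sec W V & 1[sec W V] : Sec W V"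
   unfolding normal_der_apply[OF V g] using PW_closed[OF U'(1) v' V g] PW_closed[OF U v V(1) VU g] by simp
  fix B X X' f f' assume r: "represents (normal_der W U' v) V g B X f"
  note B = rep_open[OF r] and BV = rep_sub[OF r]
  have "extends B X v"
   unfolding extends_def
  proof (intro conjI allI impI extends_vfields[OF rep_ext[OF r]], elim conjE)
   fix V' x assume V': "M.opn V'" "V' <= B" and x: "x : Sec M V'"
   have "pre V' <= U'" using pre_\<iota>_mono[OF V'(2)] BV V(2) by blast
   from normal_der_apply[OF pre_\<iota>_open[OF V'(1)] this superalg_hom.closed[OF hom_\<iota>[OF V'(1)] x]]
   show "pull \<iota> V' (X V' x) = v (pre V') (pull \<iota> V' x)" unfolding extends_eq[OF rep_ext[OF r] V' x] .
  qed
  then have r': "represents v V g B X f" by (rule representsI[OF B BV _ rep_sec[OF r] rep_pull[OF r]])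
  show "rst W V (pre B) (PW U' (normal_der W U' v) V g) = rst W V (pre B) (normal_der W U' (PW U v) V g)"
   unfolding normal_der_apply[OF V g] PW_eq[OF U'(1) v' V g r] PW_eq[OF U v V(1) VU g r'] ..
 qed
qed

lemma PW_PW:
 assumes U: "W.opn U" and v: "v : vfields W U"
 shows "PW U (PW U v) = v"
proof (rule PW_eqI[OF U PW_normal _ v v, where t = "%V. 1[sec W V]"])
 show "normal_der W U v = v" using v by (simp add: vfields_iff[OF W.srs])
 note Pv = PW_vfields[OF U v]
 fix V g assume V: "W.opn V" "V <= U" and g: "g : Sec W V"
 interpret A: superalg "sec W V" by (rule W.alg[OF V(1)])
 show "PW U (PW U v) V g : Sec W V & v V g : Sec W V & 1[sec W V] : Sec W V"
  using PW_closed[OF U Pv V g] W.vfields_closed[OF U v V g] by simp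
 fix B X X' f f' assume r: "represents v V g B X f"
 note B = rep_open[OF r] and BV = rep_sub[OF r] and f = rep_sec[OF r]
 have BU: "pre B <= U" using BV V(2) by blast
 have r': "represents (PW U v) V g B (PM B X) f"
  by (rule representsI[OF B BV extends_PW[OF U v B BU rep_ext[OF r]] f rep_pull[OF r]])
 have "gder W W U (%V. V) (%V f. f) v" using v by (simp add: vfields_iff[OF W.srs])
 from lmor.gder_rst[OF W.lmor_ident[OF U] this V g pre_\<iota>_open[OF B] BV]
 show "rst W V (pre B) (PW U (PW U v) V g) = rst W V (pre B) (v V g)"
  unfolding PW_eq[OF U Pv V g r'] M.P_P[OF B extends_vfields[OF rep_ext[OF r]]] extends_eq[OF rep_ext[OF r] B order_refl f] rep_pull[OF r] .
qed

theorem Pi_symmetry_PW: "Pi_symmetry (tangent_sheaf W) PW"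
 by (rule W.Pi_symmetryI; (rule PW_vfields PW_add PW_scale PW_part PW_rst PW_PW; assumption))

end

section \<open>Zero fibres and the theorem\<close>

text \<open>Passes from \<open>is_zero_fibre\<close>, which speaks of restricted spaces, to
  statements about \<open>N\<close> and \<open>Z\<close>; since \<open>\<phi>\<close> is an
  inclusion, the preimage of \<open>U\<close> is the part of \<open>Z\<close> in \<open>U\<close>.
  The equations are abstracted to \<open>G i\<close>, so that the lemma covers the equations of Z as
  well as their pull-backs under \<Psi>.\<close>

lemma
 assumes N: "superringed_space N" and Z: "superringed_space Z" and \<phi>: "smorphism Z N \<phi>"
  and incl: "\<And>x. x : topspace (spc Z) ==> umap \<phi> x = x" and U: "oset N U"
  and zf: "is_zero_fibre (srestrict N U) p q F (srestrict Z (topspace (spc Z) Int U)) \<phi>"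
  and G: "\<And>i. i < p + q ==> pull F (topspace (Euclidean_space p)) (std_coord p (topspace (Euclidean_space p)) i) = G i"
   "\<And>i. i < p + q ==> G i : Sec N U"
 shows zero_fibre_generated: "locally_generated Z N \<phi> U (p + q) G"
  and zero_fibre_stalk: "oset Z V ==> s : Sec Z V ==> x : V ==> x : U ==>
   \<exists>U' f. oset N U' & umap \<phi> x : U' & preim Z \<phi> U' <= V & f : Sec N U' &
    pull \<phi> U' f = rst Z V (preim Z \<phi> U') s"
proof -
 interpret N: sspace N using N by unfold_locales
 interpret Z: sspace Z using Z by unfold_locales
 interpret l: lmor N Z U "preim Z \<phi>" "umap \<phi>" "pull \<phi>" by (rule smor_lmor[OF Z N \<phi> U])
 let ?ZU = "topspace (spc Z) Int U"
 have ZU: "?ZU = preim Z \<phi> U" using incl by (auto simp: preim_def)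
 have oZ: "oset Z ?ZU" unfolding ZU by (rule l.S_open[OF U order_refl])
 have pre: "preim (srestrict Z ?ZU) \<phi> V = preim Z \<phi> V" if "V <= U" for V
  using incl that by (auto simp: preim_def)
 have o: "openin (spc (srestrict N U)) V \<longleftrightarrow> oset N V & V <= U" for V
  using openin_open_subtopology[OF U] by simp
 have oS: "openin (spc (srestrict Z ?ZU)) V \<longleftrightarrow> oset Z V & V <= ?ZU" for V
  using openin_open_subtopology[OF oZ] by simp
 have top: "topspace (spc (srestrict N U)) = U" using openin_subset[OF U] by auto
 have img: "(%i. rst (srestrict N U) (topspace (spc (srestrict N U))) U' (pull F (topspace (Euclidean_space p))
   (std_coord p (topspace (Euclidean_space p)) i))) ` {..<p + q} = (%i. rst N U U' (G i)) ` {..<p + q}" for U'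
  unfolding top by (rule image_cong) (simp_all add: G(1))
 note st = zf[unfolded is_zero_fibre_def, THEN conjunct2, THEN conjunct2, THEN conjunct2, THEN conjunct2, THEN conjunct1, rule_format]
 note ker = zf[unfolded is_zero_fibre_def img o, THEN conjunct2, THEN conjunct2, THEN conjunct2, THEN conjunct2, THEN conjunct2, rule_format, OF conjI]
 show "locally_generated Z N \<phi> U (p + q) G"
  unfolding locally_generated_def
 proof (intro conjI allI impI)
  fix i assume i: "i < p + q"
  show "G i : Sec N U" by (rule G(2)[OF i])
  interpret A: superalg "sec N U" using N.alg[OF U] .
  \<comment> \<open>Each equation lies in the ideal generated by all of them, so the description of
    the kernel shows that it vanishes on \<open>Z\<close>.\<close>
  have "G i : Idl\<^bsub>sec N U\<^esub> ((%i. rst N U U (G i)) ` {..<p + q})"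
   using A.genideal_self[of "(%i. rst N U U (G i)) ` {..<p + q}"] G(2) i N.rst_id[OF U G(2)] by force
  then have "\<forall>x\<in>preim (srestrict Z ?ZU) \<phi> U. \<exists>U'. (oset N U' & U' <= U) & x : U' & U' <= U &
    rst (srestrict N U) U U' (G i) : Idl\<^bsub>sec (srestrict N U) U'\<^esub> ((%i. rst N U U' (G i)) ` {..<p + q})"
   using U N.rst_id[OF U G(2)[OF i]] by (intro ballI exI[of _ U] conjI) (simp_all add: pre preim_def incl)
  then have "pull \<phi> U (G i) = 0[sec (srestrict Z ?ZU) (preim (srestrict Z ?ZU) \<phi> U)]"
   by (intro iffD2[OF ker]) (use U G(2)[OF i] in simp_all)
  then show "pull \<phi> U (G i) = 0[sec Z (preim Z \<phi> U)]" by (simp add: pre)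
 next
  fix V f z assume "oset N V & V <= U & f : Sec N V & pull \<phi> V f = 0[sec Z (preim Z \<phi> V)] & z : preim Z \<phi> V"
  then have V: "oset N V" "V <= U" and f: "f : Sec N V"
   and 0: "pull \<phi> V f = 0[sec Z (preim Z \<phi> V)]" and z: "z : preim Z \<phi> V" by auto
  have fc: "f : Sec (srestrict N U) V" using f by simp
  have 1: "pull \<phi> V f = 0[sec (srestrict Z ?ZU) (preim (srestrict Z ?ZU) \<phi> V)]" using 0 by (simp add: pre[OF V(2)])
  have z': "z : preim (srestrict Z ?ZU) \<phi> V" using z by (simp add: pre[OF V(2)])
  have uz: "umap \<phi> z = z" by (rule incl) (use z in \<open>simp add: preim_def\<close>)
  obtain U' where U': "oset N U'" "z : U'" "U' <= V"
   "rst (srestrict N U) V U' f : Idl\<^bsub>sec (srestrict N U) U'\<^esub> ((%i. rst N U U' (G i)) ` {..<p + q})"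
   using bspec[OF iffD1[OF ker[OF conjI[OF V] fc] 1] z'] by (elim exE conjE) (rule that)
  then show "\<exists>V'. oset N V' & umap \<phi> z : V' & V' <= V & rst N V V' f : Idl\<^bsub>sec N V'\<^esub> ((%i. rst N U V' (G i)) ` {..<p + q})"
   unfolding uz by (intro exI[of _ U'] conjI) simp_all
 qed
 assume V: "oset Z V" and s: "s : Sec Z V" and x: "x : V" "x : U"
 let ?V = "V Int ?ZU"
 have oV: "oset Z ?V" "?V <= V" using V oZ by auto
 have xZ: "x : topspace (spc Z)" using openin_subset[OF V] x by auto
 have "openin (spc (srestrict Z ?ZU)) ?V" unfolding oS using oV(1) by blast
 then have "openin (spc (srestrict Z ?ZU)) ?V & rst Z V ?V s : Sec (srestrict Z ?ZU) ?V & x : ?V"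
  using x xZ Z.rst_closed[OF V oV s] by simp
 from st[OF this] obtain U' f where U': "oset N U'" "U' <= U" "x : U'" "preim (srestrict Z ?ZU) \<phi> U' <= ?V"
  "f : Sec (srestrict N U) U'"
  "pull \<phi> U' f = rst (srestrict Z ?ZU) ?V (preim (srestrict Z ?ZU) \<phi> U') (rst Z V ?V s)"
  unfolding o by (elim exE conjE) (rule that)
 have P: "preim Z \<phi> U' <= ?V" using U'(4) by (simp only: pre[OF U'(2)])
 have "rst Z ?V (preim Z \<phi> U') (rst Z V ?V s) = rst Z V (preim Z \<phi> U') s"
  by (rule Z.rst_rst[OF V oV(1) l.S_open[OF U'(1,2)] oV(2) P s])
 then show "\<exists>U' f. oset N U' & umap \<phi> x : U' & preim Z \<phi> U' <= V & f : Sec N U' &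
    pull \<phi> U' f = rst Z V (preim Z \<phi> U') s"
  using U' P incl[OF xZ] by (intro exI[of _ U'] exI[of _ f] conjI) (auto simp: pre)
qed

theorem proposition7p7:
  fixes m n k :: nat
    and X :: "('p, 's) superspace"
    and B R :: "(nat \<Rightarrow> real, nat set \<Rightarrow> (nat \<Rightarrow> real) \<Rightarrow> real) superspace"
    and M :: "('p \<times> (nat \<Rightarrow> real), 'u) superspace"
    and Z :: "(nat \<Rightarrow> real, 'z) superspace"
    and W :: "('p \<times> (nat \<Rightarrow> real), 'w) superspace"
  defines "R \<equiv> super_euclidean n n"
  assumes X: "supermanifold m m X" "Pi_symmetry (tangent_sheaf X) PX"
    and B: "c \<in> topspace (Euclidean_space n)" "0 < r" "B = superball n c r"
           "Pi_symmetry (tangent_sheaf B) PB"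
    and R: "Pi_symmetry (tangent_sheaf R) PR"
    and M: "is_product m m X n n B M \<pi> \<rho>" "product_Pi_symmetry X PX \<pi> B PB \<rho> M PM"
    and \<Psi>: "Pi_morphism M PM R PR \<Psi>"
    and Z: "k \<le> n" "subsupermanifold k k R Z j"
           "Pi_symmetry (tangent_sheaf Z) PZ" "Pi_morphism Z PZ R PR j"
    and transversal: "supertransversal M R \<Psi> Z j"
    and W: "subsupermanifold (m + k) (m + k) M W \<iota>"
           "is_preimage M R \<Psi> (n - k) (n - k) Z j W \<iota>"
  shows "\<exists>PW. Pi_symmetry (tangent_sheaf W) PW"
proof -
 let ?p = "n - k" and ?T = "topspace (Euclidean_space (n - k))"
 have Mm: "supermanifold (m + n) (m + n) M" and PM: "Pi_symmetry (tangent_sheaf M) PM"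
  using M by (simp_all add: is_product_def product_Pi_symmetry_def)
 have Zm: "supermanifold k k Z" "smorphism Z R j" and Zi: "\<And>z. z : topspace (spc Z) ==> umap j z = z"
  using Z(2) by (auto simp: subsupermanifold_def sembedding_def)
 have Wm: "supermanifold (m + k) (m + k) W" "smorphism W M \<iota>" "embedding_map (spc W) (spc M) (umap \<iota>)"
  and Wi: "\<And>w. w : topspace (spc W) ==> umap \<iota> w = w"
  using W(1) by (auto simp: subsupermanifold_def sembedding_def)
 have lR: "locally_super n n R" unfolding R_def by (rule locally_super_euclidean)
 then have R': "superringed_space R" by (simp add: locally_super_def)
 have sr: "superringed_space M" "superringed_space Z" "superringed_space W" and H: "Hausdorff_space (spc M)" "Hausdorff_space (spc Z)"
  using Mm Zm(1) Wm(1) by (simp_all add: supermanifold_def)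
 have \<Psi>R: "smorphism M R \<Psi>" using \<Psi> by (simp add: Pi_morphism_def)
 have pts: "umap \<Psi> w : topspace (spc Z)" "w : topspace (spc M)" if "w : topspace (spc W)" for w
  using W(2) that by (auto simp: is_preimage_def preim_def)
 \<comment> \<open>Around each point of Z a single \<open>U\<close> with a single family
   \<open>g\<close> gives equations of Z and, after pull-back, of W, together with lifts of sections
   for both.\<close>
 have loc: "\<exists>U g. oset R U & z : U &
   locally_generated Z R j U (?p + ?p) g & locally_generated W M \<iota> (preim M \<Psi> U) (?p + ?p) (%i. pull \<Psi> U (g i)) &
   (\<forall>V s x. oset Z V & s : Sec Z V & x : V & x : U -->
    (\<exists>U' f. oset R U' & umap j x : U' & preim Z j U' <= V & f : Sec R U' &
     pull j U' f = rst Z V (preim Z j U') s)) &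
   (\<forall>V s x. oset W V & s : Sec W V & x : V & x : preim M \<Psi> U -->
    (\<exists>U' f. oset M U' & umap \<iota> x : U' & preim W \<iota> U' <= V & f : Sec M U' &
     pull \<iota> U' f = rst W V (preim W \<iota> U') s))"
  if z: "z : topspace (spc Z)" for z
 proof -
  obtain U G where U: "oset R U" "z : U" and G: "submersion (srestrict R U) (super_euclidean ?p ?p) G"
   and zZ: "is_zero_fibre (srestrict R U) ?p ?p G (srestrict Z (topspace (spc Z) Int U)) j"
   and zW: "is_zero_fibre (srestrict M (preim M \<Psi> U)) ?p ?p (smor_comp (srestrict R U) G \<Psi>)
     (srestrict W (topspace (spc W) Int preim M \<Psi> U)) \<iota>"
   using W(2)[unfolded is_preimage_def, THEN conjunct2, rule_format, OF z] by (elim exE conjE) (rule that)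
  have Gs: "smorphism (srestrict R U) (super_euclidean ?p ?p) G" using G by (simp add: submersion_def)
  have UR: "U <= topspace (spc R)" by (rule openin_subset[OF U(1)])
  have "continuous_map (subtopology (spc R) U) (Euclidean_space ?p) (umap G)"
   using Gs by (simp add: smorphism_def)
  from continuous_map_image_subset_topspace[OF this] have preT: "preim (srestrict R U) G ?T = U"
   using UR by (auto simp: preim_def)
  \<comment> \<open>The components of the local submersion which cuts out Z. Their pull-backs under
    \<Psi> are the components of the composite which cuts out W.\<close>
  define g where "g i = pull G ?T (std_coord ?p ?T i)" for i
  have oT: "openin (Euclidean_space ?p) ?T" by simp
  have "superalgebra_hom (superfunctions ?p ?p ?T) (sec R U) (pull G ?T)"
   using Gs[unfolded smorphism_def, THEN conjunct2, THEN conjunct1, rule_format, of ?T] by (simp add: preT)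
  then have gc: "g i : Sec R U" if "i < ?p + ?p" for i
   using superalg.part_closed[OF superalg.intro[OF sf_superalgebra[OF oT]] std_coord_part[OF oT that]]
   by (auto simp: g_def superalgebra_hom_def ring_hom_def)
  interpret l: lmor R M U "preim M \<Psi>" "umap \<Psi>" "pull \<Psi>" by (rule smor_lmor[OF sr(1) R' \<Psi>R U(1)])
  have o: "oset M (preim M \<Psi> U)" by (rule l.S_open[OF U(1) order_refl])
  have gc': "pull \<Psi> U (g i) : Sec M (preim M \<Psi> U)" if "i < ?p + ?p" for i
   by (rule superalg_hom.closed[OF l.hh[OF U(1) order_refl] gc[OF that]])
  have ge: "pull (smor_comp (srestrict R U) G \<Psi>) ?T (std_coord ?p ?T i) = pull \<Psi> U (g i)" for i
   by (simp add: smor_comp_def g_def preT)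
  show ?thesis
  proof (rule exI[of _ U], rule exI[of _ g], intro conjI allI impI U)
   show "locally_generated Z R j U (?p + ?p) g"
    by (rule zero_fibre_generated[OF R' sr(2) Zm(2) Zi U(1) zZ g_def[symmetric] gc])
   show "locally_generated W M \<iota> (preim M \<Psi> U) (?p + ?p) (%i. pull \<Psi> U (g i))"
    by (rule zero_fibre_generated[OF sr(1,3) Wm(2) Wi o zW ge gc'])
   show "\<exists>U' f. oset R U' & umap j x : U' & preim Z j U' <= V & f : Sec R U' &
     pull j U' f = rst Z V (preim Z j U') s"
    if "oset Z V & s : Sec Z V & x : V & x : U" for V s x
    by (rule zero_fibre_stalk[OF R' sr(2) Zm(2) Zi U(1) zZ g_def[symmetric] gc]) (use that in auto)
   show "\<exists>U' f. oset M U' & umap \<iota> x : U' & preim W \<iota> U' <= V & f : Sec M U' &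
     pull \<iota> U' f = rst W V (preim W \<iota> U') s"
    if "oset W V & s : Sec W V & x : V & x : preim M \<Psi> U" for V s x
    by (rule zero_fibre_stalk[OF sr(1,3) Wm(2) Wi o zW ge gc']) (use that in auto)
  qed
 qed
 have "preimage M R Z W PM PR PZ \<Psi> j \<iota> (m + n) (m + n) n n k k (m + k)"
 proof (rule preimage.intro[OF supermanifold_locally_super[OF Mm] H(1) PM lR R supermanifold_locally_super[OF Zm(1)] H(2) Z(3)
   sr(3) locally_super_has_evals[OF supermanifold_locally_super[OF Wm(1)]] \<Psi> Z(4) Wm(2)])
  show "stalk_surj Z R j"
   unfolding stalk_surj_def
  proof (intro allI impI, elim conjE)
   fix V s x assume V: "oset Z V" "s : Sec Z V" "x : V"
   then have "x : topspace (spc Z)" using openin_subset by blast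
   from loc[OF this] obtain U where "x : U" and st: "\<forall>V s x. oset Z V & s : Sec Z V & x : V & x : U -->
    (\<exists>U' f. oset R U' & umap j x : U' & preim Z j U' <= V & f : Sec R U' &
     pull j U' f = rst Z V (preim Z j U') s)" by (elim exE conjE) (rule that)
   then show "\<exists>U f. oset R U & umap j x : U & preim Z j U <= V & f : Sec R U & pull j U f = rst Z V (preim Z j U) s"
    by (intro st[rule_format] conjI V)
  qed
  show "stalk_surj W M \<iota>"
   unfolding stalk_surj_def
  proof (intro allI impI, elim conjE)
   fix V s x assume V: "oset W V" "s : Sec W V" "x : V"
   then have x: "x : topspace (spc W)" using openin_subset by blast
   from loc[OF pts(1)[OF x]] obtain U where xU: "umap \<Psi> x : U"
    and st: "\<forall>V s x. oset W V & s : Sec W V & x : V & x : preim M \<Psi> U -->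
    (\<exists>U' f. oset M U' & umap \<iota> x : U' & preim W \<iota> U' <= V & f : Sec M U' &
     pull \<iota> U' f = rst W V (preim W \<iota> U') s)" by (elim exE conjE) (rule that)
   have "x : preim M \<Psi> U" using xU pts(2)[OF x] by (simp add: preim_def)
   then show "\<exists>U f. oset M U & umap \<iota> x : U & preim W \<iota> U <= V & f : Sec M U & pull \<iota> U f = rst W V (preim W \<iota> U) s"
    by (intro st[rule_format] conjI V)
  qed
  \<comment> \<open>The underlying map of \<open>\<iota>\<close> is both an inclusion and an
    embedding, so W carries the subspace topology.\<close>
  show "\<exists>Q. oset M Q & V = preim W \<iota> Q" if V: "oset W V" for V
  proof -
   have VW: "V <= topspace (spc W)" by (rule openin_subset[OF V])
   have i: "umap \<iota> ` S = S" if "S <= topspace (spc W)" for S using that Wi by force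
   have "open_map (spc W) (subtopology (spc M) (umap \<iota> ` topspace (spc W))) (umap \<iota>)"
    using Wm(3) homeomorphic_imp_open_map unfolding embedding_map_def by blast
   then have "openin (subtopology (spc M) (umap \<iota> ` topspace (spc W))) (umap \<iota> ` V)"
    using V unfolding open_map_def by blast
   then have "openin (subtopology (spc M) (topspace (spc W))) V" unfolding i[OF VW] i[OF order_refl] .
   then obtain Q where "oset M Q" "V = Q Int topspace (spc W)" unfolding openin_subtopology by blast
   then show ?thesis using Wi by (intro exI[of _ Q]) (auto simp: preim_def)
  qed
  show "\<exists>z\<in>topspace (spc Z). umap j z = umap \<Psi> (umap \<iota> w)" if w: "w : topspace (spc W)" for w
   using pts(1)[OF w] Zi Wi[OF w] by (intro bexI[of _ "umap \<Psi> w"]) simp_all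
  show "\<exists>U r g. oset R U & umap \<Psi> (umap \<iota> w) : U &
   locally_generated Z R j U r g & locally_generated W M \<iota> (preim M \<Psi> U) r (%i. pull \<Psi> U (g i))"
   if w: "w : topspace (spc W)" for w
  proof -
   obtain U g where "oset R U" "umap \<Psi> w : U" "locally_generated Z R j U (?p + ?p) g"
    "locally_generated W M \<iota> (preim M \<Psi> U) (?p + ?p) (%i. pull \<Psi> U (g i))"
    using loc[OF pts(1)[OF w]] by (elim exE conjE) (rule that)
   then show ?thesis unfolding Wi[OF w] by (intro exI[of _ U] exI[of _ "?p + ?p"] exI[of _ g] conjI)
  qed
 qed
 then show ?thesis by (intro exI) (rule preimage.Pi_symmetry_PW)
qed

end
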